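(* Under the standing setting and the order 1 method described in the context, for every $\xi>0$ there exist a constant $C_\nu>0$ and $h_0\in(0,1)$ such that for all step-size parameters $h\in(0,h_0)$, \[ \mathbb{E}\big[\,|\nu-\tau|\,\big]\le C_\nu\, h^{1-\xi}. \]
   Context: Standing setting. Let $d,m\ge 1$ and $T>0$. For $x\in\mathbb{R}^d$ and non-empty $A\subset\mathbb{R}^d$ write $d(x,A)=\inf_{y\in A}|x-y|$ (Euclidean norm). $D\subset\mathbb{R}^d$ is a non-empty bounded domain whose boundary $\partial D$ is $C^4$. $\mathrm{reach}(D)>0$ denotes the supremum of all $R>0$ such that every $x\in\mathbb{R}^d$ with $d(x,\partial D)<R$ has a unique nearest point on $\partial D$. For $r>0$ let $D_r=\{x\in\mathbb{R}^d: d(x,D)<r\}$. The coefficients $a:\mathbb{R}^d\to\mathbb{R}^d$, $b:\mathbb{R}^d\to\mathbb{R}^{d\times m}$ satisfy: (B1) every component $a_i$, $b_{ij}$ is $C^3$ and it and all its partial derivatives up to order $3$ are bounded on $\mathbb{R}^d$; (B2) there exist $\bar R_D\in(0,\mathrm{reach}(D)/2)$ and $\hat c_b>0$ with $\xi^\top b(x)b(x)^\top\xi\ge \hat c_b|\xi|^2$ for all $x\in D_{\bar R_D}$, $\xi\in\mathbb{R}^d$; (B3) there exists $\widehat C_b>0$ with $\xi^\top b(x)b(x)^\top\xi\le \widehat C_b|\xi|^2$ for all $x,\xi\in\mathbb{R}^d$. $W=(W^1,\dots,W^m)$ is a standard $m$-dimensional Wiener process on a filtered probability space $(\Omega,\mathcal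 F,(\mathcal F_t)_{t\ge0},\mathbb P)$, $x_0\in D$ is deterministic, and $X$ is the strong solution of $\mathrm{d}X=a(X)\,\mathrm{d}t+b(X)\,\mathrm{d}W$, $X(0)=x_0$. The (truncated) exit time is $\tau=\inf\{t\ge0: X(t)\notin D\}\wedge T$. Order 1 method. For $j=1,\dots,m$ let $\mathcal L^j=\sum_{i=1}^d b_{ij}\partial_{x_i}$. For a step-size parameter $h\in(0,1)$ set $\delta=\sqrt{8\widehat C_b\, d\, h\log(h^{-1})}$ and define $\Delta t(x)=h$ if $d(x,\partial D)>\delta$ and $\Delta t(x)=h^2$ otherwise. The numerical solution is defined recursively by $t_0=0$, $\overline X(t_0)=x_0$, $\Delta t_n=\Delta t(\overline X(t_n))$, $t_{n+1}=t_n+\Delta t_n$ and, for $i=1,\dots,d$ (Milstein scheme), \[ \overline X_i(t_{n+1})=\overline X_i(t_n)+a_i(\overline X(t_n))\Delta t_n+\sum_{j=1}^m b_{ij}(\overline X(t_n))\Delta W^j_n+\sum_{j_1,j_2=1}^m \mathcal L^{j_1}b_{ij_2}(\overline X(t_n))\,I^n_{(j_1,j_2)}, \] where $\Delta W^j_n=W^j(t_{n+1})-W^j(t_n)$ and $I^n_{(j_1,j_2)}=\int_{t_n}^{t_{n+1}}\int_{t_n}^{s_2}\mathrm{d}W^{j_1}(s_1)\,\mathrm{d}W^{j_2}(s_2)$. The numerical exit time is $\nu=\min\{t_n: \overline X(t_n)\notin D\}\wedge T$. *)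

theory Defs
  imports "HOL-Probability.Probability"
begin

definition pd :: "'d::finite \<Rightarrow> (real^'d \<Rightarrow> real) \<Rightarrow> real^'d \<Rightarrow> real" where
  "pd i f x = deriv (\<lambda>t. f (x + t *\<^sub>R axis i 1)) 0"

fun Ck_fun :: "nat \<Rightarrow> (real^'d::finite \<Rightarrow> real) \<Rightarrow> bool" where
  "Ck_fun 0 f = continuous_on UNIV f"
| "Ck_fun (Suc k) f = (continuous_on UNIV f \<and>
      (\<forall>i x. (\<lambda>t. f (x + t *\<^sub>R axis i 1)) differentiable (at 0)) \<and>
      (\<forall>i. Ck_fun k (pd i f)))"

fun bdd_derivs :: "nat \<Rightarrow> (real^'d::finite \<Rightarrow> real) \<Rightarrow> bool" where
  "bdd_derivs 0 f = bounded (range f)"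
| "bdd_derivs (Suc k) f = (bounded (range f) \<and> (\<forall>i. bdd_derivs k (pd i f)))"

definition C4_boundary :: "(real^'d::finite) set \<Rightarrow> bool" where
  "C4_boundary D \<longleftrightarrow> (\<forall>p\<in>frontier D. \<exists>r>0. \<exists>\<phi>. Ck_fun 4 \<phi> \<and> (\<exists>i. pd i \<phi> p \<noteq> 0) \<and>
      D \<inter> ball p r = {x\<in>ball p r. \<phi> x < 0})"

definition reach :: "(real^'d::finite) set \<Rightarrow> real" where
  "reach D = Sup {R. R > 0 \<and> (\<forall>x. infdist x (frontier D) < R \<longrightarrow>
      (\<exists>!y. y \<in> frontier D \<and> dist x y = infdist x (frontier D)))}"

definition enlarge :: "(real^'d::finite) set \<Rightarrow> real \<Rightarrow> (real^'d) set" where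
  "enlarge D r = {x. infdist x D < r}"

definition conv_prob :: "'w measure \<Rightarrow> (nat \<Rightarrow> 'w \<Rightarrow> 'b::metric_space) \<Rightarrow> ('w \<Rightarrow> 'b) \<Rightarrow> bool" where
  "conv_prob M S Y \<longleftrightarrow>
     (\<forall>e>0. (\<lambda>N. measure M {\<omega>\<in>space M. e < dist (S N \<omega>) (Y \<omega>)}) \<longlonglongrightarrow> 0)"

definition filtration_on :: "'w measure \<Rightarrow> (real \<Rightarrow> 'w measure) \<Rightarrow> bool" where
  "filtration_on M F \<longleftrightarrow> (\<forall>t\<ge>0. subalgebra M (F t)) \<and>
     (\<forall>s t. 0 \<le> s \<longrightarrow> s \<le> t \<longrightarrow> sets (F s) \<subseteq> sets (F t))"

definition wiener :: "'w measure \<Rightarrow> (real \<Rightarrow> 'w measure) \<Rightarrow> (real \<Rightarrow> 'w \<Rightarrow> real^'m::finite) \<Rightarrow> bool" where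
  "wiener M F W \<longleftrightarrow>
     (\<forall>t\<ge>0. W t \<in> borel_measurable (F t)) \<and>
     (AE \<omega> in M. W 0 \<omega> = 0 \<and> continuous_on {0..} (\<lambda>t. W t \<omega>)) \<and>
     (\<forall>s t. 0 \<le> s \<longrightarrow> s < t \<longrightarrow>
        distributed M lborel (\<lambda>\<omega>. W t \<omega> - W s \<omega>)
           (\<lambda>x. ennreal (\<Prod>j\<in>UNIV. normal_density 0 (sqrt (t - s)) (x $ j))) \<and>
        (\<forall>A\<in>sets (F s). \<forall>B\<in>sets borel.
           measure M (A \<inter> {\<omega>\<in>space M. W t \<omega> - W s \<omega> \<in> B}) =
           measure M A * measure M {\<omega>\<in>space M. W t \<omega> - W s \<omega> \<in> B}))"

text \<open>Strong solution of dX = a(X) dt + b(X) dW, X(0) = x0. The Ito integral of the continuous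
  adapted integrand b(X) is given as the limit in probability of left-point Riemann sums.\<close>
definition strong_solution :: "'w measure \<Rightarrow> (real \<Rightarrow> 'w measure) \<Rightarrow> (real \<Rightarrow> 'w \<Rightarrow> real^'m::finite)
    \<Rightarrow> (real^'d::finite \<Rightarrow> real^'d) \<Rightarrow> (real^'d \<Rightarrow> real^'m^'d) \<Rightarrow> real^'d
    \<Rightarrow> (real \<Rightarrow> 'w \<Rightarrow> real^'d) \<Rightarrow> bool" where
  "strong_solution M F W a b x0 X \<longleftrightarrow>
     (\<forall>t\<ge>0. X t \<in> borel_measurable (F t)) \<and>
     (AE \<omega> in M. continuous_on {0..} (\<lambda>t. X t \<omega>)) \<and>
     (\<forall>\<omega>\<in>space M. X 0 \<omega> = x0) \<and>
     (\<forall>t\<ge>0. conv_prob M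
        (\<lambda>N \<omega>. \<Sum>k<N. (t / real N) *\<^sub>R a (X (real k * t / real N) \<omega>)
              + b (X (real k * t / real N) \<omega>) *v
                  (W (real (Suc k) * t / real N) \<omega> - W (real k * t / real N) \<omega>))
        (\<lambda>\<omega>. X t \<omega> - x0))"

text \<open>J is a version of the iterated Ito integrals
  I_(j1,j2)(s,t) = int_s^t int_s^{s2} dW^{j1}(s1) dW^{j2}(s2), for all deterministic 0 <= s <= t,
  again as limit in probability of left-point Riemann sums.\<close>
definition iterated_ito :: "'w measure \<Rightarrow> (real \<Rightarrow> 'w measure) \<Rightarrow> (real \<Rightarrow> 'w \<Rightarrow> real^'m::finite)
    \<Rightarrow> (real \<Rightarrow> real \<Rightarrow> 'm \<Rightarrow> 'm \<Rightarrow> 'w \<Rightarrow> real) \<Rightarrow> bool" where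
  "iterated_ito M F W J \<longleftrightarrow>
     (\<forall>s t j1 j2. 0 \<le> s \<longrightarrow> s \<le> t \<longrightarrow>
        J s t j1 j2 \<in> borel_measurable (F t) \<and>
        conv_prob M
          (\<lambda>N \<omega>. \<Sum>k<N. (W (s + real k * (t - s) / real N) \<omega> $ j1 - W s \<omega> $ j1) *
               (W (s + real (Suc k) * (t - s) / real N) \<omega> $ j2 - W (s + real k * (t - s) / real N) \<omega> $ j2))
          (J s t j1 j2))"

definition exit_time :: "real \<Rightarrow> (real^'d::finite) set \<Rightarrow> (real \<Rightarrow> 'w \<Rightarrow> real^'d) \<Rightarrow> 'w \<Rightarrow> real" where
  "exit_time T D X \<omega> = (if \<exists>t\<ge>0. X t \<omega> \<notin> D then min (Inf {t. t \<ge> 0 \<and> X t \<omega> \<notin> D}) T else T)"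

definition Lop :: "(real^'d::finite \<Rightarrow> real^'m::finite^'d) \<Rightarrow> 'm \<Rightarrow> 'd \<Rightarrow> 'm \<Rightarrow> real^'d \<Rightarrow> real" where
  "Lop b j1 i j2 x = (\<Sum>l\<in>UNIV. b x $ l $ j1 * pd l (\<lambda>y. b y $ i $ j2) x)"

definition step_size :: "(real^'d::finite) set \<Rightarrow> real \<Rightarrow> real \<Rightarrow> real^'d \<Rightarrow> real" where
  "step_size D Cb h x =
     (let \<delta> = sqrt (8 * Cb * real CARD('d) * h * ln (1 / h)) in
      if infdist x (frontier D) > \<delta> then h else h\<^sup>2)"

fun milstein :: "(real^'d::finite) set \<Rightarrow> real \<Rightarrow> real \<Rightarrow> (real^'d \<Rightarrow> real^'d) \<Rightarrow> (real^'d \<Rightarrow> real^'m::finite^'d)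
    \<Rightarrow> (real \<Rightarrow> 'w \<Rightarrow> real^'m) \<Rightarrow> (real \<Rightarrow> real \<Rightarrow> 'm \<Rightarrow> 'm \<Rightarrow> 'w \<Rightarrow> real) \<Rightarrow> real^'d
    \<Rightarrow> nat \<Rightarrow> 'w \<Rightarrow> (real \<times> (real^'d))" where
  "milstein D Cb h a b W J x0 0 \<omega> = (0, x0)"
| "milstein D Cb h a b W J x0 (Suc n) \<omega> =
     (let (t, x) = milstein D Cb h a b W J x0 n \<omega>;
          dt = step_size D Cb h x;
          t' = t + dt;
          dW = W t' \<omega> - W t \<omega>
      in (t', \<chi> i. x $ i + a x $ i * dt + (\<Sum>j\<in>UNIV. b x $ i $ j * dW $ j)
                 + (\<Sum>j1\<in>UNIV. \<Sum>j2\<in>UNIV. Lop b j1 i j2 x * J t t' j1 j2 \<omega>)))"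

definition num_exit_time :: "real \<Rightarrow> (real^'d::finite) set \<Rightarrow> real \<Rightarrow> real \<Rightarrow> (real^'d \<Rightarrow> real^'d)
    \<Rightarrow> (real^'d \<Rightarrow> real^'m::finite^'d) \<Rightarrow> (real \<Rightarrow> 'w \<Rightarrow> real^'m) \<Rightarrow> (real \<Rightarrow> real \<Rightarrow> 'm \<Rightarrow> 'm \<Rightarrow> 'w \<Rightarrow> real)
    \<Rightarrow> real^'d \<Rightarrow> 'w \<Rightarrow> real" where
  "num_exit_time T D Cb h a b W J x0 \<omega> =
     (if \<exists>n. snd (milstein D Cb h a b W J x0 n \<omega>) \<notin> D
      then min (Inf {fst (milstein D Cb h a b W J x0 n \<omega>) | n. snd (milstein D Cb h a b W J x0 n \<omega>) \<notin> D}) T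
      else T)"

end

theory Submission
  imports Defs
begin

text \<open>
  The exit times are compared by means of a barrier, and no stochastic calculus is used beyond the
  Riemann sums that define the integrals. On these sums, moment bounds conditional on \<open>F s\<close> are
  estimates for discrete martingales; they pass to the solution and to the iterated integrals by
  Fatou's lemma. This gives the mean and the mean square of the local error. The random grid times
  take finitely many values, so the squared error is a supermartingale up to an exponential factor and
  a term of order \<open>h\<^sup>2\<close>, and a maximal inequality shows that the maximal error exceeds \<open>\<rho>\<close> with
  probability at most \<open>C h\<^sup>2 / \<rho>\<^sup>2\<close>.

  The boundary has uniform exterior balls. Minimising \<open>exp (- l r\<^sup>2) - exp (- l |x - z|\<^sup>2)\<close> over the
  centres \<open>z\<close> of the balls at a finite \<open>h\<close>-net of the boundary yields a Lipschitz function \<open>g\<close> that is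
  nonnegative on \<open>D\<close>, at most \<open>L h\<close> on the boundary, and, by ellipticity, decreases in mean along the
  solution at a rate bounded below near \<open>D\<close>. The times \<open>k h\<^sup>2\<close> at which exactly one of the two paths has left \<open>D\<close>
  form an interval, and the mean length of this interval is bounded by the mean total decrease of \<open>g\<close> over it.
  When it starts the solution is close to the boundary and when it ends it is close to \<open>D\<close>, so
  the decrease is at most a multiple of the maximal error, of the oscillation of the solution over a
  time \<open>h\<^sup>2\<close>, and of \<open>h\<close>. The step size rule excludes, up to an event of probability of order \<open>h\<close>, that the
  solution leaves \<open>D\<close> unnoticed during a long step.\<close>

subsection \<open>Wiener increments\<close>

text \<open>The scheme runs on a random grid, while \<open>J\<close> is characterised at
  deterministic times only. Hence every estimate is proved for fixed times with weights or events
  from \<open>F s\<close>, and is transferred by splitting into the events on which the current time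
  and the current step have given values. The barrier stands in for both Ito's formula and the
  solution of a boundary value problem. A minimum of finitely many functions that decrease in mean
  inherits the decrease: at the start it equals one of them, later it lies below that one.
  Finiteness is the reason for a net in place of all boundary points; the defect on the boundary has
  the order of the final error. Net and \<open>g\<close> change with \<open>h\<close>, so all
  constants of the barrier are fixed before the net is chosen. Summing the tail bound of the maximal
  error over dyadic levels, up to the scale of the step size threshold, gives a mean of order h. The
  oscillation over a time h^2 has order h * sqrt (ln (1 / h)); this is the only term that costs the
  \<xi> in the exponent.\<close>

lemma lborel_prod_vec:
  fixes f :: "'m::finite \<Rightarrow> real \<Rightarrow> real"
  assumes "\<And>j. integrable lborel (f j)"
  shows "integrable lborel (\<lambda>x::real^'m. \<Prod>j\<in>UNIV. f j (x $ j))" (is ?A)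
    and "(\<integral>x. (\<Prod>j\<in>UNIV. f j (x $ j)) \<partial>(lborel :: (real^'m) measure)) = (\<Prod>j\<in>UNIV. integral\<^sup>L lborel (f j))" (is ?B)
proof -
  let ?T = "\<lambda>g. \<Sum>b\<in>Basis. g b *\<^sub>R (b::real^'m)"
  interpret product_sigma_finite "\<lambda>_::real^'m. lborel :: real measure" by standard
  \<comment> \<open>\<open>lborel_eq\<close> presents Lebesgue measure as the image of a product
    indexed by \<open>Basis\<close>, so the factors are relabelled by basis vectors.\<close>
  define f' where "f' = (\<lambda>b::real^'m. f (THE j. b = axis j 1))"
  have f'ax: "f' (axis j 1) = f j" for j
    unfolding f'_def by (simp add: axis_eq_axis)
  have bij: "bij_betw (\<lambda>j. axis j (1::real) :: real^'m) UNIV Basis"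
    by (auto simp: bij_betw_def inj_on_def axis_eq_axis Basis_vec_def)
  have nth: "?T g $ j = g (axis j 1)" for g j
  proof -
    have "?T g $ j = ?T g \<bullet> axis j 1" by (simp add: inner_axis)
    also have "\<dots> = g (axis j 1)" by (simp add: inner_sum_left_Basis)
    finally show ?thesis .
  qed
  have pr: "(\<Prod>j\<in>UNIV. f j (?T g $ j)) = (\<Prod>b\<in>Basis. f' b (g b))" for g
    unfolding nth using prod.reindex_bij_betw[OF bij, of "\<lambda>b. f' b (g b)"] by (simp add: f'ax)
  have int': "integrable lborel (f' b)" if "b \<in> Basis" for b
    unfolding f'_def by (rule assms)
  have [measurable]: "f j \<in> borel_measurable borel" for j using assms[of j] by (auto dest: borel_measurable_integrable)
  have m: "(\<lambda>x::real^'m. \<Prod>j\<in>UNIV. f j (x $ j)) \<in> borel_measurable borel" by measurable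
  have T: "?T \<in> (\<Pi>\<^sub>M b\<in>Basis. lborel) \<rightarrow>\<^sub>M borel" by measurable
  have 1: "integrable (\<Pi>\<^sub>M b\<in>(Basis::(real^'m) set). lborel) (\<lambda>g. \<Prod>b\<in>Basis. f' b (g b))"
    by (rule product_integrable_prod) (auto simp: int')
  have 2: "(\<integral>g. (\<Prod>b\<in>Basis. f' b (g b)) \<partial>(\<Pi>\<^sub>M b\<in>(Basis::(real^'m) set). lborel)) = (\<Prod>b\<in>Basis. integral\<^sup>L lborel (f' b))"
    by (rule product_integral_prod) (auto simp: int')
  have 3: "(\<Prod>b\<in>Basis. integral\<^sup>L lborel (f' b)) = (\<Prod>j\<in>UNIV. integral\<^sup>L lborel (f j))"
    using prod.reindex_bij_betw[OF bij, of "\<lambda>b. integral\<^sup>L lborel (f' b)"] by (simp add: f'ax)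
  note lb = lborel_eq[where 'a="real^'m"]
  show ?A using 1 by (subst lb, subst integrable_distr_eq[OF T m]) (simp only: pr)
  show ?B using 2 3 by (subst lb, subst integral_distr[OF T m]) (simp only: pr)
qed

text \<open>Completing the square: the factor \<open>exp (v * x)\<close> moves the mean of the
  centred normal density to \<open>v * \<sigma>\<^sup>2\<close>.\<close>

lemma gauss_exp:
  assumes "0 < \<sigma>"
  shows "integrable lborel (\<lambda>x. normal_density 0 \<sigma> x * exp (v * x))"
    and "(\<integral>x. normal_density 0 \<sigma> x * exp (v * x) \<partial>lborel) = exp (v\<^sup>2 * \<sigma>\<^sup>2 / 2)"
proof -
  have eq: "normal_density 0 \<sigma> x * exp (v * x) = exp (v\<^sup>2 * \<sigma>\<^sup>2 / 2) * normal_density (v * \<sigma>\<^sup>2) \<sigma> x" for x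
  proof -
    have "- (x\<^sup>2) / (2 * \<sigma>\<^sup>2) + v * x = v\<^sup>2 * \<sigma>\<^sup>2 / 2 + (- ((x - v * \<sigma>\<^sup>2)\<^sup>2) / (2 * \<sigma>\<^sup>2))"
      using assms by (simp add: field_simps power2_eq_square)
    then have "exp (- (x\<^sup>2) / (2 * \<sigma>\<^sup>2)) * exp (v * x) = exp (v\<^sup>2 * \<sigma>\<^sup>2 / 2) * exp (- ((x - v * \<sigma>\<^sup>2)\<^sup>2) / (2 * \<sigma>\<^sup>2))"
      by (simp add: exp_add[symmetric])
    then show ?thesis by (simp add: normal_density_def field_simps)
  qed
  show "integrable lborel (\<lambda>x. normal_density 0 \<sigma> x * exp (v * x))"
    unfolding eq using assms by (intro integrable_mult_right) auto
  show "(\<integral>x. normal_density 0 \<sigma> x * exp (v * x) \<partial>lborel) = exp (v\<^sup>2 * \<sigma>\<^sup>2 / 2)"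
    unfolding eq using assms by simp
qed

locale filtered_wiener = prob_space M
  for M :: "'w measure" +
  fixes F :: "real \<Rightarrow> 'w measure" and W :: "real \<Rightarrow> 'w \<Rightarrow> real^'m::finite"
  assumes filt: "filtration_on M F" and wien: "wiener M F W"
begin

lemma subalg: "0 \<le> t \<Longrightarrow> subalgebra M (F t)"
  using filt unfolding filtration_on_def by auto

lemma space_F: "0 \<le> t \<Longrightarrow> space (F t) = space M"
  using subalg unfolding subalgebra_def by auto

lemma sets_F_M: "0 \<le> t \<Longrightarrow> A \<in> sets (F t) \<Longrightarrow> A \<in> sets M"
  using subalg unfolding subalgebra_def by auto

lemma sets_F_mono: "0 \<le> s \<Longrightarrow> s \<le> t \<Longrightarrow> A \<in> sets (F s) \<Longrightarrow> A \<in> sets (F t)"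
  using filt unfolding filtration_on_def by auto

lemma meas_F_mono: "0 \<le> s \<Longrightarrow> s \<le> t \<Longrightarrow> f \<in> measurable (F s) N \<Longrightarrow> f \<in> measurable (F t) N"
  by (auto simp: measurable_def space_F intro: sets_F_mono)

lemma meas_F_M: "0 \<le> s \<Longrightarrow> f \<in> measurable (F s) N \<Longrightarrow> f \<in> measurable M N"
  by (auto simp: measurable_def space_F intro: sets_F_M)

lemma meas_W: "0 \<le> t \<Longrightarrow> W t \<in> borel_measurable (F t)"
  using wien unfolding wiener_def by auto

lemma meas_W_le: "0 \<le> s \<Longrightarrow> s \<le> t \<Longrightarrow> W s \<in> borel_measurable (F t)"
  using meas_W meas_F_mono by blast

lemma meas_W_M: "0 \<le> t \<Longrightarrow> W t \<in> borel_measurable M"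
  using meas_W meas_F_M by blast

definition gauss :: "real \<Rightarrow> real^'m \<Rightarrow> real" where
  "gauss t x = (\<Prod>j\<in>UNIV. normal_density 0 (sqrt t) (x $ j))"

lemma gauss_nonneg: "0 \<le> gauss t x"
  unfolding gauss_def by (intro prod_nonneg) auto

lemma gauss_meas[measurable]: "gauss t \<in> borel_measurable borel"
  unfolding gauss_def by measurable

lemma dW_distr: "0 \<le> s \<Longrightarrow> s < t \<Longrightarrow> distributed M lborel (\<lambda>w. W t w - W s w) (\<lambda>x. ennreal (gauss (t - s) x))"
  using wien unfolding wiener_def gauss_def by auto

lemma dW_meas: "0 \<le> s \<Longrightarrow> s < t \<Longrightarrow> (\<lambda>w. W t w - W s w) \<in> borel_measurable M"
  using meas_W_M by (intro borel_measurable_diff) auto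

text \<open>\<open>wiener\<close> states independence for single events. Agreement on rectangles
  extends it to the joint law, and \<open>Y\<close> may live in any measurable space, so that
  several \<open>F s\<close>-measurable quantities can be frozen at once.\<close>

lemma dW_indep:
  assumes "0 \<le> s" "s < t" and Y: "Y \<in> measurable (F s) N"
  shows "distr M N Y \<Otimes>\<^sub>M distr M borel (\<lambda>w. W t w - W s w)
    = distr M (N \<Otimes>\<^sub>M borel) (\<lambda>w. (Y w, W t w - W s w))"
proof -
  let ?Z = "\<lambda>w. W t w - W s w"
  have YM[measurable]: "Y \<in> measurable M N" using assms meas_F_M by blast
  have Z[measurable]: "?Z \<in> borel_measurable M" using dW_meas assms by auto
  interpret Y: prob_space "distr M N Y" by (rule prob_space_distr) simp
  interpret Z: prob_space "distr M borel ?Z" by (rule prob_space_distr) simp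
  show ?thesis
  proof (rule pair_measure_eqI)
    show "sigma_finite_measure (distr M N Y)" "sigma_finite_measure (distr M borel ?Z)" by unfold_locales
    show "sets (distr M N Y \<Otimes>\<^sub>M distr M borel ?Z) = sets (distr M (N \<Otimes>\<^sub>M borel) (\<lambda>w. (Y w, ?Z w)))"
      by (simp cong: sets_pair_measure_cong)
    fix A B assume "A \<in> sets (distr M N Y)" "B \<in> sets (distr M borel ?Z)"
    then have A[measurable]: "A \<in> sets N" and B[measurable]: "B \<in> sets borel" by auto
    have AF: "Y -` A \<inter> space M \<in> sets (F s)" using measurable_sets[OF Y A] space_F[OF assms(1)] by simp
    have "emeasure (distr M (N \<Otimes>\<^sub>M borel) (\<lambda>w. (Y w, ?Z w))) (A \<times> B)
       = emeasure M ((Y -` A \<inter> space M) \<inter> {w\<in>space M. ?Z w \<in> B})"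
      by (subst emeasure_distr) (auto intro!: arg_cong[where f="emeasure M"])
    also have "\<dots> = emeasure M (Y -` A \<inter> space M) * emeasure M {w\<in>space M. ?Z w \<in> B}"
      using wien AF B assms unfolding wiener_def by (simp add: emeasure_eq_measure ennreal_mult)
    also have "{w\<in>space M. ?Z w \<in> B} = ?Z -` B \<inter> space M" by auto
    finally show "emeasure (distr M N Y) A * emeasure (distr M borel ?Z) B =
       emeasure (distr M (N \<Otimes>\<^sub>M borel) (\<lambda>w. (Y w, ?Z w))) (A \<times> B)"
      by (simp add: emeasure_distr)
  qed
qed

lemma dW_integral:
  assumes "0 \<le> s" "s < t" and [measurable]: "g \<in> borel_measurable borel"
  shows "(\<integral>w. g (W t w - W s w) \<partial>M) = (\<integral>x. gauss (t - s) x * (g x :: real) \<partial>lborel)"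
    and "integrable M (\<lambda>w. g (W t w - W s w)) \<longleftrightarrow> integrable lborel (\<lambda>x. gauss (t - s) x * g x)"
  using distributed_integral[OF dW_distr[OF assms(1,2)], of g] distributed_integrable[OF dW_distr[OF assms(1,2)], of g]
    gauss_nonneg by auto

lemma dW_moment1:
  assumes "0 \<le> s" "s < t"
  shows "integrable M (\<lambda>w. W t w $ j - W s w $ j)" "(\<integral>w. W t w $ j - W s w $ j \<partial>M) = 0"
proof -
  let ?\<sigma> = "sqrt (t - s)"
  have s: "0 < ?\<sigma>" using assms by simp
  let ?f = "\<lambda>l x. normal_density 0 ?\<sigma> x * (if l = j then x else 1)"
  have i: "integrable lborel (?f l)" for l
    using integrable_normal_moment[OF s, of 0 1] integrable_normal_density[OF s, of 0] by (cases "l = j") auto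
  have e: "gauss (t - s) x * (x $ j) = (\<Prod>l\<in>UNIV. ?f l (x $ l))" for x
    unfolding gauss_def prod.distrib by simp
  have z: "integral\<^sup>L lborel (?f j) = 0"
    using integral_normal_moment_odd[OF s, of 0 0] by simp
  have "(\<Prod>l\<in>UNIV. integral\<^sup>L lborel (?f l)) = 0"
    using z by (intro prod_zero) (auto intro!: exI[of _ j])
  then show "integrable M (\<lambda>w. W t w $ j - W s w $ j)" "(\<integral>w. W t w $ j - W s w $ j \<partial>M) = 0"
    using dW_integral[OF assms, of "\<lambda>x. x $ j"] lborel_prod_vec[of ?f, OF i] by (auto simp: e)
qed

lemma dW_moment2:
  assumes "0 \<le> s" "s < t"
  shows "integrable M (\<lambda>w. (W t w $ i - W s w $ i) * (W t w $ j - W s w $ j))"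
    "(\<integral>w. (W t w $ i - W s w $ i) * (W t w $ j - W s w $ j) \<partial>M) = (if i = j then t - s else 0)"
proof -
  let ?\<sigma> = "sqrt (t - s)"
  have s: "0 < ?\<sigma>" using assms by simp
  let ?f = "\<lambda>l x. normal_density 0 ?\<sigma> x * ((if l = i then x else 1) * (if l = j then x else 1))"
  have i: "integrable lborel (?f l)" for l
    using integrable_normal_moment[OF s, of 0 1] integrable_normal_moment[OF s, of 0 2] integrable_normal_density[OF s, of 0]
    by (cases "l = j"; cases "l = i") (auto simp: power2_eq_square)
  have e: "gauss (t - s) x * ((x $ i) * (x $ j)) = (\<Prod>l\<in>UNIV. ?f l (x $ l))" for x
    unfolding gauss_def prod.distrib by simp
  have z: "integral\<^sup>L lborel (?f l) = (if l = i \<and> l = j then t - s else if l \<noteq> i \<and> l \<noteq> j then 1 else 0)" for l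
  proof -
    have 1: "(\<integral>x. normal_density 0 ?\<sigma> x * x \<partial>lborel) = 0"
      using integral_normal_moment_odd[OF s, of 0 0] by simp
    have 2: "(\<integral>x. normal_density 0 ?\<sigma> x * (x * x) \<partial>lborel) = t - s"
      using integral_normal_moment_even[OF s, of 0 1] assms by (simp add: power2_eq_square eval_nat_numeral)
    have 3: "(\<integral>x. normal_density 0 ?\<sigma> x \<partial>lborel) = 1"
      by (rule integral_normal_density[OF s])
    show ?thesis using 1 2 3 by (cases "l = i"; cases "l = j") auto
  qed
  \<comment> \<open>For distinct \<open>i\<close> and \<open>j\<close> the factor at
    \<open>i\<close> is a first moment, hence zero; for \<open>i = j\<close> all factors but one
    equal 1.\<close>
  have "(\<Prod>l\<in>UNIV. g l) = (if i = j then c else 0)"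
    if "\<And>l. g l = (if l = i \<and> l = j then c else if l \<noteq> i \<and> l \<noteq> j then 1 else 0)" for g :: "'m \<Rightarrow> real" and c
  proof (cases "i = j")
    case True
    then have "g = (\<lambda>l. if l = j then c else 1)" using that by auto
    then show ?thesis using True by simp
  next
    case False
    then show ?thesis using that[of i] by (subst prod_zero[of UNIV]) auto
  qed
  from this[OF z] have "(\<Prod>l\<in>UNIV. integral\<^sup>L lborel (?f l)) = (if i = j then t - s else 0)" .
  then show "integrable M (\<lambda>w. (W t w $ i - W s w $ i) * (W t w $ j - W s w $ j))"
    "(\<integral>w. (W t w $ i - W s w $ i) * (W t w $ j - W s w $ j) \<partial>M) = (if i = j then t - s else 0)"
    using dW_integral[OF assms, of "\<lambda>x. (x $ i) * (x $ j)"] lborel_prod_vec[of ?f, OF i] by (auto simp: e)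
qed

lemma dW_exp:
  assumes "0 \<le> s" "s < t"
  shows "(\<integral>\<^sup>+w. ennreal (exp (v \<bullet> (W t w - W s w))) \<partial>M) = ennreal (exp ((norm v)\<^sup>2 * (t - s) / 2))"
proof -
  let ?\<sigma> = "sqrt (t - s)"
  have s: "0 < ?\<sigma>" using assms by simp
  let ?f = "\<lambda>l x. normal_density 0 ?\<sigma> x * exp (v $ l * x)"
  have i: "integrable lborel (?f l)" for l by (rule gauss_exp[OF s])
  have e: "gauss (t - s) x * exp (v \<bullet> x) = (\<Prod>l\<in>UNIV. ?f l (x $ l))" for x
    unfolding gauss_def prod.distrib inner_vec_def by (simp add: exp_sum)
  have "(\<Prod>l\<in>UNIV. integral\<^sup>L lborel (?f l)) = exp (\<Sum>l\<in>UNIV. (v $ l)\<^sup>2 * (t - s) / 2)"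
    using assms by (simp add: gauss_exp(2)[OF s] exp_sum)
  also have "(\<Sum>l\<in>UNIV. (v $ l)\<^sup>2 * (t - s) / 2) = (norm v)\<^sup>2 * (t - s) / 2"
    unfolding power2_norm_eq_inner inner_vec_def by (simp add: power2_eq_square sum_distrib_right sum_divide_distrib)
  finally have *: "(\<Prod>l\<in>UNIV. integral\<^sup>L lborel (?f l)) = exp ((norm v)\<^sup>2 * (t - s) / 2)" .
  have "integrable M (\<lambda>w. exp (v \<bullet> (W t w - W s w)))" 
     "(\<integral>w. exp (v \<bullet> (W t w - W s w)) \<partial>M) = exp ((norm v)\<^sup>2 * (t - s) / 2)"
    using dW_integral[OF assms, of "\<lambda>x. exp (v \<bullet> x)"] lborel_prod_vec[of ?f, OF i] * by (auto simp: e)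
  then show ?thesis by (subst nn_integral_eq_integral) auto
qed

text \<open>Under the product law \<open>v\<close> is frozen while the increment is integrated, so
  the exact Gaussian formula applies to each value of \<open>v\<close>. With \<open>U\<close> in the
  extended nonnegative reals no integrability has to be checked.\<close>

lemma dW_exp_cond:
  assumes st: "0 \<le> s" "s < t" and U: "U \<in> borel_measurable (F s)" and v: "v \<in> borel_measurable (F s)"
  shows "(\<integral>\<^sup>+w. U w * ennreal (exp (v w \<bullet> (W t w - W s w))) \<partial>M)
     = (\<integral>\<^sup>+w. U w * ennreal (exp ((norm (v w))\<^sup>2 * (t - s) / 2)) \<partial>M)"
proof -
  let ?Z = "\<lambda>w. W t w - W s w"
  let ?Y = "\<lambda>w. (U w, v w)"
  have Y: "?Y \<in> measurable (F s) (borel \<Otimes>\<^sub>M borel)" using U v by measurable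
  have YM[measurable]: "?Y \<in> measurable M (borel \<Otimes>\<^sub>M borel)" using meas_F_M[OF st(1) Y] .
  have Z[measurable]: "?Z \<in> borel_measurable M"
    using meas_W_M st by (intro borel_measurable_diff) auto
  interpret Y: prob_space "distr M (borel \<Otimes>\<^sub>M borel) ?Y" by (rule prob_space_distr) simp
  interpret Z: prob_space "distr M borel ?Z" by (rule prob_space_distr) simp
  have eq: "distr M (borel \<Otimes>\<^sub>M borel) ?Y \<Otimes>\<^sub>M distr M borel ?Z = distr M ((borel \<Otimes>\<^sub>M borel) \<Otimes>\<^sub>M borel) (\<lambda>x. (?Y x, ?Z x))"
    by (rule dW_indep[OF st Y])
  let ?\<phi> = "\<lambda>(y, z). fst y * ennreal (exp (snd y \<bullet> z))"
  have "(\<integral>\<^sup>+w. U w * ennreal (exp (v w \<bullet> ?Z w)) \<partial>M)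
     = (\<integral>\<^sup>+p. ?\<phi> p \<partial>distr M ((borel \<Otimes>\<^sub>M borel) \<Otimes>\<^sub>M borel) (\<lambda>x. (?Y x, ?Z x)))"
    by (subst nn_integral_distr) auto
  also have "\<dots> = (\<integral>\<^sup>+y. \<integral>\<^sup>+z. fst y * ennreal (exp (snd y \<bullet> z)) \<partial>distr M borel ?Z \<partial>distr M (borel \<Otimes>\<^sub>M borel) ?Y)"
    unfolding eq[symmetric] by (subst Z.nn_integral_fst[symmetric]) (auto simp: case_prod_beta)
  also have "\<dots> = (\<integral>\<^sup>+y. fst y * ennreal (exp ((norm (snd y))\<^sup>2 * (t - s) / 2)) \<partial>distr M (borel \<Otimes>\<^sub>M borel) ?Y)"
    by (intro nn_integral_cong, subst nn_integral_cmult) (auto simp: nn_integral_distr dW_exp[OF st])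
  also have "\<dots> = (\<integral>\<^sup>+w. U w * ennreal (exp ((norm (v w))\<^sup>2 * (t - s) / 2)) \<partial>M)"
    by (subst nn_integral_distr) auto
  finally show ?thesis .
qed

text \<open>The weight is only integrable here, not bounded: \<open>mart_sum\<close> multiplies
  increments by partial sums.\<close>

lemma dW_cond:
  assumes st: "0 \<le> s" "s < t" and U: "U \<in> borel_measurable (F s)" "integrable M U"
    and g: "g \<in> borel_measurable borel" "integrable M (\<lambda>w. g (W t w - W s w))"
  shows "integrable M (\<lambda>w. U w * g (W t w - W s w))"
    and "(\<integral>w. U w * g (W t w - W s w) \<partial>M) = (\<integral>w. U w \<partial>M) * ((\<integral>w. g (W t w - W s w) \<partial>M) :: real)"
proof -
  let ?Z = "\<lambda>w. W t w - W s w"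
  have [measurable]: "U \<in> borel_measurable M" "?Z \<in> borel_measurable M" "g \<in> borel_measurable borel"
    using meas_F_M[OF st(1) U(1)] dW_meas st g by auto
  have "distr M (borel \<Otimes>\<^sub>M borel) (\<lambda>w. (U w, g (?Z w))) =
     distr (distr M (borel \<Otimes>\<^sub>M borel) (\<lambda>w. (U w, ?Z w))) (borel \<Otimes>\<^sub>M borel) (\<lambda>(u, z). (u, g z))"
    by (subst distr_distr) (auto simp: o_def)
  also have "\<dots> = distr (distr M borel U \<Otimes>\<^sub>M distr M borel ?Z) (borel \<Otimes>\<^sub>M borel) (\<lambda>(u, z). (u, g z))"
    using dW_indep[OF st U(1)] by simp
  also have "\<dots> = distr (distr M borel U) borel (\<lambda>u. u) \<Otimes>\<^sub>M distr (distr M borel ?Z) borel g"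
  proof (rule pair_measure_distr[symmetric])
    interpret p: prob_space "distr (distr M borel ?Z) borel g" 
      by (intro prob_space.prob_space_distr prob_space_distr) simp_all
    show "sigma_finite_measure (distr (distr M borel ?Z) borel g)" by unfold_locales
  qed auto
  also have "\<dots> = distr M borel U \<Otimes>\<^sub>M distr M borel (\<lambda>w. g (?Z w))"
    by (simp add: distr_distr o_def)
  finally have "indep_var borel U borel (\<lambda>w. g (?Z w))"
    unfolding indep_var_distribution_eq by simp
  from indep_var_lebesgue_integral[OF this] indep_var_integrable[OF this] U g
  show "integrable M (\<lambda>w. U w * g (W t w - W s w))"
    and "(\<integral>w. U w * g (W t w - W s w) \<partial>M) = (\<integral>w. U w \<partial>M) * ((\<integral>w. g (W t w - W s w) \<partial>M) :: real)"
    by (auto simp: o_def)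
qed

lemma dW_cond1:
  assumes st: "0 \<le> s" "s < t" and U: "U \<in> borel_measurable (F s)" "integrable M U"
  shows "integrable M (\<lambda>w. U w * (W t w $ j - W s w $ j))"
    and "(\<integral>w. U w * (W t w $ j - W s w $ j) \<partial>M) = 0"
  using dW_cond[OF st U, of "\<lambda>x. x $ j"] dW_moment1[OF st] by auto

lemma dW_cond2:
  assumes st: "0 \<le> s" "s < t" and U: "U \<in> borel_measurable (F s)" "integrable M U"
  shows "integrable M (\<lambda>w. U w * ((W t w $ i - W s w $ i) * (W t w $ j - W s w $ j)))"
    and "(\<integral>w. U w * ((W t w $ i - W s w $ i) * (W t w $ j - W s w $ j)) \<partial>M)
        = (if i = j then t - s else 0) * (\<integral>w. U w \<partial>M)"
  using dW_cond[OF st U, of "\<lambda>x. (x $ i) * (x $ j)"] dW_moment2[OF st] by auto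

end

subsection \<open>Square integrability and discrete martingales\<close>

lemma measurable_vec_nth[measurable (raw)]:
  "f \<in> borel_measurable N \<Longrightarrow> (\<lambda>x. (f x :: real^'n::finite) $ i) \<in> borel_measurable N"
  by (rule measurable_compose[OF _ borel_measurable_nth])

context prob_space
begin

definition L2 :: "('a \<Rightarrow> real) \<Rightarrow> bool" where
  "L2 Z \<longleftrightarrow> Z \<in> borel_measurable M \<and> integrable M (\<lambda>w. (Z w)\<^sup>2)"

lemma L2_meas: "L2 Z \<Longrightarrow> Z \<in> borel_measurable M"
  and L2_sq: "L2 Z \<Longrightarrow> integrable M (\<lambda>w. (Z w)\<^sup>2)"
  unfolding L2_def by auto

lemma L2_mult: "L2 X \<Longrightarrow> L2 Y \<Longrightarrow> integrable M (\<lambda>w. X w * Y w)"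
proof -
  assume X: "L2 X" and Y: "L2 Y"
  have "\<bar>x * y\<bar> \<le> x\<^sup>2 + y\<^sup>2" for x y :: real
    using zero_le_power2[of "\<bar>x\<bar> - \<bar>y\<bar>"] zero_le_power2[of x] zero_le_power2[of y] unfolding power2_diff abs_mult power2_abs
    by linarith
  then have *: "norm (x * y) \<le> norm (x\<^sup>2 + y\<^sup>2)" for x y :: real by simp
  have [measurable]: "X \<in> borel_measurable M" "Y \<in> borel_measurable M" using X Y L2_meas by auto
  have "integrable M (\<lambda>w. (X w)\<^sup>2 + (Y w)\<^sup>2)" using X Y L2_sq by auto
  then show ?thesis by (rule Bochner_Integration.integrable_bound) (use * in auto)
qed

lemma L2_const: "L2 (\<lambda>_. c)"
  unfolding L2_def by auto

lemma L2_integrable: "L2 X \<Longrightarrow> integrable M X"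
  using L2_mult[OF _ L2_const[of 1]] by simp

lemma L2_add: "L2 X \<Longrightarrow> L2 Y \<Longrightarrow> L2 (\<lambda>w. X w + Y w)"
  using L2_mult[of X Y] unfolding L2_def by (auto simp: power2_sum mult.assoc)

lemma L2_bmult:
  assumes "L2 X" "Y \<in> borel_measurable M" "\<And>w. \<bar>Y w\<bar> \<le> (B::real)"
  shows "L2 (\<lambda>w. Y w * X w)"
  unfolding L2_def
proof
  have [measurable]: "X \<in> borel_measurable M" "Y \<in> borel_measurable M" using assms L2_meas by auto
  show "(\<lambda>w. Y w * X w) \<in> borel_measurable M" by measurable
  have "(Y w)\<^sup>2 \<le> B\<^sup>2" for w using assms(3)[of w] by (metis abs_ge_zero power_mono power2_abs)
  then have "AE w in M. norm ((Y w * X w)\<^sup>2) \<le> norm (B\<^sup>2 * (X w)\<^sup>2)"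
    by (auto simp: power_mult_distrib intro!: mult_right_mono)
  moreover have "integrable M (\<lambda>w. B\<^sup>2 * (X w)\<^sup>2)" using L2_sq[OF assms(1)] by auto
  ultimately show "integrable M (\<lambda>w. (Y w * X w)\<^sup>2)"
    by (rule Bochner_Integration.integrable_bound[rotated 2]) measurable
qed

lemma L2_cmult: "L2 X \<Longrightarrow> L2 (\<lambda>w. c * X w)"
  using L2_bmult[of X "\<lambda>_. c" "\<bar>c\<bar>"] by simp

lemma L2_minus: "L2 X \<Longrightarrow> L2 (\<lambda>w. - X w)"
  using L2_cmult[of X "-1"] by simp

lemma L2_diff: "L2 X \<Longrightarrow> L2 Y \<Longrightarrow> L2 (\<lambda>w. X w - Y w)"
  using L2_add[OF _ L2_minus, of X Y] by simp

lemma L2_sum: "(\<And>i. i \<in> I \<Longrightarrow> L2 (X i)) \<Longrightarrow> L2 (\<lambda>w. \<Sum>i\<in>I. X i w)"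
  by (induction I rule: infinite_finite_induct) (auto intro: L2_add L2_const)

lemma L2_bounded: "Y \<in> borel_measurable M \<Longrightarrow> (\<And>w. \<bar>Y w\<bar> \<le> (B::real)) \<Longrightarrow> L2 Y"
  using L2_bmult[OF L2_const[of 1], of Y B] by simp

lemma L2_mono:
  assumes "L2 X" "Y \<in> borel_measurable M" "\<And>w. w \<in> space M \<Longrightarrow> \<bar>Y w\<bar> \<le> \<bar>X w\<bar>"
  shows "L2 Y"
proof -
  have [measurable]: "Y \<in> borel_measurable M" using assms by auto
  have "AE w in M. norm ((Y w)\<^sup>2) \<le> norm ((X w)\<^sup>2)"
    using assms(3) by (auto simp: abs_le_square_iff)
  then have "integrable M (\<lambda>w. (Y w)\<^sup>2)"
    by (rule Bochner_Integration.integrable_bound[rotated 2]) (use L2_sq[OF assms(1)] in auto)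
  then show ?thesis unfolding L2_def by auto
qed

lemma integrable_bdd_mult:
  assumes "integrable M X" "Y \<in> borel_measurable M" "\<And>w. \<bar>Y w\<bar> \<le> (B::real)"
  shows "integrable M (\<lambda>w. Y w * (X w :: real))"
proof (rule Bochner_Integration.integrable_bound[where f="\<lambda>w. B * \<bar>X w\<bar>"])
  have [measurable]: "X \<in> borel_measurable M" "Y \<in> borel_measurable M" using assms by auto
  show "(\<lambda>w. Y w * X w) \<in> borel_measurable M" by measurable
  have B: "0 \<le> B" using assms(3) abs_ge_zero order_trans by blast
  show "AE w in M. norm (Y w * X w) \<le> norm (B * \<bar>X w\<bar>)"
    using B assms(3) by (auto simp: abs_mult intro!: mult_right_mono)
qed (use assms in auto)

text \<open>One subsequence serves all finitely many indices: the sum over \<open>I\<close> of the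
  distances truncated at 1 tends to 0 in L1, and it dominates each truncated distance.\<close>

lemma conv_prob_AE_subseq:
  fixes S :: "'i \<Rightarrow> nat \<Rightarrow> 'a \<Rightarrow> real"
  assumes I: "finite I" and c: "\<And>i. i \<in> I \<Longrightarrow> conv_prob M (S i) (Y i)"
    and mS: "\<And>i n. i \<in> I \<Longrightarrow> S i n \<in> borel_measurable M" and mY: "\<And>i. i \<in> I \<Longrightarrow> Y i \<in> borel_measurable M"
  shows "\<exists>r::nat\<Rightarrow>nat. strict_mono r \<and> (\<forall>i\<in>I. AE w in M. (\<lambda>n. S i (r n) w) \<longlonglongrightarrow> Y i w)"
proof -
  define u where "u = (\<lambda>i n w. min 1 \<bar>S i n w - Y i w\<bar>)"
  have mu[measurable]: "u i n \<in> borel_measurable M" if "i \<in> I" for i n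
    using mS mY that unfolding u_def by measurable
  have iu: "integrable M (u i n)" if "i \<in> I" for i n
    using mu[OF that] by (intro integrable_const_bound[where B=1]) (auto simp: u_def)
  have lim1: "(\<lambda>n. \<integral>w. u i n w \<partial>M) \<longlonglongrightarrow> 0" if i: "i \<in> I" for i
  proof (rule LIMSEQ_I)
    fix e :: real assume e: "0 < e"
    define p where "p n = measure M {w\<in>space M. e/2 < dist (S i n w) (Y i w)}" for n
    have "p \<longlonglongrightarrow> 0" using c[OF i] e unfolding conv_prob_def p_def using half_gt_zero by blast
    then obtain N where N: "\<And>n. n \<ge> N \<Longrightarrow> \<bar>p n\<bar> < e/2" using e LIMSEQ_D[of p 0 "e/2"] by auto
    have "(\<integral>w. u i n w \<partial>M) \<le> e/2 + p n" for n
    proof -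
      let ?A = "{w\<in>space M. e/2 < dist (S i n w) (Y i w)}"
      have A[measurable]: "?A \<in> sets M" using mS[OF i] mY[OF i] by measurable
      have i2: "integrable M (\<lambda>w. e/2 + indicator ?A w :: real)" 
        by (intro Bochner_Integration.integrable_add integrable_const integrable_real_indicator A) (auto simp: less_top[symmetric])
      have "u i n w \<le> e/2 + indicator ?A w" if "w \<in> space M" for w
        using that e by (cases "w \<in> ?A") (auto simp: u_def dist_real_def min_def)
      then have "(\<integral>w. u i n w \<partial>M) \<le> (\<integral>w. e/2 + indicator ?A w \<partial>M)"
        by (intro integral_mono iu[OF i] i2) auto
      also have "\<dots> = (\<integral>w. e/2 \<partial>M) + (\<integral>w. indicator ?A w \<partial>M)"
        by (intro Bochner_Integration.integral_add integrable_const integrable_real_indicator A) (auto simp: less_top[symmetric])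
      also have "\<dots> = e/2 + p n" unfolding p_def using A by (simp only: integral_indicator lebesgue_integral_const prob_space) simp
      finally show ?thesis .
    qed
    moreover have "0 \<le> (\<integral>w. u i n w \<partial>M)" for n by (rule integral_nonneg_AE) (auto simp: u_def)
    ultimately have "norm ((\<integral>w. u i n w \<partial>M) - 0) < e" if "n \<ge> N" for n
      using N[OF that] by (smt (verit) field_sum_of_halves real_norm_def)
    then show "\<exists>N. \<forall>n\<ge>N. norm ((\<integral>w. u i n w \<partial>M) - 0) < e" by blast
  qed
  have iU: "integrable M (\<lambda>w. \<Sum>i\<in>I. u i n w)" for n using iu by auto
  have "(\<lambda>n. \<integral>w. (\<Sum>i\<in>I. u i n w) \<partial>M) \<longlonglongrightarrow> (\<Sum>i\<in>I. 0)"
    by (subst Bochner_Integration.integral_sum, rule iu, assumption, rule tendsto_sum, rule lim1)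
  moreover have "norm (\<Sum>i\<in>I. u i n w) = (\<Sum>i\<in>I. u i n w)" for n w
    by (simp add: sum_nonneg u_def)
  ultimately have "(\<lambda>n. \<integral>w. norm (\<Sum>i\<in>I. u i n w) \<partial>M) \<longlonglongrightarrow> 0" by simp
  from tendsto_L1_AE_subseq[OF iU this] obtain r :: "nat \<Rightarrow> nat" where r: "strict_mono r"
    "AE w in M. (\<lambda>n. \<Sum>i\<in>I. u i (r n) w) \<longlonglongrightarrow> 0" by auto
  have "AE w in M. (\<lambda>n. S i (r n) w) \<longlonglongrightarrow> Y i w" if i: "i \<in> I" for i
    using r(2)
  proof eventually_elim
    case (elim w)
    have "u i (r n) w \<le> (\<Sum>i\<in>I. u i (r n) w)" for n
      using i I by (intro member_le_sum) (auto simp: u_def)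
    then have "(\<lambda>n. u i (r n) w) \<longlonglongrightarrow> 0"
      by (intro tendsto_sandwich[OF _ _ tendsto_const elim]) (auto simp: u_def)
    then have l: "(\<lambda>n. min 1 \<bar>S i (r n) w - Y i w\<bar>) \<longlonglongrightarrow> 0" unfolding u_def .
    \<comment> \<open>The limit 0 forces values below 1, where the truncation is inactive.\<close>
    have "\<forall>\<^sub>F n in sequentially. min 1 \<bar>S i (r n) w - Y i w\<bar> = \<bar>S i (r n) w - Y i w\<bar>"
      using order_tendstoD(2)[OF l, of 1] by (auto elim!: eventually_mono)
    with l have "(\<lambda>n. \<bar>S i (r n) w - Y i w\<bar>) \<longlonglongrightarrow> 0"
      by (rule Lim_transform_eventually)
    then show ?case using LIM_zero_cancel tendsto_rabs_zero_iff by blast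
  qed
  with r(1) show ?thesis by auto
qed

text \<open>The bounds \<open>c n\<close> may vary, because approximating starting times and grid
  sizes enter them.\<close>

lemma fatou_bound:
  fixes Z :: "nat \<Rightarrow> 'a \<Rightarrow> real"
  assumes lim: "AE w in M. (\<lambda>n. Z n w) \<longlonglongrightarrow> Y w" and Y: "Y \<in> borel_measurable M"
    and nn: "\<And>n w. 0 \<le> Z n w" and i: "\<And>n. integrable M (Z n)"
    and le: "\<And>n. (\<integral>w. Z n w \<partial>M) \<le> c n" and c: "c \<longlonglongrightarrow> c'"
  shows "integrable M Y" "(\<integral>w. Y w \<partial>M) \<le> c'" "AE w in M. 0 \<le> Y w"
proof -
  show nY: "AE w in M. 0 \<le> Y w"
    using lim by eventually_elim (rule LIMSEQ_le_const, auto intro: nn)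
  have c0: "0 \<le> c n" for n
  proof -
    have "0 \<le> (\<integral>w. Z n w \<partial>M)" using nn by (intro integral_nonneg_AE) auto
    then show ?thesis using le[of n] by simp
  qed
  have [measurable]: "Z n \<in> borel_measurable M" for n using i by auto
  have "(\<integral>\<^sup>+w. ennreal (Y w) \<partial>M) = (\<integral>\<^sup>+w. liminf (\<lambda>n. ennreal (Z n w)) \<partial>M)"
  proof (rule nn_integral_cong_AE)
    show "AE w in M. ennreal (Y w) = liminf (\<lambda>n. ennreal (Z n w))"
      using lim by eventually_elim (intro lim_imp_Liminf[symmetric] tendsto_ennrealI, auto)
  qed
  also have "\<dots> \<le> liminf (\<lambda>n. \<integral>\<^sup>+w. ennreal (Z n w) \<partial>M)"
    by (rule nn_integral_liminf) simp
  also have "\<dots> \<le> liminf (\<lambda>n. ennreal (c n))"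
    using le nn i by (intro Liminf_mono always_eventually) (auto simp: nn_integral_eq_integral intro!: ennreal_leI)
  also have "\<dots> = ennreal c'"
    using c by (intro lim_imp_Liminf) auto
  finally have fin: "(\<integral>\<^sup>+w. ennreal (Y w) \<partial>M) \<le> ennreal c'" .
  then show iY: "integrable M Y" using Y nY
    by (intro integrableI_nonneg) (auto intro: le_less_trans[OF fin])
  have "0 \<le> c'" using c c0 by (intro LIMSEQ_le_const) auto
  then show "(\<integral>w. Y w \<partial>M) \<le> c'" using fin iY nY
    by (subst (asm) nn_integral_eq_integral) auto
qed

text \<open>Fatou's lemma controls squares but not signed means. The common L2 bound supplies
  uniform integrability: clipping at level \<open>c\<close> changes every mean by at most
  \<open>K / c\<close>, and clipped means converge by dominated convergence.\<close>

lemma L2_bounded_limit: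
  fixes Z :: "nat \<Rightarrow> 'a \<Rightarrow> real"
  assumes lim: "AE w in M. (\<lambda>n. Z n w) \<longlonglongrightarrow> Y w" and Y: "Y \<in> borel_measurable M"
    and L: "\<And>n. L2 (Z n)" and K: "\<And>n. (\<integral>w. (Z n w)\<^sup>2 \<partial>M) \<le> K"
  shows "L2 Y" "(\<integral>w. (Y w)\<^sup>2 \<partial>M) \<le> K" "(\<lambda>n. \<integral>w. Z n w \<partial>M) \<longlonglongrightarrow> (\<integral>w. Y w \<partial>M)"
proof -
  have [measurable]: "Z n \<in> borel_measurable M" "Y \<in> borel_measurable M" for n using L L2_meas Y by auto
  have F: "integrable M (\<lambda>w. (Y w)\<^sup>2)" "(\<integral>w. (Y w)\<^sup>2 \<partial>M) \<le> K"
    by (rule fatou_bound[of "\<lambda>n w. (Z n w)\<^sup>2" "\<lambda>w. (Y w)\<^sup>2" "\<lambda>_. K"];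
       (use lim in \<open>force elim!: eventually_mono intro!: tendsto_power\<close>)?; use L2_sq[OF L] K in simp)+
  show L2Y: "L2 Y" using F Y unfolding L2_def by simp
  show "(\<integral>w. (Y w)\<^sup>2 \<partial>M) \<le> K" by (rule F)
  have K0: "0 \<le> K"
    by (rule order_trans[OF _ K[of 0]]) (intro integral_nonneg_AE, auto)
  define g where "g c x = max (- c) (min c x)" for c x :: real
  have gd: "\<bar>x - g c x\<bar> \<le> x\<^sup>2 / c" if "0 < c" for c x
  proof -
    have "\<bar>x - g c x\<bar> * c \<le> x\<^sup>2"
    proof (cases "\<bar>x\<bar> \<le> c")
      case True then show ?thesis unfolding g_def by auto
    next
      case False
      then have "\<bar>x - g c x\<bar> \<le> \<bar>x\<bar>" "c \<le> \<bar>x\<bar>" using that unfolding g_def by auto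
      then have "\<bar>x - g c x\<bar> * c \<le> \<bar>x\<bar> * \<bar>x\<bar>" using that by (intro mult_mono) auto
      then show ?thesis by (simp add: power2_eq_square)
    qed
    then show ?thesis using that by (simp add: field_simps)
  qed
  have gm[measurable]: "g c \<in> borel_measurable borel" for c unfolding g_def by measurable
  have gi: "integrable M (\<lambda>w. g c (X w))" if "X \<in> borel_measurable M" for X c
    using that by (intro integrable_const_bound[where B="\<bar>c\<bar>"]) (auto simp: g_def)
  have tail: "\<bar>(\<integral>w. X w \<partial>M) - (\<integral>w. g c (X w) \<partial>M)\<bar> \<le> K / c"
    if X: "L2 X" "(\<integral>w. (X w)\<^sup>2 \<partial>M) \<le> K" and c: "0 < c" for X c
  proof -
    have "\<bar>(\<integral>w. X w \<partial>M) - (\<integral>w. g c (X w) \<partial>M)\<bar> = \<bar>\<integral>w. X w - g c (X w) \<partial>M\<bar>"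
      using L2_integrable[OF X(1)] gi[OF L2_meas[OF X(1)]] by simp
    also have "\<dots> \<le> (\<integral>w. \<bar>X w - g c (X w)\<bar> \<partial>M)" by (rule integral_abs_bound)
    also have "\<dots> \<le> (\<integral>w. (X w)\<^sup>2 / c \<partial>M)"
      using L2_integrable[OF X(1)] gi[OF L2_meas[OF X(1)]] gd[OF c] L2_sq[OF X(1)] by (intro integral_mono) auto
    also have "\<dots> \<le> K / c" using X(2) c by (simp add: divide_right_mono)
    finally show ?thesis .
  qed
  have mid: "(\<lambda>n. \<integral>w. g c (Z n w) \<partial>M) \<longlonglongrightarrow> (\<integral>w. g c (Y w) \<partial>M)" for c
  proof (rule integral_dominated_convergence[where w="\<lambda>_. \<bar>c\<bar>"])
    show "AE w in M. (\<lambda>n. g c (Z n w)) \<longlonglongrightarrow> g c (Y w)"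
      using lim unfolding g_def by eventually_elim (intro tendsto_max tendsto_min tendsto_const)
  qed (auto simp: g_def)
  show "(\<lambda>n. \<integral>w. Z n w \<partial>M) \<longlonglongrightarrow> (\<integral>w. Y w \<partial>M)"
  proof (rule LIMSEQ_I)
    fix e :: real assume e: "0 < e"
    \<comment> \<open>With this level the tails of the limit and of the approximation together cost
      less than \<open>e / 2\<close>.\<close>
    define c where "c = 4 * (K + 1) / e"
    have c: "0 < c" "K / c < e / 4" using e K0 by (auto simp: c_def field_simps)
    obtain N where N: "\<And>n. n \<ge> N \<Longrightarrow> \<bar>(\<integral>w. g c (Z n w) \<partial>M) - (\<integral>w. g c (Y w) \<partial>M)\<bar> < e/2"
      using LIMSEQ_D[OF mid, of "e/2"] e by auto
    have "\<bar>(\<integral>w. Z n w \<partial>M) - (\<integral>w. Y w \<partial>M)\<bar> < e" if "n \<ge> N" for n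
      using N[OF that] tail[OF L K c(1), of n] tail[OF L2Y F(2) c(1)] c(2) by linarith
    then show "\<exists>N. \<forall>n\<ge>N. norm ((\<integral>w. Z n w \<partial>M) - (\<integral>w. Y w \<partial>M)) < e" by auto
  qed
qed

text \<open>First-passage form of the maximal inequality: \<open>Act n\<close> is the event that the process is still
  running at step \<open>n\<close>, \<open>H n\<close> the event that it is stopped at step \<open>n + 1\<close> at a value of at least \<open>c\<close>.\<close>

lemma ville:
  fixes Y :: "nat \<Rightarrow> 'a \<Rightarrow> ennreal"
  assumes [measurable]: "\<And>n. Y n \<in> borel_measurable M" "\<And>n. Act n \<in> sets M" "\<And>n. H n \<in> sets M"
    and sub: "\<And>n. H n \<subseteq> Act n" "\<And>n. Act (Suc n) \<subseteq> Act n" "\<And>n. H n \<inter> Act (Suc n) = {}"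
    and step: "\<And>n. n < N \<Longrightarrow> (\<integral>\<^sup>+w. indicator (Act n) w * Y (Suc n) w \<partial>M) \<le> (\<integral>\<^sup>+w. indicator (Act n) w * Y n w \<partial>M)"
    and c: "\<And>n w. w \<in> H n \<Longrightarrow> c \<le> Y (Suc n) w"
  shows "c * emeasure M (\<Union>n<N. H n) \<le> (\<integral>\<^sup>+w. indicator (Act 0) w * Y 0 w \<partial>M)"
proof -
  \<comment> \<open>Invariant: the mass stopped so far, priced at \<open>c\<close>, plus the value
    still running does not exceed the initial value.\<close>
  have "n \<le> N \<Longrightarrow> c * (\<Sum>k<n. emeasure M (H k)) + (\<integral>\<^sup>+w. indicator (Act n) w * Y n w \<partial>M)
     \<le> (\<integral>\<^sup>+w. indicator (Act 0) w * Y 0 w \<partial>M)" for n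
  proof (induction n)
    case (Suc n)
    have "c * emeasure M (H n) + (\<integral>\<^sup>+w. indicator (Act (Suc n)) w * Y (Suc n) w \<partial>M)
       = (\<integral>\<^sup>+w. c * indicator (H n) w + indicator (Act (Suc n)) w * Y (Suc n) w \<partial>M)"
      by (subst nn_integral_add) (auto simp: nn_integral_cmult_indicator)
    \<comment> \<open>Being stopped at this step and continuing are disjoint parts of
      \<open>Act n\<close>.\<close>
    also have "\<dots> \<le> (\<integral>\<^sup>+w. indicator (Act n) w * Y (Suc n) w \<partial>M)"
      using sub[of n] c[of _ n] by (intro nn_integral_mono) (auto simp: indicator_def)
    also have "\<dots> \<le> (\<integral>\<^sup>+w. indicator (Act n) w * Y n w \<partial>M)" using Suc by (intro step) auto
    finally have "c * emeasure M (H n) + (\<integral>\<^sup>+w. indicator (Act (Suc n)) w * Y (Suc n) w \<partial>M)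
       \<le> (\<integral>\<^sup>+w. indicator (Act n) w * Y n w \<partial>M)" .
    then have "c * (\<Sum>k<n. emeasure M (H k)) + (c * emeasure M (H n) + (\<integral>\<^sup>+w. indicator (Act (Suc n)) w * Y (Suc n) w \<partial>M))
       \<le> c * (\<Sum>k<n. emeasure M (H k)) + (\<integral>\<^sup>+w. indicator (Act n) w * Y n w \<partial>M)"
      by (rule add_left_mono)
    also have "\<dots> \<le> (\<integral>\<^sup>+w. indicator (Act 0) w * Y 0 w \<partial>M)" using Suc by auto
    finally show ?case by (simp add: distrib_left add.assoc)
  qed simp
  from this[of N] have "c * (\<Sum>k<N. emeasure M (H k)) \<le> (\<integral>\<^sup>+w. indicator (Act 0) w * Y 0 w \<partial>M)"
    by (auto intro: order_trans[rotated])
  moreover have "emeasure M (\<Union>n<N. H n) \<le> (\<Sum>k<N. emeasure M (H k))"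
    by (intro emeasure_subadditive_finite) auto
  ultimately show ?thesis by (meson mult_left_mono order_trans zero_le)
qed

end

section \<open>Bounded weights, martingale sums and exponential sums\<close>

context filtered_wiener
begin

text \<open>Integrating against all bounded \<open>F s\<close>-measurable weights replaces conditional expectations.\<close>

definition bwt :: "real \<Rightarrow> ('w \<Rightarrow> real) \<Rightarrow> bool" where
  "bwt s U \<longleftrightarrow> U \<in> borel_measurable (F s) \<and> (\<exists>B. \<forall>w. \<bar>U w\<bar> \<le> B)"

lemma bwtI: "U \<in> borel_measurable (F s) \<Longrightarrow> (\<And>w. \<bar>U w\<bar> \<le> B) \<Longrightarrow> bwt s U"
  unfolding bwt_def by auto

lemma bwt_F: "bwt s U \<Longrightarrow> U \<in> borel_measurable (F s)"
  unfolding bwt_def by auto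

lemma bwt_meas: "0 \<le> s \<Longrightarrow> bwt s U \<Longrightarrow> U \<in> borel_measurable M"
  unfolding bwt_def using meas_F_M by auto

lemma bwt_mono: "0 \<le> s \<Longrightarrow> s \<le> t \<Longrightarrow> bwt s U \<Longrightarrow> bwt t U"
  unfolding bwt_def using meas_F_mono by blast

lemma bwt_L2: "0 \<le> s \<Longrightarrow> bwt s U \<Longrightarrow> L2 U"
  using bwt_meas L2_bounded unfolding bwt_def by metis

lemma bwt_integrable: "0 \<le> s \<Longrightarrow> bwt s U \<Longrightarrow> integrable M U"
  using bwt_L2 L2_integrable by blast

lemma bwt_mult: "bwt s U \<Longrightarrow> bwt s V \<Longrightarrow> bwt s (\<lambda>w. U w * V w)"
  unfolding bwt_def
proof safe
  fix B B' assume "U \<in> borel_measurable (F s)" "V \<in> borel_measurable (F s)" "\<forall>w. \<bar>U w\<bar> \<le> B" "\<forall>w. \<bar>V w\<bar> \<le> B'"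
  then show "\<exists>B. \<forall>w. \<bar>U w * V w\<bar> \<le> B"
    by (intro exI[of _ "B * B'"]) (auto simp: abs_mult intro!: mult_mono intro: order_trans[OF abs_ge_zero])
qed measurable

lemma bwt_abs: "bwt s U \<Longrightarrow> bwt s (\<lambda>w. \<bar>U w\<bar>)"
  unfolding bwt_def by auto

lemma bwt_ind: "A \<in> sets (F s) \<Longrightarrow> bwt s (indicator A)"
  by (rule bwtI[of _ _ 1]) (auto simp: indicator_def)

lemma bwt_imult: "0 \<le> s \<Longrightarrow> bwt s U \<Longrightarrow> integrable M X \<Longrightarrow> integrable M (\<lambda>w. U w * X w)"
  using bwt_meas integrable_bdd_mult unfolding bwt_def by metis

lemma bwt_L2mult: "0 \<le> s \<Longrightarrow> bwt s U \<Longrightarrow> L2 X \<Longrightarrow> L2 (\<lambda>w. U w * X w)"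
  using bwt_meas L2_bmult unfolding bwt_def by metis

text \<open>Truncation of the weight at level \<open>n\<close> and dominated convergence. The
  unbounded weights of interest are products with an error accumulated earlier, as in
  \<open>R_chain\<close>.\<close>

lemma weight_ext:
  assumes s: "0 \<le> s" and Z: "integrable M Z" and U: "U \<in> borel_measurable (F s)"
    and b: "\<And>V. bwt s V \<Longrightarrow> \<bar>\<integral>w. V w * Z w \<partial>M\<bar> \<le> c * (\<integral>w. \<bar>V w\<bar> \<partial>M)"
    and i: "integrable M U" "integrable M (\<lambda>w. U w * Z w)"
  shows "\<bar>\<integral>w. U w * Z w \<partial>M\<bar> \<le> c * (\<integral>w. \<bar>U w\<bar> \<partial>M)"
proof -
  define V where "V n w = (if \<bar>U w\<bar> \<le> real n then U w else 0)" for n w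
  have mV: "V n \<in> borel_measurable (F s)" for n using U unfolding V_def by measurable
  then have mV'[measurable]: "V n \<in> borel_measurable M" for n using meas_F_M[OF s] by auto
  have [measurable]: "Z \<in> borel_measurable M" "U \<in> borel_measurable M" using Z i by auto
  have bV: "bwt s (V n)" for n by (rule bwtI[OF mV, of _ n]) (auto simp: V_def)
  have lV: "(\<lambda>n. V n w) \<longlonglongrightarrow> U w" for w
  proof -
    obtain N where "\<bar>U w\<bar> \<le> real N" using real_arch_simple by blast
    then have "\<forall>n\<ge>N. V n w = U w" unfolding V_def by auto
    then show ?thesis by (intro tendsto_eventually) (auto simp: eventually_sequentially)
  qed
  have 1: "(\<lambda>n. \<integral>w. V n w * Z w \<partial>M) \<longlonglongrightarrow> (\<integral>w. U w * Z w \<partial>M)"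
    by (rule integral_dominated_convergence[where w="\<lambda>w. \<bar>U w * Z w\<bar>"])
       (use i lV in \<open>auto simp: V_def intro!: tendsto_mult\<close>)
  have 2: "(\<lambda>n. \<integral>w. \<bar>V n w\<bar> \<partial>M) \<longlonglongrightarrow> (\<integral>w. \<bar>U w\<bar> \<partial>M)"
    by (rule integral_dominated_convergence[where w="\<lambda>w. \<bar>U w\<bar>"])
       (use i lV in \<open>auto simp: V_def intro!: tendsto_rabs\<close>)
  show ?thesis
    by (rule LIMSEQ_le[OF tendsto_rabs[OF 1] tendsto_mult[OF tendsto_const 2]]) (use b[OF bV] in auto)
qed

text \<open>Discrete Ito isometry. Whatever was summed before step \<open>n\<close> is
  \<open>F (u n)\<close>-measurable, so the cross term vanishes; the weight \<open>U\<close> is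
  known at the first time and therefore passes through every step.\<close>

lemma mart_sum:
  fixes j :: 'm
  assumes u: "0 \<le> u 0" "\<And>k. u k < u (Suc k)"
    and H: "\<And>k. H k \<in> borel_measurable (F (u k))" "\<And>k. L2 (H k)" and U: "bwt (u 0) U"
  defines "S \<equiv> \<lambda>n w. \<Sum>k<n. H k w * (W (u (Suc k)) w $ j - W (u k) w $ j)"
  shows "S n \<in> borel_measurable (F (u n)) \<and> L2 (S n) \<and> (\<integral>w. U w * S n w \<partial>M) = 0 \<and>
    (\<integral>w. U w * (S n w)\<^sup>2 \<partial>M) = (\<Sum>k<n. (u (Suc k) - u k) * (\<integral>w. U w * (H k w)\<^sup>2 \<partial>M))"
proof (induction n)
  case 0
  show ?case unfolding S_def by (simp add: L2_const)
next
  case (Suc n)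
  have u0: "0 \<le> u k" "u 0 \<le> u k" for k
  proof -
    show "u 0 \<le> u k" using u(2) by (intro lift_Suc_mono_le[of u 0 k]) (auto intro: less_imp_le)
    then show "0 \<le> u k" using u(1) by simp
  qed
  define D where "D = (\<lambda>w. W (u (Suc n)) w $ j - W (u n) w $ j)"
  have un: "0 \<le> u n" "u n < u (Suc n)" using u0 u by auto
  have SS: "S (Suc n) = (\<lambda>w. S n w + H n w * D w)" unfolding S_def D_def by auto
  have mD: "D \<in> borel_measurable (F (u (Suc n)))"
  proof -
    have [measurable]: "W (u (Suc n)) \<in> borel_measurable (F (u (Suc n)))" "W (u n) \<in> borel_measurable (F (u (Suc n)))"
      using u0 un by (auto intro!: meas_W meas_W_le)
    show ?thesis unfolding D_def by measurable
  qed
  have mSn: "S n \<in> borel_measurable (F (u n))" "L2 (S n)" using Suc by auto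
  have 1: "S (Suc n) \<in> borel_measurable (F (u (Suc n)))"
    unfolding SS using mD meas_F_mono[OF un(1) less_imp_le[OF un(2)] mSn(1)] 
      meas_F_mono[OF un(1) less_imp_le[OF un(2)] H(1)[of n]] by measurable
  have LHD: "L2 (\<lambda>w. H n w * D w)"
  proof -
    have m: "(\<lambda>w. (H n w)\<^sup>2) \<in> borel_measurable (F (u n))" using H(1)[of n] by measurable
    have "(\<lambda>w. H n w * D w) \<in> borel_measurable M"
      using meas_F_M[OF _ mD] meas_F_M[OF un(1) H(1)] u0 by measurable
    moreover have "integrable M (\<lambda>w. (H n w * D w)\<^sup>2)"
      using dW_cond2(1)[OF un m L2_sq[OF H(2)], of j j]
      unfolding D_def by (simp add: power2_eq_square mult_ac)
    ultimately show ?thesis unfolding L2_def by auto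
  qed
  have 2: "L2 (S (Suc n))" unfolding SS by (intro L2_add mSn LHD)
  have bU: "bwt (u n) U" using bwt_mono[OF u(1) u0(2) U] .
  have mUH: "(\<lambda>w. U w * H n w) \<in> borel_measurable (F (u n))" using bwt_F[OF bU] H(1)[of n] by measurable
  have iUH: "integrable M (\<lambda>w. U w * H n w)" by (rule bwt_imult[OF un(1) bU L2_integrable[OF H(2)]])
  have eUH: "(\<integral>w. U w * H n w * D w \<partial>M) = 0" unfolding D_def by (rule dW_cond1(2)[OF un mUH iUH])
  have iU: "integrable M (\<lambda>w. U w * X w)" if "integrable M X" for X by (rule bwt_imult[OF un(1) bU that])
  have "(\<integral>w. U w * S (Suc n) w \<partial>M) = (\<integral>w. U w * S n w + U w * H n w * D w \<partial>M)"
    unfolding SS by (simp add: algebra_simps)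
  also have "\<dots> = (\<integral>w. U w * S n w \<partial>M) + (\<integral>w. U w * H n w * D w \<partial>M)"
    using iU[OF L2_integrable[OF mSn(2)]] iU[OF L2_integrable[OF LHD]]
    by (intro Bochner_Integration.integral_add) (auto simp: mult.assoc)
  finally have 3: "(\<integral>w. U w * S (Suc n) w \<partial>M) = 0" using Suc eUH by simp
  have mX: "(\<lambda>w. U w * (S n w * H n w)) \<in> borel_measurable (F (u n))"
    using bwt_F[OF bU] H(1)[of n] mSn(1) by measurable
  have iX: "integrable M (\<lambda>w. U w * (S n w * H n w))" by (intro iU L2_mult mSn H)
  have eX: "(\<integral>w. U w * (S n w * H n w) * D w \<partial>M) = 0" 
    and iXD: "integrable M (\<lambda>w. U w * (S n w * H n w) * D w)"
    unfolding D_def by (rule dW_cond1[OF un mX iX])+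
  have mQ: "(\<lambda>w. U w * (H n w)\<^sup>2) \<in> borel_measurable (F (u n))"
    using bwt_F[OF bU] H(1)[of n] by measurable
  have iQ: "integrable M (\<lambda>w. U w * (H n w)\<^sup>2)" by (intro iU L2_sq H)
  have eQ: "(\<integral>w. U w * (H n w)\<^sup>2 * (D w)\<^sup>2 \<partial>M) = (u (Suc n) - u n) * (\<integral>w. U w * (H n w)\<^sup>2 \<partial>M)"
    and iQD: "integrable M (\<lambda>w. U w * (H n w)\<^sup>2 * (D w)\<^sup>2)"
    using dW_cond2[OF un mQ iQ, of j j] unfolding D_def by (auto simp: power2_eq_square)
  have "(\<integral>w. U w * (S (Suc n) w)\<^sup>2 \<partial>M) =
     (\<integral>w. (U w * (S n w)\<^sup>2 + 2 * (U w * (S n w * H n w) * D w)) + U w * (H n w)\<^sup>2 * (D w)\<^sup>2 \<partial>M)"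
    unfolding SS by (intro Bochner_Integration.integral_cong) (auto simp: algebra_simps power2_eq_square)
  also have "\<dots> = (\<integral>w. U w * (S n w)\<^sup>2 \<partial>M) + (\<integral>w. U w * (H n w)\<^sup>2 * (D w)\<^sup>2 \<partial>M)"
    using iU[OF L2_sq[OF mSn(2)]] iXD iQD eX by simp
  finally have 4: "(\<integral>w. U w * (S (Suc n) w)\<^sup>2 \<partial>M)
     = (\<Sum>k<Suc n. (u (Suc k) - u k) * (\<integral>w. U w * (H k w)\<^sup>2 \<partial>M))" using Suc eQ by simp
  show ?case using 1 2 3 4 by auto
qed

text \<open>The discrete counterpart of the exponential martingale: each Gaussian increment contributes at most
  its exact exponential moment.\<close>

lemma exp_sum_bound:
  assumes u: "0 \<le> u 0" "\<And>k. u k < u (Suc k)"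
    and \<alpha>: "\<And>k. \<alpha> k \<in> borel_measurable (F (u k))" "\<And>k w. \<bar>\<alpha> k w\<bar> \<le> C1"
    and v: "\<And>k. v k \<in> borel_measurable (F (u k))" "\<And>k w. (norm (v k w))\<^sup>2 \<le> C2"
    and U: "U \<in> borel_measurable (F (u 0))"
  defines "S \<equiv> \<lambda>n w. \<Sum>k<n. \<alpha> k w * (u (Suc k) - u k) + v k w \<bullet> (W (u (Suc k)) w - W (u k) w)"
  shows "S n \<in> borel_measurable (F (u n)) \<and> (\<integral>\<^sup>+w. U w * ennreal (exp (l * S n w)) \<partial>M)
     \<le> ennreal (exp ((\<bar>l\<bar> * C1 + l\<^sup>2 * C2 / 2) * (u n - u 0))) * (\<integral>\<^sup>+w. U w \<partial>M)"
proof (induction n)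
  case 0
  show ?case unfolding S_def by simp
next
  case (Suc n)
  have u0: "0 \<le> u k" "u 0 \<le> u k" for k
  proof -
    show "u 0 \<le> u k" using u(2) by (intro lift_Suc_mono_le[of u 0 k]) (auto intro: less_imp_le)
    then show "0 \<le> u k" using u(1) by simp
  qed
  have un: "0 \<le> u n" "u n < u (Suc n)" using u0 u by auto
  define \<Delta> where "\<Delta> = u (Suc n) - u n"
  have \<Delta>: "0 < \<Delta>" using un unfolding \<Delta>_def by simp
  define K where "K = \<bar>l\<bar> * C1 + l\<^sup>2 * C2 / 2"
  let ?D = "\<lambda>w. W (u (Suc n)) w - W (u n) w"
  have SS: "S (Suc n) = (\<lambda>w. S n w + (\<alpha> n w * \<Delta> + v n w \<bullet> ?D w))" unfolding S_def \<Delta>_def by auto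
  have mSn: "S n \<in> borel_measurable (F (u n))" using Suc by auto
  have mD: "?D \<in> borel_measurable (F (u (Suc n)))"
    using u0 un by (intro borel_measurable_diff meas_W meas_W_le) auto
  note up = meas_F_mono[OF un(1) less_imp_le[OF un(2)]]
  have 1: "S (Suc n) \<in> borel_measurable (F (u (Suc n)))"
    unfolding SS using mD up[OF mSn] up[OF \<alpha>(1)] up[OF v(1)] by measurable
  have mU: "U \<in> borel_measurable (F (u n))" using meas_F_mono[OF u(1) u0(2) U] .
  let ?V = "\<lambda>w. U w * ennreal (exp (l * S n w) * exp (l * (\<alpha> n w * \<Delta>)))"
  have mV: "?V \<in> borel_measurable (F (u n))" using mU mSn \<alpha>(1)[of n] by measurable
  have mv: "(\<lambda>w. l *\<^sub>R v n w) \<in> borel_measurable (F (u n))" using v(1)[of n] by measurable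
  have "(\<integral>\<^sup>+w. U w * ennreal (exp (l * S (Suc n) w)) \<partial>M) = 
     (\<integral>\<^sup>+w. ?V w * ennreal (exp ((l *\<^sub>R v n w) \<bullet> ?D w)) \<partial>M)"
    unfolding SS by (intro nn_integral_cong) (auto simp: exp_add[symmetric] ennreal_mult[symmetric] mult.assoc algebra_simps)
  also have "\<dots> = (\<integral>\<^sup>+w. ?V w * ennreal (exp ((norm (l *\<^sub>R v n w))\<^sup>2 * (u (Suc n) - u n) / 2)) \<partial>M)"
    by (rule dW_exp_cond[OF un mV mv])
  also have "\<dots> \<le> (\<integral>\<^sup>+w. ennreal (exp (K * \<Delta>)) * (U w * ennreal (exp (l * S n w))) \<partial>M)"
  proof (rule nn_integral_mono)
    fix w
    have "l * (\<alpha> n w * \<Delta>) \<le> \<bar>l\<bar> * (C1 * \<Delta>)"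
    proof -
      have "l * (\<alpha> n w * \<Delta>) \<le> \<bar>l * (\<alpha> n w * \<Delta>)\<bar>" by simp
      also have "\<dots> = \<bar>l\<bar> * (\<bar>\<alpha> n w\<bar> * \<Delta>)" using \<Delta> by (simp add: abs_mult)
      also have "\<dots> \<le> \<bar>l\<bar> * (C1 * \<Delta>)" using \<Delta> \<alpha>(2) by (intro mult_left_mono mult_right_mono) auto
      finally show ?thesis .
    qed
    moreover have "(norm (l *\<^sub>R v n w))\<^sup>2 * (u (Suc n) - u n) / 2 \<le> l\<^sup>2 * C2 * \<Delta> / 2"
      using v(2)[of n w] \<Delta> unfolding \<Delta>_def[symmetric]
      by (auto simp: power_mult_distrib intro!: divide_right_mono mult_right_mono mult_left_mono)
    moreover have "\<bar>l\<bar> * (C1 * \<Delta>) + l\<^sup>2 * C2 * \<Delta> / 2 = K * \<Delta>" unfolding K_def by (simp add: algebra_simps)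
    ultimately have e: "exp (l * (\<alpha> n w * \<Delta>)) * exp ((norm (l *\<^sub>R v n w))\<^sup>2 * (u (Suc n) - u n) / 2) \<le> exp (K * \<Delta>)"
      unfolding exp_add[symmetric] exp_le_cancel_iff by linarith
    have "?V w * ennreal (exp ((norm (l *\<^sub>R v n w))\<^sup>2 * (u (Suc n) - u n) / 2))
      = U w * (ennreal (exp (l * S n w)) * ennreal (exp (l * (\<alpha> n w * \<Delta>)) * exp ((norm (l *\<^sub>R v n w))\<^sup>2 * (u (Suc n) - u n) / 2)))"
      by (simp add: ennreal_mult mult.assoc)
    also have "\<dots> \<le> U w * (ennreal (exp (l * S n w)) * ennreal (exp (K * \<Delta>)))"
      using e by (intro mult_left_mono ennreal_leI) auto
    finally show "?V w * ennreal (exp ((norm (l *\<^sub>R v n w))\<^sup>2 * (u (Suc n) - u n) / 2))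
      \<le> ennreal (exp (K * \<Delta>)) * (U w * ennreal (exp (l * S n w)))" by (simp add: mult_ac)
  qed
  also have "\<dots> = ennreal (exp (K * \<Delta>)) * (\<integral>\<^sup>+w. U w * ennreal (exp (l * S n w)) \<partial>M)"
  proof (rule nn_integral_cmult)
    have [measurable]: "U \<in> borel_measurable M" "S n \<in> borel_measurable M"
      using meas_F_M[OF u(1) U] meas_F_M[OF un(1) mSn] by auto
    show "(\<lambda>w. U w * ennreal (exp (l * S n w))) \<in> borel_measurable M" by measurable
  qed
  also have "\<dots> \<le> ennreal (exp (K * \<Delta>)) * (ennreal (exp (K * (u n - u 0))) * (\<integral>\<^sup>+w. U w \<partial>M))"
    using Suc unfolding K_def by (intro mult_left_mono) auto
  also have "\<dots> = ennreal (exp (K * (u (Suc n) - u 0))) * (\<integral>\<^sup>+w. U w \<partial>M)"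
    unfolding \<Delta>_def mult.assoc[symmetric] by (subst ennreal_mult[symmetric]) (auto simp: exp_add[symmetric] algebra_simps)
  finally show ?case using 1 unfolding K_def by auto
qed

end

subsection \<open>Short-time expansion of the diffusion\<close>

text \<open>The quantitative content of bounded C2 regularity with a single constant. The condition
  is stable under enlarging \<open>K\<close>, so one constant can serve all components of both
  coefficients.\<close>

definition nice :: "real \<Rightarrow> (real^'d::finite \<Rightarrow> real) \<Rightarrow> bool" where
  "nice K f \<longleftrightarrow> continuous_on UNIV f \<and> (\<forall>x. \<bar>f x\<bar> \<le> K) \<and> (\<forall>x y. \<bar>f y - f x\<bar> \<le> K * norm (y - x)) \<and>
     (\<forall>l. continuous_on UNIV (pd l f)) \<and> (\<forall>l x. \<bar>pd l f x\<bar> \<le> K) \<and>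
     (\<forall>x y. \<bar>f y - f x - (\<Sum>l\<in>UNIV. pd l f x * (y $ l - x $ l))\<bar> \<le> K * (norm (y - x))\<^sup>2)"

lemma nice_meas: "nice K f \<Longrightarrow> f \<in> borel_measurable borel"
  unfolding nice_def by (auto intro: borel_measurable_continuous_onI)

lemma nice_pd_meas: "nice K f \<Longrightarrow> pd l f \<in> borel_measurable borel"
  unfolding nice_def by (auto intro: borel_measurable_continuous_onI)

lemma measurable_vecI:
  fixes f :: "'a \<Rightarrow> real^'n::finite"
  assumes [measurable]: "\<And>i. (\<lambda>w. f w $ i) \<in> borel_measurable N"
  shows "f \<in> borel_measurable N"
proof -
  have "(\<lambda>w. \<Sum>i\<in>UNIV. (f w $ i) *\<^sub>R (axis i 1 :: real^'n)) \<in> borel_measurable N" by measurable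
  also have "(\<lambda>w. \<Sum>i\<in>UNIV. (f w $ i) *\<^sub>R (axis i 1 :: real^'n)) = f"
    by (intro ext) (simp add: vec_eq_iff axis_def if_distrib cong: if_cong)
  finally show ?thesis .
qed

lemma norm_pow_le:
  fixes v :: "real^'d::finite"
  shows "(norm v) ^ n \<le> real CARD('d) ^ n * (\<Sum>i\<in>UNIV. \<bar>v $ i\<bar> ^ n)"
proof -
  obtain m where m: "\<And>i. \<bar>v $ i\<bar> \<le> \<bar>v $ m\<bar>"
  proof -
    have "Max (range (\<lambda>i. \<bar>v $ i\<bar>)) \<in> range (\<lambda>i. \<bar>v $ i\<bar>)" by (intro Max_in) auto
    then obtain m where "Max (range (\<lambda>i. \<bar>v $ i\<bar>)) = \<bar>v $ m\<bar>" unfolding image_iff by blast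
    then have "\<And>i. \<bar>v $ i\<bar> \<le> \<bar>v $ m\<bar>" by (metis Max_ge finite finite_imageI rangeI)
    then show ?thesis using that by blast
  qed
  have "norm v \<le> (\<Sum>i\<in>UNIV. \<bar>v $ i\<bar>)" by (rule norm_le_l1_cart)
  also have "\<dots> \<le> (\<Sum>i\<in>(UNIV::'d set). \<bar>v $ m\<bar>)" by (intro sum_mono m)
  finally have "norm v \<le> real CARD('d) * \<bar>v $ m\<bar>" by simp
  then have "(norm v) ^ n \<le> (real CARD('d) * \<bar>v $ m\<bar>) ^ n" by (intro power_mono) auto
  also have "\<dots> = real CARD('d) ^ n * \<bar>v $ m\<bar> ^ n" by (rule power_mult_distrib)
  also have "\<dots> \<le> real CARD('d) ^ n * (\<Sum>i\<in>UNIV. \<bar>v $ i\<bar> ^ n)"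
    by (intro mult_left_mono member_le_sum) auto
  finally show ?thesis .
qed

lemma abs_pow_le_exp: "\<bar>x::real\<bar> ^ n \<le> fact n * (exp x + exp (- x))"
proof -
  have "\<bar>x\<bar> ^ n / fact n \<le> exp \<bar>x\<bar>"
  proof -
    have s: "(\<lambda>n. \<bar>x\<bar> ^ n / fact n) sums exp \<bar>x\<bar>" using exp_converges[of "\<bar>x\<bar>"] by (simp add: divide_inverse mult.commute)
    have "(\<Sum>i\<in>{n}. \<bar>x\<bar> ^ i / fact i) \<le> (\<Sum>i. \<bar>x\<bar> ^ i / fact i)"
      using s by (intro sum_le_suminf) (auto simp: sums_iff)
    then show ?thesis using s by (simp add: sums_iff)
  qed
  also have "exp \<bar>x\<bar> \<le> exp x + exp (- x)" by (cases "0 \<le> x") auto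
  finally show ?thesis by (simp add: field_simps)
qed

lemma sum_sq_le:
  fixes f :: "'i \<Rightarrow> real"
  shows "(\<Sum>i\<in>I. f i)\<^sup>2 \<le> real (card I) * (\<Sum>i\<in>I. (f i)\<^sup>2)"
  using Cauchy_Schwarz_ineq_sum[of "\<lambda>_. 1" f I] by simp

lemma sq_sum2: "((x::real) + y)\<^sup>2 \<le> 2 * x\<^sup>2 + 2 * y\<^sup>2"
  using zero_le_power2[of "x - y"] by (simp add: power2_eq_square algebra_simps)

context prob_space
begin

lemma nn_bound:
  assumes "Z \<in> borel_measurable M" "\<And>w. (0::real) \<le> Z w" "(\<integral>\<^sup>+w. ennreal (Z w) \<partial>M) \<le> ennreal c" "0 \<le> c"
  shows "integrable M Z" "(\<integral>w. Z w \<partial>M) \<le> c"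
proof -
  show i: "integrable M Z" using assms by (intro integrableI_nonneg) (auto intro: le_less_trans)
  show "(\<integral>w. Z w \<partial>M) \<le> c"
    using assms i by (subst (asm) nn_integral_eq_integral) auto
qed

end

section \<open>Riemann sums with drift and noise\<close>

context filtered_wiener
begin

text \<open>In the mean only the drift is seen. In mean square, Cauchy-Schwarz in time gives the
  drift a factor \<open>(u n - u 0)\<^sup>2\<close>, while the isometry gives the noise only a
  factor \<open>u n - u 0\<close>; a noise integrand must therefore be smaller by one order in time
  to contribute equally.\<close>

lemma grid_sum:
  assumes u: "0 \<le> u 0" "\<And>k. u k < u (Suc k)"
    and \<alpha>: "\<And>k. \<alpha> k \<in> borel_measurable (F (u k))" "\<And>k. L2 (\<alpha> k)"
    and \<beta>: "\<And>k. \<beta> k \<in> borel_measurable (F (u k))" "\<And>k j. L2 (\<lambda>w. \<beta> k w $ j)" and U: "bwt (u 0) U"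
  defines "T \<equiv> \<lambda>n w. \<Sum>k<n. \<alpha> k w * (u (Suc k) - u k) + \<beta> k w \<bullet> (W (u (Suc k)) w - W (u k) w)"
  shows "L2 (T n)"
    and "(\<integral>w. U w * T n w \<partial>M) = (\<Sum>k<n. (u (Suc k) - u k) * (\<integral>w. U w * \<alpha> k w \<partial>M))"
    and "(\<And>w. 0 \<le> U w) \<Longrightarrow> (\<And>k. k < n \<Longrightarrow> (\<integral>w. U w * (\<alpha> k w)\<^sup>2 \<partial>M) \<le> ca * (\<integral>w. U w \<partial>M)) \<Longrightarrow>
      (\<And>k j. k < n \<Longrightarrow> (\<integral>w. U w * (\<beta> k w $ j)\<^sup>2 \<partial>M) \<le> cb * (\<integral>w. U w \<partial>M)) \<Longrightarrow>
      (\<integral>w. U w * (T n w)\<^sup>2 \<partial>M) \<le> (2 * (u n - u 0)\<^sup>2 * ca + 2 * (real CARD('m))\<^sup>2 * (u n - u 0) * cb) * (\<integral>w. U w \<partial>M)"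
proof -
  define A where "A w = (\<Sum>k<n. \<alpha> k w * (u (Suc k) - u k))" for w
  define B where "B j w = (\<Sum>k<n. \<beta> k w $ j * (W (u (Suc k)) w $ j - W (u k) w $ j))" for j w
  have u0: "0 \<le> u k" "u 0 \<le> u k" for k
  proof -
    show "u 0 \<le> u k" using u(2) by (intro lift_Suc_mono_le[of u 0 k]) (auto intro: less_imp_le)
    then show "0 \<le> u k" using u(1) by simp
  qed
  have TAB: "T n w = A w + (\<Sum>j\<in>UNIV. B j w)" for w
    unfolding T_def A_def B_def sum.distrib inner_vec_def by (subst (2) sum.swap) simp
  have \<beta>m: "(\<lambda>w. \<beta> k w $ j) \<in> borel_measurable (F (u k))" for k j using \<beta>(1)[of k] by measurable
  have BS: "L2 (B j)" "(\<integral>w. V w * B j w \<partial>M) = 0" 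
    "(\<integral>w. V w * (B j w)\<^sup>2 \<partial>M) = (\<Sum>k<n. (u (Suc k) - u k) * (\<integral>w. V w * (\<beta> k w $ j)\<^sup>2 \<partial>M))" if "bwt (u 0) V" for j V
    using mart_sum[where u=u and n=n and j=j and U=V and H="\<lambda>k w. \<beta> k w $ j", OF u \<beta>m \<beta>(2) that] unfolding B_def by blast+
  have "L2 (\<lambda>w. \<alpha> k w * c)" for k c using L2_cmult[OF \<alpha>(2)[of k], of c] by (simp add: mult.commute)
  then have LA: "L2 A" unfolding A_def by (intro L2_sum)
  have LB: "L2 (\<lambda>w. \<Sum>j\<in>UNIV. B j w)" by (intro L2_sum BS(1)[OF U])
  show "L2 (T n)" unfolding TAB using LA LB by (rule L2_add)
  note iU = bwt_imult[OF u(1) U]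
  have "(\<integral>w. U w * T n w \<partial>M) = (\<integral>w. U w * A w + (\<Sum>j\<in>UNIV. U w * B j w) \<partial>M)"
    unfolding TAB by (simp add: distrib_left sum_distrib_left)
  also have "\<dots> = (\<integral>w. U w * A w \<partial>M) + (\<Sum>j\<in>UNIV. (\<integral>w. U w * B j w \<partial>M))"
    using iU[OF L2_integrable[OF LA]] iU[OF L2_integrable[OF BS(1)[OF U]]]
    by (subst Bochner_Integration.integral_add) auto
  also have "(\<integral>w. U w * A w \<partial>M) = (\<integral>w. (\<Sum>k<n. (u (Suc k) - u k) * (U w * \<alpha> k w)) \<partial>M)"
    unfolding A_def by (simp add: sum_distrib_left algebra_simps)
  also have "\<dots> = (\<Sum>k<n. (u (Suc k) - u k) * (\<integral>w. U w * \<alpha> k w \<partial>M))"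
    using iU[OF L2_integrable[OF \<alpha>(2)]] by (subst Bochner_Integration.integral_sum) auto
  finally show "(\<integral>w. U w * T n w \<partial>M) = (\<Sum>k<n. (u (Suc k) - u k) * (\<integral>w. U w * \<alpha> k w \<partial>M))"
    using BS(2)[OF U] by simp
  assume U0: "\<And>w. 0 \<le> U w" and ca: "\<And>k. k < n \<Longrightarrow> (\<integral>w. U w * (\<alpha> k w)\<^sup>2 \<partial>M) \<le> ca * (\<integral>w. U w \<partial>M)"
    and cb: "\<And>k j. k < n \<Longrightarrow> (\<integral>w. U w * (\<beta> k w $ j)\<^sup>2 \<partial>M) \<le> cb * (\<integral>w. U w \<partial>M)"
  define EU where "EU = (\<integral>w. U w \<partial>M)"
  define dt where "dt = u n - u 0"
  have tel: "(\<Sum>k<n. u (Suc k) - u k) = dt" unfolding dt_def by (rule sum_lessThan_telescope)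
  have dt0: "0 \<le> dt" unfolding dt_def using u0 by simp
  have A2: "(A w)\<^sup>2 \<le> dt * (\<Sum>k<n. (u (Suc k) - u k) * (\<alpha> k w)\<^sup>2)" for w
  proof -
    \<comment> \<open>Each time step is split into two square roots, so that Cauchy-Schwarz returns
      the weights \<open>u (Suc k) - u k\<close>.\<close>
    have "A w = (\<Sum>k<n. sqrt (u (Suc k) - u k) * (sqrt (u (Suc k) - u k) * \<alpha> k w))"
      unfolding A_def using u(2) by (intro sum.cong) (auto simp: less_imp_le mult.assoc[symmetric])
    also have "\<dots>\<^sup>2 \<le> (\<Sum>k<n. (sqrt (u (Suc k) - u k))\<^sup>2) * (\<Sum>k<n. (sqrt (u (Suc k) - u k) * \<alpha> k w)\<^sup>2)"
      by (rule Cauchy_Schwarz_ineq_sum)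
    also have "\<dots> = dt * (\<Sum>k<n. (u (Suc k) - u k) * (\<alpha> k w)\<^sup>2)"
      using u(2) by (simp add: power_mult_distrib less_imp_le tel[symmetric])
    finally show ?thesis .
  qed
  have iA: "integrable M (\<lambda>w. U w * (A w)\<^sup>2)" using iU[OF L2_sq[OF LA]] .
  have i\<alpha>: "integrable M (\<lambda>w. U w * (\<alpha> k w)\<^sup>2)" for k using iU[OF L2_sq[OF \<alpha>(2)]] .
  have iB: "integrable M (\<lambda>w. U w * (B j w)\<^sup>2)" for j using iU[OF L2_sq[OF BS(1)[OF U]]] .
  have "(\<integral>w. U w * (A w)\<^sup>2 \<partial>M) \<le> (\<integral>w. dt * (\<Sum>k<n. (u (Suc k) - u k) * (U w * (\<alpha> k w)\<^sup>2)) \<partial>M)"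
  proof (rule integral_mono[OF iA])
    show "integrable M (\<lambda>w. dt * (\<Sum>k<n. (u (Suc k) - u k) * (U w * (\<alpha> k w)\<^sup>2)))" using i\<alpha> by auto
    show "U w * (A w)\<^sup>2 \<le> dt * (\<Sum>k<n. (u (Suc k) - u k) * (U w * (\<alpha> k w)\<^sup>2))" for w
      using mult_left_mono[OF A2[of w] U0[of w]] by (simp add: sum_distrib_left algebra_simps)
  qed
  also have "\<dots> = dt * (\<Sum>k<n. (u (Suc k) - u k) * (\<integral>w. U w * (\<alpha> k w)\<^sup>2 \<partial>M))"
    using i\<alpha> by simp
  also have "\<dots> \<le> dt * (\<Sum>k<n. (u (Suc k) - u k) * (ca * EU))"
    unfolding EU_def using dt0 u(2) ca by (intro mult_left_mono sum_mono) (auto intro: less_imp_le)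
  also have "\<dots> = dt\<^sup>2 * ca * EU" unfolding sum_distrib_right[symmetric] tel by (simp add: power2_eq_square)
  finally have EA: "(\<integral>w. U w * (A w)\<^sup>2 \<partial>M) \<le> dt\<^sup>2 * ca * EU" .
  have EB: "(\<integral>w. U w * (B j w)\<^sup>2 \<partial>M) \<le> dt * cb * EU" for j
  proof -
    have "(\<integral>w. U w * (B j w)\<^sup>2 \<partial>M) \<le> (\<Sum>k<n. (u (Suc k) - u k) * (cb * EU))"
      unfolding BS(3)[OF U] EU_def using u(2) cb by (intro sum_mono mult_left_mono) (auto intro: less_imp_le)
    also have "\<dots> = dt * cb * EU" unfolding sum_distrib_right[symmetric] tel by simp
    finally show ?thesis .
  qed
  have pt: "(T n w)\<^sup>2 \<le> 2 * (A w)\<^sup>2 + 2 * real CARD('m) * (\<Sum>j\<in>UNIV. (B j w)\<^sup>2)" for w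
    unfolding TAB using sq_sum2[of "A w" "\<Sum>j\<in>UNIV. B j w"] sum_sq_le[of "\<lambda>j. B j w" UNIV] by linarith
  have "(\<integral>w. U w * (T n w)\<^sup>2 \<partial>M) \<le> (\<integral>w. 2 * (U w * (A w)\<^sup>2) + 2 * real CARD('m) * (\<Sum>j\<in>UNIV. U w * (B j w)\<^sup>2) \<partial>M)"
  proof (rule integral_mono)
    show "integrable M (\<lambda>w. U w * (T n w)\<^sup>2)" using iU[OF L2_sq[OF \<open>L2 (T n)\<close>]] .
    show "integrable M (\<lambda>w. 2 * (U w * (A w)\<^sup>2) + 2 * real CARD('m) * (\<Sum>j\<in>UNIV. U w * (B j w)\<^sup>2))"
      using iA iB by auto
    show "U w * (T n w)\<^sup>2 \<le> 2 * (U w * (A w)\<^sup>2) + 2 * real CARD('m) * (\<Sum>j\<in>UNIV. U w * (B j w)\<^sup>2)" for w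
      using mult_left_mono[OF pt[of w] U0[of w]] by (simp add: sum_distrib_left algebra_simps)
  qed
  also have "\<dots> = 2 * (\<integral>w. U w * (A w)\<^sup>2 \<partial>M) + 2 * real CARD('m) * (\<Sum>j\<in>UNIV. \<integral>w. U w * (B j w)\<^sup>2 \<partial>M)"
    using iA iB by simp
  also have "\<dots> \<le> 2 * (dt\<^sup>2 * ca * EU) + 2 * real CARD('m) * (\<Sum>j\<in>(UNIV::'m set). dt * cb * EU)"
    using EA EB by (intro add_mono mult_left_mono sum_mono) auto
  also have "\<dots> = (2 * dt\<^sup>2 * ca + 2 * (real CARD('m))\<^sup>2 * dt * cb) * EU"
    by (simp add: algebra_simps power2_eq_square)
  finally show "(\<integral>w. U w * (T n w)\<^sup>2 \<partial>M) \<le> (2 * (u n - u 0)\<^sup>2 * ca + 2 * (real CARD('m))\<^sup>2 * (u n - u 0) * cb) * (\<integral>w. U w \<partial>M)"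
    unfolding dt_def EU_def .
qed

end

text \<open>The formula continues past \<open>t\<close> for \<open>k > N\<close>. This gives the
  strictly increasing infinite sequence that \<open>mart_sum\<close> and \<open>grid_sum\<close>
  expect.\<close>

definition grid :: "real \<Rightarrow> real \<Rightarrow> nat \<Rightarrow> nat \<Rightarrow> real" where
  "grid s t N k = s + real k * (t - s) / real N"

lemma grid_props:
  assumes "0 \<le> s" "s < t" "0 < N"
  shows "grid s t N 0 = s" "grid s t N N = t" "grid s t N k < grid s t N (Suc k)"
    "grid s t N (Suc k) - grid s t N k = (t - s) / N" "s \<le> grid s t N k" "k \<le> N \<Longrightarrow> grid s t N k \<le> t"
proof -
  show "grid s t N 0 = s" "grid s t N N = t" "s \<le> grid s t N k" using assms by (auto simp: grid_def)
  show d: "grid s t N (Suc k) - grid s t N k = (t - s) / N"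
    using assms by (simp add: grid_def add_divide_distrib[symmetric] diff_divide_distrib[symmetric] algebra_simps)
  have "0 < (t - s) / N" using assms by simp
  then show "grid s t N k < grid s t N (Suc k)" using d by linarith
  assume "k \<le> N"
  then have "real k * (t - s) / real N \<le> t - s" using assms by (simp add: divide_le_eq mult.commute)
  then show "grid s t N k \<le> t" unfolding grid_def by linarith
qed

text \<open>\<open>Cb\<close> bounds the squared norm of each row of \<open>b\<close>, that is, the
  rate of quadratic variation of one coordinate of the solution; it governs the Gaussian tails
  below.\<close>

locale sde = filtered_wiener M F W
  for M :: "'w measure" and F and W :: "real \<Rightarrow> 'w \<Rightarrow> real^'m::finite" +
  fixes a :: "real^'d::finite \<Rightarrow> real^'d" and b :: "real^'d \<Rightarrow> real^'m^'d" and x0 :: "real^'d"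
    and X :: "real \<Rightarrow> 'w \<Rightarrow> real^'d" and K Cb :: real
  assumes K1: "1 \<le> K"
    and na: "\<And>i. nice K (\<lambda>x. a x $ i)" and nb: "\<And>i j. nice K (\<lambda>x. b x $ i $ j)"
    and Cb: "\<And>x i. (norm (b x $ i))\<^sup>2 \<le> Cb"
    and sol: "strong_solution M F W a b x0 X"
begin

lemma Cb0: "0 \<le> Cb" using Cb[of 0 undefined] zero_le_power2 order_trans by blast

lemma meas_X: "0 \<le> t \<Longrightarrow> X t \<in> borel_measurable (F t)"
  using sol unfolding strong_solution_def by auto

lemma meas_X_le: "0 \<le> s \<Longrightarrow> s \<le> t \<Longrightarrow> X s \<in> borel_measurable (F t)"
  using meas_X meas_F_mono by blast

lemma meas_X_M: "0 \<le> t \<Longrightarrow> X t \<in> borel_measurable M"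
  using meas_X meas_F_M by blast

lemma X_cont: "AE w in M. continuous_on {0..} (\<lambda>t. X t w)"
  using sol unfolding strong_solution_def by auto

lemma W_cont: "AE w in M. continuous_on {0..} (\<lambda>t. W t w)"
  using wien unfolding wiener_def by auto

lemma X_0: "w \<in> space M \<Longrightarrow> X 0 w = x0"
  using sol unfolding strong_solution_def by auto

lemma nice_X: "nice K f \<Longrightarrow> 0 \<le> s \<Longrightarrow> (\<lambda>w. f (X s w)) \<in> borel_measurable (F s)"
  using measurable_compose[OF meas_X nice_meas] by auto

lemma nice_X_le: "nice K f \<Longrightarrow> 0 \<le> s \<Longrightarrow> s \<le> t \<Longrightarrow> (\<lambda>w. f (X s w)) \<in> borel_measurable (F t)"
  using nice_X meas_F_mono by blast

lemma nice_bwt: "nice K f \<Longrightarrow> 0 \<le> s \<Longrightarrow> bwt s (\<lambda>w. f (X s w))"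
  by (rule bwtI[OF nice_X, of _ _ K]) (auto simp: nice_def)

lemma nice_pd_bwt: "nice K f \<Longrightarrow> 0 \<le> s \<Longrightarrow> bwt s (\<lambda>w. pd l f (X s w))"
  by (rule bwtI[of _ _ K]) (auto simp: nice_def intro!: measurable_compose[OF meas_X] borel_measurable_continuous_onI)

lemma meas_aX: "0 \<le> s \<Longrightarrow> (\<lambda>w. a (X s w) $ i) \<in> borel_measurable (F s)"
  by (rule nice_X[OF na])

lemma meas_bX: "0 \<le> s \<Longrightarrow> (\<lambda>w. b (X s w) $ i) \<in> borel_measurable (F s)"
  by (rule measurable_vecI) (rule nice_X[OF nb])

definition RS :: "'d \<Rightarrow> real \<Rightarrow> real \<Rightarrow> nat \<Rightarrow> 'w \<Rightarrow> real" where
  "RS i s t N w = (\<Sum>k<N. a (X (grid s t N k) w) $ i * (grid s t N (Suc k) - grid s t N k)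
     + b (X (grid s t N k) w) $ i \<bullet> (W (grid s t N (Suc k)) w - W (grid s t N k) w))"

lemma meas_RS: 
  assumes "0 \<le> s" "s < t" "0 < N" shows "RS i s t N \<in> borel_measurable M"
proof -
  have g: "0 \<le> grid s t N k" for k using grid_props(5)[OF assms, of k] assms by simp
  have [measurable]: "(\<lambda>w. a (X (grid s t N k) w) $ i) \<in> borel_measurable M" 
    "(\<lambda>w. b (X (grid s t N k) w) $ i) \<in> borel_measurable M" 
    "W (grid s t N k) \<in> borel_measurable M" for k
    using meas_F_M[OF g meas_aX[OF g]] meas_F_M[OF g meas_bX[OF g]] meas_W_M[OF g] by auto
  show ?thesis unfolding RS_def by measurable
qed

text \<open>Commensurable times: if \<open>s = t * p / q\<close>, then \<open>s\<close> is the point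
  with index \<open>p * m\<close> of the uniform grid with \<open>q * m\<close> steps on [0, t]. The
  case \<open>p = 0\<close> covers \<open>s = 0\<close>.\<close>

definition comm :: "real \<Rightarrow> real \<Rightarrow> bool" where
  "comm s t \<longleftrightarrow> 0 < t \<and> (\<exists>p q::nat. p < q \<and> s = t * real p / real q)"

lemma comm_bounds: "comm s t \<Longrightarrow> 0 \<le> s \<and> s < t"
  unfolding comm_def by (auto simp: divide_less_eq mult.commute)

text \<open>For a rational ratio \<open>s / t\<close> the defining Riemann sums on \<open>[0, s]\<close> and \<open>[0, t]\<close> have a common
  uniform grid, so their difference is a Riemann sum on \<open>[s, t]\<close>.\<close>

lemma comm_AE:
  assumes "comm s t"
  shows "\<exists>r. (\<forall>n. 0 < r n) \<and> filterlim r at_top sequentially \<and> (AE w in M. (\<lambda>n. RS i s t (r n) w) \<longlonglongrightarrow> X t w $ i - X s w $ i)"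
proof -
  from assms obtain p q :: nat where pq: "p < q" "s = t * real p / real q" and t: "0 < t" unfolding comm_def by auto
  have st: "0 \<le> s" "s < t" using comm_bounds[OF assms] by auto
  define G where "G = (\<lambda>\<tau> N w. \<Sum>k<N. (\<tau> / real N) *\<^sub>R a (X (real k * \<tau> / real N) w)
              + b (X (real k * \<tau> / real N) w) *v (W (real (Suc k) * \<tau> / real N) w - W (real k * \<tau> / real N) w))"
  have cG: "conv_prob M (G \<tau>) (\<lambda>w. X \<tau> w - x0)" if "0 \<le> \<tau>" for \<tau>
    using sol that unfolding strong_solution_def G_def by auto
  have mG: "(\<lambda>w. G \<tau> N w $ i) \<in> borel_measurable M" if "0 \<le> \<tau>" for \<tau> N
  proof -
    have g: "0 \<le> real k * \<tau> / real N" for k using that by simp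
    have [measurable]: "(\<lambda>w. a (X (real k * \<tau> / real N) w) $ i) \<in> borel_measurable M" 
      "(\<lambda>w. b (X (real k * \<tau> / real N) w) $ i $ j) \<in> borel_measurable M" 
      "W (real k * \<tau> / real N) \<in> borel_measurable M" for k j
      using meas_F_M[OF g meas_aX[OF g]] meas_F_M[OF g nice_X[OF nb g]] meas_W_M[OF g] by auto
    show ?thesis unfolding G_def by (simp add: matrix_vector_mult_def del: of_nat_Suc)
  qed
  \<comment> \<open>The Boolean index puts the sums on [0, t] and on [0, s] into one family, so that
    both converge along the same subsequence.\<close>
  define S where "S = (\<lambda>c m w. if c then G t (q * m) w $ i else G s (p * m) w $ i)"
  define Y where "Y = (\<lambda>c w. if c then X t w $ i - x0 $ i else X s w $ i - x0 $ i)"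
  have comp: "conv_prob M (\<lambda>m w. G \<tau> (n * m) w $ i) (\<lambda>w. X \<tau> w $ i - x0 $ i)" if \<tau>: "0 \<le> \<tau>" and n: "0 < n" for \<tau> and n :: nat
    unfolding conv_prob_def
  proof (intro allI impI)
    fix e :: real assume e: "0 < e"
    have l: "(\<lambda>N. measure M {w\<in>space M. e < dist (G \<tau> N w) (X \<tau> w - x0)}) \<longlonglongrightarrow> 0"
      using cG[OF \<tau>] e unfolding conv_prob_def by auto
    have "strict_mono (\<lambda>m. n * m)" using n by (auto simp: strict_mono_def)
    from LIMSEQ_subseq_LIMSEQ[OF l this]
    have l2: "(\<lambda>m. measure M {w\<in>space M. e < dist (G \<tau> (n * m) w) (X \<tau> w - x0)}) \<longlonglongrightarrow> 0" by (simp add: o_def)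
    have mm: "(\<lambda>w. G \<tau> N w) \<in> borel_measurable M" for N
    proof -
      have g: "0 \<le> real k * \<tau> / real N" for k using \<tau> by simp
      have [measurable]: "(\<lambda>w. a (X (real k * \<tau> / real N) w)) \<in> borel_measurable M" 
        "(\<lambda>w. b (X (real k * \<tau> / real N) w) *v (W (real (Suc k) * \<tau> / real N) w - W (real k * \<tau> / real N) w)) \<in> borel_measurable M" for k
      proof -
        have g': "0 \<le> real (Suc k) * \<tau> / real N" using \<tau> by simp
        have [measurable]: "(\<lambda>w. a (X (real k * \<tau> / real N) w) $ i) \<in> borel_measurable M" 
          "(\<lambda>w. b (X (real k * \<tau> / real N) w) $ i $ j) \<in> borel_measurable M" 
          "W (real k * \<tau> / real N) \<in> borel_measurable M" "W (real (Suc k) * \<tau> / real N) \<in> borel_measurable M" for i j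
          using meas_F_M[OF g meas_aX[OF g]] meas_F_M[OF g nice_X[OF nb g]] meas_W_M[OF g] meas_W_M[OF g'] by auto
        show "(\<lambda>w. a (X (real k * \<tau> / real N) w)) \<in> borel_measurable M" 
          by (rule measurable_vecI) measurable
        show "(\<lambda>w. b (X (real k * \<tau> / real N) w) *v (W (real (Suc k) * \<tau> / real N) w - W (real k * \<tau> / real N) w)) \<in> borel_measurable M"
          by (rule measurable_vecI) (simp add: matrix_vector_mult_def del: of_nat_Suc)
      qed
      show ?thesis unfolding G_def by measurable
    qed
    have [measurable]: "X \<tau> \<in> borel_measurable M" using meas_X_M[OF \<tau>] .
    show "(\<lambda>m. measure M {w\<in>space M. e < dist (G \<tau> (n * m) w $ i) (X \<tau> w $ i - x0 $ i)}) \<longlonglongrightarrow> 0"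
    proof (rule tendsto_sandwich[OF _ _ tendsto_const l2]; intro always_eventually allI)
      fix m
      have "dist (G \<tau> (n * m) w $ i) (X \<tau> w $ i - x0 $ i) \<le> dist (G \<tau> (n * m) w) (X \<tau> w - x0)" for w
        using dist_vec_nth_le[of "G \<tau> (n * m) w" i "X \<tau> w - x0"] by simp
      then have "{w\<in>space M. e < dist (G \<tau> (n * m) w $ i) (X \<tau> w $ i - x0 $ i)} \<subseteq> {w\<in>space M. e < dist (G \<tau> (n * m) w) (X \<tau> w - x0)}"
        by (auto intro: less_le_trans)
      moreover have "{w\<in>space M. e < dist (G \<tau> (n * m) w) (X \<tau> w - x0)} \<in> sets M" using mm[of "n * m"] by measurable
      ultimately show "measure M {w\<in>space M. e < dist (G \<tau> (n * m) w $ i) (X \<tau> w $ i - x0 $ i)} 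
        \<le> measure M {w\<in>space M. e < dist (G \<tau> (n * m) w) (X \<tau> w - x0)}"
        by (rule finite_measure_mono)
    qed auto
  qed
  \<comment> \<open>For \<open>p = 0\<close> the index \<open>p * m\<close> does not tend to
    infinity; there the sum is empty and equals \<open>X 0 - x0\<close>.\<close>
  have zero: "conv_prob M (\<lambda>m w. G s (p * m) w $ i) (\<lambda>w. X s w $ i - x0 $ i)" if "p = 0"
  proof -
    have s0: "s = 0" using pq that by simp
    have e: "{w\<in>space M. e < dist (G s (p * m) w $ i) (X s w $ i - x0 $ i)} = {}" if "0 < e" for e m
      using that X_0 unfolding s0 \<open>p = 0\<close> G_def by (auto simp: dist_real_def)
    show ?thesis unfolding conv_prob_def
    proof (intro allI impI)
      fix e :: real assume "0 < e"
      then show "(\<lambda>N. prob {w\<in>space M. e < dist (G s (p * N) w $ i) (X s w $ i - x0 $ i)}) \<longlonglongrightarrow> 0"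
        unfolding e[OF \<open>0 < e\<close>] by simp
    qed
  qed
  have cS: "conv_prob M (S c) (Y c)" for c
  proof (cases c)
    case True
    then show ?thesis using comp[of t q] pq t by (simp add: S_def Y_def)
  next
    case False
    then show ?thesis using comp[of s p] zero st by (cases "p = 0") (simp_all add: S_def Y_def)
  qed
  have mS: "S c n \<in> borel_measurable M" for c n using mG st t unfolding S_def by (cases c) auto
  have mY: "Y c \<in> borel_measurable M" for c
    using meas_X_M[of s] meas_X_M[of t] st t unfolding Y_def by (cases c) auto
  from conv_prob_AE_subseq[of UNIV S Y, OF finite cS mS mY]
  obtain r :: "nat \<Rightarrow> nat" where r: "strict_mono r" "\<And>c. AE w in M. (\<lambda>n. S c (r n) w) \<longlonglongrightarrow> Y c w" by auto
  have key: "G t (q * m) w $ i - G s (p * m) w $ i = RS i s t ((q - p) * m) w" if m: "0 < m" for m w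
  proof -
    define \<Delta> where "\<Delta> = t / real (q * m)"
    have q0: "0 < real q * real m" using pq m by simp
    have 1: "real k * t / real (q * m) = real k * \<Delta>" for k unfolding \<Delta>_def by simp
    have 2: "real k * s / real (p * m) = real k * \<Delta>" if "0 < p" for k
      using that m pq unfolding \<Delta>_def pq(2) by (simp add: field_simps)
    have ts: "(t - s) / real ((q - p) * m) = \<Delta>"
      unfolding \<Delta>_def using pq q0 m by (simp add: pq(2) of_nat_diff field_simps)
    have spm: "s = real (p * m) * \<Delta>" unfolding \<Delta>_def pq(2) using m by simp
    have 3: "grid s t ((q - p) * m) k = real (p * m + k) * \<Delta>" for k
    proof -
      have "grid s t ((q - p) * m) k = s + real k * ((t - s) / real ((q - p) * m))" unfolding grid_def by simp
      then show ?thesis unfolding ts by (subst (asm) spm) (simp add: algebra_simps)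
    qed
    define f where "f k = \<Delta> * a (X (real k * \<Delta>) w) $ i + b (X (real k * \<Delta>) w) $ i \<bullet> (W (real (Suc k) * \<Delta>) w - W (real k * \<Delta>) w)" for k
    have Gt: "G t (q * m) w $ i = (\<Sum>k<q * m. f k)"
      unfolding G_def f_def 1 by (simp add: \<Delta>_def matrix_vector_mult_def inner_vec_def mult.commute del: of_nat_Suc)
    have Gs: "G s (p * m) w $ i = (\<Sum>k<p * m. f k)"
    proof (cases "p = 0")
      case False
      then have "s / real (p * m) = \<Delta>" using 2[of 1] by simp
      then show ?thesis unfolding G_def f_def using 2 False 
        by (simp add: matrix_vector_mult_def inner_vec_def mult.commute del: of_nat_Suc of_nat_mult)
    qed (simp add: G_def)
    have sh: "(\<Sum>k<n + l. f k) = (\<Sum>k<n. f k) + (\<Sum>k<l. f (n + k))" for n l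
      by (induction l) auto
    have "q * m = p * m + (q - p) * m" using pq by (simp add: add_mult_distrib[symmetric])
    then have "G t (q * m) w $ i - G s (p * m) w $ i = (\<Sum>k<(q - p) * m. f (p * m + k))"
      unfolding Gt Gs using sh[of "p * m" "(q - p) * m"] by simp
    also have "\<dots> = RS i s t ((q - p) * m) w"
      unfolding RS_def 3 f_def by (intro sum.cong) (auto simp: algebra_simps)
    finally show ?thesis .
  qed
  \<comment> \<open>Shifting the subsequence by one excludes the empty grid.\<close>
  define r' where "r' n = (q - p) * r (Suc n)" for n
  have rpos: "0 < r (Suc n)" for n using r(1) by (metis gr0I less_nat_zero_code strict_monoD zero_less_Suc)
  have "filterlim r' at_top sequentially"
  proof -
    have "n \<le> r' n" for n
    proof -
      have "n \<le> r (Suc n)" using strict_mono_imp_increasing[OF r(1), of "Suc n"] by simp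
      also have "\<dots> \<le> r' n" unfolding r'_def using pq(1) by (intro order_trans[OF _ mult_le_mono1[of 1 "q - p" "r (Suc n)"]]) auto
      finally show ?thesis .
    qed
    then show ?thesis by (intro filterlim_at_top_mono[OF filterlim_ident always_eventually]) auto
  qed
  moreover have "AE w in M. (\<lambda>n. RS i s t (r' n) w) \<longlonglongrightarrow> X t w $ i - X s w $ i"
    using r(2)[of True] r(2)[of False]
  proof eventually_elim
    case (elim w)
    from tendsto_diff[OF LIMSEQ_Suc[OF elim(1)] LIMSEQ_Suc[OF elim(2)]]
    show ?case using key[OF rpos] unfolding S_def Y_def r'_def by simp
  qed
  moreover have "0 < r' n" for n unfolding r'_def using pq rpos by simp
  ultimately show ?thesis by blast
qed

end

section \<open>Moments of the solution and the remainder of an Euler step\<close>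

context sde
begin

text \<open>Approximation from above keeps \<open>F s\<close>-measurable weights measurable at the
  approximating times.\<close>

lemma comm_dense:
  assumes "0 \<le> s" "s < t"
  shows "\<exists>\<sigma>. (\<forall>n. comm (\<sigma> n) t \<and> s \<le> \<sigma> n) \<and> \<sigma> \<longlonglongrightarrow> s"
proof -
  have ex: "\<exists>y. comm y t \<and> s < y \<and> y < s + e" if e: "0 < e" for e
  proof -
    have t: "0 < t" using assms by simp
    have "s / t < min 1 ((s + e) / t)" using assms e t by (simp add: divide_simps)
    then obtain r where r: "r \<in> \<rat>" "s / t < r" "r < min 1 ((s + e) / t)" using Rats_dense_in_real by blast
    have r0: "0 < r" using r(2) assms t by (meson divide_nonneg_pos le_less_trans)
    obtain p q :: nat where pq: "q \<noteq> 0" "\<bar>r\<bar> = real p / real q" using Rats_abs_nat_div_natE[OF r(1)] by metis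
    have rr: "r = real p / real q" using pq r0 by simp
    have "p < q" using r(3) pq unfolding rr by (simp add: divide_less_eq)
    then have "comm (t * r) t" unfolding comm_def rr using t by (intro conjI exI[of _ p] exI[of _ q]) auto
    moreover have "s < t * r" "t * r < s + e" using r t by (auto simp: field_simps)
    ultimately show ?thesis by blast
  qed
  have "\<forall>n. \<exists>y. comm y t \<and> s < y \<and> y < s + inverse (real (Suc n))" using ex by simp
  then obtain \<sigma> where \<sigma>: "\<And>n. comm (\<sigma> n) t \<and> s < \<sigma> n \<and> \<sigma> n < s + inverse (real (Suc n))" by metis
  have "\<sigma> \<longlonglongrightarrow> s"
  proof (rule tendsto_sandwich[OF _ _ tendsto_const])
    show "(\<lambda>n. s + inverse (real (Suc n))) \<longlonglongrightarrow> s" by (rule LIMSEQ_inverse_real_of_nat_add)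
  qed (use \<sigma> in \<open>auto intro!: always_eventually less_imp_le\<close>)
  then show ?thesis using \<sigma> by (intro exI[of _ \<sigma>]) (auto intro: less_imp_le)
qed

lemma seq_cont:
  assumes "\<sigma> \<longlonglongrightarrow> s" "0 \<le> s" "\<And>n. 0 \<le> \<sigma> n"
  shows "AE w in M. (\<lambda>n. X (\<sigma> n) w) \<longlonglongrightarrow> X s w" "AE w in M. (\<lambda>n. W (\<sigma> n) w) \<longlonglongrightarrow> W s w"
proof -
  show "AE w in M. (\<lambda>n. X (\<sigma> n) w) \<longlonglongrightarrow> X s w" using X_cont
    by eventually_elim (rule continuous_on_tendsto_compose[OF _ assms(1)], use assms in auto)
  show "AE w in M. (\<lambda>n. W (\<sigma> n) w) \<longlonglongrightarrow> W s w" using W_cont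
    by eventually_elim (rule continuous_on_tendsto_compose[OF _ assms(1)], use assms in auto)
qed

text \<open>The exponent of \<open>exp_sum_bound\<close> for one coordinate, with drift at most
  \<open>K\<close> and squared row norm at most \<open>Cb\<close>.\<close>

definition \<psi> :: "real \<Rightarrow> real" where "\<psi> l = \<bar>l\<bar> * K + l\<^sup>2 * Cb / 2"

lemma nn_fatou_bound:
  fixes Z :: "nat \<Rightarrow> 'w \<Rightarrow> real" and c :: "nat \<Rightarrow> real"
  assumes "AE w in M. (\<lambda>n. Z n w) \<longlonglongrightarrow> Y w" "\<And>n. Z n \<in> borel_measurable M" "U \<in> borel_measurable M"
    and b: "\<And>n. (\<integral>\<^sup>+w. U w * ennreal (exp (Z n w)) \<partial>M) \<le> ennreal (exp (c n)) * V" and c: "c \<longlonglongrightarrow> c'"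
  shows "(\<integral>\<^sup>+w. U w * ennreal (exp (Y w)) \<partial>M) \<le> ennreal (exp c') * V"
proof -
  have [measurable]: "Z n \<in> borel_measurable M" "U \<in> borel_measurable M" for n using assms by auto
  have "(\<integral>\<^sup>+w. U w * ennreal (exp (Y w)) \<partial>M) = (\<integral>\<^sup>+w. liminf (\<lambda>n. U w * ennreal (exp (Z n w))) \<partial>M)"
  proof (rule nn_integral_cong_AE)
    show "AE w in M. U w * ennreal (exp (Y w)) = liminf (\<lambda>n. U w * ennreal (exp (Z n w)))"
      using assms(1) by eventually_elim (intro lim_imp_Liminf[symmetric] tendsto_mult_ennreal tendsto_const tendsto_ennrealI tendsto_exp, auto)
  qed
  also have "\<dots> \<le> liminf (\<lambda>n. \<integral>\<^sup>+w. U w * ennreal (exp (Z n w)) \<partial>M)"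
    by (rule nn_integral_liminf) measurable
  also have "\<dots> \<le> liminf (\<lambda>n. ennreal (exp (c n)) * V)"
    using b by (intro Liminf_mono always_eventually) auto
  also have "\<dots> = ennreal (exp c') * V"
    using c by (intro lim_imp_Liminf) (auto intro!: tendsto_mult_ennreal tendsto_ennrealI tendsto_exp)
  finally show ?thesis .
qed

lemma X_exp_comm:
  assumes st: "comm s t" and U: "U \<in> borel_measurable (F s)"
  shows "(\<integral>\<^sup>+w. U w * ennreal (exp (l * (X t w $ i - X s w $ i))) \<partial>M) \<le> ennreal (exp (\<psi> l * (t - s))) * (\<integral>\<^sup>+w. U w \<partial>M)"
proof -
  note st' = comm_bounds[OF st]
  obtain r where r: "\<And>n. 0 < r n" "AE w in M. (\<lambda>n. RS i s t (r n) w) \<longlonglongrightarrow> X t w $ i - X s w $ i"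
    using comm_AE[OF st, of i] by auto
  show ?thesis
  proof (rule nn_fatou_bound[where Z="\<lambda>n w. l * RS i s t (r n) w" and c="\<lambda>_. \<psi> l * (t - s)"])
    show "AE w in M. (\<lambda>n. l * RS i s t (r n) w) \<longlonglongrightarrow> l * (X t w $ i - X s w $ i)"
      using r(2) by eventually_elim (intro tendsto_mult tendsto_const)
    show "(\<lambda>w. l * RS i s t (r n) w) \<in> borel_measurable M" for n
      using st' r(1) by (intro borel_measurable_times meas_RS) auto
    show "U \<in> borel_measurable M" using meas_F_M[OF _ U] st' by auto
    show "(\<integral>\<^sup>+w. U w * ennreal (exp (l * RS i s t (r n) w)) \<partial>M) \<le> ennreal (exp (\<psi> l * (t - s))) * (\<integral>\<^sup>+w. U w \<partial>M)" for n
    proof -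
      note g = grid_props[of s t "r n"]
      have u: "0 \<le> grid s t (r n) k" for k using g(5)[of k] st' r(1)[of n] by auto
      have "(\<integral>\<^sup>+w. U w * ennreal (exp (l * RS i s t (r n) w)) \<partial>M) \<le> 
         ennreal (exp ((\<bar>l\<bar> * K + l\<^sup>2 * Cb / 2) * (grid s t (r n) (r n) - grid s t (r n) 0))) * (\<integral>\<^sup>+w. U w \<partial>M)"
        unfolding RS_def
      proof (rule exp_sum_bound[where u="grid s t (r n)" and \<alpha>="\<lambda>k w. a (X (grid s t (r n) k) w) $ i" 
              and v="\<lambda>k w. b (X (grid s t (r n) k) w) $ i" and U=U and l=l and n="r n" and ?C1.0=K and ?C2.0=Cb, THEN conjunct2])
        show "0 \<le> grid s t (r n) 0" by (rule u)
        show "grid s t (r n) k < grid s t (r n) (Suc k)" for k using g(3) st' r(1) by blast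
        show "(\<lambda>w. a (X (grid s t (r n) k) w) $ i) \<in> borel_measurable (F (grid s t (r n) k))" for k by (rule meas_aX[OF u])
        show "(\<lambda>w. b (X (grid s t (r n) k) w) $ i) \<in> borel_measurable (F (grid s t (r n) k))" for k by (rule meas_bX[OF u])
        show "\<bar>a (X (grid s t (r n) k) w) $ i\<bar> \<le> K" for k w using na unfolding nice_def by blast
        show "(norm (b (X (grid s t (r n) k) w) $ i))\<^sup>2 \<le> Cb" for k w by (rule Cb)
        show "U \<in> borel_measurable (F (grid s t (r n) 0))" using U g(1) st' r(1) by simp
      qed
      then show ?thesis unfolding \<psi>_def using g(1,2) st' r(1) by simp
    qed
  qed auto
qed

lemma X_exp:
  assumes st: "0 \<le> s" "s \<le> t" and U: "U \<in> borel_measurable (F s)"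
  shows "(\<integral>\<^sup>+w. U w * ennreal (exp (l * (X t w $ i - X s w $ i))) \<partial>M) \<le> ennreal (exp (\<psi> l * (t - s))) * (\<integral>\<^sup>+w. U w \<partial>M)"
proof (cases "s = t")
  case False
  then have st': "s < t" using st by simp
  obtain \<sigma> where \<sigma>: "\<And>n. comm (\<sigma> n) t" "\<And>n. s \<le> \<sigma> n" "\<sigma> \<longlonglongrightarrow> s" using comm_dense[OF st(1) st'] by auto
  have \<sigma>0: "0 \<le> \<sigma> n" for n using \<sigma>(2)[of n] st by simp
  show ?thesis
  proof (rule nn_fatou_bound[where Z="\<lambda>n w. l * (X t w $ i - X (\<sigma> n) w $ i)" and c="\<lambda>n. \<psi> l * (t - \<sigma> n)"])
    show "AE w in M. (\<lambda>n. l * (X t w $ i - X (\<sigma> n) w $ i)) \<longlonglongrightarrow> l * (X t w $ i - X s w $ i)"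
      using seq_cont(1)[OF \<sigma>(3) st(1) \<sigma>0] by eventually_elim (intro tendsto_intros)
    show "(\<lambda>w. l * (X t w $ i - X (\<sigma> n) w $ i)) \<in> borel_measurable M" for n
      using meas_X_M \<sigma>0[of n] st by (intro borel_measurable_times borel_measurable_diff measurable_vec_nth) auto
    show "U \<in> borel_measurable M" using meas_F_M[OF _ U] st by auto
    show "(\<lambda>n. \<psi> l * (t - \<sigma> n)) \<longlonglongrightarrow> \<psi> l * (t - s)" by (intro tendsto_intros \<sigma>)
  qed (rule X_exp_comm[OF \<sigma>(1) meas_F_mono[OF st(1) \<sigma>(2) U]])
qed simp

text \<open>The cardinalities come from \<open>norm_pow_le\<close> and from the sum over
  coordinates, \<open>fact n\<close> and the factor 2 from bounding a power by exponentials of both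
  signs.\<close>

definition Cn :: "nat \<Rightarrow> real" where
  "Cn n = real CARD('d) ^ n * (real CARD('d) * (2 * fact n * exp (K + Cb / 2)))"

lemma Cn_pos: "0 < Cn n" unfolding Cn_def by (intro mult_pos_pos) auto

text \<open>The exponential moment is used at the parameter \<open>1 / sqrt (t - s)\<close> and at
  its negative. There \<open>\<psi> l * (t - s)\<close> stays bounded for
  \<open>t - s \<le> 1\<close>, and rescaling produces the order
  \<open>sqrt (t - s) ^ n\<close>.\<close>

lemma X_mom_nn:
  assumes st: "0 \<le> s" "s \<le> t" "t \<le> s + 1" and U: "U \<in> borel_measurable (F s)"
  shows "(\<integral>\<^sup>+w. U w * ennreal ((norm (X t w - X s w)) ^ n) \<partial>M) \<le> ennreal (Cn n * (sqrt (t - s)) ^ n) * (\<integral>\<^sup>+w. U w \<partial>M)"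
proof (cases "s = t")
  case True
  show ?thesis
  proof (cases "n = 0")
    case True
    have "1 \<le> Cn 0" unfolding Cn_def
      using K1 Cb0 mult_mono[of 1 "real CARD('d)" 1 "2 * exp (K + Cb / 2)"] exp_ge_add_one_self[of "K + Cb / 2"] by auto
    then have "(\<integral>\<^sup>+w. U w \<partial>M) \<le> ennreal (Cn 0) * (\<integral>\<^sup>+w. U w \<partial>M)"
      using mult_right_mono[of 1 "ennreal (Cn 0)" "\<integral>\<^sup>+w. U w \<partial>M"] by simp
    then show ?thesis using True by simp
  next
    case False
    then show ?thesis using \<open>s = t\<close> by (cases n) auto
  qed
next
  case False
  then have dt: "0 < t - s" "t - s \<le> 1" using st by auto
  define q where "q = sqrt (t - s)"
  have q: "0 < q" "q\<^sup>2 = t - s" "q \<le> 1" using dt by (auto simp: q_def)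
  have [measurable]: "U \<in> borel_measurable M" "X t \<in> borel_measurable M" "X s \<in> borel_measurable M"
    using meas_F_M[OF st(1) U] meas_X_M st by auto
  let ?D = "\<lambda>i w. X t w $ i - X s w $ i"
  let ?c = "real CARD('d) ^ n * (q ^ n * fact n)"
  have c0: "0 \<le> ?c" using q by simp
  have \<psi>q: "\<psi> (1/q) * (t - s) \<le> K + Cb / 2" "\<psi> (-1/q) * (t - s) \<le> K + Cb / 2"
  proof -
    have "\<psi> (1/q) * (t - s) = q * K + Cb / 2" unfolding \<psi>_def q(2)[symmetric] using q
      by (simp add: field_simps power2_eq_square)
    moreover have "q * K \<le> K" using q K1 by simp
    ultimately show "\<psi> (1/q) * (t - s) \<le> K + Cb / 2" by simp
    moreover have "\<psi> (-1/q) = \<psi> (1/q)" unfolding \<psi>_def by simp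
    ultimately show "\<psi> (-1/q) * (t - s) \<le> K + Cb / 2" by simp
  qed
  have pt: "(norm (X t w - X s w)) ^ n \<le> ?c * (\<Sum>i\<in>UNIV. exp (1/q * ?D i w) + exp (-1/q * ?D i w))" for w
  proof -
    have "\<bar>?D i w\<bar> ^ n \<le> q ^ n * fact n * (exp (1/q * ?D i w) + exp (-1/q * ?D i w))" for i
    proof -
      have "\<bar>?D i w\<bar> ^ n = q ^ n * \<bar>?D i w / q\<bar> ^ n" using q by (simp add: abs_divide power_divide)
      also have "\<dots> \<le> q ^ n * (fact n * (exp (?D i w / q) + exp (- (?D i w / q))))"
        using q by (intro mult_left_mono abs_pow_le_exp) auto
      finally show ?thesis by (simp add: mult.assoc)
    qed
    then have "(\<Sum>i\<in>UNIV. \<bar>?D i w\<bar> ^ n) \<le> q ^ n * fact n * (\<Sum>i\<in>UNIV. exp (1/q * ?D i w) + exp (-1/q * ?D i w))"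
      unfolding sum_distrib_left by (intro sum_mono)
    then have *: "real CARD('d) ^ n * (\<Sum>i\<in>UNIV. \<bar>?D i w\<bar> ^ n) \<le> real CARD('d) ^ n * (q ^ n * fact n * (\<Sum>i\<in>UNIV. exp (1/q * ?D i w) + exp (-1/q * ?D i w)))"
      by (intro mult_left_mono) auto
    show ?thesis using order_trans[OF norm_pow_le[of "X t w - X s w" n, unfolded vector_minus_component] *] by (simp only: mult.assoc)
  qed
  have "(\<integral>\<^sup>+w. U w * ennreal ((norm (X t w - X s w)) ^ n) \<partial>M)
    \<le> (\<integral>\<^sup>+w. ennreal ?c * (\<Sum>i\<in>UNIV. U w * ennreal (exp (1/q * ?D i w)) + U w * ennreal (exp (-1/q * ?D i w))) \<partial>M)"
  proof (rule nn_integral_mono)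
    fix w
    have "U w * ennreal ((norm (X t w - X s w)) ^ n) \<le> U w * ennreal (?c * (\<Sum>i\<in>UNIV. exp (1/q * ?D i w) + exp (-1/q * ?D i w)))"
      using pt by (intro mult_left_mono ennreal_leI) auto
    also have "ennreal (?c * (\<Sum>i\<in>UNIV. exp (1/q * ?D i w) + exp (-1/q * ?D i w)))
        = ennreal ?c * ennreal (\<Sum>i\<in>UNIV. exp (1/q * ?D i w) + exp (-1/q * ?D i w))"
      by (rule ennreal_mult[OF c0]) (intro sum_nonneg add_nonneg_nonneg exp_ge_zero)
    also have "ennreal (\<Sum>i\<in>UNIV. exp (1/q * ?D i w) + exp (-1/q * ?D i w))
        = (\<Sum>i\<in>UNIV. ennreal (exp (1/q * ?D i w)) + ennreal (exp (-1/q * ?D i w)))"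
      by (subst sum_ennreal[symmetric]) (auto intro!: sum.cong)
    also have "U w * (ennreal ?c * (\<Sum>i\<in>UNIV. ennreal (exp (1/q * ?D i w)) + ennreal (exp (-1/q * ?D i w))))
       = ennreal ?c * (\<Sum>i\<in>UNIV. U w * ennreal (exp (1/q * ?D i w)) + U w * ennreal (exp (-1/q * ?D i w)))"
      by (simp only: distrib_left[symmetric] sum_distrib_left[symmetric] mult.left_commute)
    finally show "U w * ennreal ((norm (X t w - X s w)) ^ n) \<le> \<dots>" .
  qed
  also have "\<dots> = ennreal ?c * (\<Sum>i\<in>UNIV. (\<integral>\<^sup>+w. U w * ennreal (exp (1/q * ?D i w)) \<partial>M) + (\<integral>\<^sup>+w. U w * ennreal (exp (-1/q * ?D i w)) \<partial>M))"
    by (simp add: nn_integral_cmult nn_integral_sum nn_integral_add)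
  also have "\<dots> \<le> ennreal ?c * (\<Sum>i\<in>(UNIV::'d set). ennreal (exp (K + Cb / 2)) * (\<integral>\<^sup>+w. U w \<partial>M) + ennreal (exp (K + Cb / 2)) * (\<integral>\<^sup>+w. U w \<partial>M))"
  proof (intro mult_left_mono sum_mono add_mono)
    show "(\<integral>\<^sup>+w. U w * ennreal (exp (1/q * ?D i w)) \<partial>M) \<le> ennreal (exp (K + Cb / 2)) * (\<integral>\<^sup>+w. U w \<partial>M)" for i
      using \<psi>q by (intro order_trans[OF X_exp[OF st(1,2) U]] mult_right_mono ennreal_leI) auto
    show "(\<integral>\<^sup>+w. U w * ennreal (exp (-1/q * ?D i w)) \<partial>M) \<le> ennreal (exp (K + Cb / 2)) * (\<integral>\<^sup>+w. U w \<partial>M)" for i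
      using \<psi>q by (intro order_trans[OF X_exp[OF st(1,2) U]] mult_right_mono ennreal_leI) auto
  qed auto
  also have "\<dots> = ennreal (Cn n * q ^ n) * (\<integral>\<^sup>+w. U w \<partial>M)"
  proof -
    have "ennreal (Cn n * q ^ n) = ennreal ?c * (of_nat CARD('d) * (2 * ennreal (exp (K + Cb / 2))))"
    proof -
      have "Cn n * q ^ n = ?c * (real CARD('d) * (2 * exp (K + Cb / 2)))" unfolding Cn_def by (simp add: mult_ac)
      then have "ennreal (Cn n * q ^ n) = ennreal (?c * (real CARD('d) * (2 * exp (K + Cb / 2))))" by (rule arg_cong)
      also have "\<dots> = ennreal ?c * (ennreal (real CARD('d)) * (ennreal 2 * ennreal (exp (K + Cb / 2))))"
        using c0 by (simp only: ennreal_mult mult_nonneg_nonneg of_nat_0_le_iff zero_le_numeral exp_ge_zero)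
      finally show ?thesis by (simp add: ennreal_of_nat_eq_real_of_nat)
    qed
    then show ?thesis by (simp add: mult.assoc mult_2 distrib_left distrib_right)
  qed
  finally show ?thesis unfolding q_def .
qed

lemma X_mom:
  assumes st: "0 \<le> s" "s \<le> t" "t \<le> s + 1" and U: "U \<in> borel_measurable (F s)" "\<And>w. (0::real) \<le> U w" "integrable M U"
  shows "integrable M (\<lambda>w. U w * (norm (X t w - X s w)) ^ n)" 
    "(\<integral>w. U w * (norm (X t w - X s w)) ^ n \<partial>M) \<le> Cn n * (sqrt (t - s)) ^ n * (\<integral>w. U w \<partial>M)"
proof -
  have m[measurable]: "U \<in> borel_measurable M" "X t \<in> borel_measurable M" "X s \<in> borel_measurable M"
    using meas_F_M[OF st(1) U(1)] meas_X_M st by auto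
  have mU: "(\<lambda>w. ennreal (U w)) \<in> borel_measurable (F s)" using U(1) by measurable
  have e: "0 \<le> (\<integral>w. U w \<partial>M)" using U by (intro integral_nonneg_AE) auto
  have c: "0 \<le> Cn n * (sqrt (t - s)) ^ n" using Cn_pos[of n] st by (intro mult_nonneg_nonneg) auto
  have "(\<integral>\<^sup>+w. ennreal (U w * (norm (X t w - X s w)) ^ n) \<partial>M) = (\<integral>\<^sup>+w. ennreal (U w) * ennreal ((norm (X t w - X s w)) ^ n) \<partial>M)"
    using U by (intro nn_integral_cong) (auto simp: ennreal_mult)
  also have "\<dots> \<le> ennreal (Cn n * (sqrt (t - s)) ^ n) * (\<integral>\<^sup>+w. ennreal (U w) \<partial>M)" by (rule X_mom_nn[OF st mU])
  also have "(\<integral>\<^sup>+w. ennreal (U w) \<partial>M) = ennreal (\<integral>w. U w \<partial>M)" using U by (intro nn_integral_eq_integral) auto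
  also have "ennreal (Cn n * (sqrt (t - s)) ^ n) * ennreal (\<integral>w. U w \<partial>M) = ennreal (Cn n * (sqrt (t - s)) ^ n * (\<integral>w. U w \<partial>M))"
    using e c by (simp add: ennreal_mult)
  finally have *: "(\<integral>\<^sup>+w. ennreal (U w * (norm (X t w - X s w)) ^ n) \<partial>M) \<le> ennreal (Cn n * (sqrt (t - s)) ^ n * (\<integral>w. U w \<partial>M))" .
  show "integrable M (\<lambda>w. U w * (norm (X t w - X s w)) ^ n)" 
    "(\<integral>w. U w * (norm (X t w - X s w)) ^ n \<partial>M) \<le> Cn n * (sqrt (t - s)) ^ n * (\<integral>w. U w \<partial>M)"
    by (rule nn_bound[OF _ _ *]; use U e c in \<open>auto intro!: mult_nonneg_nonneg\<close>)+
qed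

lemma X_mom2:
  assumes st: "0 \<le> s" "s \<le> t" "t \<le> s + 1" and U: "U \<in> borel_measurable (F s)" "\<And>w. (0::real) \<le> U w" "integrable M U"
  shows "integrable M (\<lambda>w. U w * (norm (X t w - X s w))\<^sup>2)" 
    "(\<integral>w. U w * (norm (X t w - X s w))\<^sup>2 \<partial>M) \<le> Cn 2 * (t - s) * (\<integral>w. U w \<partial>M)"
  using X_mom[OF st U, of 2] st by auto

lemma X_L2_inc:
  assumes st: "0 \<le> s" "s \<le> t" "t \<le> s + 1"
  shows "L2 (\<lambda>w. norm (X t w - X s w))"
proof -
  have [measurable]: "X t \<in> borel_measurable M" "X s \<in> borel_measurable M" using meas_X_M st by auto
  have "(\<lambda>w. norm (X t w - X s w)) \<in> borel_measurable M" by measurable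
  moreover have "integrable M (\<lambda>w. 1 * (norm (X t w - X s w))\<^sup>2)"
    by (rule X_mom2(1)[OF st]) auto
  ultimately show ?thesis unfolding L2_def by simp
qed

lemma X_L2_inci:
  assumes st: "0 \<le> s" "s \<le> t" "t \<le> s + 1"
  shows "L2 (\<lambda>w. X t w $ i - X s w $ i)"
proof (rule L2_mono[OF X_L2_inc[OF st]])
  show "(\<lambda>w. X t w $ i - X s w $ i) \<in> borel_measurable M" 
    using meas_X_M st by (intro borel_measurable_diff measurable_vec_nth) auto
  show "\<bar>X t w $ i - X s w $ i\<bar> \<le> \<bar>norm (X t w - X s w)\<bar>" for w
    using component_le_norm_cart[of "X t w - X s w" i] by simp
qed

lemma nice_inc:
  assumes st: "0 \<le> s" "s \<le> t" "t \<le> s + 1" and U: "bwt s U" "\<And>w. 0 \<le> U w" and f: "nice K f"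
  shows "(\<integral>w. U w * (f (X t w) - f (X s w))\<^sup>2 \<partial>M) \<le> K\<^sup>2 * Cn 2 * (t - s) * (\<integral>w. U w \<partial>M)"
proof -
  have bU: "U \<in> borel_measurable (F s)" "integrable M U" using U bwt_F bwt_integrable[OF st(1)] by auto
  have L: "L2 (\<lambda>w. f (X t w) - f (X s w))"
    using bwt_L2[OF _ nice_bwt[OF f]] st by (intro L2_diff) auto
  have "(\<integral>w. U w * (f (X t w) - f (X s w))\<^sup>2 \<partial>M) \<le> (\<integral>w. K\<^sup>2 * (U w * (norm (X t w - X s w))\<^sup>2) \<partial>M)"
  proof (rule integral_mono)
    show "integrable M (\<lambda>w. U w * (f (X t w) - f (X s w))\<^sup>2)" by (rule bwt_imult[OF st(1) U(1) L2_sq[OF L]])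
    show "integrable M (\<lambda>w. K\<^sup>2 * (U w * (norm (X t w - X s w))\<^sup>2))" using X_mom2[OF st bU(1) U(2) bU(2)] by simp
    fix w
    have "\<bar>f (X t w) - f (X s w)\<bar> \<le> K * norm (X t w - X s w)" using f unfolding nice_def by auto
    then have "\<bar>f (X t w) - f (X s w)\<bar>\<^sup>2 \<le> (K * norm (X t w - X s w))\<^sup>2" by (intro power_mono) auto
    then have "U w * (f (X t w) - f (X s w))\<^sup>2 \<le> U w * (K * norm (X t w - X s w))\<^sup>2"
      using U(2) by (intro mult_left_mono) auto
    then show "U w * (f (X t w) - f (X s w))\<^sup>2 \<le> K\<^sup>2 * (U w * (norm (X t w - X s w))\<^sup>2)" 
      by (simp add: power_mult_distrib mult_ac)
  qed
  also have "\<dots> \<le> K\<^sup>2 * (Cn 2 * (t - s) * (\<integral>w. U w \<partial>M))"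
    using X_mom2(2)[OF st bU(1) U(2) bU(2)] by (simp add: mult_left_mono)
  finally show ?thesis by (simp add: mult_ac)
qed

text \<open>The remainder of one Euler step started on the path itself.\<close>

definition R :: "'d \<Rightarrow> real \<Rightarrow> real \<Rightarrow> 'w \<Rightarrow> real" where
  "R i s t w = X t w $ i - X s w $ i - a (X s w) $ i * (t - s) - b (X s w) $ i \<bullet> (W t w - W s w)"

text \<open>The outcome of \<open>grid_sum\<close> when coefficient increments have mean square
  \<open>K\<^sup>2 * Cn 2 * (t - s)\<close>; the additional factor of the drift part is absorbed by
  \<open>t - s \<le> 1\<close>.\<close>

definition CR :: real where
  "CR = 2 * (K\<^sup>2 * Cn 2) + 2 * (real CARD('m))\<^sup>2 * (K\<^sup>2 * Cn 2)"

lemma CR0: "0 \<le> CR" unfolding CR_def using Cn_pos[of 2] by (intro add_nonneg_nonneg mult_nonneg_nonneg) auto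

lemma meas_R:
  assumes st: "0 \<le> s" "s \<le> t"
  shows "R i s t \<in> borel_measurable (F t)" "R i s t \<in> borel_measurable M"
proof -
  have [measurable]: "X t \<in> borel_measurable (F t)" "X s \<in> borel_measurable (F t)" 
    "W t \<in> borel_measurable (F t)" "W s \<in> borel_measurable (F t)"
    "(\<lambda>w. a (X s w) $ i) \<in> borel_measurable (F t)" "(\<lambda>w. b (X s w) $ i) \<in> borel_measurable (F t)"
    using st meas_X meas_X_le meas_W meas_W_le meas_F_mono[OF st meas_aX] meas_F_mono[OF st meas_bX] by auto
  show "R i s t \<in> borel_measurable (F t)" unfolding R_def by measurable
  then show "R i s t \<in> borel_measurable M" using meas_F_M st by (meson order_trans)
qed

lemma R_comm:
  assumes st: "comm s t" "t \<le> s + 1" and U: "bwt s U"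
  shows "L2 (R i s t)" 
    "(\<And>w. 0 \<le> U w) \<Longrightarrow> (\<integral>w. U w * (R i s t w)\<^sup>2 \<partial>M) \<le> CR * (t - s)\<^sup>2 * (\<integral>w. U w \<partial>M)"
    "(\<And>u. s \<le> u \<Longrightarrow> u \<le> t \<Longrightarrow> \<bar>\<integral>w. U w * (a (X u w) $ i - a (X s w) $ i) \<partial>M\<bar> \<le> c) \<Longrightarrow> \<bar>\<integral>w. U w * R i s t w \<partial>M\<bar> \<le> c * (t - s)"
proof -
  note st' = comm_bounds[OF st(1)]
  have s0: "0 \<le> s" "s < t" "s \<le> t" using st' by auto
  obtain r where r: "\<And>n. 0 < r n" "AE w in M. (\<lambda>n. RS i s t (r n) w) \<longlonglongrightarrow> X t w $ i - X s w $ i"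
    using comm_AE[OF st(1), of i] by auto
  define \<alpha> where "\<alpha> N k w = a (X (grid s t N k) w) $ i - a (X s w) $ i" for N k w
  define \<beta> where "\<beta> N k w = b (X (grid s t N k) w) $ i - b (X s w) $ i" for N k w
  define T where "T N w = (\<Sum>k<N. \<alpha> N k w * (grid s t N (Suc k) - grid s t N k)
     + \<beta> N k w \<bullet> (W (grid s t N (Suc k)) w - W (grid s t N k) w))" for N w
  have T_RS: "T N w = RS i s t N w - a (X s w) $ i * (t - s) - b (X s w) $ i \<bullet> (W t w - W s w)" if N: "0 < N" for N w
  proof -
    note g = grid_props[OF s0(1,2) N]
    have "(\<Sum>k<N. W (grid s t N (Suc k)) w - W (grid s t N k) w) = W t w - W s w"
      using sum_lessThan_telescope[of "\<lambda>k. W (grid s t N k) w" N] g by simp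
    moreover have "(\<Sum>k<N. grid s t N (Suc k) - grid s t N k) = t - s"
      using sum_lessThan_telescope[of "\<lambda>k. grid s t N k" N] g by simp
    moreover have "T N w = RS i s t N w - (\<Sum>k<N. a (X s w) $ i * (grid s t N (Suc k) - grid s t N k))
       - (\<Sum>k<N. b (X s w) $ i \<bullet> (W (grid s t N (Suc k)) w - W (grid s t N k) w))"
      unfolding T_def RS_def \<alpha>_def \<beta>_def sum_subtractf[symmetric]
      by (intro sum.cong) (auto simp: algebra_simps inner_diff_left)
    ultimately show ?thesis by (simp add: sum_distrib_left[symmetric] inner_sum_right[symmetric])
  qed
  have lim: "AE w in M. (\<lambda>n. T (r n) w) \<longlonglongrightarrow> R i s t w"
    using r(2) unfolding T_RS[OF r(1)] R_def by eventually_elim (intro tendsto_intros)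
  have core: "L2 (T N) \<and> (\<integral>w. V w * T N w \<partial>M) = (\<Sum>k<N. (grid s t N (Suc k) - grid s t N k) * (\<integral>w. V w * \<alpha> N k w \<partial>M)) \<and>
     ((\<forall>w. 0 \<le> V w) \<longrightarrow> (\<integral>w. V w * (T N w)\<^sup>2 \<partial>M) \<le> CR * (t - s)\<^sup>2 * (\<integral>w. V w \<partial>M))" if V: "bwt s V" and N: "0 < N" for V N
  proof -
    note g = grid_props[OF s0(1,2) N]
    have g0: "0 \<le> grid s t N k" for k using g(5)[of k] s0 by simp
    have u: "0 \<le> grid s t N 0" "\<And>k. grid s t N k < grid s t N (Suc k)" using g s0 by auto
    have ma: "\<alpha> N k \<in> borel_measurable (F (grid s t N k))" for k
      unfolding \<alpha>_def using meas_aX[OF g0] nice_X_le[OF na s0(1) g(5)] by (intro borel_measurable_diff) auto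
    have mb: "\<beta> N k \<in> borel_measurable (F (grid s t N k))" for k
      unfolding \<beta>_def using meas_bX[OF g0] meas_F_mono[OF s0(1) g(5) meas_bX[OF s0(1)]] by (intro borel_measurable_diff) auto
    have la: "L2 (\<alpha> N k)" for k unfolding \<alpha>_def
      using bwt_L2[OF g0 nice_bwt[OF na g0]] bwt_L2[OF s0(1) nice_bwt[OF na s0(1)]] by (intro L2_diff)
    have lb: "L2 (\<lambda>w. \<beta> N k w $ j)" for k j unfolding \<beta>_def vector_minus_component
      using bwt_L2[OF g0 nice_bwt[OF nb g0]] bwt_L2[OF s0(1) nice_bwt[OF nb s0(1)]] by (intro L2_diff)
    have V': "bwt (grid s t N 0) V" using V g by simp
    note G = grid_sum[where u="grid s t N" and \<alpha>="\<alpha> N" and \<beta>="\<beta> N" and U=V and n=N, OF u ma la mb lb V', folded T_def]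
    have "(\<integral>w. V w * (T N w)\<^sup>2 \<partial>M) \<le> CR * (t - s)\<^sup>2 * (\<integral>w. V w \<partial>M)" if V0: "\<forall>w. 0 \<le> V w"
    proof -
      define EV where "EV = (\<integral>w. V w \<partial>M)"
      have EV: "0 \<le> EV" unfolding EV_def using V0 by (intro integral_nonneg_AE) auto
      have b: "(\<integral>w. V w * (f (X (grid s t N k) w) - f (X s w))\<^sup>2 \<partial>M) \<le> K\<^sup>2 * Cn 2 * (t - s) * EV"
        if "k < N" "nice K f" for k f
      proof -
        have gk: "s \<le> grid s t N k" "grid s t N k \<le> t" using g that by auto
        have "(\<integral>w. V w * (f (X (grid s t N k) w) - f (X s w))\<^sup>2 \<partial>M) \<le> K\<^sup>2 * Cn 2 * (grid s t N k - s) * EV"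
          unfolding EV_def using gk st(2) V0 by (intro nice_inc s0 V that) auto
        also have "\<dots> \<le> K\<^sup>2 * Cn 2 * (t - s) * EV"
          using gk Cn_pos[of 2] EV by (intro mult_right_mono mult_left_mono mult_nonneg_nonneg) auto
        finally show ?thesis .
      qed
      have "(\<integral>w. V w * (T N w)\<^sup>2 \<partial>M) \<le> (2 * (grid s t N N - grid s t N 0)\<^sup>2 * (K\<^sup>2 * Cn 2 * (t - s)) + 2 * (real CARD('m))\<^sup>2 * (grid s t N N - grid s t N 0) * (K\<^sup>2 * Cn 2 * (t - s))) * EV"
        unfolding EV_def
      proof (rule G(3))
        show "0 \<le> V w" for w using V0 by simp
        show "(\<integral>w. V w * (\<alpha> N k w)\<^sup>2 \<partial>M) \<le> K\<^sup>2 * Cn 2 * (t - s) * (\<integral>w. V w \<partial>M)" if "k < N" for k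
          using b[OF that na] unfolding \<alpha>_def EV_def .
        show "(\<integral>w. V w * (\<beta> N k w $ j)\<^sup>2 \<partial>M) \<le> K\<^sup>2 * Cn 2 * (t - s) * (\<integral>w. V w \<partial>M)" if "k < N" for k j
          using b[OF that nb] unfolding \<beta>_def EV_def vector_minus_component .
      qed
      also have "\<dots> \<le> CR * (t - s)\<^sup>2 * EV"
      proof (rule mult_right_mono[OF _ EV])
        have "(t - s)\<^sup>2 * (K\<^sup>2 * Cn 2 * (t - s)) \<le> (t - s)\<^sup>2 * (K\<^sup>2 * Cn 2 * 1)"
          using s0 st(2) Cn_pos[of 2] by (intro mult_left_mono) auto
        then show "2 * (grid s t N N - grid s t N 0)\<^sup>2 * (K\<^sup>2 * Cn 2 * (t - s)) + 2 * (real CARD('m))\<^sup>2 * (grid s t N N - grid s t N 0) * (K\<^sup>2 * Cn 2 * (t - s)) \<le> CR * (t - s)\<^sup>2"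
          unfolding g(1,2) CR_def by (simp add: algebra_simps power2_eq_square)
      qed
      finally show ?thesis unfolding EV_def .
    qed
    then show ?thesis using G(1,2) by auto
  qed
  note iU = bwt_imult[OF s0(1)]
  have mR: "R i s t \<in> borel_measurable M" by (rule meas_R[OF s0(1,3)])
  have b1: "bwt s (\<lambda>_. 1)" by (rule bwtI[of _ _ 1]) auto
  \<comment> \<open>With the weight put inside the sequence, \<open>L2_bounded_limit\<close> yields
    convergence of the weighted means; the square of a bounded weight is again one.\<close>
  have LL: "L2 (\<lambda>w. U w * R i s t w) \<and> (\<lambda>n. \<integral>w. U w * T (r n) w \<partial>M) \<longlonglongrightarrow> (\<integral>w. U w * R i s t w \<partial>M)" if U: "bwt s U" for U
  proof -
    have UU: "bwt s (\<lambda>w. U w * U w)" using bwt_mult[OF U U] .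
    have KU: "(\<integral>w. (U w * T (r n) w)\<^sup>2 \<partial>M) \<le> CR * (t - s)\<^sup>2 * (\<integral>w. U w * U w \<partial>M)" for n
      using core[OF UU r(1)[of n]] by (simp add: power_mult_distrib power2_eq_square mult_ac)
    have lU: "AE w in M. (\<lambda>n. U w * T (r n) w) \<longlonglongrightarrow> U w * R i s t w"
      using lim by eventually_elim (intro tendsto_intros)
    have mU: "(\<lambda>w. U w * R i s t w) \<in> borel_measurable M" using mR bwt_meas[OF s0(1) U] by measurable
    have LU: "L2 (\<lambda>w. U w * T (r n) w)" for n using bwt_L2mult[OF s0(1) U] core[OF U r(1)] by blast
    show ?thesis using L2_bounded_limit[of "\<lambda>n w. U w * T (r n) w" "\<lambda>w. U w * R i s t w", OF lU mU LU KU] by blast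
  qed
  show L2R: "L2 (R i s t)" using LL[OF b1] by simp
  show "(\<integral>w. U w * (R i s t w)\<^sup>2 \<partial>M) \<le> CR * (t - s)\<^sup>2 * (\<integral>w. U w \<partial>M)" if "\<And>w. 0 \<le> U w"
  proof (rule fatou_bound[of "\<lambda>n w. U w * (T (r n) w)\<^sup>2" _ "\<lambda>_. CR * (t - s)\<^sup>2 * (\<integral>w. U w \<partial>M)"])
    show "AE w in M. (\<lambda>n. U w * (T (r n) w)\<^sup>2) \<longlonglongrightarrow> U w * (R i s t w)\<^sup>2"
      using lim by eventually_elim (intro tendsto_intros)
    show "integrable M (\<lambda>w. U w * (T (r n) w)\<^sup>2)" for n using iU[OF U] L2_sq core[OF U r(1)] by blast
    show "(\<lambda>w. U w * (R i s t w)\<^sup>2) \<in> borel_measurable M" using mR bwt_meas[OF s0(1) U] by measurable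
  qed (use that core[OF U r(1)] in auto)
  assume c: "\<And>u. s \<le> u \<Longrightarrow> u \<le> t \<Longrightarrow> \<bar>\<integral>w. U w * (a (X u w) $ i - a (X s w) $ i) \<partial>M\<bar> \<le> c"
  have "\<bar>\<integral>w. U w * T (r n) w \<partial>M\<bar> \<le> c * (t - s)" for n
  proof -
    note g = grid_props[OF s0(1,2) r(1)[of n]]
    have "\<bar>\<integral>w. U w * T (r n) w \<partial>M\<bar> \<le> (\<Sum>k<r n. \<bar>(grid s t (r n) (Suc k) - grid s t (r n) k) * (\<integral>w. U w * \<alpha> (r n) k w \<partial>M)\<bar>)"
      using core[OF U r(1)[of n]] by (simp only: sum_abs)
    also have "\<dots> \<le> (\<Sum>k<r n. (grid s t (r n) (Suc k) - grid s t (r n) k) * c)"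
    proof (rule sum_mono)
      fix k assume "k \<in> {..<r n}"
      then have "\<bar>\<integral>w. U w * \<alpha> (r n) k w \<partial>M\<bar> \<le> c" unfolding \<alpha>_def using g by (intro c) auto
      moreover have "0 \<le> grid s t (r n) (Suc k) - grid s t (r n) k" using g(3)[of k] by simp
      ultimately show "\<bar>(grid s t (r n) (Suc k) - grid s t (r n) k) * (\<integral>w. U w * \<alpha> (r n) k w \<partial>M)\<bar> \<le> (grid s t (r n) (Suc k) - grid s t (r n) k) * c"
        unfolding abs_mult by (intro mult_mono) auto
    qed
    also have "\<dots> = c * (t - s)"
      unfolding sum_distrib_right[symmetric] sum_lessThan_telescope g(1,2) by simp
    finally show ?thesis .
  qed
  then show "\<bar>\<integral>w. U w * R i s t w \<partial>M\<bar> \<le> c * (t - s)"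
    using LL[OF U] by (intro LIMSEQ_le_const2[OF tendsto_rabs[of "\<lambda>n. \<integral>w. U w * T (r n) w \<partial>M"]]) auto
qed

text \<open>Starting times commensurable with \<open>t\<close> tend to \<open>s\<close> from above,
  and the paths are continuous. The condition on the drift ranges over all \<open>s'\<close> because
  \<open>R_comm\<close> is applied at the approximating starting times.\<close>

lemma R_general:
  assumes st: "0 \<le> s" "s < t" "t \<le> s + 1" and U: "bwt s U"
  shows "L2 (R i s t)" 
    "(\<And>w. 0 \<le> U w) \<Longrightarrow> (\<integral>w. U w * (R i s t w)\<^sup>2 \<partial>M) \<le> CR * (t - s)\<^sup>2 * (\<integral>w. U w \<partial>M)"
    "(\<And>s' u. s \<le> s' \<Longrightarrow> s' \<le> u \<Longrightarrow> u \<le> t \<Longrightarrow> \<bar>\<integral>w. U w * (a (X u w) $ i - a (X s' w) $ i) \<partial>M\<bar> \<le> c) \<Longrightarrow> \<bar>\<integral>w. U w * R i s t w \<partial>M\<bar> \<le> c * (t - s)"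
proof -
  obtain \<sigma> where \<sigma>: "\<And>n. comm (\<sigma> n) t" "\<And>n. s \<le> \<sigma> n" "\<sigma> \<longlonglongrightarrow> s" using comm_dense[OF st(1,2)] by auto
  have \<sigma>0: "0 \<le> \<sigma> n" "\<sigma> n < t" "t \<le> \<sigma> n + 1" for n using \<sigma>(2)[of n] st comm_bounds[OF \<sigma>(1)[of n]] by auto
  have s': "s \<le> t" using st by simp
  have ac: "continuous_on UNIV (\<lambda>x. a x $ i)" "continuous_on UNIV (\<lambda>x. b x $ i $ j)" for j using na nb unfolding nice_def by auto
  have lim: "AE w in M. (\<lambda>n. R i (\<sigma> n) t w) \<longlonglongrightarrow> R i s t w"
    using seq_cont[OF \<sigma>(3) st(1) \<sigma>0(1)]
  proof eventually_elim
    case (elim w)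
    have lA: "(\<lambda>n. a (X (\<sigma> n) w) $ i) \<longlonglongrightarrow> a (X s w) $ i"
      by (rule continuous_on_tendsto_compose[OF ac(1) elim(1)]) auto
    have lB: "(\<lambda>n. b (X (\<sigma> n) w) $ i) \<longlonglongrightarrow> b (X s w) $ i"
      by (rule vec_tendstoI) (rule continuous_on_tendsto_compose[OF ac(2) elim(1)], auto)
    show ?case unfolding R_def
      by (intro tendsto_diff tendsto_mult tendsto_inner tendsto_const tendsto_vec_nth[OF elim(1)] elim(2) \<sigma>(3) lA lB)
  qed
  have U': "bwt (\<sigma> n) U" for n by (rule bwt_mono[OF st(1) \<sigma>(2) U])
  note RC = R_comm[OF \<sigma>(1) \<sigma>0(3)]
  have b1: "bwt s (\<lambda>_. 1)" for s by (rule bwtI[of _ _ 1]) auto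
  have L2n: "L2 (R i (\<sigma> n) t)" for n by (rule RC(1)[OF b1])
  have mR: "R i s t \<in> borel_measurable M" by (rule meas_R[OF st(1) s'])
  have LL: "L2 (\<lambda>w. U w * R i s t w) \<and> (\<lambda>n. \<integral>w. U w * R i (\<sigma> n) t w \<partial>M) \<longlonglongrightarrow> (\<integral>w. U w * R i s t w \<partial>M)" if U: "bwt s U" for U
  proof -
    have UU: "bwt s (\<lambda>w. U w * U w)" using bwt_mult[OF U U] .
    have KU: "(\<integral>w. (U w * R i (\<sigma> n) t w)\<^sup>2 \<partial>M) \<le> CR * 1 * (\<integral>w. U w * U w \<partial>M)" for n
    proof -
      have "(\<integral>w. (U w * R i (\<sigma> n) t w)\<^sup>2 \<partial>M) \<le> CR * (t - \<sigma> n)\<^sup>2 * (\<integral>w. U w * U w \<partial>M)"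
        using RC(2)[OF bwt_mono[OF st(1) \<sigma>(2) UU]] by (simp add: power_mult_distrib power2_eq_square mult_ac)
      also have "\<dots> \<le> CR * 1 * (\<integral>w. U w * U w \<partial>M)"
        using \<sigma>0[of n] CR0 by (intro mult_right_mono mult_left_mono) (auto intro!: integral_nonneg_AE power_le_one)
      finally show ?thesis .
    qed
    have lU: "AE w in M. (\<lambda>n. U w * R i (\<sigma> n) t w) \<longlonglongrightarrow> U w * R i s t w"
      using lim by eventually_elim (intro tendsto_intros)
    have mU: "(\<lambda>w. U w * R i s t w) \<in> borel_measurable M" using mR bwt_meas[OF st(1) U] by measurable
    have LU: "L2 (\<lambda>w. U w * R i (\<sigma> n) t w)" for n using bwt_L2mult[OF st(1) U L2n] by blast
    show ?thesis using L2_bounded_limit[of "\<lambda>n w. U w * R i (\<sigma> n) t w" "\<lambda>w. U w * R i s t w", OF lU mU LU KU] by blast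
  qed
  show "L2 (R i s t)" using LL[OF b1] by simp
  have ct: "(\<lambda>n. CR * (t - \<sigma> n)\<^sup>2 * c) \<longlonglongrightarrow> CR * (t - s)\<^sup>2 * c" for c by (intro tendsto_intros \<sigma>)
  show "(\<integral>w. U w * (R i s t w)\<^sup>2 \<partial>M) \<le> CR * (t - s)\<^sup>2 * (\<integral>w. U w \<partial>M)" if "\<And>w. 0 \<le> U w"
  proof (rule fatou_bound[of "\<lambda>n w. U w * (R i (\<sigma> n) t w)\<^sup>2" _ "\<lambda>n. CR * (t - \<sigma> n)\<^sup>2 * (\<integral>w. U w \<partial>M)", OF _ _ _ _ _ ct])
    show "AE w in M. (\<lambda>n. U w * (R i (\<sigma> n) t w)\<^sup>2) \<longlonglongrightarrow> U w * (R i s t w)\<^sup>2"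
      using lim by eventually_elim (intro tendsto_intros)
    show "integrable M (\<lambda>w. U w * (R i (\<sigma> n) t w)\<^sup>2)" for n using bwt_imult[OF st(1) U] L2_sq[OF L2n] by blast
    show "(\<lambda>w. U w * (R i s t w)\<^sup>2) \<in> borel_measurable M" using mR bwt_meas[OF st(1) U] by measurable
  qed (use that RC(2)[OF U'] in auto)
  assume c: "\<And>s' u. s \<le> s' \<Longrightarrow> s' \<le> u \<Longrightarrow> u \<le> t \<Longrightarrow> \<bar>\<integral>w. U w * (a (X u w) $ i - a (X s' w) $ i) \<partial>M\<bar> \<le> c"
  have "\<bar>\<integral>w. U w * R i (\<sigma> n) t w \<partial>M\<bar> \<le> c * (t - \<sigma> n)" for n
    by (rule RC(3)[OF U']) (rule c[OF \<sigma>(2)])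
  then show "\<bar>\<integral>w. U w * R i s t w \<partial>M\<bar> \<le> c * (t - s)"
    using LIMSEQ_le[OF tendsto_rabs[OF LL[OF U, THEN conjunct2]], of "\<lambda>n. c * (t - \<sigma> n)" "c * (t - s)"]
      tendsto_mult[OF tendsto_const tendsto_diff[OF tendsto_const \<sigma>(3)]] by blast
qed

lemma dX_eq: "X t w $ i - X s w $ i = a (X s w) $ i * (t - s) + b (X s w) $ i \<bullet> (W t w - W s w) + R i s t w"
  unfolding R_def by simp

lemma EUbW:
  assumes st: "0 \<le> s" "s < t" and U: "bwt s U" and f: "\<And>j. bwt s (\<lambda>w. v w $ j)"
  shows "integrable M (\<lambda>w. U w * (v w \<bullet> (W t w - W s w)))" "(\<integral>w. U w * (v w \<bullet> (W t w - W s w)) \<partial>M) = 0"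
proof -
  have b: "bwt s (\<lambda>w. U w * v w $ j)" for j by (rule bwt_mult[OF U f])
  have e: "U w * (v w \<bullet> (W t w - W s w)) = (\<Sum>j\<in>UNIV. (U w * v w $ j) * (W t w $ j - W s w $ j))" for w
    by (simp add: inner_vec_def sum_distrib_left mult_ac)
  note D = dW_cond1[OF st bwt_F[OF b] bwt_integrable[OF st(1) b]]
  show "integrable M (\<lambda>w. U w * (v w \<bullet> (W t w - W s w)))" "(\<integral>w. U w * (v w \<bullet> (W t w - W s w)) \<partial>M) = 0"
    unfolding e using D by (auto simp: Bochner_Integration.integral_sum)
qed

lemma X_mean:
  assumes st: "0 \<le> s" "s < t" "t \<le> s + 1" and U: "bwt s U"
  shows "\<bar>\<integral>w. U w * (X t w $ i - X s w $ i) \<partial>M\<bar> \<le> 3 * K * (t - s) * (\<integral>w. \<bar>U w\<bar> \<partial>M)"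
proof -
  define EU where "EU = (\<integral>w. \<bar>U w\<bar> \<partial>M)"
  have iU: "integrable M U" "integrable M (\<lambda>w. \<bar>U w\<bar>)" using bwt_integrable[OF st(1) U] by auto
  have bd: "\<bar>\<integral>w. U w * g w \<partial>M\<bar> \<le> c * EU" if "\<And>w. \<bar>g w\<bar> \<le> c" "g \<in> borel_measurable M" for g c
  proof -
    have "\<bar>\<integral>w. U w * g w \<partial>M\<bar> \<le> (\<integral>w. \<bar>U w * g w\<bar> \<partial>M)" by (rule integral_abs_bound)
    also have "\<dots> \<le> (\<integral>w. c * \<bar>U w\<bar> \<partial>M)"
    proof (rule integral_mono)
      show "integrable M (\<lambda>w. \<bar>U w * g w\<bar>)" using integrable_bdd_mult[OF iU(1) that(2,1)] by (auto simp: mult.commute)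
      show "\<bar>U w * g w\<bar> \<le> c * \<bar>U w\<bar>" for w 
        using mult_left_mono[OF that(1)[of w], of "\<bar>U w\<bar>"] by (simp add: abs_mult mult.commute)
    qed (use iU in auto)
    finally show ?thesis unfolding EU_def by simp
  qed
  have aX: "\<bar>a (X u w) $ i\<bar> \<le> K" for u w using na unfolding nice_def by blast
  have aM: "(\<lambda>w. a (X u w) $ i) \<in> borel_measurable M" if "0 \<le> u" for u using meas_F_M[OF that meas_aX[OF that]] .
  have "\<bar>\<integral>w. U w * (a (X u w) $ i - a (X s' w) $ i) \<partial>M\<bar> \<le> (2 * K) * EU" if "s \<le> s'" "s' \<le> u" "u \<le> t" for s' u
  proof (rule bd)
    show "\<bar>a (X u w) $ i - a (X s' w) $ i\<bar> \<le> 2 * K" for w using aX[of u w] aX[of s' w] by linarith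
  qed (use aM that st in \<open>auto intro!: borel_measurable_diff\<close>)
  then have 1: "\<bar>\<integral>w. U w * R i s t w \<partial>M\<bar> \<le> (2 * K) * EU * (t - s)" by (rule R_general(3)[OF st U])
  have 2: "\<bar>\<integral>w. U w * (a (X s w) $ i * (t - s)) \<partial>M\<bar> \<le> (K * (t - s)) * EU"
    by (rule bd) (use aM[OF st(1)] aX[of s] st in \<open>auto simp: abs_mult intro!: mult_right_mono\<close>)
  note 3 = EUbW[OF st(1,2) U nice_bwt[OF nb[of i] st(1)]]
  have i1: "integrable M (\<lambda>w. U w * (a (X s w) $ i * (t - s)))"
    using bwt_imult[OF st(1) U bwt_integrable[OF st(1) nice_bwt[OF na st(1)]], of i] by (simp add: mult.assoc[symmetric])
  have i2: "integrable M (\<lambda>w. U w * R i s t w)" by (rule bwt_imult[OF st(1) U L2_integrable[OF R_general(1)[OF st U]]])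
  have "(\<integral>w. U w * (X t w $ i - X s w $ i) \<partial>M) = (\<integral>w. U w * (a (X s w) $ i * (t - s)) \<partial>M) + 0 + (\<integral>w. U w * R i s t w \<partial>M)"
    unfolding dX_eq[of t _ i s] distrib_left using i1 i2 3 by simp
  then have "\<bar>\<integral>w. U w * (X t w $ i - X s w $ i) \<partial>M\<bar> \<le> (K * (t - s)) * EU + (2 * K) * EU * (t - s)" using 1 2 by linarith
  then show ?thesis unfolding EU_def by (simp add: algebra_simps)
qed

definition CM :: real where "CM = 3 * K\<^sup>2 * real CARD('d) + K * Cn 2"

lemma CM0: "0 \<le> CM" unfolding CM_def using K1 Cn_pos[of 2] by (intro add_nonneg_nonneg mult_nonneg_nonneg) auto

text \<open>A substitute for Ito's formula in the mean. The linear Taylor term is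
  \<open>X_mean\<close> with the weight multiplied by a partial derivative at \<open>X s\<close>,
  the quadratic remainder is a second moment; both have order \<open>t - s\<close>, although the
  increment itself has the size \<open>sqrt (t - s)\<close>.\<close>

lemma nice_mean:
  assumes st: "0 \<le> s" "s < t" "t \<le> s + 1" and U: "bwt s U" and f: "nice K f"
  shows "\<bar>\<integral>w. U w * (f (X t w) - f (X s w)) \<partial>M\<bar> \<le> CM * (t - s) * (\<integral>w. \<bar>U w\<bar> \<partial>M)"
proof -
  define EU where "EU = (\<integral>w. \<bar>U w\<bar> \<partial>M)"
  have st': "s \<le> t" "0 \<le> t" using st by auto
  have aU: "\<bar>U w\<bar> \<ge> 0" for w by simp
  define Q where "Q w = f (X t w) - f (X s w) - (\<Sum>l\<in>UNIV. pd l f (X s w) * (X t w $ l - X s w $ l))" for w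
  have bl: "bwt s (\<lambda>w. U w * pd l f (X s w))" for l by (rule bwt_mult[OF U nice_pd_bwt[OF f st(1)]])
  note X2 = X_L2_inci[OF st(1) st'(1) st(3)]
  have il: "integrable M (\<lambda>w. (U w * pd l f (X s w)) * (X t w $ l - X s w $ l))" for l
    by (rule bwt_imult[OF st(1) bl L2_integrable[OF X2]])
  have iff: "integrable M (\<lambda>w. U w * (f (X t w) - f (X s w)))"
    using bwt_integrable[OF _ nice_bwt[OF f]] st st' by (intro bwt_imult[OF st(1) U]) auto
  have e: "U w * (f (X t w) - f (X s w)) = U w * Q w + (\<Sum>l\<in>UNIV. (U w * pd l f (X s w)) * (X t w $ l - X s w $ l))" for w
    unfolding Q_def by (simp add: algebra_simps sum_distrib_left)
  have iS: "integrable M (\<lambda>w. \<Sum>l\<in>UNIV. (U w * pd l f (X s w)) * (X t w $ l - X s w $ l))" using il by auto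
  have iQ: "integrable M (\<lambda>w. U w * Q w)"
  proof -
    have "integrable M (\<lambda>w. U w * (f (X t w) - f (X s w)) - (\<Sum>l\<in>UNIV. (U w * pd l f (X s w)) * (X t w $ l - X s w $ l)))"
      using iff iS by auto
    then show ?thesis unfolding e by simp
  qed
  note X_mom2' = X_mom2[OF st(1) st'(1) st(3) bwt_F[OF bwt_abs[OF U]] aU bwt_integrable[OF st(1) bwt_abs[OF U]]]
  have Q: "\<bar>\<integral>w. U w * Q w \<partial>M\<bar> \<le> K * Cn 2 * (t - s) * EU"
  proof -
    have "\<bar>\<integral>w. U w * Q w \<partial>M\<bar> \<le> (\<integral>w. \<bar>U w * Q w\<bar> \<partial>M)" by (rule integral_abs_bound)
    also have "\<dots> \<le> (\<integral>w. K * (\<bar>U w\<bar> * (norm (X t w - X s w))\<^sup>2) \<partial>M)"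
    proof (rule integral_mono)
      have "\<bar>Q w\<bar> \<le> K * (norm (X t w - X s w))\<^sup>2" for w using f unfolding nice_def Q_def by blast
      then show "\<bar>U w * Q w\<bar> \<le> K * (\<bar>U w\<bar> * (norm (X t w - X s w))\<^sup>2)" for w
        unfolding abs_mult using mult_left_mono[of "\<bar>Q w\<bar>" "K * (norm (X t w - X s w))\<^sup>2" "\<bar>U w\<bar>"] by (simp add: mult_ac)
    qed (use iQ X_mom2' in auto)
    also have "\<dots> \<le> K * (Cn 2 * (t - s) * EU)" using X_mom2' K1 unfolding EU_def by simp
    finally show ?thesis by (simp add: mult_ac)
  qed
  have l: "\<bar>\<integral>w. (U w * pd l f (X s w)) * (X t w $ l - X s w $ l) \<partial>M\<bar> \<le> 3 * K\<^sup>2 * (t - s) * EU" for l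
  proof -
    have "\<bar>\<integral>w. (U w * pd l f (X s w)) * (X t w $ l - X s w $ l) \<partial>M\<bar> \<le> 3 * K * (t - s) * (\<integral>w. \<bar>U w * pd l f (X s w)\<bar> \<partial>M)"
      by (rule X_mean[OF st bl])
    also have "\<dots> \<le> 3 * K * (t - s) * (K * EU)"
    proof (rule mult_left_mono)
      have "(\<integral>w. \<bar>U w * pd l f (X s w)\<bar> \<partial>M) \<le> (\<integral>w. K * \<bar>U w\<bar> \<partial>M)"
      proof (rule integral_mono)
        have p: "\<bar>pd l f (X s w)\<bar> \<le> K" for w using f unfolding nice_def by blast
        show "\<bar>U w * pd l f (X s w)\<bar> \<le> K * \<bar>U w\<bar>" for w
          using mult_left_mono[OF p[of w], of "\<bar>U w\<bar>"] by (simp add: abs_mult mult.commute)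
      qed (use bwt_integrable[OF st(1) bl] bwt_integrable[OF st(1) U] in auto)
      then show "(\<integral>w. \<bar>U w * pd l f (X s w)\<bar> \<partial>M) \<le> K * EU" unfolding EU_def by simp
    qed (use K1 st in auto)
    finally show ?thesis by (simp add: power2_eq_square mult_ac)
  qed
  have "\<bar>\<integral>w. U w * (f (X t w) - f (X s w)) \<partial>M\<bar> 
     = \<bar>(\<integral>w. U w * Q w \<partial>M) + (\<Sum>l\<in>UNIV. \<integral>w. (U w * pd l f (X s w)) * (X t w $ l - X s w $ l) \<partial>M)\<bar>"
    unfolding e using iQ il by (simp add: Bochner_Integration.integral_sum)
  also have "\<dots> \<le> K * Cn 2 * (t - s) * EU + (\<Sum>l\<in>(UNIV::'d set). 3 * K\<^sup>2 * (t - s) * EU)"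
  proof -
    have "\<bar>\<Sum>l\<in>UNIV. \<integral>w. (U w * pd l f (X s w)) * (X t w $ l - X s w $ l) \<partial>M\<bar> \<le> (\<Sum>l\<in>(UNIV::'d set). 3 * K\<^sup>2 * (t - s) * EU)"
      by (rule order_trans[OF sum_abs sum_mono[OF l]])
    then show ?thesis using Q by linarith
  qed
  also have "\<dots> = CM * (t - s) * EU" unfolding CM_def by (simp add: algebra_simps)
  finally show ?thesis unfolding EU_def .
qed

text \<open>The noise part of the remainder has mean zero, and \<open>nice_mean\<close> makes the
  mean of the drift increments of order \<open>t - s\<close>; integration over time adds the second
  power.\<close>

lemma R_mean:
  assumes st: "0 \<le> s" "s < t" "t \<le> s + 1" and U: "bwt s U"
  shows "\<bar>\<integral>w. U w * R i s t w \<partial>M\<bar> \<le> CM * (t - s)\<^sup>2 * (\<integral>w. \<bar>U w\<bar> \<partial>M)"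
proof -
  have e0: "0 \<le> (\<integral>w. \<bar>U w\<bar> \<partial>M)" by (intro integral_nonneg_AE) auto
  have "\<bar>\<integral>w. U w * (a (X u w) $ i - a (X s' w) $ i) \<partial>M\<bar> \<le> CM * (t - s) * (\<integral>w. \<bar>U w\<bar> \<partial>M)" if "s \<le> s'" "s' \<le> u" "u \<le> t" for s' u
  proof (cases "s' = u")
    case False
    have "\<bar>\<integral>w. U w * (a (X u w) $ i - a (X s' w) $ i) \<partial>M\<bar> \<le> CM * (u - s') * (\<integral>w. \<bar>U w\<bar> \<partial>M)"
      using that st False by (intro nice_mean[OF _ _ _ _ na] bwt_mono[OF _ _ U]) auto
    also have "\<dots> \<le> CM * (t - s) * (\<integral>w. \<bar>U w\<bar> \<partial>M)"
      using that CM0 e0 by (intro mult_right_mono mult_left_mono) auto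
    finally show ?thesis .
  qed (use CM0 e0 st in auto)
  from R_general(3)[OF st U this] show ?thesis by (simp add: power2_eq_square mult_ac)
qed

end

subsection \<open>Local error of the Milstein scheme\<close>

locale sde_mil = sde M F W a b x0 X K Cb
  for M :: "'w measure" and F and W :: "real \<Rightarrow> 'w \<Rightarrow> real^'m::finite"
    and a :: "real^'d::finite \<Rightarrow> real^'d" and b :: "real^'d \<Rightarrow> real^'m^'d" and x0 X K Cb +
  fixes J :: "real \<Rightarrow> real \<Rightarrow> 'm \<Rightarrow> 'm \<Rightarrow> 'w \<Rightarrow> real"
  assumes ito: "iterated_ito M F W J"
    and nb2: "\<And>i j l x y. \<bar>pd l (\<lambda>x. b x $ i $ j) y - pd l (\<lambda>x. b x $ i $ j) x\<bar> \<le> K * norm (y - x)"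
begin

lemma meas_J: "0 \<le> s \<Longrightarrow> s \<le> t \<Longrightarrow> J s t j1 j2 \<in> borel_measurable (F t)"
  using ito unfolding iterated_ito_def by auto

lemma meas_J_M: "0 \<le> s \<Longrightarrow> s \<le> t \<Longrightarrow> J s t j1 j2 \<in> borel_measurable M"
  using meas_J meas_F_M by (meson order_trans)

definition Jn :: "real \<Rightarrow> real \<Rightarrow> nat \<Rightarrow> 'm \<Rightarrow> 'm \<Rightarrow> 'w \<Rightarrow> real" where
  "Jn s t N j1 j2 w = (\<Sum>k<N. (W (grid s t N k) w $ j1 - W s w $ j1) * (W (grid s t N (Suc k)) w $ j2 - W (grid s t N k) w $ j2))"

lemma Jn_props:
  assumes st: "0 \<le> s" "s < t" and N: "0 < N" and U: "bwt s U"
  shows "L2 (Jn s t N j1 j2)" "(\<integral>w. U w * Jn s t N j1 j2 w \<partial>M) = 0"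
    "(\<And>w. 0 \<le> U w) \<Longrightarrow> (\<integral>w. U w * (Jn s t N j1 j2 w)\<^sup>2 \<partial>M) \<le> (t - s)\<^sup>2 * (\<integral>w. U w \<partial>M)"
proof -
  note g = grid_props[OF st N]
  have g0: "0 \<le> grid s t N k" for k using g(5)[of k] st by simp
  define H where "H k w = W (grid s t N k) w $ j1 - W s w $ j1" for k w
  have mH: "H k \<in> borel_measurable (F (grid s t N k))" for k
    unfolding H_def using meas_W[OF g0] meas_W_le[OF st(1) g(5)] by (intro borel_measurable_diff measurable_vec_nth) auto
  have EH: "integrable M (\<lambda>w. V w * (H k w)\<^sup>2) \<and> (\<integral>w. V w * (H k w)\<^sup>2 \<partial>M) = (grid s t N k - s) * (\<integral>w. V w \<partial>M)" if V: "bwt s V" for V k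
  proof (cases "k = 0")
    case True
    then show ?thesis using g by (simp add: H_def)
  next
    case False
    then have "s < grid s t N k" unfolding grid_def using st N by simp
    from dW_cond2[OF st(1) this bwt_F[OF V] bwt_integrable[OF st(1) V], of j1 j1]
    show ?thesis unfolding H_def by (simp add: power2_eq_square)
  qed
  have b1: "bwt s (\<lambda>_. 1)" by (rule bwtI[of _ _ 1]) auto
  have LH: "L2 (H k)" for k using EH[OF b1, of k] meas_F_M[OF g0 mH] unfolding L2_def by simp
  have U': "bwt (grid s t N 0) U" using U g by simp
  have MS: "L2 (Jn s t N j1 j2) \<and> (\<integral>w. U w * Jn s t N j1 j2 w \<partial>M) = 0 \<and>
    (\<integral>w. U w * (Jn s t N j1 j2 w)\<^sup>2 \<partial>M) = (\<Sum>k<N. (grid s t N (Suc k) - grid s t N k) * (\<integral>w. U w * (H k w)\<^sup>2 \<partial>M))"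
    using mart_sum[where u="grid s t N" and n=N and j=j2 and U=U and H=H, OF _ g(3) mH LH U'] g0
    unfolding Jn_def H_def by blast
  then show "L2 (Jn s t N j1 j2)" "(\<integral>w. U w * Jn s t N j1 j2 w \<partial>M) = 0" by auto
  assume U0: "\<And>w. 0 \<le> U w"
  have EU: "0 \<le> (\<integral>w. U w \<partial>M)" using U0 by (intro integral_nonneg_AE) auto
  have "(\<integral>w. U w * (Jn s t N j1 j2 w)\<^sup>2 \<partial>M) \<le> (\<Sum>k<N. (grid s t N (Suc k) - grid s t N k) * ((t - s) * (\<integral>w. U w \<partial>M)))"
  proof -
    have "(grid s t N (Suc k) - grid s t N k) * (\<integral>w. U w * (H k w)\<^sup>2 \<partial>M) \<le> (grid s t N (Suc k) - grid s t N k) * ((t - s) * (\<integral>w. U w \<partial>M))" if "k < N" for k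
      using EH[OF U, of k] g(6)[of k] that EU less_imp_le[OF g(3)[of k]] by (intro mult_left_mono) (auto intro!: mult_right_mono)
    then show ?thesis using MS by (auto intro: sum_mono)
  qed
  also have "\<dots> = (t - s)\<^sup>2 * (\<integral>w. U w \<partial>M)"
    unfolding sum_distrib_right[symmetric] sum_lessThan_telescope g(1,2) by (simp add: power2_eq_square mult_ac)
  finally show "(\<integral>w. U w * (Jn s t N j1 j2 w)\<^sup>2 \<partial>M) \<le> (t - s)\<^sup>2 * (\<integral>w. U w \<partial>M)" .
qed

lemma J_AE:
  assumes st: "0 \<le> s" "s < t"
  shows "\<exists>r. (\<forall>n. 0 < r n) \<and> filterlim r at_top sequentially \<and> (\<forall>j1 j2. AE w in M. (\<lambda>n. Jn s t (r n) j1 j2 w) \<longlonglongrightarrow> J s t j1 j2 w)"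
proof -
  have mJn: "Jn s t N j1 j2 \<in> borel_measurable M" for N j1 j2
  proof (cases "N = 0")
    case False
    have b1: "bwt s (\<lambda>_. 1)" by (rule bwtI[of _ _ 1]) auto
    show ?thesis using Jn_props(1)[OF st _ b1, of N] False L2_meas by auto
  next
    case True
    moreover have "Jn s t 0 j1 j2 = (\<lambda>_. 0)" by (auto simp: Jn_def)
    ultimately show ?thesis by simp
  qed
  have "\<exists>r::nat\<Rightarrow>nat. strict_mono r \<and> (\<forall>p\<in>UNIV. AE w in M. (\<lambda>n. Jn s t (r n) (fst p) (snd p) w) \<longlonglongrightarrow> J s t (fst p) (snd p) w)"
  proof (rule conv_prob_AE_subseq[of UNIV "\<lambda>p N. Jn s t N (fst p) (snd p)" "\<lambda>p. J s t (fst p) (snd p)"])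
    show "conv_prob M (\<lambda>N. Jn s t N (fst p) (snd p)) (J s t (fst p) (snd p))" for p :: "'m \<times> 'm"
      using ito st unfolding iterated_ito_def Jn_def grid_def by (auto simp: less_imp_le)
  qed (use mJn meas_J_M st in \<open>auto simp: less_imp_le\<close>)
  then obtain r :: "nat \<Rightarrow> nat" where r: "strict_mono r" "\<And>j1 j2. AE w in M. (\<lambda>n. Jn s t (r n) j1 j2 w) \<longlonglongrightarrow> J s t j1 j2 w"
    by auto
  have "0 < r (Suc n)" for n using r(1) by (metis gr0I less_nat_zero_code strict_monoD zero_less_Suc)
  moreover have "filterlim (\<lambda>n. r (Suc n)) at_top sequentially"
    using filterlim_subseq[OF r(1)] filterlim_Suc filterlim_compose by blast
  moreover have "AE w in M. (\<lambda>n. Jn s t (r (Suc n)) j1 j2 w) \<longlonglongrightarrow> J s t j1 j2 w" for j1 j2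
    using r(2)[of j1 j2] by eventually_elim (rule LIMSEQ_Suc)
  ultimately show ?thesis by (intro exI[of _ "\<lambda>n. r (Suc n)"]) auto
qed

lemma J_props:
  assumes st: "0 \<le> s" "s < t" and U: "bwt s U"
  shows "L2 (J s t j1 j2)" "(\<integral>w. U w * J s t j1 j2 w \<partial>M) = 0"
    "(\<And>w. 0 \<le> U w) \<Longrightarrow> (\<integral>w. U w * (J s t j1 j2 w)\<^sup>2 \<partial>M) \<le> (t - s)\<^sup>2 * (\<integral>w. U w \<partial>M)"
proof -
  obtain r where r: "\<And>n. 0 < r n" "AE w in M. (\<lambda>n. Jn s t (r n) j1 j2 w) \<longlonglongrightarrow> J s t j1 j2 w"
    using J_AE[OF st] by auto
  have b1: "bwt s (\<lambda>_. 1)" by (rule bwtI[of _ _ 1]) auto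
  have mJ: "J s t j1 j2 \<in> borel_measurable M" using meas_J_M st by auto
  have LL: "L2 (\<lambda>w. U w * J s t j1 j2 w) \<and> (\<lambda>n. \<integral>w. U w * Jn s t (r n) j1 j2 w \<partial>M) \<longlonglongrightarrow> (\<integral>w. U w * J s t j1 j2 w \<partial>M)" if U: "bwt s U" for U
  proof -
    have UU: "bwt s (\<lambda>w. U w * U w)" using bwt_mult[OF U U] .
    have KU: "(\<integral>w. (U w * Jn s t (r n) j1 j2 w)\<^sup>2 \<partial>M) \<le> (t - s)\<^sup>2 * (\<integral>w. U w * U w \<partial>M)" for n
      using Jn_props(3)[OF st r(1)[of n] UU] by (simp add: power_mult_distrib power2_eq_square mult_ac)
    have lU: "AE w in M. (\<lambda>n. U w * Jn s t (r n) j1 j2 w) \<longlonglongrightarrow> U w * J s t j1 j2 w"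
      using r(2) by eventually_elim (intro tendsto_intros)
    have mU: "(\<lambda>w. U w * J s t j1 j2 w) \<in> borel_measurable M" using mJ bwt_meas[OF st(1) U] by measurable
    have LU: "L2 (\<lambda>w. U w * Jn s t (r n) j1 j2 w)" for n using bwt_L2mult[OF st(1) U Jn_props(1)[OF st r(1) U]] .
    show ?thesis using L2_bounded_limit[of "\<lambda>n w. U w * Jn s t (r n) j1 j2 w" "\<lambda>w. U w * J s t j1 j2 w", OF lU mU LU KU] by blast
  qed
  show "L2 (J s t j1 j2)" using LL[OF b1] by simp
  show "(\<integral>w. U w * J s t j1 j2 w \<partial>M) = 0"
    using LL[OF U] Jn_props(2)[OF st r(1) U] LIMSEQ_unique[OF tendsto_const] by force
  show "(\<integral>w. U w * (J s t j1 j2 w)\<^sup>2 \<partial>M) \<le> (t - s)\<^sup>2 * (\<integral>w. U w \<partial>M)" if "\<And>w. 0 \<le> U w"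
  proof (rule fatou_bound[of "\<lambda>n w. U w * (Jn s t (r n) j1 j2 w)\<^sup>2" _ "\<lambda>_. (t - s)\<^sup>2 * (\<integral>w. U w \<partial>M)"])
    show "AE w in M. (\<lambda>n. U w * (Jn s t (r n) j1 j2 w)\<^sup>2) \<longlonglongrightarrow> U w * (J s t j1 j2 w)\<^sup>2"
      using r(2) by eventually_elim (intro tendsto_intros)
    show "integrable M (\<lambda>w. U w * (Jn s t (r n) j1 j2 w)\<^sup>2)" for n using bwt_imult[OF st(1) U L2_sq[OF Jn_props(1)[OF st r(1) U]]] .
    show "(\<lambda>w. U w * (J s t j1 j2 w)\<^sup>2) \<in> borel_measurable M" using mJ bwt_meas[OF st(1) U] by measurable
  qed (use that Jn_props(3)[OF st r(1) U] in auto)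
qed

text \<open>Each of the \<open>CARD('d)\<close> summands of \<open>Lop\<close> is a product of two
  functions that are bounded and Lipschitz with constant \<open>K\<close>. The factor 2 is the
  product rule, and the same constant also dominates the supremum.\<close>

definition KL :: real where "KL = 2 * real CARD('d) * K\<^sup>2"

lemma Lop_bound: "\<bar>Lop b j1 i j2 x\<bar> \<le> KL"
proof -
  have "\<bar>b x $ l $ j1 * pd l (\<lambda>y. b y $ i $ j2) x\<bar> \<le> K * K" for l
    unfolding abs_mult using nb K1 unfolding nice_def by (intro mult_mono) auto
  then have "(\<Sum>l\<in>UNIV. \<bar>b x $ l $ j1 * pd l (\<lambda>y. b y $ i $ j2) x\<bar>) \<le> (\<Sum>l\<in>(UNIV::'d set). K * K)" by (intro sum_mono)
  then have "\<bar>Lop b j1 i j2 x\<bar> \<le> real CARD('d) * (K * K)" unfolding Lop_def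
    by (intro order_trans[OF sum_abs]) simp
  also have "\<dots> \<le> KL" unfolding KL_def by (simp add: power2_eq_square)
  finally show ?thesis .
qed

lemma Lop_lip: "\<bar>Lop b j1 i j2 y - Lop b j1 i j2 x\<bar> \<le> KL * norm (y - x)"
proof -
  define f where "f = (\<lambda>y. b y $ i $ j2)"
  have "\<bar>b y $ l $ j1 * pd l f y - b x $ l $ j1 * pd l f x\<bar> \<le> 2 * K\<^sup>2 * norm (y - x)" for l
  proof -
    have "b y $ l $ j1 * pd l f y - b x $ l $ j1 * pd l f x = (b y $ l $ j1 - b x $ l $ j1) * pd l f y + b x $ l $ j1 * (pd l f y - pd l f x)"
      by (simp add: algebra_simps)
    also have "\<bar>\<dots>\<bar> \<le> \<bar>b y $ l $ j1 - b x $ l $ j1\<bar> * \<bar>pd l f y\<bar> + \<bar>b x $ l $ j1\<bar> * \<bar>pd l f y - pd l f x\<bar>"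
      unfolding abs_mult[symmetric] by (rule abs_triangle_ineq)
    also have "\<dots> \<le> (K * norm (y - x)) * K + K * (K * norm (y - x))"
      using nb nb2 K1 unfolding nice_def f_def by (intro add_mono mult_mono) auto
    finally show ?thesis by (simp add: power2_eq_square algebra_simps)
  qed
  then have "(\<Sum>l\<in>UNIV. \<bar>b y $ l $ j1 * pd l f y - b x $ l $ j1 * pd l f x\<bar>) \<le> (\<Sum>l\<in>(UNIV::'d set). 2 * K\<^sup>2 * norm (y - x))"
    by (intro sum_mono)
  then have "\<bar>\<Sum>l\<in>UNIV. b y $ l $ j1 * pd l f y - b x $ l $ j1 * pd l f x\<bar> \<le> (\<Sum>l\<in>(UNIV::'d set). 2 * K\<^sup>2 * norm (y - x))"
    by (rule order_trans[OF sum_abs])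
  then show ?thesis unfolding Lop_def f_def KL_def by (simp add: sum_subtractf mult_ac)
qed

lemma Lop_meas: "Lop b j1 i j2 \<in> borel_measurable borel"
  unfolding Lop_def using nice_meas[OF nb] nice_pd_meas[OF nb] by measurable

lemma Lop_bwt: "0 \<le> s \<Longrightarrow> Y \<in> borel_measurable (F s) \<Longrightarrow> bwt s (\<lambda>w. Lop b j1 i j2 (Y w))"
  by (rule bwtI[of _ _ KL]) (auto intro: measurable_compose[OF _ Lop_meas] Lop_bound)

definition Rem :: "'d \<Rightarrow> real \<Rightarrow> real \<Rightarrow> 'w \<Rightarrow> real" where
  "Rem i s t w = R i s t w - (\<Sum>j1\<in>UNIV. \<Sum>j2\<in>UNIV. Lop b j1 i j2 (X s w) * J s t j1 j2 w)"

text \<open>The three summands belong to the Taylor remainder of \<open>b\<close>, to the drift and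
  to \<open>R\<close> in \<open>beta_bound\<close>; the outer factor is that of
  \<open>sq_sum3\<close>.\<close>

definition CB :: real where
  "CB = 3 * (K\<^sup>2 * Cn 4 + (real CARD('d))\<^sup>2 * K ^ 4 + (real CARD('d))\<^sup>2 * K\<^sup>2 * CR)"

definition CT :: real where
  "CT = 2 * (K\<^sup>2 * Cn 2) + 2 * (real CARD('m))\<^sup>2 * CB"

lemma CB0: "0 \<le> CB" unfolding CB_def using CR0 Cn_pos[of 4] by (intro mult_nonneg_nonneg add_nonneg_nonneg) auto
lemma CT0: "0 \<le> CT" unfolding CT_def using CB0 Cn_pos[of 2] by (intro mult_nonneg_nonneg add_nonneg_nonneg) auto

lemma sq_sum3: "((x::real) + y + z)\<^sup>2 \<le> 3 * (x\<^sup>2 + y\<^sup>2 + z\<^sup>2)"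
  using zero_le_power2[of "x - y"] zero_le_power2[of "x - z"] zero_le_power2[of "z - y"]
  by (simp add: power2_eq_square algebra_simps)

text \<open>\<open>\<beta>\<close> is the error of the frozen integrand \<open>b (X s)\<close> after the Milstein correction; its square is of order
  \<open>(u - s)\<^sup>2\<close>, one order better than without it.\<close>

lemma beta_bound:
  fixes i :: 'd and j :: 'm
  assumes su: "0 \<le> s" "s \<le> u" "u \<le> s + 1" and U: "bwt s U" "\<And>w. 0 \<le> U w"
  defines "\<beta> \<equiv> \<lambda>w. b (X u w) $ i $ j - b (X s w) $ i $ j - (\<Sum>j1\<in>UNIV. Lop b j1 i j (X s w) * (W u w $ j1 - W s w $ j1))"
  shows "L2 \<beta>" "(\<integral>w. U w * (\<beta> w)\<^sup>2 \<partial>M) \<le> CB * (u - s)\<^sup>2 * (\<integral>w. U w \<partial>M)"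
proof -
  define dt where "dt = u - s"
  define EU where "EU = (\<integral>w. U w \<partial>M)"
  have EU0: "0 \<le> EU" unfolding EU_def using U(2) by (intro integral_nonneg_AE) auto
  have u0: "0 \<le> u" using su by simp
  have mU: "U \<in> borel_measurable (F s)" "integrable M U" using U bwt_F bwt_integrable[OF su(1)] by auto
  let ?B = "\<lambda>w. 3 * (K\<^sup>2 * (norm (X u w - X s w)) ^ 4 + (real CARD('d))\<^sup>2 * K ^ 4 * dt\<^sup>2 + real CARD('d) * K\<^sup>2 * (\<Sum>l\<in>UNIV. (R l s u w)\<^sup>2))"
  have pt: "(\<beta> w)\<^sup>2 \<le> ?B w" for w
  proof -
    define f where "f = (\<lambda>x. b x $ i $ j)"
    have nf: "nice K f" unfolding f_def by (rule nb)
    define Q where "Q = f (X u w) - f (X s w) - (\<Sum>l\<in>UNIV. pd l f (X s w) * (X u w $ l - X s w $ l))"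
    define A where "A = (\<Sum>l\<in>UNIV. pd l f (X s w) * (a (X s w) $ l * dt))"
    define B where "B = (\<Sum>l\<in>UNIV. pd l f (X s w) * R l s u w)"
    \<comment> \<open>Contracting \<open>Lop\<close> with the noise gives the gradient of the entry
      of \<open>b\<close> along the noise part of the Euler step. The correction thus removes
      exactly the leading term of the Taylor expansion and leaves \<open>Q\<close>, \<open>A\<close>
      and \<open>B\<close>.\<close>
    have "(\<Sum>j1\<in>UNIV. Lop b j1 i j (X s w) * (W u w $ j1 - W s w $ j1)) = (\<Sum>l\<in>UNIV. pd l f (X s w) * (b (X s w) $ l \<bullet> (W u w - W s w)))"
      unfolding Lop_def f_def inner_vec_def sum_distrib_right sum_distrib_left
      by (subst sum.swap) (simp add: mult_ac)
    then have "\<beta> w = Q + A + B"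
      unfolding \<beta>_def Q_def A_def B_def dX_eq[of u w _ s] dt_def
      by (simp add: f_def distrib_left sum.distrib)
    then have "(\<beta> w)\<^sup>2 \<le> 3 * (Q\<^sup>2 + A\<^sup>2 + B\<^sup>2)" using sq_sum3 by simp
    moreover have "Q\<^sup>2 \<le> K\<^sup>2 * (norm (X u w - X s w)) ^ 4"
    proof -
      have "\<bar>Q\<bar> \<le> K * (norm (X u w - X s w))\<^sup>2" using nf unfolding nice_def Q_def by blast
      then have "\<bar>Q\<bar>\<^sup>2 \<le> (K * (norm (X u w - X s w))\<^sup>2)\<^sup>2" by (intro power_mono) auto
      then show ?thesis by (simp add: power_mult_distrib flip: power_mult)
    qed
    moreover have "A\<^sup>2 \<le> (real CARD('d))\<^sup>2 * K ^ 4 * dt\<^sup>2"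
    proof -
      have p: "\<bar>pd l f (X s w)\<bar> \<le> K" "\<bar>a (X s w) $ l\<bar> \<le> K" for l using nf na unfolding nice_def by blast+
      have "\<bar>pd l f (X s w) * (a (X s w) $ l * dt)\<bar> \<le> K * (K * dt)" for l
        unfolding abs_mult using p su K1 unfolding dt_def by (intro mult_mono mult_nonneg_nonneg) auto
      then have "(\<Sum>l\<in>UNIV. \<bar>pd l f (X s w) * (a (X s w) $ l * dt)\<bar>) \<le> (\<Sum>l\<in>(UNIV::'d set). K * (K * dt))" by (intro sum_mono)
      then have "\<bar>A\<bar> \<le> (\<Sum>l\<in>(UNIV::'d set). K * (K * dt))" unfolding A_def by (rule order_trans[OF sum_abs])
      then have "\<bar>A\<bar>\<^sup>2 \<le> (real CARD('d) * (K * (K * dt)))\<^sup>2" by (intro power_mono) auto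
      then show ?thesis by (simp add: power_mult_distrib power2_eq_square eval_nat_numeral mult_ac)
    qed
    moreover have "B\<^sup>2 \<le> real CARD('d) * K\<^sup>2 * (\<Sum>l\<in>UNIV. (R l s u w)\<^sup>2)"
    proof -
      have "B\<^sup>2 \<le> real CARD('d) * (\<Sum>l\<in>UNIV. (pd l f (X s w) * R l s u w)\<^sup>2)"
        unfolding B_def using sum_sq_le by blast
      also have "\<dots> \<le> real CARD('d) * (\<Sum>l\<in>UNIV. K\<^sup>2 * (R l s u w)\<^sup>2)"
      proof (intro mult_left_mono sum_mono)
        fix l
        have "\<bar>pd l f (X s w)\<bar> \<le> K" using nf unfolding nice_def by blast
        then have "\<bar>pd l f (X s w)\<bar>\<^sup>2 \<le> K\<^sup>2" by (intro power_mono) auto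
        then show "(pd l f (X s w) * R l s u w)\<^sup>2 \<le> K\<^sup>2 * (R l s u w)\<^sup>2"
          unfolding power_mult_distrib by (intro mult_right_mono) auto
      qed auto
      finally show ?thesis by (simp add: sum_distrib_left mult.assoc)
    qed
    ultimately show ?thesis by argo
  qed
  have LR: "L2 (R l s u)" and ER: "(\<integral>w. U w * (R l s u w)\<^sup>2 \<partial>M) \<le> CR * dt\<^sup>2 * EU" for l
  proof -
    have "L2 (R l s u) \<and> (\<integral>w. U w * (R l s u w)\<^sup>2 \<partial>M) \<le> CR * dt\<^sup>2 * EU"
    proof (cases "s = u")
      case True
      then have "R l s u = (\<lambda>_. 0)" unfolding R_def by auto
      then show ?thesis using CR0 EU0 L2_const[of 0] by simp
    next
      case False
      then show ?thesis unfolding dt_def EU_def using su U by (intro conjI R_general) auto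
    qed
    then show "L2 (R l s u)" "(\<integral>w. U w * (R l s u w)\<^sup>2 \<partial>M) \<le> CR * dt\<^sup>2 * EU" by auto
  qed
  have i4: "integrable M (\<lambda>w. V w * (norm (X u w - X s w)) ^ 4)" 
    and E4: "(\<integral>w. V w * (norm (X u w - X s w)) ^ 4 \<partial>M) \<le> Cn 4 * (sqrt dt) ^ 4 * (\<integral>w. V w \<partial>M)"
    if "bwt s V" "\<And>w. 0 \<le> V w" for V
    unfolding dt_def by (rule X_mom[OF su bwt_F[OF that(1)] that(2) bwt_integrable[OF su(1) that(1)]])+
  have [measurable]: "W u \<in> borel_measurable M" "W s \<in> borel_measurable M" "X u \<in> borel_measurable M" "X s \<in> borel_measurable M"
    "(\<lambda>w. b (X u w) $ i $ j) \<in> borel_measurable M" "(\<lambda>w. b (X s w) $ i $ j) \<in> borel_measurable M"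
    "(\<lambda>w. Lop b j1 i j (X s w)) \<in> borel_measurable M" for j1
    using meas_W_M meas_X_M su u0 meas_F_M[OF su(1) nice_X[OF nb su(1)]] meas_F_M[OF u0 nice_X[OF nb u0]] 
      bwt_meas[OF su(1) Lop_bwt[OF su(1) meas_X[OF su(1)]]] by auto
  have mb: "\<beta> \<in> borel_measurable M" unfolding \<beta>_def by measurable
  have iB: "integrable M (\<lambda>w. V w * ?B w)" if V: "bwt s V" "\<And>w. 0 \<le> V w" for V
  proof -
    have "integrable M (\<lambda>w. 3 * (K\<^sup>2 * (V w * (norm (X u w - X s w)) ^ 4) + (real CARD('d))\<^sup>2 * K ^ 4 * dt\<^sup>2 * V w + real CARD('d) * K\<^sup>2 * (\<Sum>l\<in>UNIV. V w * (R l s u w)\<^sup>2)))"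
      using i4[OF V] bwt_integrable[OF su(1) V(1)] bwt_imult[OF su(1) V(1) L2_sq[OF LR]] by simp
    then show ?thesis by (rule Bochner_Integration.integrable_cong[THEN iffD1, rotated 2]) (auto simp: algebra_simps sum_distrib_left)
  qed
  have b1: "bwt s (\<lambda>_. 1)" by (rule bwtI[of _ _ 1]) auto
  show L: "L2 \<beta>" unfolding L2_def
  proof (intro conjI mb)
    show "integrable M (\<lambda>w. (\<beta> w)\<^sup>2)"
    proof (rule Bochner_Integration.integrable_bound)
      show "integrable M (\<lambda>w. 1 * ?B w)" by (rule iB[OF b1]) auto
      show "AE w in M. norm ((\<beta> w)\<^sup>2) \<le> norm (1 * ?B w)" using order_trans[OF pt abs_ge_self] by auto
    qed (use mb in measurable)
  qed
  have "(\<integral>w. U w * (\<beta> w)\<^sup>2 \<partial>M) \<le> (\<integral>w. U w * ?B w \<partial>M)"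
    using iB[OF U] bwt_imult[OF su(1) U(1) L2_sq[OF L]] U(2) pt by (intro integral_mono mult_left_mono) auto
  also have "\<dots> = (\<integral>w. 3 * (K\<^sup>2 * (U w * (norm (X u w - X s w)) ^ 4) + (real CARD('d))\<^sup>2 * K ^ 4 * dt\<^sup>2 * U w + real CARD('d) * K\<^sup>2 * (\<Sum>l\<in>UNIV. U w * (R l s u w)\<^sup>2)) \<partial>M)"
    by (intro Bochner_Integration.integral_cong) (auto simp: algebra_simps sum_distrib_left)
  also have "\<dots> = 3 * (K\<^sup>2 * (\<integral>w. U w * (norm (X u w - X s w)) ^ 4 \<partial>M) + (real CARD('d))\<^sup>2 * K ^ 4 * dt\<^sup>2 * EU + real CARD('d) * K\<^sup>2 * (\<Sum>l\<in>UNIV. \<integral>w. U w * (R l s u w)\<^sup>2 \<partial>M))"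
    unfolding EU_def using i4[OF U] mU bwt_imult[OF su(1) U(1) L2_sq[OF LR]] by simp
  also have "\<dots> \<le> 3 * (K\<^sup>2 * (Cn 4 * (sqrt dt) ^ 4 * EU) + (real CARD('d))\<^sup>2 * K ^ 4 * dt\<^sup>2 * EU + real CARD('d) * K\<^sup>2 * (\<Sum>l\<in>(UNIV::'d set). CR * dt\<^sup>2 * EU))"
    using E4[OF U] ER unfolding EU_def by (intro mult_left_mono add_mono sum_mono order_refl) auto
  also have "(sqrt dt) ^ 4 = dt\<^sup>2"
  proof -
    have "(sqrt dt) ^ 4 = ((sqrt dt)\<^sup>2)\<^sup>2" by (simp flip: power_mult)
    then show ?thesis using su unfolding dt_def by simp
  qed
  also have "3 * (K\<^sup>2 * (Cn 4 * dt\<^sup>2 * EU) + (real CARD('d))\<^sup>2 * K ^ 4 * dt\<^sup>2 * EU + real CARD('d) * K\<^sup>2 * (\<Sum>l\<in>(UNIV::'d set). CR * dt\<^sup>2 * EU))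
     = CB * dt\<^sup>2 * EU" unfolding CB_def by (simp add: algebra_simps power2_eq_square)
  finally show "(\<integral>w. U w * (\<beta> w)\<^sup>2 \<partial>M) \<le> CB * (u - s)\<^sup>2 * (\<integral>w. U w \<partial>M)" unfolding dt_def EU_def .
qed

text \<open>Remainders of Euler steps accumulated over a fine grid are negligible. The cross term is
  controlled by the conditional mean \<open>R_mean\<close>; adding the mean of \<open>U\<close>
  turns the recursion into pure growth by the factor \<open>1 + x\<close> with \<open>x\<close> of
  order \<open>1 / N\<^sup>2\<close>, so after \<open>N\<close> steps the growth exceeds 1 by order
  \<open>1 / N\<close> only.\<close>

lemma R_chain:
  fixes i :: 'd
  assumes st: "0 \<le> s" "s < t" "t \<le> s + 1" and N: "0 < N" and U: "bwt s U" "\<And>w. 0 \<le> U w"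
  defines "S \<equiv> \<lambda>n w. \<Sum>k<n. R i (grid s t N k) (grid s t N (Suc k)) w"
  defines "x \<equiv> (2 * CM + CR) * ((t - s) / real N)\<^sup>2"
  shows "n \<le> N \<Longrightarrow> S n \<in> borel_measurable (F (grid s t N n)) \<and> L2 (S n) \<and> (\<integral>w. U w * (S n w)\<^sup>2 \<partial>M) + (\<integral>w. U w \<partial>M) \<le> (1 + x) ^ n * (\<integral>w. U w \<partial>M)"
proof (induction n)
  case 0
  show ?case unfolding S_def by (simp add: L2_const)
next
  case (Suc n)
  note g = grid_props[OF st(1,2) N]
  define \<Delta> where "\<Delta> = (t - s) / real N"
  define q where "q = grid s t N n"
  define q' where "q' = grid s t N (Suc n)"
  have q: "0 \<le> q" "s \<le> q" "q < q'" "q' - q = \<Delta>" "q' \<le> t" unfolding q_def q'_def \<Delta>_def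
    using g(3)[of n] g(4)[of n] g(5)[of n] g(6)[of "Suc n"] st Suc(2) by auto
  have q1: "q' \<le> q + 1" using q st by simp
  have \<Delta>0: "0 < \<Delta>" using q by simp
  define Rn where "Rn = R i q q'"
  have SS: "S (Suc n) = (\<lambda>w. S n w + Rn w)" unfolding S_def Rn_def q_def q'_def by simp
  have IH: "S n \<in> borel_measurable (F q)" "L2 (S n)" "(\<integral>w. U w * (S n w)\<^sup>2 \<partial>M) + (\<integral>w. U w \<partial>M) \<le> (1 + x) ^ n * (\<integral>w. U w \<partial>M)"
    using Suc unfolding q_def by auto
  have Uq: "bwt q U" by (rule bwt_mono[OF st(1) q(2) U(1)])
  have LR: "L2 Rn" unfolding Rn_def by (rule R_general(1)[OF q(1,3) q1 Uq])
  have mR: "Rn \<in> borel_measurable (F q')" unfolding Rn_def using q by (intro meas_R) auto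
  define EU where "EU = (\<integral>w. U w \<partial>M)"
  define qn where "qn = (\<integral>w. U w * (S n w)\<^sup>2 \<partial>M)"
  have ER: "(\<integral>w. U w * (Rn w)\<^sup>2 \<partial>M) \<le> CR * \<Delta>\<^sup>2 * EU"
    unfolding Rn_def EU_def q(4)[symmetric] by (rule R_general(2)[OF q(1,3) q1 Uq U(2)])
  note iU = bwt_imult[OF st(1) U(1)]
  have iS2: "integrable M (\<lambda>w. U w * (S n w)\<^sup>2)" by (rule iU[OF L2_sq[OF IH(2)]])
  have iU1: "integrable M U" using bwt_integrable[OF st(1) U(1)] .
  have mUS: "(\<lambda>w. U w * S n w) \<in> borel_measurable (F q)" using bwt_F[OF Uq] IH(1) by measurable
  have iUS: "integrable M (\<lambda>w. U w * S n w)" by (rule iU[OF L2_integrable[OF IH(2)]])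
  have iUSR: "integrable M (\<lambda>w. U w * S n w * Rn w)" using iU[OF L2_mult[OF IH(2) LR]] by (simp add: mult.assoc)
  have "\<bar>\<integral>w. U w * S n w * Rn w \<partial>M\<bar> \<le> (CM * \<Delta>\<^sup>2) * (\<integral>w. \<bar>U w * S n w\<bar> \<partial>M)"
  proof (rule weight_ext[OF q(1) L2_integrable[OF LR] mUS _ iUS iUSR])
    \<comment> \<open>The weight \<open>U * S n\<close> is unbounded, so \<open>R_mean\<close>
      enters through \<open>weight_ext\<close>.\<close>
    show "\<bar>\<integral>w. V w * Rn w \<partial>M\<bar> \<le> CM * \<Delta>\<^sup>2 * (\<integral>w. \<bar>V w\<bar> \<partial>M)" if "bwt q V" for V
      using R_mean[OF q(1,3) q1 that, of i] unfolding Rn_def q(4) .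
  qed
  also have "\<dots> \<le> (CM * \<Delta>\<^sup>2) * (EU + qn)"
  proof (rule mult_left_mono)
    have "(\<integral>w. \<bar>U w * S n w\<bar> \<partial>M) \<le> (\<integral>w. U w + U w * (S n w)\<^sup>2 \<partial>M)"
    proof (rule integral_mono)
      fix w
      have "\<bar>S n w\<bar> \<le> 1 + (S n w)\<^sup>2" using zero_le_power2[of "\<bar>S n w\<bar> - 1"] unfolding power2_diff by simp
      from mult_left_mono[OF this U(2)[of w]] show "\<bar>U w * S n w\<bar> \<le> U w + U w * (S n w)\<^sup>2"
        using U(2)[of w] by (simp add: abs_mult distrib_left)
    qed (use iUS iU1 iS2 in auto)
    then show "(\<integral>w. \<bar>U w * S n w\<bar> \<partial>M) \<le> EU + qn" unfolding EU_def qn_def using iU1 iS2 by simp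
  qed (use CM0 in auto)
  finally have cross: "(\<integral>w. U w * S n w * Rn w \<partial>M) \<le> (CM * \<Delta>\<^sup>2) * (EU + qn)" by simp
  have "(\<integral>w. U w * (S (Suc n) w)\<^sup>2 \<partial>M) = (\<integral>w. U w * (S n w)\<^sup>2 + 2 * (U w * S n w * Rn w) + U w * (Rn w)\<^sup>2 \<partial>M)"
    unfolding SS by (intro Bochner_Integration.integral_cong) (auto simp: algebra_simps power2_eq_square)
  also have "\<dots> = qn + 2 * (\<integral>w. U w * S n w * Rn w \<partial>M) + (\<integral>w. U w * (Rn w)\<^sup>2 \<partial>M)"
    unfolding qn_def using iS2 iUSR iU[OF L2_sq[OF LR]] by simp
  also have "\<dots> \<le> qn + 2 * ((CM * \<Delta>\<^sup>2) * (EU + qn)) + CR * \<Delta>\<^sup>2 * EU" using cross ER by linarith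
  also have "\<dots> + EU \<le> (1 + x) * (qn + EU)"
  proof -
    have "0 \<le> qn" unfolding qn_def using U(2) by (intro integral_nonneg_AE) auto
    then have "0 \<le> CR * \<Delta>\<^sup>2 * qn" using CR0 by simp
    then show ?thesis unfolding x_def \<Delta>_def[symmetric] by (simp add: algebra_simps)
  qed
  also have "\<dots> \<le> (1 + x) * ((1 + x) ^ n * EU)"
    using IH(3) CM0 CR0 unfolding qn_def EU_def x_def by (intro mult_left_mono add_nonneg_nonneg) auto
  finally have 1: "(\<integral>w. U w * (S (Suc n) w)\<^sup>2 \<partial>M) + EU \<le> (1 + x) ^ Suc n * EU" by simp
  have 2: "S (Suc n) \<in> borel_measurable (F q')" unfolding SS
    using meas_F_mono[OF q(1) less_imp_le[OF q(3)] IH(1)] mR by measurable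
  show ?case using 1 2 L2_add[OF IH(2) LR] unfolding SS q'_def EU_def by auto
qed

text \<open>\<open>Rem\<close> is approximated by \<open>T N + S N\<close>: a grid sum with the
  drift increments and the corrected noise integrands, plus the accumulated remainders, which vanish
  as the grid is refined. By \<open>beta_bound\<close> the noise integrand has mean square of order
  \<open>(t - s)\<^sup>2\<close>, so drift and noise both contribute the third power.\<close>

lemma Rem_props:
  assumes st: "0 \<le> s" "s < t" "t \<le> s + 1" and U: "bwt s U"
  shows "L2 (Rem i s t)"
    "(\<And>w. 0 \<le> U w) \<Longrightarrow> (\<integral>w. U w * (Rem i s t w)\<^sup>2 \<partial>M) \<le> 2 * CT * (t - s) ^ 3 * (\<integral>w. U w \<partial>M)"
    "\<bar>\<integral>w. U w * Rem i s t w \<partial>M\<bar> \<le> 2 * CM * (t - s)\<^sup>2 * (\<integral>w. \<bar>U w\<bar> \<partial>M)"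
proof -
  define dt where "dt = t - s"
  have dt: "0 < dt" "dt \<le> 1" using st by (auto simp: dt_def)
  \<comment> \<open>Chosen so that the growth factor of \<open>R_chain\<close> over \<open>N\<close>
    steps is at most \<open>exp (y / N)\<close>.\<close>
  define y where "y = (2 * CM + CR) * dt\<^sup>2"
  have y0: "0 \<le> y" unfolding y_def using CM0 CR0 by simp
  obtain r where r: "\<And>n. 0 < r n" "filterlim r at_top sequentially" 
    "\<And>j1 j2. AE w in M. (\<lambda>n. Jn s t (r n) j1 j2 w) \<longlonglongrightarrow> J s t j1 j2 w" using J_AE[OF st(1,2)] by auto
  define Z where "Z N w = R i s t w - (\<Sum>j1\<in>UNIV. \<Sum>j2\<in>UNIV. Lop b j1 i j2 (X s w) * Jn s t N j1 j2 w)" for N w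
  have "AE w in M. \<forall>j1 j2. (\<lambda>n. Jn s t (r n) j1 j2 w) \<longlonglongrightarrow> J s t j1 j2 w" using r(3) by (simp add: AE_all_countable)
  then have lim: "AE w in M. (\<lambda>n. Z (r n) w) \<longlonglongrightarrow> Rem i s t w"
    unfolding Z_def Rem_def by eventually_elim (intro tendsto_diff tendsto_sum tendsto_mult tendsto_const, auto)
  have mX: "X s \<in> borel_measurable (F s)" by (rule meas_X[OF st(1)])
  have core: "L2 (Z N) \<and> \<bar>\<integral>w. V w * Z N w \<partial>M\<bar> \<le> 2 * CM * dt\<^sup>2 * (\<integral>w. \<bar>V w\<bar> \<partial>M) \<and>
     ((\<forall>w. 0 \<le> V w) \<longrightarrow> (\<integral>w. V w * (Z N w)\<^sup>2 \<partial>M) \<le> (2 * CT * dt ^ 3 + 2 * (exp (y / N) - 1)) * (\<integral>w. V w \<partial>M))" 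
    if V: "bwt s V" and N: "0 < N" for V N
  proof -
    note g = grid_props[OF st(1,2) N]
    let ?u = "grid s t N"
    have g0: "0 \<le> ?u k" for k using g(5)[of k] st by simp
    have g1: "?u k \<le> s + 1" if "k \<le> N" for k using g(6)[OF that] st by simp
    define \<alpha> where "\<alpha> k w = a (X (?u k) w) $ i - a (X s w) $ i" for k w
    define \<beta>' where "\<beta>' k w = (\<chi> j. b (X (?u k) w) $ i $ j - b (X s w) $ i $ j - (\<Sum>j1\<in>UNIV. Lop b j1 i j (X s w) * (W (?u k) w $ j1 - W s w $ j1)))" for k w
    \<comment> \<open>Set to zero beyond the grid: \<open>grid_sum\<close> wants square
      integrability at every index, whereas \<open>beta_bound\<close> covers times up to
      \<open>s + 1\<close> only.\<close>
    define \<beta> where "\<beta> k w = (if k < N then \<beta>' k w else 0)" for k w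
    define T where "T n w = (\<Sum>k<n. \<alpha> k w * (?u (Suc k) - ?u k) + \<beta> k w \<bullet> (W (?u (Suc k)) w - W (?u k) w))" for n w
    define S where "S n w = (\<Sum>k<n. R i (?u k) (?u (Suc k)) w)" for n w
    \<comment> \<open>An exact identity: the increments of \<open>X\<close> over the fine grid
      telescope, and the deviation from their Euler form is collected in \<open>S\<close>.\<close>
    have ZTS: "Z N w = T N w + S N w" for w
    proof -
      have te: "(\<Sum>k<N. c * (?u (Suc k) - ?u k)) = c * (t - s)" for c
        unfolding sum_distrib_left[symmetric] sum_lessThan_telescope g(1,2) ..
      have tw: "(\<Sum>k<N. v \<bullet> (W (?u (Suc k)) w - W (?u k) w)) = v \<bullet> (W t w - W s w)" for v
        unfolding inner_sum_right[symmetric] sum_lessThan_telescope[of "\<lambda>k. W (?u k) w"] g(1,2) ..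
      have tx: "(\<Sum>k<N. X (?u (Suc k)) w $ i - X (?u k) w $ i) = X t w $ i - X s w $ i"
        unfolding sum_lessThan_telescope[of "\<lambda>k. X (?u k) w $ i"] g(1,2) ..
      have bk: "\<beta> k w \<bullet> D = b (X (?u k) w) $ i \<bullet> D - b (X s w) $ i \<bullet> D
           - (\<Sum>j1\<in>UNIV. \<Sum>j2\<in>UNIV. Lop b j1 i j2 (X s w) * ((W (?u k) w $ j1 - W s w $ j1) * D $ j2))" if "k < N" for k D
      proof -
        have "\<beta> k w \<bullet> D = (\<Sum>j2\<in>UNIV. b (X (?u k) w) $ i $ j2 * D $ j2 - b (X s w) $ i $ j2 * D $ j2 
            - (\<Sum>j1\<in>UNIV. Lop b j1 i j2 (X s w) * ((W (?u k) w $ j1 - W s w $ j1) * D $ j2)))"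
          using that unfolding \<beta>_def \<beta>'_def inner_vec_def by (simp add: left_diff_distrib sum_distrib_right mult.assoc)
        also have "\<dots> = b (X (?u k) w) $ i \<bullet> D - b (X s w) $ i \<bullet> D
           - (\<Sum>j2\<in>UNIV. \<Sum>j1\<in>UNIV. Lop b j1 i j2 (X s w) * ((W (?u k) w $ j1 - W s w $ j1) * D $ j2))"
          unfolding inner_vec_def by (simp add: sum_subtractf)
        finally show ?thesis by (subst sum.swap)
      qed
      have "T N w + S N w = (\<Sum>k<N. (X (?u (Suc k)) w $ i - X (?u k) w $ i) - a (X s w) $ i * (?u (Suc k) - ?u k)
          - b (X s w) $ i \<bullet> (W (?u (Suc k)) w - W (?u k) w)
          - (\<Sum>j1\<in>UNIV. \<Sum>j2\<in>UNIV. Lop b j1 i j2 (X s w) * ((W (?u k) w $ j1 - W s w $ j1) * (W (?u (Suc k)) w - W (?u k) w) $ j2)))"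
        unfolding T_def S_def sum.distrib[symmetric]
      proof (rule sum.cong[OF refl])
        fix k assume "k \<in> {..<N}"
        then show "\<alpha> k w * (?u (Suc k) - ?u k) + \<beta> k w \<bullet> (W (?u (Suc k)) w - W (?u k) w) + R i (?u k) (?u (Suc k)) w = 
          (X (?u (Suc k)) w $ i - X (?u k) w $ i) - a (X s w) $ i * (?u (Suc k) - ?u k)
          - b (X s w) $ i \<bullet> (W (?u (Suc k)) w - W (?u k) w)
          - (\<Sum>j1\<in>UNIV. \<Sum>j2\<in>UNIV. Lop b j1 i j2 (X s w) * ((W (?u k) w $ j1 - W s w $ j1) * (W (?u (Suc k)) w - W (?u k) w) $ j2))"
          using bk[of k "W (?u (Suc k)) w - W (?u k) w"] unfolding dX_eq[of "?u (Suc k)" w i "?u k"] \<alpha>_def by (simp add: left_diff_distrib)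
      qed
      also have "\<dots> = R i s t w - (\<Sum>k<N. \<Sum>j1\<in>UNIV. \<Sum>j2\<in>UNIV. Lop b j1 i j2 (X s w) * ((W (?u k) w $ j1 - W s w $ j1) * (W (?u (Suc k)) w - W (?u k) w) $ j2))"
        using tx unfolding sum_subtractf te tw R_def by simp
      also have "(\<Sum>k<N. \<Sum>j1\<in>UNIV. \<Sum>j2\<in>UNIV. Lop b j1 i j2 (X s w) * ((W (?u k) w $ j1 - W s w $ j1) * (W (?u (Suc k)) w - W (?u k) w) $ j2))
          = (\<Sum>j1\<in>UNIV. \<Sum>j2\<in>UNIV. Lop b j1 i j2 (X s w) * Jn s t N j1 j2 w)"
        unfolding Jn_def sum_distrib_left
        by (subst sum.swap, rule sum.cong[OF refl], subst sum.swap) simp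
      finally show ?thesis unfolding Z_def by simp
    qed
    have ma: "\<alpha> k \<in> borel_measurable (F (?u k))" for k
      unfolding \<alpha>_def using meas_aX[OF g0] nice_X_le[OF na st(1) g(5)] by (intro borel_measurable_diff) auto
    have la: "L2 (\<alpha> k)" for k unfolding \<alpha>_def
      using bwt_L2[OF g0 nice_bwt[OF na g0]] bwt_L2[OF st(1) nice_bwt[OF na st(1)]] by (intro L2_diff)
    have mb: "\<beta> k \<in> borel_measurable (F (?u k))" for k
    proof -
      have [measurable]: "(\<lambda>w. b (X (?u k) w) $ i $ j) \<in> borel_measurable (F (?u k))" "(\<lambda>w. b (X s w) $ i $ j) \<in> borel_measurable (F (?u k))"
         "W (?u k) \<in> borel_measurable (F (?u k))" "W s \<in> borel_measurable (F (?u k))"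
         "(\<lambda>w. Lop b j1 i j (X s w)) \<in> borel_measurable (F (?u k))" for j j1
        using nice_X[OF nb g0] nice_X_le[OF nb st(1) g(5)] meas_W[OF g0] meas_W_le[OF st(1) g(5)]
          meas_F_mono[OF st(1) g(5) bwt_F[OF Lop_bwt[OF st(1) mX]]] by auto
      show ?thesis unfolding \<beta>_def \<beta>'_def by (cases "k < N") (auto intro!: measurable_vecI)
    qed
    have b1: "bwt s (\<lambda>_. 1)" by (rule bwtI[of _ _ 1]) auto
    have lb: "L2 (\<lambda>w. \<beta> k w $ j)" for k j
      using beta_bound(1)[OF st(1) g(5) g1 b1, of k i j] unfolding \<beta>_def \<beta>'_def by (cases "k < N") (auto simp: L2_const)
    have V': "bwt (?u 0) V" using V g by simp
    note G = grid_sum[where u="?u" and \<alpha>="\<alpha>" and \<beta>="\<beta>" and U=V and n=N, OF g0 g(3) ma la mb lb V', folded T_def]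
    note iV = bwt_imult[OF st(1) V]
    have LS: "L2 (S N)" using R_chain[OF st N b1, where i=i and n=N] unfolding S_def by simp
    have LZ: "L2 (Z N)" unfolding ZTS by (rule L2_add[OF G(1) LS])
    have iT: "integrable M (\<lambda>w. V w * T N w)" and iS: "integrable M (\<lambda>w. V w * S N w)" 
      using iV[OF L2_integrable[OF G(1)]] iV[OF L2_integrable[OF LS]] by auto
    define EV where "EV = (\<integral>w. \<bar>V w\<bar> \<partial>M)"
    have EV0: "0 \<le> EV" unfolding EV_def by (intro integral_nonneg_AE) auto
    have mT: "\<bar>\<integral>w. V w * T N w \<partial>M\<bar> \<le> CM * dt\<^sup>2 * EV"
    proof -
      have "\<bar>\<integral>w. V w * T N w \<partial>M\<bar> \<le> (\<Sum>k<N. \<bar>(?u (Suc k) - ?u k) * (\<integral>w. V w * \<alpha> k w \<partial>M)\<bar>)"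
        unfolding G(2) by (rule sum_abs)
      also have "\<dots> \<le> (\<Sum>k<N. (?u (Suc k) - ?u k) * (CM * dt * EV))"
      proof (rule sum_mono)
        fix k assume k: "k \<in> {..<N}"
        have "\<bar>\<integral>w. V w * \<alpha> k w \<partial>M\<bar> \<le> CM * dt * EV"
        proof (cases "k = 0")
          case True
          then show ?thesis unfolding \<alpha>_def using g dt CM0 EV0 by simp
        next
          case False
          then have sk: "s < ?u k" unfolding grid_def using st N by simp
          have "\<bar>\<integral>w. V w * \<alpha> k w \<partial>M\<bar> \<le> CM * (?u k - s) * EV"
            unfolding \<alpha>_def EV_def by (rule nice_mean[OF st(1) sk g1 V na]) (use k in auto)
          also have "\<dots> \<le> CM * dt * EV" unfolding dt_def using g(6)[of k] k CM0 EV0 by (intro mult_right_mono mult_left_mono) auto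
          finally show ?thesis .
        qed
        then show "\<bar>(?u (Suc k) - ?u k) * (\<integral>w. V w * \<alpha> k w \<partial>M)\<bar> \<le> (?u (Suc k) - ?u k) * (CM * dt * EV)"
          unfolding abs_mult using less_imp_le[OF g(3)[of k]] by (intro mult_mono) auto
      qed
      also have "\<dots> = CM * dt\<^sup>2 * EV"
        unfolding sum_distrib_right[symmetric] sum_lessThan_telescope g(1,2) dt_def by (simp add: power2_eq_square)
      finally show ?thesis .
    qed
    have mS: "\<bar>\<integral>w. V w * S N w \<partial>M\<bar> \<le> CM * dt\<^sup>2 * EV"
    proof -
      have d: "?u k < ?u (Suc k)" "?u (Suc k) \<le> ?u k + 1" "bwt (?u k) V" for k
      proof -
        show "?u k < ?u (Suc k)" using g by auto
        have "(t - s) / N \<le> (t - s) / 1" using st N by (intro divide_left_mono) auto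
        then have "(t - s) / N \<le> t - s" by simp
        then show "?u (Suc k) \<le> ?u k + 1" using g(4)[of k] st by linarith
        show "bwt (?u k) V" by (rule bwt_mono[OF st(1) g(5) V])
      qed
      have iR: "integrable M (\<lambda>w. V w * R i (?u k) (?u (Suc k)) w)" for k
        by (rule iV[OF L2_integrable[OF R_general(1)[OF g0 d]]])
      have "(\<integral>w. V w * S N w \<partial>M) = (\<Sum>k<N. \<integral>w. V w * R i (?u k) (?u (Suc k)) w \<partial>M)"
        unfolding S_def sum_distrib_left using iR by simp
      also have "\<bar>\<dots>\<bar> \<le> (\<Sum>k<N. CM * (?u (Suc k) - ?u k)\<^sup>2 * EV)"
        unfolding EV_def by (rule order_trans[OF sum_abs sum_mono]) (rule R_mean[OF g0 d])
      also have "\<dots> = CM * (real N * ((t - s) / N)\<^sup>2) * EV" unfolding g(4) by simp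
      also have "\<dots> \<le> CM * dt\<^sup>2 * EV"
      proof (intro mult_right_mono mult_left_mono)
        have "real N * ((t - s) / N)\<^sup>2 = dt\<^sup>2 / N" unfolding dt_def using N by (simp add: power2_eq_square)
        also have "\<dots> \<le> dt\<^sup>2 / 1" using N by (intro divide_left_mono) auto
        finally show "real N * ((t - s) / N)\<^sup>2 \<le> dt\<^sup>2" by simp
      qed (use CM0 EV0 in auto)
      finally show ?thesis .
    qed
    have "(\<integral>w. V w * Z N w \<partial>M) = (\<integral>w. V w * T N w \<partial>M) + (\<integral>w. V w * S N w \<partial>M)"
      unfolding ZTS distrib_left using iT iS by simp
    then have mZ: "\<bar>\<integral>w. V w * Z N w \<partial>M\<bar> \<le> 2 * CM * dt\<^sup>2 * EV" using mT mS by linarith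
    have "(\<integral>w. V w * (Z N w)\<^sup>2 \<partial>M) \<le> (2 * CT * dt ^ 3 + 2 * (exp (y / N) - 1)) * (\<integral>w. V w \<partial>M)" if V0: "\<And>w. 0 \<le> V w"
    proof -
      define E1 where "E1 = (\<integral>w. V w \<partial>M)"
      have E10: "0 \<le> E1" unfolding E1_def using V0 by (intro integral_nonneg_AE) auto
      have "(\<integral>w. V w * (T N w)\<^sup>2 \<partial>M) \<le> (2 * (?u N - ?u 0)\<^sup>2 * (K\<^sup>2 * Cn 2 * dt) + 2 * (real CARD('m))\<^sup>2 * (?u N - ?u 0) * (CB * dt\<^sup>2)) * E1"
        unfolding E1_def
      proof (rule G(3)[OF V0])
        fix k assume k: "k < N"
        have gk: "?u k \<le> t" "?u k \<le> s + 1" using g(6)[of k] g1[of k] k by auto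
        have "(\<integral>w. V w * (\<alpha> k w)\<^sup>2 \<partial>M) \<le> K\<^sup>2 * Cn 2 * (?u k - s) * E1"
          unfolding \<alpha>_def E1_def by (rule nice_inc[OF st(1) g(5) gk(2) V V0 na])
        also have "\<dots> \<le> K\<^sup>2 * Cn 2 * dt * E1"
          using gk Cn_pos[of 2] E10 unfolding dt_def by (intro mult_right_mono mult_left_mono mult_nonneg_nonneg) auto
        finally show "(\<integral>w. V w * (\<alpha> k w)\<^sup>2 \<partial>M) \<le> K\<^sup>2 * Cn 2 * dt * (\<integral>w. V w \<partial>M)" unfolding E1_def .
        fix j
        have "(\<integral>w. V w * (\<beta> k w $ j)\<^sup>2 \<partial>M) \<le> CB * (?u k - s)\<^sup>2 * E1"
          using beta_bound(2)[OF st(1) g(5) gk(2) V V0, of i j] k unfolding \<beta>_def \<beta>'_def E1_def by simp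
        also have "\<dots> \<le> CB * dt\<^sup>2 * E1"
          using gk g(5)[of k] CB0 E10 unfolding dt_def by (intro mult_right_mono mult_left_mono power_mono) auto
        finally show "(\<integral>w. V w * (\<beta> k w $ j)\<^sup>2 \<partial>M) \<le> CB * dt\<^sup>2 * (\<integral>w. V w \<partial>M)" unfolding E1_def .
      qed
      also have "\<dots> = CT * dt ^ 3 * E1"
        unfolding g(1,2) CT_def dt_def by (simp add: algebra_simps power2_eq_square power3_eq_cube)
      finally have T2: "(\<integral>w. V w * (T N w)\<^sup>2 \<partial>M) \<le> CT * dt ^ 3 * E1" .
      have "(\<integral>w. V w * (S N w)\<^sup>2 \<partial>M) + E1 \<le> (1 + (2 * CM + CR) * ((t - s) / real N)\<^sup>2) ^ N * E1"
        using R_chain[OF st N V V0, where i=i and n=N] unfolding S_def E1_def by simp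
      also have "\<dots> \<le> exp (y / N) * E1"
      proof (rule mult_right_mono[OF _ E10])
        have "(1 + (2 * CM + CR) * ((t - s) / real N)\<^sup>2) ^ N \<le> (exp ((2 * CM + CR) * ((t - s) / real N)\<^sup>2)) ^ N"
          using CM0 CR0 by (intro power_mono exp_ge_add_one_self add_nonneg_nonneg mult_nonneg_nonneg) auto
        also have "\<dots> = exp (real N * ((2 * CM + CR) * ((t - s) / real N)\<^sup>2))" by (simp add: exp_of_nat_mult)
        also have "real N * ((2 * CM + CR) * ((t - s) / real N)\<^sup>2) = y / N" unfolding y_def dt_def using N by (simp add: power2_eq_square)
        finally show "(1 + (2 * CM + CR) * ((t - s) / real N)\<^sup>2) ^ N \<le> exp (y / N)" .
      qed
      finally have S2: "(\<integral>w. V w * (S N w)\<^sup>2 \<partial>M) \<le> (exp (y / N) - 1) * E1" by (simp add: algebra_simps)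
      have "(\<integral>w. V w * (Z N w)\<^sup>2 \<partial>M) \<le> (\<integral>w. 2 * (V w * (T N w)\<^sup>2) + 2 * (V w * (S N w)\<^sup>2) \<partial>M)"
      proof (rule integral_mono)
        show "integrable M (\<lambda>w. V w * (Z N w)\<^sup>2)" by (rule iV[OF L2_sq[OF LZ]])
        show "integrable M (\<lambda>w. 2 * (V w * (T N w)\<^sup>2) + 2 * (V w * (S N w)\<^sup>2))" using iV[OF L2_sq[OF LS]] iV[OF L2_sq[OF G(1)]] by simp
        show "V w * (Z N w)\<^sup>2 \<le> 2 * (V w * (T N w)\<^sup>2) + 2 * (V w * (S N w)\<^sup>2)" for w
          using mult_left_mono[OF sq_sum2[of "T N w" "S N w"] V0[of w]] unfolding ZTS by (simp add: algebra_simps)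
      qed
      also have "\<dots> = 2 * (\<integral>w. V w * (T N w)\<^sup>2 \<partial>M) + 2 * (\<integral>w. V w * (S N w)\<^sup>2 \<partial>M)"
        using iV[OF L2_sq[OF LS]] iV[OF L2_sq[OF G(1)]] by simp
      also have "\<dots> \<le> 2 * (CT * dt ^ 3 * E1) + 2 * ((exp (y / N) - 1) * E1)" using T2 S2 by linarith
      finally show ?thesis unfolding E1_def by (simp add: algebra_simps)
    qed
    then show ?thesis using LZ mZ unfolding EV_def by auto
  qed
  have mRem: "Rem i s t \<in> borel_measurable M"
  proof -
    have [measurable]: "R i s t \<in> borel_measurable M" "(\<lambda>w. Lop b j1 i j2 (X s w)) \<in> borel_measurable M" "J s t j1 j2 \<in> borel_measurable M" for j1 j2
      using meas_R[of s t] bwt_meas[OF st(1) Lop_bwt[OF st(1) mX]] meas_J_M st by auto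
    show ?thesis unfolding Rem_def by measurable
  qed
  have b1: "bwt s (\<lambda>_. 1)" by (rule bwtI[of _ _ 1]) auto
  have LL: "L2 (\<lambda>w. U w * Rem i s t w) \<and> (\<lambda>n. \<integral>w. U w * Z (r n) w \<partial>M) \<longlonglongrightarrow> (\<integral>w. U w * Rem i s t w \<partial>M)" if U: "bwt s U" for U
  proof -
    have UU: "bwt s (\<lambda>w. U w * U w)" using bwt_mult[OF U U] .
    have KU: "(\<integral>w. (U w * Z (r n) w)\<^sup>2 \<partial>M) \<le> (2 * CT * dt ^ 3 + 2 * (exp y - 1)) * (\<integral>w. U w * U w \<partial>M)" for n
    proof -
      have "(\<integral>w. (U w * Z (r n) w)\<^sup>2 \<partial>M) \<le> (2 * CT * dt ^ 3 + 2 * (exp (y / r n) - 1)) * (\<integral>w. U w * U w \<partial>M)"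
        using core[OF UU r(1)[of n]] by (simp add: power_mult_distrib power2_eq_square mult_ac)
      also have "\<dots> \<le> (2 * CT * dt ^ 3 + 2 * (exp y - 1)) * (\<integral>w. U w * U w \<partial>M)"
      proof (rule mult_right_mono)
        have "y / r n \<le> y / 1" using r(1)[of n] y0 by (intro divide_left_mono) auto
        then show "2 * CT * dt ^ 3 + 2 * (exp (y / r n) - 1) \<le> 2 * CT * dt ^ 3 + 2 * (exp y - 1)" by simp
      qed (auto intro!: integral_nonneg_AE)
      finally show ?thesis .
    qed
    have lU: "AE w in M. (\<lambda>n. U w * Z (r n) w) \<longlonglongrightarrow> U w * Rem i s t w"
      using lim by eventually_elim (intro tendsto_intros)
    have mU: "(\<lambda>w. U w * Rem i s t w) \<in> borel_measurable M" using mRem bwt_meas[OF st(1) U] by measurable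
    have LU: "L2 (\<lambda>w. U w * Z (r n) w)" for n using bwt_L2mult[OF st(1) U] core[OF U r(1)] by blast
    show ?thesis using L2_bounded_limit[of "\<lambda>n w. U w * Z (r n) w" "\<lambda>w. U w * Rem i s t w", OF lU mU LU KU] by blast
  qed
  show "L2 (Rem i s t)" using LL[OF b1] by simp
  show "\<bar>\<integral>w. U w * Rem i s t w \<partial>M\<bar> \<le> 2 * CM * (t - s)\<^sup>2 * (\<integral>w. \<bar>U w\<bar> \<partial>M)"
    using LL[OF U] core[OF U r(1)] unfolding dt_def
    by (intro LIMSEQ_le_const2[OF tendsto_rabs[of "\<lambda>n. \<integral>w. U w * Z (r n) w \<partial>M"]]) auto
  have c1: "(\<lambda>n. (2 * CT * dt ^ 3 + 2 * (exp (y / real (r n)) - 1)) * (\<integral>w. U w \<partial>M)) \<longlonglongrightarrow> (2 * CT * dt ^ 3 + 2 * (exp 0 - 1)) * (\<integral>w. U w \<partial>M)"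
  proof -
    have "(\<lambda>n. y / real (r n)) \<longlonglongrightarrow> 0"
      by (rule tendsto_divide_0[OF tendsto_const filterlim_at_top_imp_at_infinity[OF filterlim_compose[OF filterlim_real_sequentially r(2)]]])
    then show ?thesis by (intro tendsto_intros)
  qed
  show "(\<integral>w. U w * (Rem i s t w)\<^sup>2 \<partial>M) \<le> 2 * CT * (t - s) ^ 3 * (\<integral>w. U w \<partial>M)" if "\<And>w. 0 \<le> U w"
  proof -
    have "(\<integral>w. U w * (Rem i s t w)\<^sup>2 \<partial>M) \<le> (2 * CT * dt ^ 3 + 2 * (exp 0 - 1)) * (\<integral>w. U w \<partial>M)"
    proof (rule fatou_bound(2)[of "\<lambda>n w. U w * (Z (r n) w)\<^sup>2", OF _ _ _ _ _ c1])
      show "AE w in M. (\<lambda>n. U w * (Z (r n) w)\<^sup>2) \<longlonglongrightarrow> U w * (Rem i s t w)\<^sup>2"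
        using lim by eventually_elim (intro tendsto_intros)
      show "integrable M (\<lambda>w. U w * (Z (r n) w)\<^sup>2)" for n using bwt_imult[OF st(1) U] L2_sq core[OF U r(1)] by blast
      show "(\<lambda>w. U w * (Rem i s t w)\<^sup>2) \<in> borel_measurable M" using mRem bwt_meas[OF st(1) U] by measurable
    qed (use that core[OF U r(1)] in auto)
    then show ?thesis unfolding dt_def by simp
  qed
qed

end

section \<open>Propagation of the error over one step\<close>

context sde_mil
begin

lemma bwt_diff: "bwt s U \<Longrightarrow> bwt s V \<Longrightarrow> bwt s (\<lambda>w. U w - V w)"
  unfolding bwt_def
proof safe
  fix B B' assume "U \<in> borel_measurable (F s)" "V \<in> borel_measurable (F s)" "\<forall>w. \<bar>U w\<bar> \<le> B" "\<forall>w. \<bar>V w\<bar> \<le> B'"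
  then show "\<exists>B. \<forall>w. \<bar>U w - V w\<bar> \<le> B"
    by (intro exI[of _ "B + B'"] allI order_trans[OF abs_triangle_ineq4 add_mono]) auto
qed measurable

lemma sq_sum4: "((x::real) + y + z + w)\<^sup>2 \<le> 4 * (x\<^sup>2 + y\<^sup>2 + z\<^sup>2 + w\<^sup>2)"
  using zero_le_power2[of "x - y"] zero_le_power2[of "x - z"] zero_le_power2[of "z - y"]
    zero_le_power2[of "x - w"] zero_le_power2[of "w - z"] zero_le_power2[of "w - y"]
  by (simp add: power2_eq_square algebra_simps)

lemma dW_L2:
  assumes q: "0 \<le> q" "q < t" and v: "\<And>j. bwt q (\<lambda>w. v w $ j)" and U: "bwt q U" "\<And>w. 0 \<le> U w"
    and c: "\<And>j. (\<integral>w. U w * (v w $ j)\<^sup>2 \<partial>M) \<le> c"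
  shows "L2 (\<lambda>w. v w \<bullet> (W t w - W q w))" 
    "(\<integral>w. U w * (v w \<bullet> (W t w - W q w))\<^sup>2 \<partial>M) \<le> (real CARD('m))\<^sup>2 * (t - q) * c"
proof -
  let ?D = "\<lambda>j w. W t w $ j - W q w $ j"
  have vv: "bwt q (\<lambda>w. (v w $ j)\<^sup>2)" for j using bwt_mult[OF v v] by (simp add: power2_eq_square)
  have Uv: "bwt q (\<lambda>w. U w * (v w $ j)\<^sup>2)" for j by (rule bwt_mult[OF U(1) vv])
  have i1: "integrable M (\<lambda>w. (v w $ j * ?D j w)\<^sup>2)" for j
    using dW_cond2(1)[OF q bwt_F[OF vv] bwt_integrable[OF q(1) vv], of j j j] by (simp add: power2_eq_square mult_ac)
  have [measurable]: "(\<lambda>w. v w $ j) \<in> borel_measurable M" "W t \<in> borel_measurable M" "W q \<in> borel_measurable M" for j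
    using bwt_meas[OF q(1) v] meas_W_M q by auto
  have L: "L2 (\<lambda>w. v w $ j * ?D j w)" for j unfolding L2_def using i1 by auto
  have e: "v w \<bullet> (W t w - W q w) = (\<Sum>j\<in>UNIV. v w $ j * ?D j w)" for w by (simp add: inner_vec_def)
  show L2: "L2 (\<lambda>w. v w \<bullet> (W t w - W q w))" unfolding e by (intro L2_sum L)
  have iU: "integrable M (\<lambda>w. U w * (v w $ j * ?D j w)\<^sup>2)" for j by (rule bwt_imult[OF q(1) U(1) i1])
  have "(\<integral>w. U w * (v w \<bullet> (W t w - W q w))\<^sup>2 \<partial>M) \<le> (\<integral>w. real CARD('m) * (\<Sum>j\<in>UNIV. U w * (v w $ j * ?D j w)\<^sup>2) \<partial>M)"
  proof (rule integral_mono)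
    show "U w * (v w \<bullet> (W t w - W q w))\<^sup>2 \<le> real CARD('m) * (\<Sum>j\<in>UNIV. U w * (v w $ j * ?D j w)\<^sup>2)" for w
      using mult_left_mono[OF sum_sq_le[of "\<lambda>j. v w $ j * ?D j w" UNIV] U(2)[of w]] unfolding e by (simp add: sum_distrib_left mult_ac)
  qed (use iU bwt_imult[OF q(1) U(1) L2_sq[OF L2]] in auto)
  also have "\<dots> = real CARD('m) * (\<Sum>j\<in>UNIV. \<integral>w. U w * (v w $ j * ?D j w)\<^sup>2 \<partial>M)" using iU by simp
  also have "\<dots> \<le> real CARD('m) * (\<Sum>j\<in>(UNIV::'m set). (t - q) * c)"
  proof (intro mult_left_mono sum_mono)
    fix j
    have "(\<integral>w. U w * (v w $ j * ?D j w)\<^sup>2 \<partial>M) = (t - q) * (\<integral>w. U w * (v w $ j)\<^sup>2 \<partial>M)"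
      using dW_cond2(2)[OF q bwt_F[OF Uv] bwt_integrable[OF q(1) Uv], of j j j] by (simp add: power2_eq_square mult_ac)
    also have "\<dots> \<le> (t - q) * c" using q c by (intro mult_left_mono) auto
    finally show "(\<integral>w. U w * (v w $ j * ?D j w)\<^sup>2 \<partial>M) \<le> (t - q) * c" .
  qed auto
  finally show "(\<integral>w. U w * (v w \<bullet> (W t w - W q w))\<^sup>2 \<partial>M) \<le> (real CARD('m))\<^sup>2 * (t - q) * c"
    by (simp add: power2_eq_square mult_ac)
qed

text \<open>The state is a plain argument and the times are deterministic; random states are
  inserted only on events that fix both times.\<close>

definition mstep :: "'d \<Rightarrow> real \<Rightarrow> real \<Rightarrow> real^'d \<Rightarrow> 'w \<Rightarrow> real" where
  "mstep i q t y w = y $ i + a y $ i * (t - q) + (\<Sum>j\<in>UNIV. b y $ i $ j * (W t w - W q w) $ j)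
     + (\<Sum>j1\<in>UNIV. \<Sum>j2\<in>UNIV. Lop b j1 i j2 y * J q t j1 j2 w)"

text \<open>\<open>2 * K\<close> and \<open>2 * CM\<close> stem from the cross term with the drift
  difference and with the mean of the local error; the bracket with factor 4 collects the squares of
  drift, noise and iterated integrals. \<open>CS2\<close> contains what does not involve the
  inherited error.\<close>

definition CS1 :: real where
  "CS1 = real CARD('d) * (2 * K + 2 * CM + 4 * (K\<^sup>2 + (real CARD('m))\<^sup>2 * K\<^sup>2 + real CARD('m) ^ 4 * KL\<^sup>2))"
definition CS2 :: real where
  "CS2 = real CARD('d) * (2 * CM + 8 * CT)"

lemma CS0: "0 \<le> CS1" "0 \<le> CS2"
  unfolding CS1_def CS2_def using K1 CM0 CT0 by (auto intro!: mult_nonneg_nonneg add_nonneg_nonneg)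

text \<open>The local error enters squared at order \<open>(t - q) ^ 3\<close>; its product with the inherited error is controlled by the
  conditional mean of the local error, which is of order \<open>(t - q)\<^sup>2\<close>.\<close>

lemma one_step:
  assumes q: "0 \<le> q" "q < t" "t \<le> q + 1" and A: "A \<in> sets (F q)" and Y: "Y \<in> borel_measurable (F q)"
    and \<rho>: "\<And>w. w \<in> A \<Longrightarrow> norm (X q w - Y w) \<le> \<rho>"
  shows "integrable M (\<lambda>w. indicator A w * (\<Sum>i\<in>UNIV. (X t w $ i - mstep i q t (Y w) w)\<^sup>2))" (is ?I)
    "integrable M (\<lambda>w. indicator A w * (norm (X q w - Y w))\<^sup>2)" (is ?NN)
    "(\<integral>w. indicator A w * (\<Sum>i\<in>UNIV. (X t w $ i - mstep i q t (Y w) w)\<^sup>2) \<partial>M)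
      \<le> (1 + CS1 * (t - q)) * (\<integral>w. indicator A w * (norm (X q w - Y w))\<^sup>2 \<partial>M) + CS2 * (t - q) ^ 3 * prob A" (is ?E)
proof -
  define U :: "'w \<Rightarrow> real" where "U = indicator A"
  define \<theta> where "\<theta> = t - q"
  have \<theta>: "0 < \<theta>" "\<theta> \<le> 1" using q by (auto simp: \<theta>_def)
  have bU: "bwt q U" unfolding U_def by (rule bwt_ind[OF A])
  have U0: "0 \<le> U w" for w unfolding U_def by simp
  have EU: "(\<integral>w. U w \<partial>M) = prob A" unfolding U_def using sets_F_M[OF q(1) A] by simp
  have mX: "X q \<in> borel_measurable (F q)" by (rule meas_X[OF q(1)])
  define N where "N w = norm (X q w - Y w)" for w
  define e where "e i w = X q w $ i - Y w $ i" for i w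
  have eN: "\<bar>e i w\<bar> \<le> N w" for i w unfolding e_def N_def using component_le_norm_cart[of "X q w - Y w" i] by simp
  have N0: "0 \<le> N w" for w unfolding N_def by simp
  have N2: "(N w)\<^sup>2 = (\<Sum>i\<in>UNIV. (e i w)\<^sup>2)" for w
    unfolding N_def e_def power2_norm_eq_inner inner_vec_def by (simp add: power2_eq_square)
  \<comment> \<open>On \<open>A\<close> the inherited error is at most \<open>\<rho>\<close>, which
    makes its products with \<open>U\<close> admissible as bounded weights.\<close>
  have \<rho>0: "\<bar>U w * N w\<bar> \<le> \<bar>\<rho>\<bar>" for w
    using \<rho>[of w] N0[of w] unfolding U_def N_def by (auto simp: indicator_def)
  have bUN: "bwt q (\<lambda>w. U w * N w)"
    by (rule bwtI[OF _ \<rho>0]) (use bwt_F[OF bU] mX Y in \<open>unfold N_def, measurable\<close>)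
  have bUN2: "bwt q (\<lambda>w. U w * (N w)\<^sup>2)"
  proof -
    have "(\<lambda>w. U w * (N w)\<^sup>2) = (\<lambda>w. (U w * N w) * (U w * N w))"
      by (auto simp: U_def indicator_def power2_eq_square)
    then show ?thesis using bwt_mult[OF bUN bUN] by simp
  qed
  have me[measurable]: "e i \<in> borel_measurable (F q)" for i unfolding e_def using mX Y by measurable
  have bUe: "bwt q (\<lambda>w. U w * e i w)" for i
  proof (rule bwtI[of _ _ "\<bar>\<rho>\<bar>"])
    show "(\<lambda>w. U w * e i w) \<in> borel_measurable (F q)" using bwt_F[OF bU] by measurable
    show "\<bar>U w * e i w\<bar> \<le> \<bar>\<rho>\<bar>" for w
      using mult_left_mono[OF eN[of i w] U0[of w]] \<rho>0[of w] U0[of w] by (simp add: abs_mult N0)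
  qed
  have bUe2: "bwt q (\<lambda>w. U w * (e i w)\<^sup>2)" for i
  proof -
    have "(\<lambda>w. U w * (e i w)\<^sup>2) = (\<lambda>w. (U w * e i w) * (U w * e i w))"
      by (auto simp: U_def indicator_def power2_eq_square)
    then show ?thesis using bwt_mult[OF bUe bUe] by simp
  qed
  define E0 where "E0 = (\<integral>w. U w * (N w)\<^sup>2 \<partial>M)"
  have E00: "0 \<le> E0" unfolding E0_def using U0 by (intro integral_nonneg_AE) auto
  have le_E0: "(\<integral>w. U w * (g w)\<^sup>2 \<partial>M) \<le> c\<^sup>2 * E0" if "bwt q (\<lambda>w. U w * (g w)\<^sup>2)" "\<And>w. \<bar>g w\<bar> \<le> c * N w" for g c
  proof -
    have "(\<integral>w. U w * (g w)\<^sup>2 \<partial>M) \<le> (\<integral>w. c\<^sup>2 * (U w * (N w)\<^sup>2) \<partial>M)"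
    proof (rule integral_mono)
      fix w
      have "\<bar>g w\<bar>\<^sup>2 \<le> (c * N w)\<^sup>2" using that(2) by (intro power_mono) auto
      then show "U w * (g w)\<^sup>2 \<le> c\<^sup>2 * (U w * (N w)\<^sup>2)" using mult_left_mono[OF _ U0[of w], of "(g w)\<^sup>2" "(c * N w)\<^sup>2"]
        by (simp add: power_mult_distrib mult_ac)
    qed (use bwt_integrable[OF q(1) that(1)] bwt_integrable[OF q(1) bUN2] in auto)
    then show ?thesis unfolding E0_def by simp
  qed
  have nY: "bwt q (\<lambda>w. f (Y w))" if "nice K f" for f
    by (rule bwtI[OF measurable_compose[OF Y nice_meas[OF that]], of K]) (use that in \<open>auto simp: nice_def\<close>)
  define \<alpha> where "\<alpha> i w = a (X q w) $ i - a (Y w) $ i" for i w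
  define \<beta> where "\<beta> i w = b (X q w) $ i - b (Y w) $ i" for i w
  define \<gamma> where "\<gamma> i j1 j2 w = Lop b j1 i j2 (X q w) - Lop b j1 i j2 (Y w)" for i j1 j2 w
  have b\<alpha>: "bwt q (\<alpha> i)" for i unfolding \<alpha>_def by (rule bwt_diff[OF nice_bwt[OF na q(1)] nY[OF na]])
  have b\<beta>: "bwt q (\<lambda>w. \<beta> i w $ j)" for i j unfolding \<beta>_def vector_minus_component by (rule bwt_diff[OF nice_bwt[OF nb q(1)] nY[OF nb]])
  have b\<gamma>: "bwt q (\<gamma> i j1 j2)" for i j1 j2 unfolding \<gamma>_def by (rule bwt_diff[OF Lop_bwt[OF q(1) mX] Lop_bwt[OF q(1) Y]])
  have l\<alpha>: "\<bar>\<alpha> i w\<bar> \<le> K * N w" for i w using na unfolding nice_def \<alpha>_def N_def by blast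
  have l\<beta>: "\<bar>\<beta> i w $ j\<bar> \<le> K * N w" for i j w using nb unfolding nice_def \<beta>_def N_def vector_minus_component by blast
  have l\<gamma>: "\<bar>\<gamma> i j1 j2 w\<bar> \<le> KL * N w" for i j1 j2 w unfolding \<gamma>_def N_def by (rule Lop_lip)
  have bU2: "bwt q (\<lambda>w. U w * (g w)\<^sup>2)" if "bwt q g" for g
    using bwt_mult[OF bU bwt_mult[OF that that]] by (simp add: power2_eq_square)
  note iU = bwt_imult[OF q(1) bU]
  have main: "integrable M (\<lambda>w. U w * (X t w $ i - mstep i q t (Y w) w)\<^sup>2) \<and>
    (\<integral>w. U w * (X t w $ i - mstep i q t (Y w) w)\<^sup>2 \<partial>M) \<le> (\<integral>w. U w * (e i w)\<^sup>2 \<partial>M)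
      + (2 * K + 2 * CM + 4 * (K\<^sup>2 + (real CARD('m))\<^sup>2 * K\<^sup>2 + real CARD('m) ^ 4 * KL\<^sup>2)) * \<theta> * E0 + (2 * CM + 8 * CT) * \<theta> ^ 3 * prob A" for i
  proof -
    define B where "B w = \<beta> i w \<bullet> (W t w - W q w)" for w
    define G where "G w = (\<Sum>j1\<in>UNIV. \<Sum>j2\<in>UNIV. \<gamma> i j1 j2 w * J q t j1 j2 w)" for w
    define Rm where "Rm = Rem i q t"
    define \<Delta> where "\<Delta> w = \<alpha> i w * \<theta> + B w + G w + Rm w" for w
    have ee: "X t w $ i - mstep i q t (Y w) w = e i w + \<Delta> w" for w
      unfolding mstep_def \<Delta>_def B_def G_def Rm_def Rem_def R_def e_def \<alpha>_def \<beta>_def \<gamma>_def \<theta>_def inner_diff_left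
      by (simp add: inner_vec_def algebra_simps sum_subtractf)
    have L\<alpha>: "L2 (\<lambda>w. \<alpha> i w * \<theta>)" using L2_cmult[OF bwt_L2[OF q(1) b\<alpha>], of \<theta> i] by (simp add: mult.commute)
    have LB: "L2 B" and EB: "(\<integral>w. U w * (B w)\<^sup>2 \<partial>M) \<le> (real CARD('m))\<^sup>2 * \<theta> * (K\<^sup>2 * E0)"
      unfolding B_def \<theta>_def by (rule dW_L2[OF q(1,2) b\<beta> bU U0 le_E0[OF bU2[OF b\<beta>] l\<beta>]])+
    have LgJ: "L2 (\<lambda>w. \<gamma> i j1 j2 w * J q t j1 j2 w)" for j1 j2
      by (rule bwt_L2mult[OF q(1) b\<gamma> J_props(1)[OF q(1,2) bU]])
    have LG: "L2 G" unfolding G_def by (intro L2_sum LgJ)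
    have EgJ: "(\<integral>w. U w * (\<gamma> i j1 j2 w * J q t j1 j2 w)\<^sup>2 \<partial>M) \<le> \<theta>\<^sup>2 * (KL\<^sup>2 * E0)" for j1 j2
    proof -
      have "(\<integral>w. U w * (\<gamma> i j1 j2 w * J q t j1 j2 w)\<^sup>2 \<partial>M) = (\<integral>w. (U w * (\<gamma> i j1 j2 w)\<^sup>2) * (J q t j1 j2 w)\<^sup>2 \<partial>M)"
        by (simp add: power_mult_distrib mult_ac)
      also have "\<dots> \<le> \<theta>\<^sup>2 * (\<integral>w. U w * (\<gamma> i j1 j2 w)\<^sup>2 \<partial>M)" unfolding \<theta>_def
        by (rule J_props(3)[OF q(1,2) bU2[OF b\<gamma>]]) (use U0 in auto)
      also have "\<dots> \<le> \<theta>\<^sup>2 * (KL\<^sup>2 * E0)" by (intro mult_left_mono le_E0[OF bU2[OF b\<gamma>] l\<gamma>]) auto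
      finally show ?thesis .
    qed
    have EG: "(\<integral>w. U w * (G w)\<^sup>2 \<partial>M) \<le> real CARD('m) ^ 4 * (\<theta>\<^sup>2 * (KL\<^sup>2 * E0))"
    proof -
      define m where "m = real CARD('m)"
      have m0: "0 \<le> m" unfolding m_def by simp
      have G2: "(G w)\<^sup>2 \<le> m * (\<Sum>j1\<in>UNIV. m * (\<Sum>j2\<in>UNIV. (\<gamma> i j1 j2 w * J q t j1 j2 w)\<^sup>2))" for w
      proof -
        have "(G w)\<^sup>2 \<le> m * (\<Sum>j1\<in>UNIV. (\<Sum>j2\<in>UNIV. \<gamma> i j1 j2 w * J q t j1 j2 w)\<^sup>2)" unfolding G_def m_def by (rule sum_sq_le)
        also have "\<dots> \<le> m * (\<Sum>j1\<in>UNIV. m * (\<Sum>j2\<in>UNIV. (\<gamma> i j1 j2 w * J q t j1 j2 w)\<^sup>2))"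
          unfolding m_def by (intro mult_left_mono sum_mono sum_sq_le) auto
        finally show ?thesis .
      qed
      have ii: "integrable M (\<lambda>w. U w * (\<gamma> i j1 j2 w * J q t j1 j2 w)\<^sup>2)" for j1 j2 by (rule iU[OF L2_sq[OF LgJ]])
      have "(\<integral>w. U w * (G w)\<^sup>2 \<partial>M) \<le> (\<integral>w. m * (\<Sum>j1\<in>UNIV. m * (\<Sum>j2\<in>UNIV. U w * (\<gamma> i j1 j2 w * J q t j1 j2 w)\<^sup>2)) \<partial>M)"
      proof (rule integral_mono)
        show "U w * (G w)\<^sup>2 \<le> m * (\<Sum>j1\<in>UNIV. m * (\<Sum>j2\<in>UNIV. U w * (\<gamma> i j1 j2 w * J q t j1 j2 w)\<^sup>2))" for w
          using mult_left_mono[OF G2[of w] U0[of w]] by (simp add: sum_distrib_left mult.left_commute)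
      qed (use ii iU[OF L2_sq[OF LG]] in auto)
      also have "\<dots> = m * (\<Sum>j1\<in>UNIV. m * (\<Sum>j2\<in>UNIV. \<integral>w. U w * (\<gamma> i j1 j2 w * J q t j1 j2 w)\<^sup>2 \<partial>M))"
        using ii by simp
      also have "\<dots> \<le> m * (\<Sum>j1\<in>(UNIV::'m set). m * (\<Sum>j2\<in>(UNIV::'m set). \<theta>\<^sup>2 * (KL\<^sup>2 * E0)))"
        using m0 by (intro mult_left_mono sum_mono EgJ) auto
      also have "\<dots> = m ^ 4 * (\<theta>\<^sup>2 * (KL\<^sup>2 * E0))" by (simp add: m_def[symmetric] eval_nat_numeral)
      finally show ?thesis unfolding m_def .
    qed
    note RP = Rem_props[OF q bU, of i, folded Rm_def \<theta>_def]
    have LD: "L2 \<Delta>" unfolding \<Delta>_def by (intro L2_add L\<alpha> LB LG RP(1))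
    have E\<alpha>: "(\<integral>w. U w * (\<alpha> i w * \<theta>)\<^sup>2 \<partial>M) \<le> \<theta>\<^sup>2 * (K\<^sup>2 * E0)"
    proof -
      have "(\<integral>w. U w * (\<alpha> i w * \<theta>)\<^sup>2 \<partial>M) = (\<integral>w. \<theta>\<^sup>2 * (U w * (\<alpha> i w)\<^sup>2) \<partial>M)" by (simp add: power_mult_distrib mult_ac)
      also have "\<dots> \<le> \<theta>\<^sup>2 * (K\<^sup>2 * E0)" using le_E0[OF bU2[OF b\<alpha>] l\<alpha>] by (simp add: mult_left_mono)
      finally show ?thesis .
    qed
    have ED: "(\<integral>w. U w * (\<Delta> w)\<^sup>2 \<partial>M) \<le> 4 * (\<theta>\<^sup>2 * (K\<^sup>2 * E0) + (real CARD('m))\<^sup>2 * \<theta> * (K\<^sup>2 * E0) + real CARD('m) ^ 4 * (\<theta>\<^sup>2 * (KL\<^sup>2 * E0)) + 2 * CT * \<theta> ^ 3 * prob A)"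
    proof -
      have "(\<integral>w. U w * (\<Delta> w)\<^sup>2 \<partial>M) \<le> (\<integral>w. 4 * (U w * (\<alpha> i w * \<theta>)\<^sup>2 + U w * (B w)\<^sup>2 + U w * (G w)\<^sup>2 + U w * (Rm w)\<^sup>2) \<partial>M)"
      proof (rule integral_mono)
        show "U w * (\<Delta> w)\<^sup>2 \<le> 4 * (U w * (\<alpha> i w * \<theta>)\<^sup>2 + U w * (B w)\<^sup>2 + U w * (G w)\<^sup>2 + U w * (Rm w)\<^sup>2)" for w
          using mult_left_mono[OF sq_sum4[of "\<alpha> i w * \<theta>" "B w" "G w" "Rm w"] U0[of w]] unfolding \<Delta>_def by (simp add: algebra_simps)
      qed (use iU L2_sq[OF LD] L2_sq[OF L\<alpha>] L2_sq[OF LB] L2_sq[OF LG] L2_sq[OF RP(1)] in auto)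
      also have "\<dots> = 4 * ((\<integral>w. U w * (\<alpha> i w * \<theta>)\<^sup>2 \<partial>M) + (\<integral>w. U w * (B w)\<^sup>2 \<partial>M) + (\<integral>w. U w * (G w)\<^sup>2 \<partial>M) + (\<integral>w. U w * (Rm w)\<^sup>2 \<partial>M))"
        using iU[OF L2_sq[OF L\<alpha>]] iU[OF L2_sq[OF LB]] iU[OF L2_sq[OF LG]] iU[OF L2_sq[OF RP(1)]] by simp
      also have "\<dots> \<le> 4 * (\<theta>\<^sup>2 * (K\<^sup>2 * E0) + (real CARD('m))\<^sup>2 * \<theta> * (K\<^sup>2 * E0) + real CARD('m) ^ 4 * (\<theta>\<^sup>2 * (KL\<^sup>2 * E0)) + 2 * CT * \<theta> ^ 3 * prob A)"
        by (intro mult_left_mono add_mono E\<alpha> EB EG RP(2)[OF U0, unfolded EU]) simp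
      finally show ?thesis .
    qed
    have iUe: "integrable M (\<lambda>w. (U w * e i w) * Z w)" if "L2 Z" for Z by (rule bwt_imult[OF q(1) bUe L2_integrable[OF that]])
    have cross: "(\<integral>w. (U w * e i w) * \<Delta> w \<partial>M) \<le> K * \<theta> * E0 + CM * (\<theta> ^ 3 * prob A + \<theta> * E0)"
    proof -
      have c1: "(\<integral>w. (U w * e i w) * (\<alpha> i w * \<theta>) \<partial>M) \<le> K * \<theta> * E0"
      proof -
        have "(\<integral>w. (U w * e i w) * (\<alpha> i w * \<theta>) \<partial>M) \<le> (\<integral>w. (K * \<theta>) * (U w * (N w)\<^sup>2) \<partial>M)"
        proof (rule integral_mono)
          fix w
          have "\<bar>e i w\<bar> * \<bar>\<alpha> i w\<bar> \<le> N w * (K * N w)" using eN l\<alpha> N0 by (intro mult_mono) auto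
          then have "e i w * \<alpha> i w \<le> K * (N w)\<^sup>2" unfolding abs_mult[symmetric] by (simp add: power2_eq_square mult_ac)
          then have "(U w * \<theta>) * (e i w * \<alpha> i w) \<le> (U w * \<theta>) * (K * (N w)\<^sup>2)" using U0 \<theta> by (intro mult_left_mono) auto
          then show "(U w * e i w) * (\<alpha> i w * \<theta>) \<le> (K * \<theta>) * (U w * (N w)\<^sup>2)" by (simp add: mult_ac)
        qed (use iUe[OF L\<alpha>] bwt_integrable[OF q(1) bUN2] in auto)
        then show ?thesis unfolding E0_def by simp
      qed
      have c2: "(\<integral>w. (U w * e i w) * B w \<partial>M) = 0" unfolding B_def by (rule EUbW(2)[OF q(1,2) bUe b\<beta>])
      have c3: "(\<integral>w. (U w * e i w) * G w \<partial>M) = 0"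
      proof -
        have z: "(\<integral>w. (U w * e i w * \<gamma> i j1 j2 w) * J q t j1 j2 w \<partial>M) = 0" for j1 j2
          by (rule J_props(2)[OF q(1,2) bwt_mult[OF bUe b\<gamma>]])
        have zi: "integrable M (\<lambda>w. (U w * e i w * \<gamma> i j1 j2 w) * J q t j1 j2 w)" for j1 j2
          using iUe[OF LgJ] by (simp add: mult.assoc)
        have "(\<integral>w. (U w * e i w) * G w \<partial>M) = (\<integral>w. (\<Sum>j1\<in>UNIV. \<Sum>j2\<in>UNIV. (U w * e i w * \<gamma> i j1 j2 w) * J q t j1 j2 w) \<partial>M)"
          unfolding G_def by (simp add: sum_distrib_left mult.assoc)
        also have "\<dots> = (\<Sum>j1\<in>UNIV. \<Sum>j2\<in>UNIV. \<integral>w. (U w * e i w * \<gamma> i j1 j2 w) * J q t j1 j2 w \<partial>M)"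
          using zi by (simp add: Bochner_Integration.integral_sum)
        finally show ?thesis using z by simp
      qed
      have c4: "(\<integral>w. (U w * e i w) * Rm w \<partial>M) \<le> CM * (\<theta> ^ 3 * prob A + \<theta> * E0)"
      proof -
        have "(\<integral>w. (U w * e i w) * Rm w \<partial>M) \<le> 2 * CM * \<theta>\<^sup>2 * (\<integral>w. \<bar>U w * e i w\<bar> \<partial>M)"
          using Rem_props(3)[OF q bUe, of i i] unfolding Rm_def \<theta>_def by linarith
        also have "\<dots> = CM * (\<integral>w. 2 * \<theta>\<^sup>2 * \<bar>U w * e i w\<bar> \<partial>M)" by simp
        also have "\<dots> \<le> CM * (\<integral>w. \<theta> ^ 3 * U w + \<theta> * (U w * (N w)\<^sup>2) \<partial>M)"
        proof (intro mult_left_mono integral_mono CM0)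
          fix w
          \<comment> \<open>The weighting is chosen so that, after multiplication by
            \<open>\<theta>\<close>, the pure local part has order \<open>\<theta> ^ 3\<close> and
            the inherited part is linear in \<open>\<theta>\<close>.\<close>
          have "2 * \<theta> * \<bar>e i w\<bar> \<le> \<theta>\<^sup>2 + (N w)\<^sup>2"
          proof -
            have "2 * \<theta> * \<bar>e i w\<bar> \<le> 2 * \<theta> * N w" using eN \<theta> by (intro mult_left_mono) auto
            also have "\<dots> \<le> \<theta>\<^sup>2 + (N w)\<^sup>2" using zero_le_power2[of "\<theta> - N w"] unfolding power2_diff by simp
            finally show ?thesis .
          qed
          from mult_left_mono[OF this, of "\<theta> * U w"] show "2 * \<theta>\<^sup>2 * \<bar>U w * e i w\<bar> \<le> \<theta> ^ 3 * U w + \<theta> * (U w * (N w)\<^sup>2)"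
            using U0[of w] \<theta> by (simp add: abs_mult algebra_simps power2_eq_square power3_eq_cube)
        qed (use bwt_integrable[OF q(1) bU] bwt_integrable[OF q(1) bUN2] bwt_integrable[OF q(1) bUe] in auto)
        also have "(\<integral>w. \<theta> ^ 3 * U w + \<theta> * (U w * (N w)\<^sup>2) \<partial>M) = \<theta> ^ 3 * prob A + \<theta> * E0"
          unfolding E0_def EU[symmetric] using bwt_integrable[OF q(1) bU] bwt_integrable[OF q(1) bUN2] by simp
        finally show ?thesis .
      qed
      have "(\<integral>w. (U w * e i w) * \<Delta> w \<partial>M) = (\<integral>w. (U w * e i w) * (\<alpha> i w * \<theta>) \<partial>M) + (\<integral>w. (U w * e i w) * B w \<partial>M) + (\<integral>w. (U w * e i w) * G w \<partial>M) + (\<integral>w. (U w * e i w) * Rm w \<partial>M)"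
        unfolding \<Delta>_def distrib_left[of "U _ * e i _"] using iUe[OF L\<alpha>] iUe[OF LB] iUe[OF LG] iUe[OF RP(1)] by simp
      then show ?thesis using c1 c2 c3 c4 by linarith
    qed
    have sq: "U w * (e i w + \<Delta> w)\<^sup>2 = U w * (e i w)\<^sup>2 + 2 * ((U w * e i w) * \<Delta> w) + U w * (\<Delta> w)\<^sup>2" for w
      by (simp add: algebra_simps power2_eq_square)
    have i1: "integrable M (\<lambda>w. U w * (e i w)\<^sup>2)" "integrable M (\<lambda>w. U w * (\<Delta> w)\<^sup>2)" "integrable M (\<lambda>w. (U w * e i w) * \<Delta> w)"
      using bwt_integrable[OF q(1) bUe2] iU[OF L2_sq[OF LD]] iUe[OF LD] by auto
    have "\<theta>\<^sup>2 \<le> \<theta>" using \<theta> by (simp add: power2_eq_square)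
    then have tk: "\<theta>\<^sup>2 * (c\<^sup>2 * E0) \<le> \<theta> * (c\<^sup>2 * E0)" for c using E00 by (intro mult_right_mono) auto
    have th: "4 * (\<theta>\<^sup>2 * (K\<^sup>2 * E0) + (real CARD('m))\<^sup>2 * \<theta> * (K\<^sup>2 * E0) + real CARD('m) ^ 4 * (\<theta>\<^sup>2 * (KL\<^sup>2 * E0)) + 2 * CT * \<theta> ^ 3 * prob A)
       \<le> 4 * (\<theta> * (K\<^sup>2 * E0) + (real CARD('m))\<^sup>2 * \<theta> * (K\<^sup>2 * E0) + real CARD('m) ^ 4 * (\<theta> * (KL\<^sup>2 * E0)) + 2 * CT * \<theta> ^ 3 * prob A)"
      by (intro mult_left_mono add_mono order_refl tk) auto
    have "(\<integral>w. U w * (e i w + \<Delta> w)\<^sup>2 \<partial>M) = (\<integral>w. U w * (e i w)\<^sup>2 \<partial>M) + 2 * (\<integral>w. (U w * e i w) * \<Delta> w \<partial>M) + (\<integral>w. U w * (\<Delta> w)\<^sup>2 \<partial>M)"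
      unfolding sq using i1 by simp
    also have "\<dots> \<le> (\<integral>w. U w * (e i w)\<^sup>2 \<partial>M) + 2 * (K * \<theta> * E0 + CM * (\<theta> ^ 3 * prob A + \<theta> * E0))
       + 4 * (\<theta> * (K\<^sup>2 * E0) + (real CARD('m))\<^sup>2 * \<theta> * (K\<^sup>2 * E0) + real CARD('m) ^ 4 * (\<theta> * (KL\<^sup>2 * E0)) + 2 * CT * \<theta> ^ 3 * prob A)"
      by (intro add_mono mult_left_mono order_refl cross order_trans[OF ED th]) simp
    also have "\<dots> = (\<integral>w. U w * (e i w)\<^sup>2 \<partial>M)
      + (2 * K + 2 * CM + 4 * (K\<^sup>2 + (real CARD('m))\<^sup>2 * K\<^sup>2 + real CARD('m) ^ 4 * KL\<^sup>2)) * \<theta> * E0 + (2 * CM + 8 * CT) * \<theta> ^ 3 * prob A"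
      by (simp add: algebra_simps)
    finally show ?thesis unfolding ee using i1 unfolding sq by auto
  qed
  have s1: "U w * (\<Sum>i\<in>UNIV. (X t w $ i - mstep i q t (Y w) w)\<^sup>2) = (\<Sum>i\<in>UNIV. U w * (X t w $ i - mstep i q t (Y w) w)\<^sup>2)" for w
    by (rule sum_distrib_left)
  show ?I unfolding U_def[symmetric] s1 using main by auto
  show ?NN unfolding U_def[symmetric] using bwt_integrable[OF q(1) bUN2] unfolding N_def .
  have "(\<integral>w. U w * (\<Sum>i\<in>UNIV. (X t w $ i - mstep i q t (Y w) w)\<^sup>2) \<partial>M) = (\<Sum>i\<in>UNIV. \<integral>w. U w * (X t w $ i - mstep i q t (Y w) w)\<^sup>2 \<partial>M)"
    unfolding s1 using main by simp
  also have "\<dots> \<le> (\<Sum>i\<in>UNIV. (\<integral>w. U w * (e i w)\<^sup>2 \<partial>M)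
      + (2 * K + 2 * CM + 4 * (K\<^sup>2 + (real CARD('m))\<^sup>2 * K\<^sup>2 + real CARD('m) ^ 4 * KL\<^sup>2)) * \<theta> * E0 + (2 * CM + 8 * CT) * \<theta> ^ 3 * prob A)"
    by (intro sum_mono) (use main in blast)
  also have "\<dots> = (\<Sum>i\<in>UNIV. (\<integral>w. U w * (e i w)\<^sup>2 \<partial>M)) + CS1 * \<theta> * E0 + CS2 * \<theta> ^ 3 * prob A"
    unfolding CS1_def CS2_def sum.distrib by simp
  also have "(\<Sum>i\<in>UNIV. (\<integral>w. U w * (e i w)\<^sup>2 \<partial>M)) = E0"
    unfolding E0_def N2 sum_distrib_left using bwt_integrable[OF q(1) bUe2] by simp
  finally show ?E unfolding U_def[symmetric] N_def[symmetric] E0_def[symmetric] \<theta>_def[symmetric] by (simp add: algebra_simps)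
qed

end

subsection \<open>Strong error on the random time grid\<close>

locale scheme = sde_mil M F W a b x0 X K Cb J
  for M :: "'w measure" and F and W :: "real \<Rightarrow> 'w \<Rightarrow> real^'m::finite"
    and a :: "real^'d::finite \<Rightarrow> real^'d" and b :: "real^'d \<Rightarrow> real^'m^'d" and x0 X K Cb J +
  fixes D :: "(real^'d) set" and h T :: real
  assumes h: "0 < h" "h < 1" and T0: "0 < T"
begin

definition tn :: "nat \<Rightarrow> 'w \<Rightarrow> real" where "tn n w = fst (milstein D Cb h a b W J x0 n w)"
definition yn :: "nat \<Rightarrow> 'w \<Rightarrow> real^'d" where "yn n w = snd (milstein D Cb h a b W J x0 n w)"
definition th :: "real^'d \<Rightarrow> real" where "th y = step_size D Cb h y"

lemma tn_0: "tn 0 w = 0" and yn_0: "yn 0 w = x0"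
  by (auto simp: tn_def yn_def)

lemma tn_Suc: "tn (Suc n) w = tn n w + th (yn n w)"
  by (simp add: tn_def yn_def th_def case_prod_beta Let_def)

lemma yn_Suc: "yn (Suc n) w $ i = mstep i (tn n w) (tn (Suc n) w) (yn n w) w"
  by (simp add: tn_def yn_def th_def case_prod_beta Let_def mstep_def)

lemma h2: "0 < h\<^sup>2" "h\<^sup>2 < h" "h\<^sup>2 < 1"
proof -
  show "0 < h\<^sup>2" using h by simp
  have "h * h < 1 * h" using h by (intro mult_strict_right_mono) auto
  then show "h\<^sup>2 < h" by (simp add: power2_eq_square)
  then show "h\<^sup>2 < 1" using h by linarith
qed

lemma th_cases: "th y = h \<or> th y = h\<^sup>2"
  unfolding th_def step_size_def Let_def by auto

lemma th_bounds: "0 < th y" "h\<^sup>2 \<le> th y" "th y \<le> h" "th y \<le> 1"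
proof -
  have "0 < th y \<and> h\<^sup>2 \<le> th y \<and> th y \<le> h \<and> th y \<le> 1"
    using th_cases[of y]
  proof
    assume "th y = h"
    then show ?thesis using h h2(2) by (intro conjI) linarith+
  next
    assume "th y = h\<^sup>2"
    then show ?thesis using h2 by (intro conjI) linarith+
  qed
  then show "0 < th y" "h\<^sup>2 \<le> th y" "th y \<le> h" "th y \<le> 1" by auto
qed

lemma th_meas: "th \<in> borel_measurable borel"
proof -
  have [measurable]: "(\<lambda>y. infdist y (frontier D)) \<in> borel_measurable borel"
    by (intro borel_measurable_continuous_onI continuous_on_infdist continuous_on_id)
  show ?thesis unfolding th_def step_size_def Let_def by measurable
qed

lemma tn_mono: "tn n w < tn (Suc n) w"
  unfolding tn_Suc using th_bounds by simp

lemma tn_le: "m \<le> n \<Longrightarrow> tn m w \<le> tn n w"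
  by (rule lift_Suc_mono_le[of "\<lambda>n. tn n w"]) (auto intro: less_imp_le tn_mono)

lemma tn_nonneg: "0 \<le> tn n w"
  using tn_le[of 0 n w] tn_0 by simp

lemma tn_ge: "real n * h\<^sup>2 \<le> tn n w"
proof (induction n)
  case (Suc n)
  then show ?case unfolding tn_Suc using th_bounds(2)[of "yn n w"] by (simp add: algebra_simps)
qed (simp add: tn_0)

primrec Ts :: "nat \<Rightarrow> real set" where
  "Ts 0 = {0}"
| "Ts (Suc n) = (\<lambda>p. fst p + snd p) ` (Ts n \<times> {h, h\<^sup>2})"

lemma Ts_finite: "finite (Ts n)" by (induction n) auto

lemma Ts_nonneg: "q \<in> Ts n \<Longrightarrow> 0 \<le> q"
  using h by (induction n arbitrary: q) (auto intro: add_nonneg_nonneg less_imp_le)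

lemma tn_Ts: "tn n w \<in> Ts n"
proof (induction n)
  case (Suc n)
  then show ?case unfolding tn_Suc using th_cases[of "yn n w"] by (auto intro!: image_eqI[of _ _ "(tn n w, th (yn n w))"])
qed (simp add: tn_0)

definition Eq :: "nat \<Rightarrow> real \<Rightarrow> 'w set" where "Eq n q = {w\<in>space M. tn n w = q}"
text \<open>The default value 0 off the event makes the function \<open>F q\<close>-measurable,
  which the state of the scheme at a random time need not be.\<close>

definition Yq :: "nat \<Rightarrow> real \<Rightarrow> 'w \<Rightarrow> real^'d" where "Yq n q w = (if tn n w = q then yn n w else 0)"
text \<open>Fixing the step together with the time makes the next time deterministic on the event,
  so that \<open>J\<close> occurs there at deterministic times only.\<close>

definition G :: "nat \<Rightarrow> real \<times> real \<Rightarrow> 'w set" where "G n p = {w\<in>space M. tn n w = fst p \<and> th (yn n w) = snd p}"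

lemma G_sets:
  assumes "0 \<le> q" "Eq n q \<in> sets (F q)" "Yq n q \<in> borel_measurable (F q)"
  shows "G n (q, \<theta>) \<in> sets (F q)"
proof -
  have m: "(\<lambda>w. th (Yq n q w)) \<in> borel_measurable (F q)" by (rule measurable_compose[OF assms(3) th_meas])
  have "G n (q, \<theta>) = Eq n q \<inter> ((\<lambda>w. th (Yq n q w)) -` {\<theta>} \<inter> space (F q))"
    unfolding G_def Eq_def Yq_def space_F[OF assms(1)] by auto
  also have "\<dots> \<in> sets (F q)" by (rule sets.Int[OF assms(2) measurable_sets[OF m]]) simp
  finally show ?thesis .
qed

lemma G_cover: "w \<in> space M \<Longrightarrow> w \<in> G n p \<longleftrightarrow> p = (tn n w, th (yn n w))"
  unfolding G_def by (cases p) auto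

text \<open>A time \<open>q'\<close> is reached at step \<open>n + 1\<close> from finitely many
  pairs of an earlier time and a step; on each of these events the new state is a measurable
  function of quantities known at \<open>q'\<close>.\<close>

lemma adapted: "0 \<le> q \<Longrightarrow> Eq n q \<in> sets (F q) \<and> Yq n q \<in> borel_measurable (F q)"
proof (induction n arbitrary: q)
  case 0
  have "Eq 0 q = (if q = 0 then space (F q) else {})" unfolding Eq_def using space_F 0 by (auto simp: tn_0)
  moreover have "Yq 0 q = (\<lambda>_. if q = 0 then x0 else 0)" unfolding Yq_def by (auto simp: tn_0 yn_0)
  ultimately show ?case by auto
next
  case (Suc n q')
  define I where "I = {p \<in> Ts n \<times> {h, h\<^sup>2}. fst p + snd p = q'}"
  have fI: "finite I" unfolding I_def using Ts_finite by auto
  have Iq: "0 \<le> fst p" "fst p \<le> q'" "fst p < q'" if "p \<in> I" for p using that Ts_nonneg h unfolding I_def by auto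
  have GI: "G n p \<in> sets (F (fst p))" if "p \<in> I" for p
    using G_sets[OF Iq(1)[OF that]] Suc.IH[OF Iq(1)[OF that]] by (cases p) auto
  have GI': "G n p \<in> sets (F q')" if "p \<in> I" for p using sets_F_mono[OF Iq(1,2)[OF that] GI[OF that]] .
  have E: "Eq (Suc n) q' = (\<Union>p\<in>I. G n p)"
  proof (intro set_eqI iffI)
    fix w assume "w \<in> Eq (Suc n) q'"
    then have w: "w \<in> space M" "tn n w + th (yn n w) = q'" unfolding Eq_def tn_Suc by auto
    then have "(tn n w, th (yn n w)) \<in> I" unfolding I_def using tn_Ts th_cases[of "yn n w"] by auto
    moreover have "w \<in> G n (tn n w, th (yn n w))" using G_cover[OF w(1)] by auto
    ultimately show "w \<in> (\<Union>p\<in>I. G n p)" by blast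
  qed (auto simp: Eq_def tn_Suc G_def I_def)
  define \<Psi> where "\<Psi> p w = (\<chi> i. mstep i (fst p) q' (Yq n (fst p) w) w)" for p :: "real \<times> real" and w
  have m\<Psi>: "\<Psi> p \<in> borel_measurable (F q')" if p: "p \<in> I" for p
  proof -
    have "Yq n (fst p) \<in> borel_measurable (F (fst p))" using Suc.IH[OF Iq(1)[OF p]] by simp
    then have Y[measurable]: "Yq n (fst p) \<in> borel_measurable (F q')" by (rule meas_F_mono[OF Iq(1,2)[OF p]])
    have [measurable]: "W q' \<in> borel_measurable (F q')" "W (fst p) \<in> borel_measurable (F q')" 
      "J (fst p) q' j1 j2 \<in> borel_measurable (F q')"
      "(\<lambda>w. a (Yq n (fst p) w) $ i) \<in> borel_measurable (F q')"
      "(\<lambda>w. b (Yq n (fst p) w) $ i $ j) \<in> borel_measurable (F q')"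
      "(\<lambda>w. Lop b j1 i j2 (Yq n (fst p) w)) \<in> borel_measurable (F q')" for j1 j2 i j
      using meas_W[of q'] meas_W_le[of "fst p" q'] meas_J[of "fst p" q'] Iq[OF p] Suc.prems
        measurable_compose[OF Y nice_meas[OF na]] measurable_compose[OF Y nice_meas[OF nb]] measurable_compose[OF Y Lop_meas] by auto
    show ?thesis unfolding \<Psi>_def by (rule measurable_vecI) (simp add: mstep_def)
  qed
  have "(\<lambda>w. \<Sum>p\<in>I. indicator (G n p) w *\<^sub>R \<Psi> p w) \<in> borel_measurable (F q')"
    by (intro borel_measurable_sum borel_measurable_scaleR m\<Psi> borel_measurable_indicator GI')
  moreover have "Yq (Suc n) q' w = (\<Sum>p\<in>I. indicator (G n p) w *\<^sub>R \<Psi> p w)" if w: "w \<in> space (F q')" for w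
  proof -
    have w: "w \<in> space M" using w space_F[OF Suc.prems] by simp
    let ?p = "(tn n w, th (yn n w))"
    have "(\<Sum>p\<in>I. indicator (G n p) w *\<^sub>R \<Psi> p w) = (\<Sum>p\<in>I. if p = ?p then \<Psi> p w else 0)"
      by (intro sum.cong refl) (auto simp: indicator_def G_cover[OF w])
    also have "\<dots> = (if ?p \<in> I then \<Psi> ?p w else 0)" using fI by simp
    also have "?p \<in> I \<longleftrightarrow> tn (Suc n) w = q'" unfolding I_def tn_Suc using tn_Ts th_cases[of "yn n w"] by auto
    also have "(if tn (Suc n) w = q' then \<Psi> ?p w else 0) = Yq (Suc n) q' w"
      unfolding Yq_def \<Psi>_def by (auto simp: vec_eq_iff yn_Suc)
    finally show ?thesis by simp
  qed
  ultimately have "Yq (Suc n) q' \<in> borel_measurable (F q')" by (subst measurable_cong) auto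
  moreover have "Eq (Suc n) q' \<in> sets (F q')" unfolding E using fI GI' by auto
  ultimately show ?case by simp
qed

text \<open>Membership in the sigma-algebra of the stopping time \<open>tn n\<close>, which takes finitely many values.\<close>

definition obs :: "nat \<Rightarrow> 'w set \<Rightarrow> bool" where
  "obs n A \<longleftrightarrow> A \<subseteq> space M \<and> (\<forall>q\<ge>0. A \<inter> Eq n q \<in> sets (F q))"

lemma G_F: "0 \<le> fst p \<Longrightarrow> G n p \<in> sets (F (fst p))"
  using G_sets adapted by (cases p) auto

lemma obs_G: "obs n A \<Longrightarrow> 0 \<le> fst p \<Longrightarrow> A \<inter> G n p \<in> sets (F (fst p))"
proof -
  assume A: "obs n A" "0 \<le> fst p"
  have "A \<inter> G n p = (A \<inter> Eq n (fst p)) \<inter> G n p" unfolding G_def Eq_def by auto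
  moreover have "A \<inter> Eq n (fst p) \<in> sets (F (fst p))" using A unfolding obs_def by auto
  ultimately show ?thesis using sets.Int[OF _ G_F[OF A(2), of n]] by simp
qed

lemma obs_Suc: assumes "obs n A" shows "obs (Suc n) A"
  unfolding obs_def
proof (intro conjI allI impI)
  show "A \<subseteq> space M" using assms unfolding obs_def by simp
  fix q' :: real assume q': "0 \<le> q'"
  define I where "I = {p \<in> Ts n \<times> {h, h\<^sup>2}. fst p + snd p = q'}"
  have fI: "finite I" unfolding I_def using Ts_finite by auto
  have "A \<inter> Eq (Suc n) q' = (\<Union>p\<in>I. A \<inter> G n p)"
  proof (intro set_eqI iffI)
    fix w assume "w \<in> A \<inter> Eq (Suc n) q'"
    then have w: "w \<in> A" "w \<in> space M" "tn n w + th (yn n w) = q'" unfolding Eq_def tn_Suc by auto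
    then have "(tn n w, th (yn n w)) \<in> I" unfolding I_def using tn_Ts th_cases[of "yn n w"] by auto
    moreover have "w \<in> G n (tn n w, th (yn n w))" using G_cover[OF w(2)] by auto
    ultimately show "w \<in> (\<Union>p\<in>I. A \<inter> G n p)" using w(1) by blast
  qed (auto simp: Eq_def tn_Suc G_def I_def)
  also have "\<dots> \<in> sets (F q')"
  proof (intro sets.finite_UN fI)
    fix p assume p: "p \<in> I"
    then have "0 \<le> fst p" "fst p \<le> q'" using Ts_nonneg h unfolding I_def by auto
    then show "A \<inter> G n p \<in> sets (F q')" using obs_G[OF assms] sets_F_mono by blast
  qed
  finally show "A \<inter> Eq (Suc n) q' \<in> sets (F q')" .
qed

lemma obs_mono: "obs m A \<Longrightarrow> m \<le> n \<Longrightarrow> obs n A"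
  by (induction n) (auto simp: le_Suc_eq intro: obs_Suc)

lemma obs_Int: "obs n A \<Longrightarrow> obs n B \<Longrightarrow> obs n (A \<inter> B)"
  unfolding obs_def
proof (intro conjI allI impI)
  fix q :: real assume *: "A \<subseteq> space M \<and> (\<forall>q\<ge>0. A \<inter> Eq n q \<in> sets (F q))" "B \<subseteq> space M \<and> (\<forall>q\<ge>0. B \<inter> Eq n q \<in> sets (F q))" "0 \<le> q"
  have "A \<inter> B \<inter> Eq n q = (A \<inter> Eq n q) \<inter> (B \<inter> Eq n q)" by auto
  then show "A \<inter> B \<inter> Eq n q \<in> sets (F q)" using * by auto
qed auto

lemma obs_space: "obs n (space M)"
  unfolding obs_def using adapted[of _ n] by (auto simp: Eq_def Int_absorb1)

lemma obs_INT: "finite I \<Longrightarrow> (\<And>i. i \<in> I \<Longrightarrow> obs n (A i)) \<Longrightarrow> obs n (space M \<inter> (\<Inter>i\<in>I. A i))"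
proof (induction I rule: finite_induct)
  case (insert i I)
  have "space M \<inter> (\<Inter>i\<in>insert i I. A i) = (space M \<inter> (\<Inter>i\<in>I. A i)) \<inter> A i" by auto
  then show ?case using insert obs_Int by auto
qed (simp add: obs_space)

lemma obs_pred: 
  assumes "\<And>q. 0 \<le> q \<Longrightarrow> {w\<in>space M. P q w (Yq n q w)} \<in> sets (F q)"
  shows "obs n {w\<in>space M. P (tn n w) w (yn n w)}"
  unfolding obs_def
proof (intro conjI allI impI)
  fix q :: real assume q: "0 \<le> q"
  have "{w\<in>space M. P (tn n w) w (yn n w)} \<inter> Eq n q = {w\<in>space M. P q w (Yq n q w)} \<inter> Eq n q"
    unfolding Eq_def Yq_def by auto
  then show "{w\<in>space M. P (tn n w) w (yn n w)} \<inter> Eq n q \<in> sets (F q)" using assms[OF q] adapted[OF q] by auto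
qed auto

lemma obs_M: assumes "obs n A" shows "A \<in> sets M"
proof -
  have "A = (\<Union>q\<in>Ts n. A \<inter> Eq n q)" using assms tn_Ts unfolding obs_def Eq_def by auto
  also have "\<dots> \<in> sets M" using assms Ts_nonneg sets_F_M unfolding obs_def
    by (intro sets.finite_UN Ts_finite) blast
  finally show ?thesis .
qed

definition err :: "nat \<Rightarrow> 'w \<Rightarrow> real" where
  "err n w = norm (X (tn n w) w - yn n w)"

lemma obs_err: "obs n {w\<in>space M. err n w \<le> \<rho>}"
  unfolding err_def
proof (rule obs_pred[where P="\<lambda>q w y. norm (X q w - y) \<le> \<rho>"])
  fix q :: real assume q: "0 \<le> q"
  have [measurable]: "X q \<in> borel_measurable (F q)" "Yq n q \<in> borel_measurable (F q)" using meas_X[OF q] adapted[OF q] by auto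
  show "{w\<in>space M. norm (X q w - Yq n q w) \<le> \<rho>} \<in> sets (F q)" unfolding space_F[OF q, symmetric] by measurable
qed

lemma obs_tn: "obs n {w\<in>space M. tn n w < c}"
proof (rule obs_pred[where P="\<lambda>q w y. q < c"])
  fix q :: real assume q: "0 \<le> q"
  show "{w\<in>space M. q < c} \<in> sets (F q)" unfolding space_F[OF q, symmetric] by measurable
qed

lemma err_meas: "err n \<in> borel_measurable M"
proof (subst borel_measurable_iff_le, intro allI)
  fix c show "{w\<in>space M. err n w \<le> c} \<in> sets M" by (rule obs_M[OF obs_err])
qed

lemma tn_meas: "tn n \<in> borel_measurable M"
proof (subst borel_measurable_iff_less, intro allI)
  fix c show "{w\<in>space M. tn n w < c} \<in> sets M" by (rule obs_M[OF obs_tn])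
qed

text \<open>A Gronwall factor times the local errors collected over the horizon.
  \<open>T + 1\<close> replaces \<open>T\<close> because the step that crosses \<open>T\<close> may
  end up to one unit later.\<close>

definition CE :: real where "CE = CS2 * (T + 1) * exp (CS1 * (T + 1))"

lemma CE0: "0 \<le> CE" unfolding CE_def using CS0 T0 by auto

text \<open>Activity requires that the error has not exceeded \<open>\<rho>\<close> so far; this
  provides the bounded inherited error that \<open>one_step\<close> asks for and at the same time
  yields the first passage form of the maximum.\<close>

lemma err_ville:
  assumes \<rho>: "0 < \<rho>"
  shows "emeasure M {w\<in>space M. \<exists>n<N. tn n w < T \<and> \<rho> < err (Suc n) w} \<le> ennreal (CE * h\<^sup>2 / \<rho>\<^sup>2)"
proof -
  define Act where "Act n = {w\<in>space M. \<forall>k\<le>n. tn k w < T \<and> err k w \<le> \<rho>}" for n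
  define H where "H n = Act n \<inter> {w\<in>space M. \<rho> < err (Suc n) w}" for n
  \<comment> \<open>The discount compensates the growth rate \<open>CS1\<close>; the second term is
    a budget for local errors still to come, and it stays nonnegative up to time
    \<open>T + 1\<close>.\<close>
  define Y where "Y n w = exp (- CS1 * tn n w) * (err n w)\<^sup>2 + CS2 * h\<^sup>2 * (T + 1 - tn n w)" for n w
  have oAct: "obs n (Act n)" for n
  proof -
    have "Act n = space M \<inter> (\<Inter>k\<in>{..n}. {w\<in>space M. tn k w < T} \<inter> {w\<in>space M. err k w \<le> \<rho>})" unfolding Act_def by auto
    moreover have "obs n (space M \<inter> (\<Inter>k\<in>{..n}. {w\<in>space M. tn k w < T} \<inter> {w\<in>space M. err k w \<le> \<rho>}))"
      by (intro obs_INT finite_atMost obs_Int; rule obs_mono[OF obs_tn] obs_mono[OF obs_err]; simp)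
    ultimately show ?thesis by simp
  qed
  have mAct[measurable]: "Act n \<in> sets M" for n by (rule obs_M[OF oAct])
  note err_meas[measurable] tn_meas[measurable]
  have mH[measurable]: "H n \<in> sets M" for n unfolding H_def by measurable
  have mY[measurable]: "Y n \<in> borel_measurable M" for n unfolding Y_def by measurable
  have step: "(\<integral>\<^sup>+w. indicator (Act n) w * ennreal (Y (Suc n) w) \<partial>M) \<le> (\<integral>\<^sup>+w. indicator (Act n) w * ennreal (Y n w) \<partial>M)" for n
  proof -
    let ?P = "Ts n \<times> {h, h\<^sup>2}"
    have fP: "finite ?P" using Ts_finite by auto
    have split: "indicator (Act n) w = (\<Sum>p\<in>?P. indicator (Act n \<inter> G n p) w :: ennreal)" if w: "w \<in> space M" for w
    proof -
      let ?p = "(tn n w, th (yn n w))"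
      have "(\<Sum>p\<in>?P. indicator (Act n \<inter> G n p) w :: ennreal) = (\<Sum>p\<in>?P. if p = ?p then indicator (Act n) w else 0)"
        by (intro sum.cong refl) (auto simp: indicator_def G_cover[OF w])
      also have "\<dots> = indicator (Act n) w" using fP tn_Ts[of n w] th_cases[of "yn n w"] by simp
      finally show ?thesis by simp
    qed
    have Gm[measurable]: "Act n \<inter> G n p \<in> sets M" if "p \<in> ?P" for p
      using obs_G[OF oAct, of p n] Ts_nonneg that sets_F_M by (cases p) auto
    have sp: "(\<integral>\<^sup>+w. indicator (Act n) w * f w \<partial>M) = (\<Sum>p\<in>?P. \<integral>\<^sup>+w. indicator (Act n \<inter> G n p) w * f w \<partial>M)" 
      if [measurable]: "f \<in> borel_measurable M" for f
    proof -
      have "(\<integral>\<^sup>+w. indicator (Act n) w * f w \<partial>M) = (\<integral>\<^sup>+w. (\<Sum>p\<in>?P. indicator (Act n \<inter> G n p) w * f w) \<partial>M)"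
        by (intro nn_integral_cong) (simp only: split sum_distrib_right)
      also have "\<dots> = (\<Sum>p\<in>?P. \<integral>\<^sup>+w. indicator (Act n \<inter> G n p) w * f w \<partial>M)"
        using Gm by (intro nn_integral_sum) measurable
      finally show ?thesis .
    qed
    have "(\<integral>\<^sup>+w. indicator (Act n \<inter> G n p) w * ennreal (Y (Suc n) w) \<partial>M) \<le> (\<integral>\<^sup>+w. indicator (Act n \<inter> G n p) w * ennreal (Y n w) \<partial>M)"
      if p: "p \<in> ?P" for p
    proof (cases "fst p < T")
      case False
      then have "Act n \<inter> G n p = {}" unfolding Act_def G_def by auto
      then show ?thesis by simp
    next
      case True
      obtain q \<theta> where pq: "p = (q, \<theta>)" by (cases p)
      have q: "0 \<le> q" "q < T" using p True Ts_nonneg unfolding pq by auto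
      have "\<theta> = h \<or> \<theta> = h\<^sup>2" using p unfolding pq by auto
      then have \<theta>: "0 < \<theta>" "\<theta> \<le> 1" "\<theta> \<le> h" using h h2 by (elim disjE; linarith)+
      define A where "A = Act n \<inter> G n p"
      have AF: "A \<in> sets (F q)" unfolding A_def using obs_G[OF oAct, of p n] q unfolding pq by simp
      have AM[measurable]: "A \<in> sets M" using sets_F_M[OF q(1) AF] .
      have onA: "tn n w = q" "tn (Suc n) w = q + \<theta>" "err n w \<le> \<rho>" "yn n w = Yq n q w" "w \<in> space M" if "w \<in> A" for w
        using that unfolding A_def Act_def G_def pq tn_Suc Yq_def by auto
      have YF: "Yq n q \<in> borel_measurable (F q)" using adapted[OF q(1)] by simp
      have qt: "q < q + \<theta>" "q + \<theta> \<le> q + 1" using \<theta> by auto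
      have bnd: "norm (X q w - Yq n q w) \<le> \<rho>" if "w \<in> A" for w using onA[OF that] unfolding err_def by simp
      note OS = one_step[OF q(1) qt AF YF bnd]
      have e1: "indicator A w * (err (Suc n) w)\<^sup>2 = indicator A w * (\<Sum>i\<in>UNIV. (X (q + \<theta>) w $ i - mstep i q (q + \<theta>) (Yq n q w) w)\<^sup>2)" for w
      proof (cases "w \<in> A")
        case True
        have "(err (Suc n) w)\<^sup>2 = (\<Sum>i\<in>UNIV. (X (tn (Suc n) w) w $ i - yn (Suc n) w $ i)\<^sup>2)"
          unfolding err_def power2_norm_eq_inner inner_vec_def by (simp add: power2_eq_square)
        then show ?thesis unfolding yn_Suc onA(1,2,4)[OF True] by simp
      qed simp
      have e0: "indicator A w * (err n w)\<^sup>2 = indicator A w * (norm (X q w - Yq n q w))\<^sup>2" for w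
        using onA[of w] by (auto simp: indicator_def err_def)
      note OS' = OS[folded e1 e0]
      have iA: "integrable M (indicator A :: 'w \<Rightarrow> real)" using AM by (simp add: less_top[symmetric])
      have Y1: "indicator A w * Y (Suc n) w = exp (- CS1 * (q + \<theta>)) * (indicator A w * (err (Suc n) w)\<^sup>2) + CS2 * h\<^sup>2 * (T + 1 - (q + \<theta>)) * indicator A w" for w
        using onA[of w] unfolding Y_def by (auto simp: indicator_def)
      have Y0: "indicator A w * Y n w = exp (- CS1 * q) * (indicator A w * (err n w)\<^sup>2) + CS2 * h\<^sup>2 * (T + 1 - q) * indicator A w" for w
        using onA[of w] unfolding Y_def by (auto simp: indicator_def)
      define E1 where "E1 = (\<integral>w. indicator A w * (err (Suc n) w)\<^sup>2 \<partial>M)"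
      define E0 where "E0 = (\<integral>w. indicator A w * (err n w)\<^sup>2 \<partial>M)"
      have E00: "0 \<le> E0" unfolding E0_def by (intro integral_nonneg_AE) auto
      have i1: "integrable M (\<lambda>w. indicator A w * Y (Suc n) w)" and I1: "(\<integral>w. indicator A w * Y (Suc n) w \<partial>M) = exp (- CS1 * (q + \<theta>)) * E1 + CS2 * h\<^sup>2 * (T + 1 - (q + \<theta>)) * prob A"
        unfolding Y1 E1_def using OS'(1) iA by auto
      have i0: "integrable M (\<lambda>w. indicator A w * Y n w)" and I0: "(\<integral>w. indicator A w * Y n w \<partial>M) = exp (- CS1 * q) * E0 + CS2 * h\<^sup>2 * (T + 1 - q) * prob A"
        unfolding Y0 E0_def using OS'(2) iA by auto
      have "E1 \<le> (1 + CS1 * \<theta>) * E0 + CS2 * \<theta> ^ 3 * prob A" using OS'(3) unfolding E1_def E0_def by simp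
      also have "\<dots> \<le> exp (CS1 * \<theta>) * E0 + CS2 * (h\<^sup>2 * \<theta>) * prob A"
      proof (intro add_mono mult_right_mono mult_left_mono E00 CS0)
        show "1 + CS1 * \<theta> \<le> exp (CS1 * \<theta>)" by (rule exp_ge_add_one_self)
        \<comment> \<open>The local error is paid from the part of the budget released during a step
          of length \<open>\<theta>\<close>.\<close>
        show "\<theta> ^ 3 \<le> h\<^sup>2 * \<theta>" unfolding power3_eq_cube power2_eq_square using \<theta> by (intro mult_right_mono mult_mono) auto
      qed auto
      finally have "exp (- CS1 * (q + \<theta>)) * E1 \<le> exp (- CS1 * (q + \<theta>)) * (exp (CS1 * \<theta>) * E0 + CS2 * (h\<^sup>2 * \<theta>) * prob A)"
        by (intro mult_left_mono) auto
      also have "\<dots> = exp (- CS1 * q) * E0 + exp (- CS1 * (q + \<theta>)) * (CS2 * (h\<^sup>2 * \<theta>) * prob A)"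
      proof -
        have "exp (- CS1 * (q + \<theta>)) * exp (CS1 * \<theta>) = exp (- CS1 * q)" unfolding exp_add[symmetric] by (simp add: algebra_simps)
        then show ?thesis by (simp only: distrib_left mult.assoc[symmetric])
      qed
      also have "\<dots> \<le> exp (- CS1 * q) * E0 + 1 * (CS2 * (h\<^sup>2 * \<theta>) * prob A)"
        using CS0 q \<theta> by (intro add_left_mono mult_right_mono) (auto intro!: mult_nonneg_nonneg)
      finally have le: "(\<integral>w. indicator A w * Y (Suc n) w \<partial>M) \<le> (\<integral>w. indicator A w * Y n w \<partial>M)"
        unfolding I1 I0 by (simp add: algebra_simps)
      have nn1: "0 \<le> indicator A w * Y (Suc n) w" for w
        unfolding Y1 using CS0 q \<theta> by (intro add_nonneg_nonneg mult_nonneg_nonneg) auto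
      have nn0: "0 \<le> indicator A w * Y n w" for w
        unfolding Y0 using CS0 q \<theta> by (intro add_nonneg_nonneg mult_nonneg_nonneg) auto
      have conv: "indicator A w * ennreal y = ennreal (indicator A w * y)" for w y by (auto simp: indicator_def)
      show ?thesis unfolding A_def[symmetric] conv
        using le nn1 nn0 i1 i0 by (simp add: nn_integral_eq_integral ennreal_leI)
    qed
    then show ?thesis by (subst (1 2) sp) (auto intro!: sum_mono)
  qed
  define c where "c = exp (- CS1 * (T + 1)) * \<rho>\<^sup>2"
  have c0: "0 < c" unfolding c_def using \<rho> by simp
  have V: "ennreal c * emeasure M (\<Union>n<N. H n) \<le> (\<integral>\<^sup>+w. indicator (Act 0) w * ennreal (Y 0 w) \<partial>M)"
  proof (rule ville[where Y="\<lambda>n w. ennreal (Y n w)" and Act=Act and H=H])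
    show "ennreal c \<le> ennreal (Y (Suc n) w)" if "w \<in> H n" for n w
    proof (rule ennreal_leI)
      have w: "tn n w < T" "\<rho> < err (Suc n) w" using that unfolding H_def Act_def by auto
      have t1: "tn (Suc n) w \<le> T + 1" unfolding tn_Suc using w th_bounds(4)[of "yn n w"] by simp
      have "c \<le> exp (- CS1 * tn (Suc n) w) * (err (Suc n) w)\<^sup>2"
        unfolding c_def using w t1 \<rho> CS0 by (intro mult_mono power_mono) (auto intro: mult_left_mono)
      also have "\<dots> \<le> Y (Suc n) w" unfolding Y_def using CS0 t1 by simp
      finally show "c \<le> Y (Suc n) w" .
    qed
  qed (use step in \<open>auto simp: H_def Act_def\<close>)
  also have "(\<integral>\<^sup>+w. indicator (Act 0) w * ennreal (Y 0 w) \<partial>M) \<le> (\<integral>\<^sup>+w. ennreal (CS2 * h\<^sup>2 * (T + 1)) \<partial>M)"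
    by (intro nn_integral_mono) (auto simp: indicator_def Y_def tn_0 err_def yn_0 X_0)
  also have "\<dots> = ennreal (CS2 * h\<^sup>2 * (T + 1))" by (simp add: emeasure_space_1)
  finally have "ennreal c * emeasure M (\<Union>n<N. H n) \<le> ennreal (CS2 * h\<^sup>2 * (T + 1))" .
  then have "ennreal (c * prob (\<Union>n<N. H n)) \<le> ennreal (CS2 * h\<^sup>2 * (T + 1))"
    using c0 by (simp add: emeasure_eq_measure ennreal_mult)
  then have cp: "c * prob (\<Union>n<N. H n) \<le> CS2 * h\<^sup>2 * (T + 1)"
    using CS0 T0 by (subst (asm) ennreal_le_iff) auto
  have "prob (\<Union>n<N. H n) \<le> CS2 * h\<^sup>2 * (T + 1) / c"
    using cp c0 by (simp add: pos_le_divide_eq mult.commute)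
  also have "\<dots> = CE * h\<^sup>2 / \<rho>\<^sup>2"
  proof -
    define z where "z = exp (CS1 * (T + 1))"
    have "exp (- CS1 * (T + 1)) = inverse z" unfolding z_def by (simp flip: exp_minus)
    then have cz: "c = inverse z * \<rho>\<^sup>2" unfolding c_def by simp
    have "0 < z" unfolding z_def by simp
    then show ?thesis unfolding cz CE_def z_def[symmetric] using \<rho> by (simp add: field_simps)
  qed
  finally have P: "prob (\<Union>n<N. H n) \<le> CE * h\<^sup>2 / \<rho>\<^sup>2" .
  have "{w\<in>space M. \<exists>n<N. tn n w < T \<and> \<rho> < err (Suc n) w} \<subseteq> (\<Union>n<N. H n)"
  proof
    fix w assume w: "w \<in> {w\<in>space M. \<exists>n<N. tn n w < T \<and> \<rho> < err (Suc n) w}"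
    define n where "n = (LEAST n. tn n w < T \<and> \<rho> < err (Suc n) w)"
    obtain n' where n': "n' < N" "tn n' w < T \<and> \<rho> < err (Suc n') w" using w by auto
    have n: "tn n w < T" "\<rho> < err (Suc n) w" unfolding n_def using LeastI[of "\<lambda>n. tn n w < T \<and> \<rho> < err (Suc n) w", OF n'(2)] by auto
    have nN: "n < N" unfolding n_def using Least_le[of "\<lambda>n. tn n w < T \<and> \<rho> < err (Suc n) w", OF n'(2)] n'(1) by simp
    have "tn k w < T \<and> err k w \<le> \<rho>" if k: "k \<le> n" for k
    proof
      show tk: "tn k w < T" using tn_le[OF k, of w] n by simp
      show "err k w \<le> \<rho>"
      proof (cases k)
        case 0
        then show ?thesis using w \<rho> by (simp add: err_def tn_0 yn_0 X_0)
      next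
        case (Suc k')
        then have "k' < n" using k by simp
        from not_less_Least[OF this[unfolded n_def]] have "\<not> (tn k' w < T \<and> \<rho> < err (Suc k') w)" .
        moreover have "tn k' w < T" using tn_le[of k' k w] tk Suc by simp
        ultimately show ?thesis using Suc by simp
      qed
    qed
    then have "w \<in> H n" unfolding H_def Act_def using n w by auto
    then show "w \<in> (\<Union>n<N. H n)" using nN by auto
  qed
  then have "emeasure M {w\<in>space M. \<exists>n<N. tn n w < T \<and> \<rho> < err (Suc n) w} \<le> emeasure M (\<Union>n<N. H n)"
    by (intro emeasure_mono) auto
  also have "\<dots> \<le> ennreal (CE * h\<^sup>2 / \<rho>\<^sup>2)" using P by (simp add: emeasure_eq_measure ennreal_leI)
  finally show ?thesis .
qed

end

subsection \<open>Taylor estimates\<close>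

lemma Ck_fun_cont: "Ck_fun k f \<Longrightarrow> continuous_on UNIV f"
  by (cases k) auto

lemma Ck_fun_pd: "Ck_fun (Suc k) f \<Longrightarrow> Ck_fun k (pd i f)"
  by simp

lemma Ck_fun_DERIV:
  assumes "Ck_fun (Suc k) f"
  shows "((\<lambda>t. f (x + t *\<^sub>R axis i 1)) has_real_derivative pd i f (x + s *\<^sub>R axis i 1)) (at s)"
proof -
  have 0: "((\<lambda>t. f (y + t *\<^sub>R axis i 1)) has_real_derivative pd i f y) (at 0)" for y
    using assms unfolding pd_def by (auto simp: DERIV_deriv_iff_real_differentiable)
  have "((\<lambda>t. f ((x + s *\<^sub>R axis i 1) + (t - s) *\<^sub>R axis i 1)) has_real_derivative pd i f (x + s *\<^sub>R axis i 1) * 1) (at s)"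
    by (rule DERIV_chain2[of "\<lambda>t. f ((x + s *\<^sub>R axis i 1) + t *\<^sub>R axis i 1)"]) (use 0 in \<open>auto intro!: derivative_eq_intros\<close>)
  moreover have "(x + s *\<^sub>R axis i 1) + (t - s) *\<^sub>R axis i 1 = x + t *\<^sub>R axis i 1" for t
    by (simp add: algebra_simps)
  ultimately show ?thesis by simp
qed

text \<open>Changing one coordinate at a time reduces the multivariate estimate to the mean value theorem;
  all intermediate points stay in the box spanned by \<open>x\<close> and \<open>y\<close>.\<close>

lemma box_taylor:
  fixes f :: "real^'d::finite \<Rightarrow> real"
  assumes f: "Ck_fun (Suc k) f"
    and G: "\<And>\<xi> j. (\<And>l. \<xi> $ l \<in> closed_segment (x $ l) (y $ l)) \<Longrightarrow> \<bar>pd j f \<xi> - c j\<bar> \<le> G"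
  shows "\<bar>f y - f x - (\<Sum>j\<in>UNIV. c j * (y $ j - x $ j))\<bar> \<le> G * (\<Sum>j\<in>UNIV. \<bar>y $ j - x $ j\<bar>)"
proof -
  define z where "z A = (\<chi> j. if j \<in> A then y $ j else x $ j)" for A
  have "\<bar>f (z A) - f x - (\<Sum>j\<in>A. c j * (y $ j - x $ j))\<bar> \<le> G * (\<Sum>j\<in>A. \<bar>y $ j - x $ j\<bar>)" for A
  proof (induction A rule: infinite_finite_induct)
    case empty
    have "z {} = x" by (simp add: z_def vec_eq_iff)
    then show ?case by simp
  next
    case (insert i A)
    define \<delta> where "\<delta> = y $ i - x $ i"
    have zi: "z (insert i A) = z A + \<delta> *\<^sub>R axis i 1"
      using insert(2) by (auto simp: z_def vec_eq_iff \<delta>_def axis_def)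
    define \<phi> where "\<phi> t = f (z A + t *\<^sub>R axis i 1) - c i * t" for t
    have "norm (\<phi> \<delta> - \<phi> 0) \<le> G * norm (\<delta> - 0)"
    proof (rule field_differentiable_bound[where S="closed_segment 0 \<delta>" and f'="\<lambda>t. pd i f (z A + t *\<^sub>R axis i 1) - c i"])
      fix t assume t: "t \<in> closed_segment 0 \<delta>"
      show "(\<phi> has_field_derivative pd i f (z A + t *\<^sub>R axis i 1) - c i) (at t within closed_segment 0 \<delta>)"
        unfolding \<phi>_def by (rule derivative_eq_intros has_field_derivative_at_within[OF Ck_fun_DERIV[OF f]] refl | simp)+
      have "(z A + t *\<^sub>R axis i 1) $ l \<in> closed_segment (x $ l) (y $ l)" for l
      proof (cases "l = i")
        case True
        obtain u where u: "0 \<le> u" "u \<le> 1" "t = u * \<delta>" using t by (auto simp: closed_segment_def)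
        have "(z A + t *\<^sub>R axis i 1) $ l = (1 - u) * x $ l + u * y $ l"
          using True insert(2) u(3) by (simp add: z_def axis_def \<delta>_def algebra_simps)
        then show ?thesis using u by (auto simp: closed_segment_def)
      next
        case False
        then show ?thesis by (auto simp: z_def axis_def)
      qed
      then show "norm (pd i f (z A + t *\<^sub>R axis i 1) - c i) \<le> G" using G by simp
    qed auto
    then have "\<bar>f (z (insert i A)) - f (z A) - c i * \<delta>\<bar> \<le> G * \<bar>\<delta>\<bar>" unfolding \<phi>_def zi by simp
    moreover have "f (z (insert i A)) - f x - (\<Sum>j\<in>insert i A. c j * (y $ j - x $ j)) 
       = (f (z (insert i A)) - f (z A) - c i * \<delta>) + (f (z A) - f x - (\<Sum>j\<in>A. c j * (y $ j - x $ j)))"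
      using insert(1,2) by (simp add: \<delta>_def)
    ultimately have "\<bar>f (z (insert i A)) - f x - (\<Sum>j\<in>insert i A. c j * (y $ j - x $ j))\<bar> \<le> G * \<bar>\<delta>\<bar> + G * (\<Sum>j\<in>A. \<bar>y $ j - x $ j\<bar>)"
      using insert(3) by linarith
    then show ?case using insert(1,2) by (simp add: \<delta>_def distrib_left)
  qed simp
  from this[of UNIV] show ?thesis by (simp add: z_def)
qed

lemma l1_le_norm: "(\<Sum>j\<in>UNIV. \<bar>(x::real^'d::finite) $ j\<bar>) \<le> real CARD('d) * norm x"
proof -
  have "(\<Sum>j\<in>UNIV. \<bar>x $ j\<bar>) \<le> (\<Sum>j\<in>(UNIV::'d set). norm x)" by (intro sum_mono component_le_norm_cart)
  then show ?thesis by simp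
qed

lemma l1_diff_le_norm: "(\<Sum>j\<in>UNIV. \<bar>(y::real^'d::finite) $ j - x $ j\<bar>) \<le> real CARD('d) * norm (y - x)"
  using l1_le_norm[of "y - x"] by simp

lemma box_l1: 
  assumes "\<And>l. \<xi> $ l \<in> closed_segment (x $ l) ((y::real^'d::finite) $ l)"
  shows "(\<Sum>l\<in>UNIV. \<bar>\<xi> $ l - x $ l\<bar>) \<le> (\<Sum>l\<in>UNIV. \<bar>y $ l - x $ l\<bar>)"
proof (rule sum_mono)
  fix l
  obtain u where u: "0 \<le> u" "u \<le> 1" "\<xi> $ l = (1 - u) * x $ l + u * y $ l" using assms[of l] by (auto simp: closed_segment_def)
  have "\<xi> $ l - x $ l = u * (y $ l - x $ l)" unfolding u(3) by (simp add: algebra_simps)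
  then have "\<bar>\<xi> $ l - x $ l\<bar> = u * \<bar>y $ l - x $ l\<bar>" using u by (simp add: abs_mult)
  also have "\<dots> \<le> 1 * \<bar>y $ l - x $ l\<bar>" using u by (intro mult_right_mono) auto
  finally show "\<bar>\<xi> $ l - x $ l\<bar> \<le> \<bar>y $ l - x $ l\<bar>" by simp
qed

lemma box_taylor2:
  fixes f :: "real^'d::finite \<Rightarrow> real"
  assumes f: "Ck_fun (Suc (Suc k)) f"
    and S: "\<And>\<xi>. (\<And>l. \<xi> $ l \<in> closed_segment (x $ l) (y $ l)) \<Longrightarrow> \<xi> \<in> S"
    and B: "\<And>\<xi> j l. \<xi> \<in> S \<Longrightarrow> \<bar>pd l (pd j f) \<xi>\<bar> \<le> B"
  shows "\<bar>f y - f x - (\<Sum>j\<in>UNIV. pd j f x * (y $ j - x $ j))\<bar> \<le> B * (real CARD('d) * norm (y - x))\<^sup>2"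
proof -
  define s where "s = (\<Sum>l\<in>UNIV. \<bar>y $ l - x $ l\<bar>)"
  have s0: "0 \<le> s" unfolding s_def by (intro sum_nonneg) auto
  have "x \<in> S" by (rule S) auto
  then have B0: "0 \<le> B" using B[of x undefined undefined] abs_ge_zero order_trans by blast
  have H: "\<bar>pd j f \<xi> - pd j f x\<bar> \<le> B * s" if \<xi>: "\<And>l. \<xi> $ l \<in> closed_segment (x $ l) (y $ l)" for \<xi> j
  proof -
    \<comment> \<open>With all coefficients zero, \<open>box_taylor\<close> is a Lipschitz
      estimate.\<close>
    have "\<bar>pd j f \<xi> - pd j f x - (\<Sum>l\<in>UNIV. 0 * (\<xi> $ l - x $ l))\<bar> \<le> B * (\<Sum>l\<in>UNIV. \<bar>\<xi> $ l - x $ l\<bar>)"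
    proof (rule box_taylor[OF Ck_fun_pd[OF f]])
      fix \<zeta> l assume \<zeta>: "\<And>l. \<zeta> $ l \<in> closed_segment (x $ l) (\<xi> $ l)"
      have "\<zeta> $ l \<in> closed_segment (x $ l) (y $ l)" for l
        using \<zeta>[of l] \<xi>[of l] subset_closed_segment[of "x $ l" "\<xi> $ l" "x $ l" "y $ l"] by auto
      then show "\<bar>pd l (pd j f) \<zeta> - 0\<bar> \<le> B" using B[OF S] by simp
    qed
    also have "\<dots> \<le> B * s" unfolding s_def by (intro mult_left_mono box_l1 \<xi> B0)
    finally show ?thesis by simp
  qed
  have "\<bar>f y - f x - (\<Sum>j\<in>UNIV. pd j f x * (y $ j - x $ j))\<bar> \<le> (B * s) * s"
  proof -
    have "\<bar>f y - f x - (\<Sum>j\<in>UNIV. pd j f x * (y $ j - x $ j))\<bar> \<le> (B * s) * (\<Sum>l\<in>UNIV. \<bar>y $ l - x $ l\<bar>)"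
    proof (rule box_taylor[OF f])
      fix \<xi> j assume "\<And>l. \<xi> $ l \<in> closed_segment (x $ l) (y $ l)"
      then show "\<bar>pd j f \<xi> - pd j f x\<bar> \<le> B * s" by (rule H)
    qed
    then show ?thesis unfolding s_def[symmetric] .
  qed
  also have "\<dots> = B * s\<^sup>2" by (simp add: power2_eq_square)
  also have "\<dots> \<le> B * (real CARD('d) * norm (y - x))\<^sup>2"
    using s0 B0 l1_diff_le_norm[of y x] unfolding s_def by (intro mult_left_mono power_mono) auto
  finally show ?thesis .
qed

text \<open>Stated for all larger constants, so that the maximum over finitely many components works
  simultaneously.\<close>

lemma nice_exists:
  fixes f :: "real^'d::finite \<Rightarrow> real"
  assumes C: "Ck_fun 3 f" and b: "bdd_derivs 3 f"
  shows "\<exists>K. \<forall>K'\<ge>K. nice K' f \<and> (\<forall>l x y. \<bar>pd l f y - pd l f x\<bar> \<le> K' * norm (y - x))"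
proof -
  have C': "Ck_fun (Suc (Suc (Suc 0))) f" "bdd_derivs (Suc (Suc (Suc 0))) f" using C b by (simp_all add: eval_nat_numeral)
  have bd: "bounded (range f)" "\<And>j. bounded (range (pd j f))" "\<And>j l. bounded (range (pd l (pd j f)))"
    using C'(2) by auto
  obtain B0 where B0: "\<And>x. \<bar>f x\<bar> \<le> B0" using bd(1) unfolding bounded_iff by auto
  have "\<exists>B. \<forall>j. \<forall>x. \<bar>pd j f x\<bar> \<le> B j" using bd(2) unfolding bounded_iff by (intro choice) auto
  then obtain B1 where B1: "\<And>j x. \<bar>pd j f x\<bar> \<le> B1 j" by auto
  have "\<exists>B. \<forall>p. \<forall>x. \<bar>pd (fst p) (pd (snd p) f) x\<bar> \<le> B p" using bd(3) unfolding bounded_iff by (intro choice) auto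
  then obtain B2 where B2: "\<And>p x. \<bar>pd (fst p) (pd (snd p) f) x\<bar> \<le> B2 p" by blast
  define B where "B = \<bar>B0\<bar> + (\<Sum>j\<in>UNIV. \<bar>B1 j\<bar>) + (\<Sum>p\<in>UNIV. \<bar>B2 p\<bar>)"
  have n1: "0 \<le> (\<Sum>j\<in>UNIV. \<bar>B1 j\<bar>)" "0 \<le> (\<Sum>p\<in>UNIV. \<bar>B2 p\<bar>)" by (intro sum_nonneg, simp)+
  have f0: "\<bar>f x\<bar> \<le> B" for x using B0[of x] n1 unfolding B_def by linarith
  have f1: "\<bar>pd j f x\<bar> \<le> B" for j x
  proof -
    have "\<bar>B1 j\<bar> \<le> (\<Sum>j\<in>UNIV. \<bar>B1 j\<bar>)" by (rule member_le_sum) auto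
    then show ?thesis using B1[of j x] n1 unfolding B_def by linarith
  qed
  have f2: "\<bar>pd l (pd j f) x\<bar> \<le> B" for j l x
  proof -
    have "\<bar>B2 (l, j)\<bar> \<le> (\<Sum>p\<in>UNIV. \<bar>B2 p\<bar>)" by (rule member_le_sum) auto
    then show ?thesis using B2[of "(l, j)" x] n1 unfolding B_def by (simp only: fst_conv snd_conv)
  qed
  have B0': "0 \<le> B" using f0[of 0] by linarith
  define d where "d = real CARD('d)"
  have d: "1 \<le> d" unfolding d_def by (simp add: Suc_leI)
  have lip: "\<bar>g y - g x\<bar> \<le> B * d * norm (y - x)" if g: "Ck_fun (Suc k) g" "\<And>l x. \<bar>pd l g x\<bar> \<le> B" for g :: "real^'d \<Rightarrow> real" and k x y
  proof -
    have "\<bar>g y - g x - (\<Sum>l\<in>UNIV. 0 * (y $ l - x $ l))\<bar> \<le> B * (\<Sum>l\<in>UNIV. \<bar>y $ l - x $ l\<bar>)"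
      by (rule box_taylor[OF g(1)]) (use g(2) in simp)
    also have "\<dots> \<le> B * (d * norm (y - x))" unfolding d_def by (intro mult_left_mono l1_diff_le_norm B0')
    finally show ?thesis by (simp add: mult.assoc)
  qed
  have L0: "\<bar>f y - f x\<bar> \<le> B * d * norm (y - x)" for x y by (rule lip[OF C'(1) f1])
  have L1: "\<bar>pd l f y - pd l f x\<bar> \<le> B * d * norm (y - x)" for x y l by (rule lip[OF Ck_fun_pd[OF C'(1)] f2])
  have T: "\<bar>f y - f x - (\<Sum>j\<in>UNIV. pd j f x * (y $ j - x $ j))\<bar> \<le> B * (d * norm (y - x))\<^sup>2" for x y
    unfolding d_def by (rule box_taylor2[OF C'(1), of x y UNIV]) (use f2 in auto)
  have Bd: "B \<le> B * d\<^sup>2" "B * d \<le> B * d\<^sup>2" 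
  proof -
    have "1 \<le> d * d" "d \<le> d * d" using mult_mono[OF d d] mult_left_mono[OF d, of d] d by auto
    then show "B \<le> B * d\<^sup>2" "B * d \<le> B * d\<^sup>2"
      using mult_left_mono[of 1 "d * d" B] mult_left_mono[of d "d * d" B] B0' by (auto simp: power2_eq_square)
  qed
  show ?thesis
  proof (intro exI[of _ "B * d\<^sup>2"] allI impI conjI)
    fix K' assume K': "B * d\<^sup>2 \<le> K'"
    show "nice K' f" unfolding nice_def
    proof (intro conjI allI)
      show "continuous_on UNIV f" by (rule Ck_fun_cont[OF C])
      show "continuous_on UNIV (pd l f)" for l by (rule Ck_fun_cont[OF Ck_fun_pd[OF C'(1)]])
      show "\<bar>f x\<bar> \<le> K'" for x using f0[of x] Bd K' by linarith
      show "\<bar>pd l f x\<bar> \<le> K'" for l x using f1[of l x] Bd K' by linarith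
      show "\<bar>f y - f x\<bar> \<le> K' * norm (y - x)" for x y
        using L0[of y x] Bd K' by (intro order_trans[OF L0] mult_right_mono) auto
      show "\<bar>f y - f x - (\<Sum>l\<in>UNIV. pd l f x * (y $ l - x $ l))\<bar> \<le> K' * (norm (y - x))\<^sup>2" for x y
      proof -
        have "B * (d * norm (y - x))\<^sup>2 \<le> K' * (norm (y - x))\<^sup>2"
          unfolding power_mult_distrib mult.assoc[symmetric] using K' by (intro mult_right_mono) auto
        then show ?thesis using T[of y x] by linarith
      qed
    qed
    show "\<bar>pd l f y - pd l f x\<bar> \<le> K' * norm (y - x)" for l x y
      using Bd K' by (intro order_trans[OF L1] mult_right_mono) auto
  qed
qed

subsection \<open>Uniform exterior spheres\<close>

lemma box_in_cball:
  fixes p x y :: "real^'d::finite"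
  assumes x: "dist p x \<le> s" and y: "dist p y \<le> s" and \<xi>: "\<And>l. \<xi> $ l \<in> closed_segment (x $ l) (y $ l)"
  shows "dist p \<xi> \<le> real CARD('d) * s"
proof -
  have "\<bar>\<xi> $ l - p $ l\<bar> \<le> s" for l
  proof -
    have "\<bar>x $ l - p $ l\<bar> \<le> s" "\<bar>y $ l - p $ l\<bar> \<le> s"
      using component_le_norm_cart[of "x - p" l] component_le_norm_cart[of "y - p" l] x y by (auto simp: dist_norm norm_minus_commute)
    then have "closed_segment (x $ l) (y $ l) \<subseteq> {p $ l - s .. p $ l + s}"
      by (intro closed_segment_subset) (auto simp: abs_le_iff)
    then show ?thesis using \<xi>[of l] by (auto simp: abs_le_iff)
  qed
  then have "(\<Sum>l\<in>UNIV. \<bar>(\<xi> - p) $ l\<bar>) \<le> (\<Sum>l\<in>(UNIV::'d set). s)" by (intro sum_mono) auto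
  then show ?thesis using norm_le_l1_cart[of "\<xi> - p"] by (simp add: dist_norm norm_minus_commute)
qed

text \<open>The ball is centred at distance \<open>r\<close> from \<open>q\<close> along the
  normalised gradient of the defining function. For a point of the ball the linear Taylor term at
  \<open>q\<close> dominates the quadratic remainder if \<open>r\<close> is small compared with
  gradient over curvature, so the point is not in \<open>D\<close>. All smaller radii are included,
  which lets a finite cover share one radius.\<close>

lemma ext_sphere_local:
  fixes D :: "(real^'d::finite) set"
  assumes D: "open D" and p: "p \<in> frontier D" and C: "C4_boundary D"
  shows "\<exists>\<rho>>0. \<exists>r0>0. \<forall>q\<in>frontier D \<inter> ball p \<rho>. \<forall>r. 0 < r \<longrightarrow> r \<le> r0 \<longrightarrow> (\<exists>z. dist z q = r \<and> (\<forall>y\<in>D. r \<le> dist z y))"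
proof -
  obtain rp \<phi> i where rp: "0 < rp" and \<phi>: "Ck_fun 4 \<phi>" and i: "pd i \<phi> p \<noteq> 0" and eq: "D \<inter> ball p rp = {x\<in>ball p rp. \<phi> x < 0}"
    using C p unfolding C4_boundary_def by blast
  have C2: "Ck_fun (Suc (Suc (Suc (Suc 0)))) \<phi>" using \<phi> by (simp add: eval_nat_numeral)
  define d where "d = real CARD('d)"
  have d: "1 \<le> d" unfolding d_def by (simp add: Suc_leI)
  have "\<exists>B. \<forall>x\<in>cball p rp. \<bar>pd l (pd j \<phi>) x\<bar> \<le> B" for l j
  proof -
    have "continuous_on (cball p rp) (pd l (pd j \<phi>))"
      using Ck_fun_cont[OF Ck_fun_pd[OF Ck_fun_pd[OF C2]]] continuous_on_subset by blast
    then have "bounded (pd l (pd j \<phi>) ` cball p rp)" by (intro compact_imp_bounded compact_continuous_image) auto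
    then show ?thesis unfolding bounded_iff by auto
  qed
  then have "\<exists>B. \<forall>q. \<forall>x\<in>cball p rp. \<bar>pd (fst q) (pd (snd q) \<phi>) x\<bar> \<le> B q" by (intro choice) auto
  then obtain B2 where B2: "\<And>q x. x \<in> cball p rp \<Longrightarrow> \<bar>pd (fst q) (pd (snd q) \<phi>) x\<bar> \<le> B2 q" by blast
  define B where "B = 1 + (\<Sum>q\<in>UNIV. \<bar>B2 q\<bar>)"
  have Bp: "0 < B" unfolding B_def by (intro add_pos_nonneg sum_nonneg) auto
  have B: "\<bar>pd l (pd j \<phi>) x\<bar> \<le> B" if "x \<in> cball p rp" for x l j
  proof -
    have "\<bar>B2 (l, j)\<bar> \<le> (\<Sum>p\<in>UNIV. \<bar>B2 p\<bar>)" by (rule member_le_sum) auto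
    then show ?thesis using B2[OF that, of "(l, j)"] unfolding B_def by (simp only: fst_conv snd_conv)
  qed
  \<comment> \<open>Half of the nonzero derivative at \<open>p\<close>: by continuity the gradient
    keeps at least this size near \<open>p\<close>.\<close>
  define m where "m = \<bar>pd i \<phi> p\<bar> / 2"
  have m: "0 < m" using i by (simp add: m_def)
  have "isCont (pd i \<phi>) p" using Ck_fun_cont[OF Ck_fun_pd[OF C2]] continuous_on_eq_continuous_at open_UNIV by blast
  then obtain \<rho>1 where \<rho>1: "0 < \<rho>1" "\<And>x. dist x p < \<rho>1 \<Longrightarrow> dist (pd i \<phi> x) (pd i \<phi> p) < m"
    using m unfolding continuous_at_eps_delta by blast
  define s where "s = rp / (2 * d)"
  have s: "0 < s" "d * s < rp" "s < rp" using rp d by (auto simp: s_def field_simps)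
  define \<rho> where "\<rho> = min \<rho>1 (s / 2)"
  \<comment> \<open>The first bound keeps the ball inside the chart, the second is the curvature
    condition that makes \<open>2 * r * B * d\<^sup>2\<close> at most \<open>m\<close>.\<close>
  define r0 where "r0 = min (s / 4) (m / (2 * B * d\<^sup>2))"
  have \<rho>: "0 < \<rho>" and r0: "0 < r0" using \<rho>1 s m Bp d by (auto simp: \<rho>_def r0_def)
  have "\<exists>z. dist z q = r \<and> (\<forall>y\<in>D. r \<le> dist z y)" if q: "q \<in> frontier D" "q \<in> ball p \<rho>" and r: "0 < r" "r \<le> r0" for q r
  proof -
    define g :: "real^'d" where "g = (\<chi> j. pd j \<phi> q)"
    have "dist (pd i \<phi> q) (pd i \<phi> p) < m" using \<rho>1(2)[of q] q(2) by (auto simp: \<rho>_def dist_commute)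
    then have "m \<le> \<bar>pd i \<phi> q\<bar>" unfolding m_def dist_real_def by linarith
    then have mg: "m \<le> norm g" using component_le_norm_cart[of g i] unfolding g_def by simp
    then have g0: "0 < norm g" using m by linarith
    define n where "n = g /\<^sub>R norm g"
    have n1: "norm n = 1" unfolding n_def using g0 by simp
    define z where "z = q + r *\<^sub>R n"
    have qD: "q \<notin> D" using q(1) D by (simp add: frontier_def interior_open)
    have qb: "dist p q < s / 2" using q(2) by (auto simp: \<rho>_def)
    have "q \<in> ball p rp" using qb s by simp
    moreover have "q \<notin> {x\<in>ball p rp. \<phi> x < 0}" unfolding eq[symmetric] using qD by simp
    ultimately have "\<phi> q \<ge> 0" by simp
    have "r \<le> dist z y" if y: "y \<in> D" for y
    proof (rule ccontr)
      assume "\<not> r \<le> dist z y"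
      then have zy: "norm (y - z) < r" by (simp add: dist_norm norm_minus_commute)
      define v where "v = y - q"
      have yz: "y - z = v - r *\<^sub>R n" unfolding v_def z_def by simp
      have nv: "norm v < 2 * r" using zy norm_triangle_ineq[of "y - z" "r *\<^sub>R n"] n1 r unfolding yz by simp
      have py: "dist p y < s"
      proof -
        have "dist p y \<le> dist p q + norm v" unfolding v_def using dist_triangle[of p y q] by (simp add: dist_norm norm_minus_commute)
        also have "\<dots> < s / 2 + 2 * r" using qb nv by linarith
        also have "\<dots> \<le> s" using r(2) unfolding r0_def by simp
        finally show ?thesis .
      qed
      have "y \<in> D \<inter> ball p rp" using y py s by simp
      then have "\<phi> y < 0" unfolding eq by simp
      have "(norm (v - r *\<^sub>R n))\<^sup>2 < r\<^sup>2" using zy r unfolding yz by (intro power_strict_mono) auto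
      \<comment> \<open>Lying in the ball means that the squared distance to \<open>q\<close> is
        bounded by the component along the normal; in particular this component is positive.\<close>
      then have vn: "(norm v)\<^sup>2 < 2 * r * (n \<bullet> v)"
      proof -
        have "(norm (v - r *\<^sub>R n))\<^sup>2 = (norm v)\<^sup>2 - 2 * r * (n \<bullet> v) + r\<^sup>2 * (norm n)\<^sup>2"
          unfolding power2_norm_eq_inner by (simp add: inner_diff_left inner_diff_right inner_commute[of v n] power2_eq_square algebra_simps)
        then show ?thesis using \<open>(norm (v - r *\<^sub>R n))\<^sup>2 < r\<^sup>2\<close> n1 by simp
      qed
      have tay: "\<bar>\<phi> y - \<phi> q - (\<Sum>j\<in>UNIV. pd j \<phi> q * (y $ j - q $ j))\<bar> \<le> B * (real CARD('d) * norm (y - q))\<^sup>2"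
      proof (rule box_taylor2[OF C2, of q y "cball p rp"])
        fix \<xi> :: "real^'d" assume "\<And>l. \<xi> $ l \<in> closed_segment (q $ l) (y $ l)"
        from box_in_cball[OF _ _ this, of p s] show "\<xi> \<in> cball p rp" using qb py s unfolding d_def by auto
      qed (rule B)
      have gs: "(\<Sum>j\<in>UNIV. pd j \<phi> q * (y $ j - q $ j)) = g \<bullet> v" unfolding g_def v_def inner_vec_def by simp
      have "g \<bullet> v = norm g * (n \<bullet> v)" unfolding n_def using g0 by simp
      have "B * (d * norm v)\<^sup>2 \<le> g \<bullet> v"
      proof -
        have "0 < (2 * r) * (n \<bullet> v)" using le_less_trans[OF zero_le_power2 vn] .
        moreover have "0 < 2 * r" using r by simp
        ultimately have nv0: "0 \<le> n \<bullet> v" by (rule less_imp_le[OF zero_less_mult_pos])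
        have Bd: "0 < 2 * B * d\<^sup>2" using Bp d by simp
        have "r \<le> m / (2 * B * d\<^sup>2)" using r(2) unfolding r0_def by simp
        then have "r * (2 * B * d\<^sup>2) \<le> m" using Bd by (simp only: pos_le_divide_eq)
        then have "2 * r * B * d\<^sup>2 \<le> m" by (simp add: mult_ac)
        then have rm: "2 * r * B * d\<^sup>2 \<le> norm g" using mg by linarith
        have "B * (d * norm v)\<^sup>2 = (B * d\<^sup>2) * (norm v)\<^sup>2" by (simp add: power_mult_distrib)
        also have "\<dots> \<le> (B * d\<^sup>2) * (2 * r * (n \<bullet> v))" using vn Bp by (intro mult_left_mono) auto
        also have "\<dots> = (2 * r * B * d\<^sup>2) * (n \<bullet> v)" by simp
        also have "\<dots> \<le> norm g * (n \<bullet> v)" using rm nv0 by (intro mult_right_mono)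
        finally show ?thesis using \<open>g \<bullet> v = norm g * (n \<bullet> v)\<close> by simp
      qed
      then show False using tay \<open>\<phi> y < 0\<close> \<open>\<phi> q \<ge> 0\<close> unfolding gs v_def d_def by linarith
    qed
    moreover have "dist z q = r" unfolding z_def dist_norm using n1 r by simp
    ultimately show ?thesis by blast
  qed
  then show ?thesis using \<rho> r0 by blast
qed

lemma ext_sphere:
  fixes D :: "(real^'d::finite) set"
  assumes D: "open D" "bounded D" and C: "C4_boundary D"
  shows "\<exists>r>0. \<forall>q\<in>frontier D. \<exists>z. dist z q = r \<and> (\<forall>y\<in>D. r \<le> dist z y)"
proof -
  have "\<forall>p\<in>frontier D. \<exists>\<rho>>0. \<exists>r0>0. \<forall>q\<in>frontier D \<inter> ball p \<rho>. \<forall>r. 0 < r \<longrightarrow> r \<le> r0 \<longrightarrow> (\<exists>z. dist z q = r \<and> (\<forall>y\<in>D. r \<le> dist z y))"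
    using ext_sphere_local[OF D(1) _ C] by blast
  then obtain \<rho> r0 where \<rho>: "\<And>p. p \<in> frontier D \<Longrightarrow> 0 < \<rho> p" and r0: "\<And>p. p \<in> frontier D \<Longrightarrow> 0 < r0 p"
    and S: "\<And>p q r. p \<in> frontier D \<Longrightarrow> q \<in> frontier D \<inter> ball p (\<rho> p) \<Longrightarrow> 0 < r \<Longrightarrow> r \<le> r0 p \<Longrightarrow> \<exists>z. dist z q = r \<and> (\<forall>y\<in>D. r \<le> dist z y)"
    by metis
  have "compact (frontier D)" using D by (intro compact_frontier_bounded)
  then obtain P where P: "P \<subseteq> frontier D" "finite P" "frontier D \<subseteq> (\<Union>p\<in>P. ball p (\<rho> p))"
    using \<rho> by (elim compactE_image[of "frontier D" "frontier D" "\<lambda>p. ball p (\<rho> p)"]) force+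
  \<comment> \<open>The 1 keeps the set nonempty even if the cover is empty.\<close>
  define r where "r = Min (insert 1 (r0 ` P))"
  have r: "0 < r" "\<And>p. p \<in> P \<Longrightarrow> r \<le> r0 p" unfolding r_def using P r0 by (auto simp: Min_gr_iff)
  have "\<exists>z. dist z q = r \<and> (\<forall>y\<in>D. r \<le> dist z y)" if q: "q \<in> frontier D" for q
  proof -
    obtain p where p: "p \<in> P" "q \<in> ball p (\<rho> p)" using P(3) q by blast
    show ?thesis using S[of p q r] p P q r by blast
  qed
  then show ?thesis using r by blast
qed

subsection \<open>Oscillation and barrier functions\<close>

context sde
begin

text \<open>First passage estimate for the exponential of \<open>l\<close> times one coordinate,
  discounted by its growth rate \<open>\<psi> l\<close>. The sign of \<open>l\<close> selects the
  direction of the passage, and the bound does not depend on the number of grid points.\<close>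

lemma osc_coord:
  assumes q: "0 \<le> q" "0 < \<theta>" and A: "A \<in> sets (F q)" and c: "0 < c" and N: "0 < N"
  shows "prob (A \<inter> {w\<in>space M. \<exists>k<N. \<bar>l\<bar> * c < l * (X (grid q (q + \<theta>) N (Suc k)) w $ i - X q w $ i)}) \<le> exp (\<psi> l * \<theta> - \<bar>l\<bar> * c) * prob A"
proof -
  let ?u = "grid q (q + \<theta>) N"
  have qt: "q < q + \<theta>" using q by simp
  note g = grid_props[OF q(1) qt N]
  have g0: "0 \<le> ?u k" for k using g(5)[of k] q by simp
  define Z where "Z k w = l * (X (?u k) w $ i - X q w $ i)" for k w
  define Y where "Y k w = ennreal (exp (Z k w - \<psi> l * (?u k - q)))" for k w
  define Act where "Act n = A \<inter> {w\<in>space M. \<forall>k\<le>n. Z k w \<le> \<bar>l\<bar> * c}" for n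
  \<comment> \<open>Empty from \<open>N\<close> on, since the discount is bounded by
    \<open>\<psi> l * \<theta>\<close> only up to the end of the interval.\<close>
  define H where "H n = (if n < N then Act n \<inter> {w\<in>space M. \<bar>l\<bar> * c < Z (Suc n) w} else {})" for n
  have um: "?u j \<le> ?u k" if "j \<le> k" for j k 
    by (rule lift_Suc_mono_le[of ?u, OF less_imp_le[OF g(3)] that])
  have \<psi>0: "0 \<le> \<psi> l" unfolding \<psi>_def using K1 Cb0 by auto
  have mZF: "Z j \<in> borel_measurable (F (?u k))" if "j \<le> k" for j k
  proof -
    have [measurable]: "X (?u j) \<in> borel_measurable (F (?u k))" "X q \<in> borel_measurable (F (?u k))"
      using meas_X_le[OF g0 um[OF that]] meas_X_le[OF q(1) g(5)] by auto
    show ?thesis unfolding Z_def by measurable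
  qed
  have mZ[measurable]: "Z k \<in> borel_measurable M" for k using meas_F_M[OF g0 mZF[OF order_refl]] .
  have mY[measurable]: "Y k \<in> borel_measurable M" for k unfolding Y_def by measurable
  have ActF: "Act k \<in> sets (F (?u k))" for k
  proof -
    have "Act k = A \<inter> {w\<in>space (F (?u k)). \<forall>j\<in>{..k}. Z j w \<le> \<bar>l\<bar> * c}" unfolding Act_def space_F[OF g0] by auto
    moreover have "{w\<in>space (F (?u k)). \<forall>j\<in>{..k}. Z j w \<le> \<bar>l\<bar> * c} \<in> sets (F (?u k))"
      using mZF by (intro sets.sets_Collect_finite_All borel_measurable_le) auto
    ultimately show ?thesis using sets_F_mono[OF q(1) g(5) A] by auto
  qed
  have AM[measurable]: "A \<in> sets M" using sets_F_M[OF q(1) A] .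
  have mAct[measurable]: "Act k \<in> sets M" for k using sets_F_M[OF g0 ActF] .
  have "Act k \<inter> {w\<in>space M. \<bar>l\<bar> * c < Z (Suc k) w} \<in> sets M" for k by measurable
  then have mH[measurable]: "H k \<in> sets M" for k unfolding H_def by simp
  have V: "ennreal (exp (\<bar>l\<bar> * c - \<psi> l * \<theta>)) * emeasure M (\<Union>n<N. H n) \<le> (\<integral>\<^sup>+w. indicator (Act 0) w * Y 0 w \<partial>M)"
  proof (rule ville)
    fix n assume n: "n < N"
    define V where "V w = indicator (Act n) w * ennreal (exp (Z n w - \<psi> l * (?u (Suc n) - q)))" for w
    have mV: "V \<in> borel_measurable (F (?u n))" unfolding V_def using mZF[of n n] ActF[of n] by measurable
    have "(\<integral>\<^sup>+w. indicator (Act n) w * Y (Suc n) w \<partial>M) = (\<integral>\<^sup>+w. V w * ennreal (exp (l * (X (?u (Suc n)) w $ i - X (?u n) w $ i))) \<partial>M)"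
    proof (intro nn_integral_cong)
      fix w
      have "Z (Suc n) w - \<psi> l * (?u (Suc n) - q) = (Z n w - \<psi> l * (?u (Suc n) - q)) + l * (X (?u (Suc n)) w $ i - X (?u n) w $ i)"
        unfolding Z_def by (simp add: algebra_simps)
      then have e: "exp (Z (Suc n) w - \<psi> l * (?u (Suc n) - q)) = exp (Z n w - \<psi> l * (?u (Suc n) - q)) * exp (l * (X (?u (Suc n)) w $ i - X (?u n) w $ i))"
        by (simp only: exp_add)
      show "indicator (Act n) w * Y (Suc n) w = V w * ennreal (exp (l * (X (?u (Suc n)) w $ i - X (?u n) w $ i)))"
        unfolding V_def Y_def e by (simp add: ennreal_mult mult.assoc)
    qed
    also have "\<dots> \<le> ennreal (exp (\<psi> l * (?u (Suc n) - ?u n))) * (\<integral>\<^sup>+w. V w \<partial>M)"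
      by (rule X_exp[OF g0 less_imp_le[OF g(3)] mV])
    also have "\<dots> = (\<integral>\<^sup>+w. ennreal (exp (\<psi> l * (?u (Suc n) - ?u n))) * V w \<partial>M)"
      using meas_F_M[OF g0 mV] by (simp add: nn_integral_cmult)
    also have "\<dots> = (\<integral>\<^sup>+w. indicator (Act n) w * Y n w \<partial>M)"
    proof (intro nn_integral_cong)
      fix w
      have "Z n w - \<psi> l * (?u n - q) = \<psi> l * (?u (Suc n) - ?u n) + (Z n w - \<psi> l * (?u (Suc n) - q))" by (simp add: algebra_simps)
      then have "exp (Z n w - \<psi> l * (?u n - q)) = exp (\<psi> l * (?u (Suc n) - ?u n)) * exp (Z n w - \<psi> l * (?u (Suc n) - q))"
        by (simp only: exp_add)
      then show "ennreal (exp (\<psi> l * (?u (Suc n) - ?u n))) * V w = indicator (Act n) w * Y n w"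
        unfolding V_def Y_def by (simp add: ennreal_mult mult.left_commute)
    qed
    finally show "(\<integral>\<^sup>+w. indicator (Act n) w * Y (Suc n) w \<partial>M) \<le> (\<integral>\<^sup>+w. indicator (Act n) w * Y n w \<partial>M)" .
  next
    fix n w assume "w \<in> H n"
    then have w: "\<bar>l\<bar> * c < Z (Suc n) w" "n < N" unfolding H_def by (auto split: if_splits)
    have "?u (Suc n) - q \<le> \<theta>" using g(6)[of "Suc n"] w by simp
    then have "\<psi> l * (?u (Suc n) - q) \<le> \<psi> l * \<theta>" using \<psi>0 by (rule mult_left_mono)
    then show "ennreal (exp (\<bar>l\<bar> * c - \<psi> l * \<theta>)) \<le> Y (Suc n) w"
      using w unfolding Y_def by (intro ennreal_leI) simp
  qed (auto simp: H_def Act_def split: if_splits)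
  also have "(\<integral>\<^sup>+w. indicator (Act 0) w * Y 0 w \<partial>M) \<le> (\<integral>\<^sup>+w. indicator A w \<partial>M)"
    by (intro nn_integral_mono) (auto simp: Act_def Y_def Z_def g(1) indicator_def)
  also have "\<dots> = ennreal (prob A)" by (simp add: emeasure_eq_measure)
  finally have "ennreal (exp (\<bar>l\<bar> * c - \<psi> l * \<theta>) * prob (\<Union>n<N. H n)) \<le> ennreal (prob A)"
    by (simp add: emeasure_eq_measure ennreal_mult)
  then have 1: "exp (\<bar>l\<bar> * c - \<psi> l * \<theta>) * prob (\<Union>n<N. H n) \<le> prob A" by (subst (asm) ennreal_le_iff) auto
  have "prob (\<Union>n<N. H n) = exp (\<psi> l * \<theta> - \<bar>l\<bar> * c) * (exp (\<bar>l\<bar> * c - \<psi> l * \<theta>) * prob (\<Union>n<N. H n))"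
    by (simp add: mult.assoc[symmetric] exp_add[symmetric])
  also have "\<dots> \<le> exp (\<psi> l * \<theta> - \<bar>l\<bar> * c) * prob A" using 1 by (intro mult_left_mono) auto
  finally have P: "prob (\<Union>n<N. H n) \<le> exp (\<psi> l * \<theta> - \<bar>l\<bar> * c) * prob A" .
  have "A \<inter> {w\<in>space M. \<exists>k<N. \<bar>l\<bar> * c < Z (Suc k) w} \<subseteq> (\<Union>n<N. H n)"
  proof
    fix w assume w: "w \<in> A \<inter> {w\<in>space M. \<exists>k<N. \<bar>l\<bar> * c < Z (Suc k) w}"
    define n where "n = (LEAST n. \<bar>l\<bar> * c < Z (Suc n) w)"
    obtain n' where n': "n' < N" "\<bar>l\<bar> * c < Z (Suc n') w" using w by auto
    have n: "\<bar>l\<bar> * c < Z (Suc n) w" unfolding n_def by (rule LeastI[of "\<lambda>n. \<bar>l\<bar> * c < Z (Suc n) w", OF n'(2)])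
    have nN: "n < N" unfolding n_def using Least_le[of "\<lambda>n. \<bar>l\<bar> * c < Z (Suc n) w", OF n'(2)] n'(1) by simp
    have "Z k w \<le> \<bar>l\<bar> * c" if k: "k \<le> n" for k
    proof (cases k)
      case 0
      then show ?thesis using c by (simp add: Z_def g(1))
    next
      case (Suc k')
      then have "k' < n" using k by simp
      from not_less_Least[OF this[unfolded n_def]] show ?thesis using Suc by simp
    qed
    then have "w \<in> H n" unfolding H_def Act_def using n nN w by auto
    then show "w \<in> (\<Union>n<N. H n)" using nN by auto
  qed
  then have "prob (A \<inter> {w\<in>space M. \<exists>k<N. \<bar>l\<bar> * c < Z (Suc k) w}) \<le> prob (\<Union>n<N. H n)"
    by (intro finite_measure_mono) auto
  then show ?thesis using P unfolding Z_def by linarith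
qed

text \<open>Dyadic points suffice to control a continuous path and form an increasing family of grids.\<close>

definition Osc :: "real \<Rightarrow> real \<Rightarrow> real \<Rightarrow> 'w set" where
  "Osc q \<theta> \<rho> = {w\<in>space M. \<exists>n. \<exists>k<2^n. \<rho> < norm (X (grid q (q + \<theta>) (2^n) (Suc k)) w - X q w)}"

lemma Osc_sets:
  assumes "0 \<le> q" "0 < \<theta>" shows "Osc q \<theta> \<rho> \<in> sets M"
proof -
  have g0: "0 \<le> grid q (q + \<theta>) (2^n) k" for n k
    using grid_props(5)[of q "q + \<theta>" "2^n" k] assms by simp
  note meas_X_M[OF g0, measurable] meas_X_M[OF assms(1), measurable]
  show ?thesis unfolding Osc_def by measurable
qed

definition osc_bound :: "real \<Rightarrow> real \<Rightarrow> real" where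
  "osc_bound \<theta> c = 2 * real CARD('d) * exp (c * K / Cb - c\<^sup>2 / (2 * Cb * \<theta>))"

text \<open>If the norm exceeds \<open>sqrt CARD('d) * c\<close>, some coordinate exceeds
  \<open>c\<close> in absolute value; the events of the dyadic levels increase, so a bound uniform
  in the level passes to their union.\<close>

lemma Osc_prob:
  assumes q: "0 \<le> q" "0 < \<theta>" and A: "A \<in> sets (F q)" and c: "0 < c" and Cbp: "0 < Cb"
  shows "prob (A \<inter> Osc q \<theta> (sqrt (real CARD('d)) * c)) \<le> osc_bound \<theta> c * prob A"
proof -
  define \<rho> where "\<rho> = sqrt (real CARD('d)) * c"
  define Bn where "Bn n = A \<inter> {w\<in>space M. \<exists>k<2^n. \<rho> < norm (X (grid q (q + \<theta>) (2^n) (Suc k)) w - X q w)}" for n :: nat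
  have AM[measurable]: "A \<in> sets M" using sets_F_M[OF q(1) A] .
  have g0: "0 \<le> grid q (q + \<theta>) (2^n) k" for n k
    using grid_props(5)[of q "q + \<theta>" "2^n" k] q by simp
  note meas_X_M[OF g0, measurable] meas_X_M[OF q(1), measurable]
  have mB: "Bn n \<in> sets M" for n unfolding Bn_def by measurable
  have U: "A \<inter> Osc q \<theta> \<rho> = (\<Union>n. Bn n)" unfolding Bn_def Osc_def by auto
  have inc: "incseq Bn"
  proof (rule incseq_SucI, rule subsetI)
    fix n w assume "w \<in> Bn n"
    then obtain k where w: "w \<in> A" "w \<in> space M" "k < 2^n" "\<rho> < norm (X (grid q (q + \<theta>) (2^n) (Suc k)) w - X q w)"
      unfolding Bn_def by auto
    \<comment> \<open>The point with index \<open>k + 1\<close> reappears with index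
      \<open>2 * k + 2\<close> on the next level.\<close>
    have "grid q (q + \<theta>) (2^Suc n) (Suc (2 * k + 1)) = grid q (q + \<theta>) (2^n) (Suc k)"
      unfolding grid_def by (simp add: field_simps)
    then show "w \<in> Bn (Suc n)" unfolding Bn_def using w by (auto intro!: exI[of _ "2 * k + 1"])
  qed
  \<comment> \<open>The minimiser of \<open>l\<^sup>2 * Cb * \<theta> / 2 - l * c\<close>, the part
    of the exponent without the drift.\<close>
  define l where "l = c / (Cb * \<theta>)"
  have l: "0 < l" using c Cbp q by (simp add: l_def)
  have \<psi>l: "\<psi> l * \<theta> - \<bar>l\<bar> * c = c * K / Cb - c\<^sup>2 / (2 * Cb * \<theta>)" "\<psi> (- l) * \<theta> - \<bar>- l\<bar> * c = c * K / Cb - c\<^sup>2 / (2 * Cb * \<theta>)"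
  proof -
    show "\<psi> l * \<theta> - \<bar>l\<bar> * c = c * K / Cb - c\<^sup>2 / (2 * Cb * \<theta>)"
      using l q Cbp unfolding \<psi>_def l_def by (simp add: field_simps power2_eq_square)
    then show "\<psi> (- l) * \<theta> - \<bar>- l\<bar> * c = c * K / Cb - c\<^sup>2 / (2 * Cb * \<theta>)" unfolding \<psi>_def by simp
  qed
  have Pn: "prob (Bn n) \<le> osc_bound \<theta> c * prob A" for n
  proof -
    define E where "E i m = A \<inter> {w\<in>space M. \<exists>k<2^n. \<bar>m\<bar> * c < m * (X (grid q (q + \<theta>) (2^n) (Suc k)) w $ i - X q w $ i)}" for i and m :: real
    have mE: "E i m \<in> sets M" for i m unfolding E_def by measurable
    have "Bn n \<subseteq> (\<Union>i\<in>UNIV. E i l \<union> E i (- l))"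
    proof
      fix w assume "w \<in> Bn n"
      then obtain k where w: "w \<in> A" "w \<in> space M" "k < 2^n" "\<rho> < norm (X (grid q (q + \<theta>) (2^n) (Suc k)) w - X q w)"
        unfolding Bn_def by auto
      define v where "v = X (grid q (q + \<theta>) (2^n) (Suc k)) w - X q w"
      have "\<exists>i. c < \<bar>v $ i\<bar>"
      proof (rule ccontr)
        assume "\<not> (\<exists>i. c < \<bar>v $ i\<bar>)"
        then have "\<bar>v $ i\<bar>\<^sup>2 \<le> c\<^sup>2" for i by (intro power_mono) (auto simp: not_less)
        then have "(\<Sum>i\<in>UNIV. (v $ i)\<^sup>2) \<le> (\<Sum>i\<in>(UNIV::'d set). c\<^sup>2)" by (intro sum_mono) auto
        then have "(norm v)\<^sup>2 \<le> \<rho>\<^sup>2" unfolding power2_norm_eq_inner inner_vec_def \<rho>_def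
          by (simp add: power2_eq_square algebra_simps)
        moreover have "0 \<le> \<rho>" unfolding \<rho>_def using c by simp
        ultimately have "norm v \<le> \<rho>" by (rule power2_le_imp_le)
        then show False using w unfolding v_def by simp
      qed
      then obtain i where "c < \<bar>v $ i\<bar>" by auto
      then have "c < v $ i \<or> c < - (v $ i)" by linarith
      then have "l * c < l * (v $ i) \<or> l * c < - l * (v $ i)" using mult_strict_left_mono[OF _ l, of c] by fastforce
      then have "w \<in> E i l \<union> E i (- l)" unfolding E_def using w l by (auto simp: v_def)
      then show "w \<in> (\<Union>i\<in>UNIV. E i l \<union> E i (- l))" by auto
    qed
    then have "prob (Bn n) \<le> prob (\<Union>i\<in>UNIV. E i l \<union> E i (- l))" using mE by (intro finite_measure_mono) auto
    also have "\<dots> \<le> (\<Sum>i\<in>(UNIV::'d set). prob (E i l \<union> E i (- l)))"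
      using mE by (intro finite_measure_subadditive_finite) auto
    also have "\<dots> \<le> (\<Sum>i\<in>(UNIV::'d set). exp (c * K / Cb - c\<^sup>2 / (2 * Cb * \<theta>)) * prob A + exp (c * K / Cb - c\<^sup>2 / (2 * Cb * \<theta>)) * prob A)"
    proof (rule sum_mono)
      fix i
      have "prob (E i l \<union> E i (- l)) \<le> prob (E i l) + prob (E i (- l))" using mE by (intro measure_Un_le) auto
      moreover have "prob (E i l) \<le> exp (c * K / Cb - c\<^sup>2 / (2 * Cb * \<theta>)) * prob A"
        unfolding E_def using osc_coord[OF q A c, of "2^n" l i] \<psi>l by simp
      moreover have "prob (E i (- l)) \<le> exp (c * K / Cb - c\<^sup>2 / (2 * Cb * \<theta>)) * prob A"
        unfolding E_def using osc_coord[OF q A c, of "2^n" "- l" i] \<psi>l(2) by simp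
      ultimately show "prob (E i l \<union> E i (- l)) \<le> exp (c * K / Cb - c\<^sup>2 / (2 * Cb * \<theta>)) * prob A + exp (c * K / Cb - c\<^sup>2 / (2 * Cb * \<theta>)) * prob A"
        by linarith
    qed
    also have "\<dots> = osc_bound \<theta> c * prob A" unfolding osc_bound_def by simp
    finally show ?thesis .
  qed
  have "(\<lambda>n. prob (Bn n)) \<longlonglongrightarrow> prob (\<Union>n. Bn n)"
    using mB inc by (intro finite_Lim_measure_incseq) auto
  then have "prob (\<Union>n. Bn n) \<le> osc_bound \<theta> c * prob A"
    by (rule LIMSEQ_le_const2) (use Pn in auto)
  then show ?thesis unfolding U[symmetric] \<rho>_def .
qed

text \<open>Dyadic times obtained from \<open>u\<close> by rounding up converge to \<open>u\<close>.
  Rounding up gives indices of the form \<open>Suc k\<close>, as used in \<open>Osc\<close>; this is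
  why \<open>u = q\<close> is treated apart.\<close>

lemma not_Osc:
  assumes q: "0 \<le> q" "0 < \<theta>" and w: "w \<in> space M" "w \<notin> Osc q \<theta> \<rho>" and c: "continuous_on {0..} (\<lambda>t. X t w)"
    and u: "q \<le> u" "u \<le> q + \<theta>" and \<rho>: "0 \<le> \<rho>"
  shows "norm (X u w - X q w) \<le> \<rho>"
proof (cases "u = q")
  case False
  define x where "x = (u - q) / \<theta>"
  have x: "0 < x" "x \<le> 1" using u q False by (auto simp: x_def)
  define k where "k n = nat (\<lceil>x * 2^n\<rceil> - 1)" for n :: nat
  have cl: "0 < \<lceil>x * 2^n\<rceil>" "\<lceil>x * 2^n\<rceil> \<le> 2^n" for n :: nat
  proof -
    have "0 < x * 2^n" using x by simp
    then show "0 < \<lceil>x * 2^n\<rceil>" by simp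
    have "x * 2^n \<le> 1 * 2^n" using x by (intro mult_right_mono) auto
    then show "\<lceil>x * 2^n\<rceil> \<le> 2^n" by (simp add: ceiling_le_iff)
  qed
  have sk: "real (Suc (k n)) = \<lceil>x * 2^n\<rceil>" for n using cl(1)[of n] unfolding k_def by (simp add: of_nat_nat)
  have kn: "k n < 2^n" for n
  proof -
    have "real (Suc (k n)) \<le> 2^n" unfolding sk using cl(2)[of n] by (metis of_int_le_iff of_int_numeral of_int_power)
    then have "real (Suc (k n)) \<le> real (2^n)" by simp
    then show ?thesis by (simp only: of_nat_le_iff Suc_le_eq)
  qed
  define v where "v n = grid q (q + \<theta>) (2^n) (Suc (k n))" for n
  have vb: "norm (X (v n) w - X q w) \<le> \<rho>" for n using w kn[of n] unfolding Osc_def v_def by (force simp: not_less)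
  have "v \<longlonglongrightarrow> q + x * \<theta>"
  proof -
    have v: "v n = q + (\<lceil>x * 2^n\<rceil> / 2^n) * \<theta>" for n unfolding v_def grid_def sk by simp
    have "(\<lambda>n. \<lceil>x * 2^n\<rceil> / 2^n) \<longlonglongrightarrow> x"
    proof (rule tendsto_sandwich[OF _ _ tendsto_const])
      show "(\<lambda>n. x + 1 / 2^n) \<longlonglongrightarrow> x"
        using tendsto_add[OF tendsto_const LIMSEQ_divide_realpow_zero[of "2::real" 1]] by simp
      show "\<forall>\<^sub>F n in sequentially. x \<le> \<lceil>x * 2^n\<rceil> / 2^n"
        by (intro always_eventually allI) (simp add: pos_le_divide_eq le_of_int_ceiling)
      show "\<forall>\<^sub>F n in sequentially. \<lceil>x * 2^n\<rceil> / 2^n \<le> x + 1 / 2^n"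
        by (intro always_eventually allI) (simp add: pos_divide_le_eq distrib_right of_int_ceiling_le_add_one)
    qed
    then show ?thesis unfolding v by (intro tendsto_intros)
  qed
  moreover have "q + x * \<theta> = u" using q by (simp add: x_def)
  ultimately have vu: "v \<longlonglongrightarrow> u" by simp
  have v0: "0 \<le> v n" for n unfolding v_def using grid_props(5)[of q "q + \<theta>" "2^n"] q by (meson less_add_same_cancel1 order_trans zero_less_numeral zero_less_power)
  have "(\<lambda>n. X (v n) w) \<longlonglongrightarrow> X u w"
    by (rule continuous_on_tendsto_compose[OF c vu]) (use v0 u q in auto)
  then have "(\<lambda>n. norm (X (v n) w - X q w)) \<longlonglongrightarrow> norm (X u w - X q w)" by (intro tendsto_intros)
  then show ?thesis by (rule LIMSEQ_le_const2) (use vb in auto)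
qed (use \<rho> in simp)

text \<open>An identity in place of the upper bound \<open>dW_L2\<close>, because ellipticity enters
  the barrier estimate as a lower bound.\<close>

lemma dW_quad:
  assumes q: "0 \<le> q" "q < t" and v: "\<And>j. bwt q (\<lambda>w. v w $ j)" and U: "bwt q U"
  shows "integrable M (\<lambda>w. U w * (v w \<bullet> (W t w - W q w))\<^sup>2)"
    "(\<integral>w. U w * (v w \<bullet> (W t w - W q w))\<^sup>2 \<partial>M) = (t - q) * (\<integral>w. U w * (norm (v w))\<^sup>2 \<partial>M)"
proof -
  let ?D = "\<lambda>j w. W t w $ j - W q w $ j"
  have Uv: "bwt q (\<lambda>w. U w * (v w $ i * v w $ j))" for i j by (rule bwt_mult[OF U bwt_mult[OF v v]])
  note C = dW_cond2[OF q bwt_F[OF Uv] bwt_integrable[OF q(1) Uv]]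
  have e: "U w * (v w \<bullet> (W t w - W q w))\<^sup>2 = (\<Sum>i\<in>UNIV. \<Sum>j\<in>UNIV. (U w * (v w $ i * v w $ j)) * (?D i w * ?D j w))" for w
  proof -
    have "(v w \<bullet> (W t w - W q w))\<^sup>2 = (\<Sum>i\<in>UNIV. v w $ i * ?D i w) * (\<Sum>j\<in>UNIV. v w $ j * ?D j w)"
      by (simp add: inner_vec_def power2_eq_square)
    also have "\<dots> = (\<Sum>i\<in>UNIV. \<Sum>j\<in>UNIV. (v w $ i * ?D i w) * (v w $ j * ?D j w))" by (rule sum_product)
    finally show ?thesis by (simp only: sum_distrib_left) (simp add: mult_ac)
  qed
  have n: "U w * (norm (v w))\<^sup>2 = (\<Sum>i\<in>UNIV. U w * (v w $ i * v w $ i))" for w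
    unfolding power2_norm_eq_inner inner_vec_def sum_distrib_left by simp
  show "integrable M (\<lambda>w. U w * (v w \<bullet> (W t w - W q w))\<^sup>2)" unfolding e using C(1) by auto
  have "(\<integral>w. U w * (v w \<bullet> (W t w - W q w))\<^sup>2 \<partial>M) = (\<Sum>i\<in>UNIV. \<Sum>j\<in>UNIV. \<integral>w. (U w * (v w $ i * v w $ j)) * (?D i w * ?D j w) \<partial>M)"
    unfolding e using C(1) by (simp add: Bochner_Integration.integral_sum)
  also have "\<dots> = (\<Sum>i\<in>UNIV. \<Sum>j\<in>UNIV. (if i = j then t - q else 0) * (\<integral>w. U w * (v w $ i * v w $ j) \<partial>M))"
    unfolding C(2) ..
  also have "\<dots> = (\<Sum>i\<in>UNIV. (t - q) * (\<integral>w. U w * (v w $ i * v w $ i) \<partial>M))"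
    by (simp add: if_distrib[where f="\<lambda>x. x * _"] cong: if_cong)
  also have "\<dots> = (t - q) * (\<integral>w. U w * (norm (v w))\<^sup>2 \<partial>M)"
    unfolding n using bwt_integrable[OF q(1) Uv] by (simp add: Bochner_Integration.integral_sum sum_distrib_left)
  finally show "(\<integral>w. U w * (v w \<bullet> (W t w - W q w))\<^sup>2 \<partial>M) = (t - q) * (\<integral>w. U w * (norm (v w))\<^sup>2 \<partial>M)" .
qed

end

text \<open>The remainder after the cubic term has even order and is therefore nonnegative for
  either sign of \<open>x\<close>.\<close>

lemma exp_lower3: "1 + x + x\<^sup>2 / 2 + x ^ 3 / 6 \<le> exp (x::real)"
proof -
  obtain t where "exp x = (\<Sum>m<4. x ^ m / fact m) + exp t / fact 4 * x ^ 4"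
    using Maclaurin_exp_le[of x 4] by auto
  moreover have "(\<Sum>m<4. x ^ m / fact m) = 1 + x + x\<^sup>2 / 2 + x ^ 3 / 6"
    by (simp add: eval_nat_numeral fact_numeral)
  moreover have "0 \<le> exp t / fact 4 * x ^ 4" by (intro mult_nonneg_nonneg) auto
  ultimately show ?thesis by linarith
qed

text \<open>Positive outside the ball of radius \<open>r\<close> about \<open>z\<close>. For large \<open>l\<close> the second order term of the generator dominates, so that
  uniform ellipticity makes the drift strictly negative.\<close>

definition bar :: "real \<Rightarrow> real \<Rightarrow> real \<Rightarrow> real^'d \<Rightarrow> real^'d::finite \<Rightarrow> real" where
  "bar l Kb r z x = Kb * (exp (- l * r\<^sup>2) - exp (- l * (norm (x - z))\<^sup>2))"

text \<open>A pathwise expansion in place of Ito's formula: \<open>2 * p + n\<^sup>2\<close> is the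
  increment of the squared distance to the centre. The term with \<open>p\<^sup>2\<close> will carry
  the ellipticity; all of higher order is moved into \<open>n ^ 3 + n ^ 6\<close>, whose moments are
  of order 3/2 in time or smaller.\<close>

lemma bar_pointwise:
  fixes x y z :: "real^'d::finite"
  assumes l: "0 < l" and Kb: "0 \<le> Kb" and w: "norm (x - z) \<le> Lw"
  defines "p \<equiv> (x - z) \<bullet> (y - x)" and "n \<equiv> norm (y - x)"
  shows "bar l Kb r z y - bar l Kb r z x \<le> Kb * exp (- l * (norm (x - z))\<^sup>2) * (l * (2 * p + n\<^sup>2 - 2 * l * p\<^sup>2 + (2 * l * Lw + l\<^sup>2 * (16 / 3 * Lw ^ 3 + 2 / 3)) * (n ^ 3 + n ^ 6)))"
proof -
  define \<eta> where "\<eta> = 2 * p + n\<^sup>2"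
  define H where "H = 2 * l * Lw + l\<^sup>2 * (16 / 3 * Lw ^ 3 + 2 / 3)"
  have n0: "0 \<le> n" unfolding n_def by simp
  have Lw0: "0 \<le> Lw" using w norm_ge_zero order_trans by blast
  have yz: "(norm (y - z))\<^sup>2 = (norm (x - z))\<^sup>2 + \<eta>"
  proof -
    have "y - z = (x - z) + (y - x)" by simp
    then show ?thesis unfolding \<eta>_def p_def n_def power2_norm_eq_inner
      by (metis (no_types, lifting) add.assoc inner_add_left inner_add_right inner_commute mult_2)
  qed
  have pn: "\<bar>p\<bar> \<le> Lw * n"
    unfolding p_def n_def by (rule order_trans[OF Cauchy_Schwarz_ineq2]) (intro mult_right_mono w norm_ge_zero)
  have e1: "bar l Kb r z y - bar l Kb r z x = Kb * exp (- l * (norm (x - z))\<^sup>2) * (1 - exp (- l * \<eta>))"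
    unfolding bar_def yz by (simp add: algebra_simps exp_add[symmetric])
  have t: "1 - exp (- l * \<eta>) \<le> l * \<eta> - l\<^sup>2 * \<eta>\<^sup>2 / 2 + l ^ 3 * \<eta> ^ 3 / 6"
    using exp_lower3[of "- l * \<eta>"] by (simp add: power_mult_distrib power3_eq_cube power2_eq_square mult_ac)
  have \<eta>2: "4 * p\<^sup>2 - 4 * (Lw * n ^ 3) \<le> \<eta>\<^sup>2"
  proof -
    have "- (Lw * n) * n\<^sup>2 \<le> p * n\<^sup>2" using pn by (intro mult_right_mono) auto
    then have "- (Lw * n ^ 3) \<le> p * n\<^sup>2" by (simp add: power3_eq_cube power2_eq_square mult_ac)
    moreover have "\<eta>\<^sup>2 = 4 * p\<^sup>2 + 4 * (p * n\<^sup>2) + (n\<^sup>2)\<^sup>2" unfolding \<eta>_def by (simp add: power2_eq_square algebra_simps)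
    moreover have "0 \<le> (n\<^sup>2)\<^sup>2" by simp
    ultimately show ?thesis by linarith
  qed
  have \<eta>3: "\<eta> ^ 3 \<le> 32 * Lw ^ 3 * n ^ 3 + 4 * n ^ 6"
  proof -
    define A where "A = 2 * Lw * n"
    define B where "B = n\<^sup>2"
    have AB: "0 \<le> A" "0 \<le> B" unfolding A_def B_def using Lw0 n0 by auto
    have "\<eta> \<le> A + B" unfolding \<eta>_def A_def B_def using pn by linarith
    then have "\<eta> ^ 3 \<le> (A + B) ^ 3"
    proof (cases "0 \<le> \<eta>")
      case False
      then have "\<eta> ^ 3 \<le> 0" by (simp add: power3_eq_cube mult_nonneg_nonpos mult_nonpos_nonpos zero_le_mult_iff)
      also have "0 \<le> (A + B) ^ 3" using AB by simp
      finally show ?thesis .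
    qed (intro power_mono)
    also have "\<dots> \<le> 4 * (A ^ 3 + B ^ 3)"
    proof -
      have "4 * (A ^ 3 + B ^ 3) - (A + B) ^ 3 = 3 * (A + B) * (A - B)\<^sup>2"
        by (simp add: power3_eq_cube power2_eq_square algebra_simps)
      moreover have "0 \<le> 3 * (A + B) * (A - B)\<^sup>2" using AB by (intro mult_nonneg_nonneg) auto
      ultimately show ?thesis by linarith
    qed
    also have "\<dots> = 32 * Lw ^ 3 * n ^ 3 + 4 * n ^ 6"
      unfolding A_def B_def by (simp add: power_mult_distrib flip: power_mult)
    finally show ?thesis .
  qed
  have "1 - exp (- l * \<eta>) \<le> l * (2 * p + n\<^sup>2 - 2 * l * p\<^sup>2 + H * (n ^ 3 + n ^ 6))"
  proof -
    have a1: "l\<^sup>2 / 2 * (4 * p\<^sup>2 - 4 * (Lw * n ^ 3)) \<le> l\<^sup>2 / 2 * \<eta>\<^sup>2" using \<eta>2 by (intro mult_left_mono) auto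
    have a2: "l ^ 3 / 6 * \<eta> ^ 3 \<le> l ^ 3 / 6 * (32 * Lw ^ 3 * n ^ 3 + 4 * n ^ 6)" using \<eta>3 l by (intro mult_left_mono) auto
    \<comment> \<open>Nonnegative terms that are added so that both powers of \<open>n\<close> share
      the coefficient \<open>H\<close>.\<close>
    have a3: "0 \<le> l * (2 * l * Lw + l\<^sup>2 * (16 / 3 * Lw ^ 3)) * n ^ 6 + l * (l\<^sup>2 * (2 / 3)) * n ^ 3" 
      using l Lw0 n0 by (intro add_nonneg_nonneg mult_nonneg_nonneg) auto
    have "l * (2 * p + n\<^sup>2 - 2 * l * p\<^sup>2 + H * (n ^ 3 + n ^ 6)) = 
       l * \<eta> - l\<^sup>2 / 2 * (4 * p\<^sup>2 - 4 * (Lw * n ^ 3)) + l ^ 3 / 6 * (32 * Lw ^ 3 * n ^ 3 + 4 * n ^ 6)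
       + (l * (2 * l * Lw + l\<^sup>2 * (16 / 3 * Lw ^ 3)) * n ^ 6 + l * (l\<^sup>2 * (2 / 3)) * n ^ 3)"
      unfolding H_def \<eta>_def by (simp add: power2_eq_square power3_eq_cube algebra_simps)
    then show ?thesis using t a1 a2 a3 by (simp add: mult.commute) 
  qed
  then show ?thesis unfolding e1 H_def using Kb by (intro mult_left_mono) auto
qed

section \<open>Mean decrease of a single barrier\<close>

context sde
begin

text \<open>The first order and trace terms contribute at most \<open>6 * d * K * Lw + Cn 2\<close>,
  with \<open>d\<close> the dimension and independently of \<open>l\<close>. The squared radial
  increment contributes a negative term proportional to \<open>l\<close>, which wins for large
  \<open>l\<close>; the rest carries an additional \<open>sqrt (t - s)\<close>. The exponential
  stays inside the weight, so that the bound is relative to the size of the barrier.\<close>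

lemma bar_drift:
  assumes st: "0 \<le> s" "s < t" "t \<le> s + 1" and A: "A \<in> sets (F s)" and l: "0 < l" and Kb: "0 \<le> Kb"
    and w: "\<And>w. w \<in> A \<Longrightarrow> \<rho>1 \<le> norm (X s w - z)" "\<And>w. w \<in> A \<Longrightarrow> norm (X s w - z) \<le> Lw" and \<rho>1: "0 \<le> \<rho>1" and Lw: "0 \<le> Lw"
    and ell: "\<And>w \<xi>. w \<in> A \<Longrightarrow> c_b * (norm \<xi>)\<^sup>2 \<le> \<xi> \<bullet> ((b (X s w) ** transpose (b (X s w))) *v \<xi>)" and cb: "0 \<le> c_b"
  defines "H \<equiv> 2 * l * Lw + l\<^sup>2 * (16 / 3 * Lw ^ 3 + 2 / 3)"
  defines "C' \<equiv> 2 * (real CARD('d))\<^sup>2 * Lw\<^sup>2 * (K\<^sup>2 + CR)"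
  shows "(\<integral>w. indicator A w * (bar l Kb r z (X t w) - bar l Kb r z (X s w)) \<partial>M)
     \<le> l * (t - s) * (6 * real CARD('d) * K * Lw + Cn 2 - l * c_b * \<rho>1\<^sup>2 + (2 * l * C' + H * (Cn 3 + Cn 6)) * sqrt (t - s))
        * (\<integral>w. indicator A w * (Kb * exp (- l * (norm (X s w - z))\<^sup>2)) \<partial>M)"
proof -
  define \<kappa> where "\<kappa> = t - s"
  have \<kappa>: "0 < \<kappa>" "\<kappa> \<le> 1" using st by (auto simp: \<kappa>_def)
  have sl: "s \<le> t" "0 \<le> t" using st by auto
  define d where "d = real CARD('d)"
  define U where "U w = indicator A w * (Kb * exp (- l * (norm (X s w - z))\<^sup>2))" for w
  have mX[measurable]: "X s \<in> borel_measurable (F s)" by (rule meas_X[OF st(1)])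
  have U0: "0 \<le> U w" for w unfolding U_def using Kb by simp
  have UKb: "U w \<le> Kb" for w unfolding U_def using Kb l mult_left_mono[of "exp (- l * (norm (X s w - z))\<^sup>2)" 1 Kb] by (auto simp: indicator_def)
  have bU: "bwt s U"
    by (rule bwtI[of _ _ Kb]) (use A U0 UKb in \<open>auto simp: U_def[abs_def]\<close>)
  define EU where "EU = (\<integral>w. U w \<partial>M)"
  have EU0: "0 \<le> EU" unfolding EU_def using U0 by (intro integral_nonneg_AE) auto
  \<comment> \<open>Cut off outside \<open>A\<close>, where nothing bounds the distance to the
    centre; so each component is a bounded weight.\<close>
  define wv where "wv w = (\<chi> i. indicator A w * (X s w $ i - z $ i))" for w
  have wvA: "wv w = X s w - z" if "w \<in> A" for w using that by (simp add: wv_def vec_eq_iff)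
  have wvi: "\<bar>wv w $ i\<bar> \<le> Lw" for w i
    using w(2)[of w] Lw component_le_norm_cart[of "X s w - z" i] by (cases "w \<in> A") (auto simp: wv_def)
  have bw: "bwt s (\<lambda>w. wv w $ i)" for i
    by (rule bwtI[OF _ wvi]) (use A in \<open>simp add: wv_def\<close>)
  define p where "p w = wv w \<bullet> (X t w - X s w)" for w
  define n where "n w = norm (X t w - X s w)" for w
  have UA: "U w = 0" if "w \<notin> A" for w using that by (simp add: U_def)
  note iU = bwt_imult[OF st(1) bU]
  note mom = X_mom[OF st(1) sl(1) st(3) bwt_F[OF bU] U0 bwt_integrable[OF st(1) bU], folded n_def \<kappa>_def EU_def]
  have Uw: "bwt s (\<lambda>w. U w * wv w $ i)" for i by (rule bwt_mult[OF bU bw])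
  note L2i = X_L2_inci[OF st(1) sl(1) st(3)]
  have iUw: "integrable M (\<lambda>w. (U w * wv w $ i) * (X t w $ i - X s w $ i))" for i
    by (rule bwt_imult[OF st(1) Uw L2_integrable[OF L2i]])
  have pe: "U w * p w = (\<Sum>i\<in>UNIV. (U w * wv w $ i) * (X t w $ i - X s w $ i))" for w
    unfolding p_def inner_vec_def sum_distrib_left by (simp add: mult_ac)
  have ip: "integrable M (\<lambda>w. U w * p w)" unfolding pe using iUw by auto
  have Ep: "(\<integral>w. U w * p w \<partial>M) \<le> 3 * d * K * Lw * \<kappa> * EU"
  proof -
    have "(\<integral>w. U w * p w \<partial>M) = (\<Sum>i\<in>UNIV. \<integral>w. (U w * wv w $ i) * (X t w $ i - X s w $ i) \<partial>M)"
      unfolding pe using iUw by (simp add: Bochner_Integration.integral_sum)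
    also have "\<dots> \<le> (\<Sum>i\<in>(UNIV::'d set). 3 * K * \<kappa> * (Lw * EU))"
    proof (rule sum_mono)
      fix i
      have "(\<integral>w. (U w * wv w $ i) * (X t w $ i - X s w $ i) \<partial>M) \<le> 3 * K * \<kappa> * (\<integral>w. \<bar>U w * wv w $ i\<bar> \<partial>M)"
        using X_mean[OF st Uw, of i i] unfolding \<kappa>_def by linarith
      also have "\<dots> \<le> 3 * K * \<kappa> * (\<integral>w. Lw * U w \<partial>M)"
      proof (intro mult_left_mono integral_mono)
        show "\<bar>U w * wv w $ i\<bar> \<le> Lw * U w" for w
          using mult_left_mono[OF wvi[of w i] U0[of w]] U0[of w] by (simp add: abs_mult mult.commute)
      qed (use bwt_integrable[OF st(1) Uw] bwt_integrable[OF st(1) bU] K1 \<kappa> in auto)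
      finally show "(\<integral>w. (U w * wv w $ i) * (X t w $ i - X s w $ i) \<partial>M) \<le> 3 * K * \<kappa> * (Lw * EU)" unfolding EU_def by simp
    qed
    finally show ?thesis unfolding d_def by (simp add: mult_ac)
  qed
  have L2p: "L2 p"
  proof -
    have "p = (\<lambda>w. \<Sum>i\<in>UNIV. wv w $ i * (X t w $ i - X s w $ i))" unfolding p_def inner_vec_def by auto
    moreover have "L2 (\<lambda>w. \<Sum>i\<in>UNIV. wv w $ i * (X t w $ i - X s w $ i))"
      by (intro L2_sum bwt_L2mult[OF st(1) bw L2i])
    ultimately show ?thesis by simp
  qed
  define v where "v w = (\<chi> j. \<Sum>i\<in>UNIV. wv w $ i * b (X s w) $ i $ j)" for w
  have bv: "bwt s (\<lambda>w. v w $ j)" for j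
  proof (rule bwtI[of _ _ "d * (Lw * K)"])
    show "(\<lambda>w. v w $ j) \<in> borel_measurable (F s)"
      unfolding v_def using bwt_F[OF bw] nice_X[OF nb st(1)] by simp
    have "\<bar>b x $ i $ j\<bar> \<le> K" for x i using nb unfolding nice_def by blast
    then have "(\<Sum>i\<in>UNIV. \<bar>wv w $ i * b (X s w) $ i $ j\<bar>) \<le> (\<Sum>i\<in>(UNIV::'d set). Lw * K)" for w
      unfolding abs_mult using wvi Lw by (intro sum_mono mult_mono) auto
    then show "\<bar>v w $ j\<bar> \<le> d * (Lw * K)" for w
      unfolding v_def d_def by (simp add: order_trans[OF sum_abs])
  qed
  define x where "x w = v w \<bullet> (W t w - W s w)" for w
  define y where "y w = (\<Sum>i\<in>UNIV. wv w $ i * (a (X s w) $ i * \<kappa> + R i s t w))" for w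
  have pxy: "p w = x w + y w" for w
  proof -
    have "x w = (\<Sum>i\<in>UNIV. wv w $ i * (b (X s w) $ i \<bullet> (W t w - W s w)))"
      unfolding x_def v_def inner_vec_def by (simp add: sum_distrib_left sum_distrib_right mult.assoc, subst sum.swap) (rule refl)
    moreover have "p w = (\<Sum>i\<in>UNIV. wv w $ i * (X t w $ i - X s w $ i))" unfolding p_def inner_vec_def by simp
    moreover have "\<dots> = (\<Sum>i\<in>UNIV. wv w $ i * (b (X s w) $ i \<bullet> (W t w - W s w)) + wv w $ i * (a (X s w) $ i * \<kappa> + R i s t w))"
      unfolding dX_eq[of t w _ s] \<kappa>_def by (intro sum.cong refl) (simp add: algebra_simps)
    ultimately show ?thesis unfolding y_def by (simp add: sum.distrib)
  qed
  have quad: "integrable M (\<lambda>w. U w * (x w)\<^sup>2)" "(\<integral>w. U w * (x w)\<^sup>2 \<partial>M) = \<kappa> * (\<integral>w. U w * (norm (v w))\<^sup>2 \<partial>M)"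
    unfolding x_def \<kappa>_def by (rule dW_quad[OF st(1,2) bv bU])+
  have Ex: "\<kappa> * (c_b * \<rho>1\<^sup>2) * EU \<le> (\<integral>w. U w * (x w)\<^sup>2 \<partial>M)"
  proof -
    have vA: "c_b * \<rho>1\<^sup>2 \<le> (norm (v w))\<^sup>2" if wA: "w \<in> A" for w
    proof -
      let ?B = "b (X s w)"
      have "v w = wv w v* ?B" unfolding v_def vector_matrix_mult_def by (simp add: vec_eq_iff mult.commute)
      then have "(norm (v w))\<^sup>2 = (wv w v* ?B) \<bullet> (wv w v* ?B)" by (simp add: power2_norm_eq_inner)
      also have "\<dots> = wv w \<bullet> (?B *v (wv w v* ?B))" by (rule dot_lmul_matrix)
      also have "\<dots> = wv w \<bullet> ((?B ** transpose ?B) *v wv w)"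
        by (simp only: matrix_vector_mul_assoc[symmetric] transpose_matrix_vector)
      finally have "c_b * (norm (wv w))\<^sup>2 \<le> (norm (v w))\<^sup>2" using ell[OF wA, of "wv w"] by simp
      moreover have "\<rho>1\<^sup>2 \<le> (norm (wv w))\<^sup>2" unfolding wvA[OF wA] using w(1)[OF wA] \<rho>1 by (intro power_mono) auto
      ultimately show ?thesis using cb by (meson mult_left_mono order_trans)
    qed
    have nv: "bwt s (\<lambda>w. U w * (norm (v w))\<^sup>2)"
    proof -
      have "bwt s (\<lambda>w. \<Sum>j\<in>UNIV. v w $ j * v w $ j)"
      proof -
        have "\<forall>j. \<exists>B. \<forall>w. \<bar>v w $ j * v w $ j\<bar> \<le> B" using bwt_mult[OF bv bv] unfolding bwt_def by blast
        then obtain B where "\<forall>j. \<forall>w. \<bar>v w $ j * v w $ j\<bar> \<le> B j" by (rule choice[THEN exE])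
        then have B: "\<And>j w. \<bar>v w $ j * v w $ j\<bar> \<le> B j" by blast
        have mv: "(\<lambda>w. \<Sum>j\<in>UNIV. v w $ j * v w $ j) \<in> borel_measurable (F s)" using bwt_F[OF bv] by measurable
        show ?thesis by (rule bwtI[OF mv, of "\<Sum>j\<in>UNIV. B j"]) (rule order_trans[OF sum_abs sum_mono[OF B]])
      qed
      then show ?thesis using bwt_mult[OF bU] unfolding power2_norm_eq_inner inner_vec_def by simp
    qed
    have "c_b * \<rho>1\<^sup>2 * EU = (\<integral>w. c_b * \<rho>1\<^sup>2 * U w \<partial>M)" unfolding EU_def by simp
    also have "\<dots> \<le> (\<integral>w. U w * (norm (v w))\<^sup>2 \<partial>M)"
    proof (rule integral_mono)
      show "c_b * \<rho>1\<^sup>2 * U w \<le> U w * (norm (v w))\<^sup>2" for w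
        using mult_left_mono[OF vA U0[of w]] UA[of w] by (cases "w \<in> A") (auto simp: mult_ac)
    qed (use bwt_integrable[OF st(1) bU] bwt_integrable[OF st(1) nv] in auto)
    finally show ?thesis unfolding quad(2) using \<kappa> by (simp add: mult.assoc mult_left_mono)
  qed
  have LR: "L2 (R i s t)" for i by (rule R_general(1)[OF st bU])
  have Laux: "L2 (\<lambda>w. a (X s w) $ i * \<kappa> + R i s t w)" for i
    using L2_cmult[OF bwt_L2[OF st(1) nice_bwt[OF na st(1)]], of \<kappa> i] by (intro L2_add LR) (simp add: mult.commute)
  have Ly: "L2 y" unfolding y_def by (intro L2_sum bwt_L2mult[OF st(1) bw Laux])
  have Ey: "(\<integral>w. U w * (y w)\<^sup>2 \<partial>M) \<le> C' * \<kappa>\<^sup>2 * EU"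
  proof -
    have pt: "(y w)\<^sup>2 \<le> d * (\<Sum>i\<in>UNIV. Lw\<^sup>2 * (2 * (K\<^sup>2 * \<kappa>\<^sup>2) + 2 * (R i s t w)\<^sup>2))" for w
    proof -
      have "(y w)\<^sup>2 \<le> d * (\<Sum>i\<in>UNIV. (wv w $ i * (a (X s w) $ i * \<kappa> + R i s t w))\<^sup>2)" unfolding y_def d_def by (rule sum_sq_le)
      also have "\<dots> \<le> d * (\<Sum>i\<in>UNIV. Lw\<^sup>2 * (2 * (K\<^sup>2 * \<kappa>\<^sup>2) + 2 * (R i s t w)\<^sup>2))"
      proof (intro mult_left_mono sum_mono)
        fix i
        have "\<bar>wv w $ i\<bar>\<^sup>2 \<le> Lw\<^sup>2" by (rule power_mono[OF wvi]) auto
        moreover have "(a (X s w) $ i * \<kappa> + R i s t w)\<^sup>2 \<le> 2 * (K\<^sup>2 * \<kappa>\<^sup>2) + 2 * (R i s t w)\<^sup>2"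
        proof -
          have "\<bar>a (X s w) $ i\<bar> \<le> K" using na unfolding nice_def by blast
          then have "\<bar>a (X s w) $ i\<bar>\<^sup>2 \<le> K\<^sup>2" by (intro power_mono) auto
          then have "(a (X s w) $ i * \<kappa>)\<^sup>2 \<le> K\<^sup>2 * \<kappa>\<^sup>2" unfolding power_mult_distrib by (intro mult_right_mono) auto
          then show ?thesis using sq_sum2[of "a (X s w) $ i * \<kappa>" "R i s t w"] by linarith
        qed
        ultimately show "(wv w $ i * (a (X s w) $ i * \<kappa> + R i s t w))\<^sup>2 \<le> Lw\<^sup>2 * (2 * (K\<^sup>2 * \<kappa>\<^sup>2) + 2 * (R i s t w)\<^sup>2)"
          unfolding power_mult_distrib by (intro mult_mono) auto
      qed (auto simp: d_def)
      finally show ?thesis .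
    qed
    have iR: "integrable M (\<lambda>w. U w * (R i s t w)\<^sup>2)" for i by (rule iU[OF L2_sq[OF LR]])
    have "(\<integral>w. U w * (y w)\<^sup>2 \<partial>M) \<le> (\<integral>w. d * (\<Sum>i\<in>UNIV. Lw\<^sup>2 * (2 * (K\<^sup>2 * \<kappa>\<^sup>2) * U w + 2 * (U w * (R i s t w)\<^sup>2))) \<partial>M)"
    proof (rule integral_mono)
      show "U w * (y w)\<^sup>2 \<le> d * (\<Sum>i\<in>UNIV. Lw\<^sup>2 * (2 * (K\<^sup>2 * \<kappa>\<^sup>2) * U w + 2 * (U w * (R i s t w)\<^sup>2)))" for w
        using mult_left_mono[OF pt[of w] U0[of w]] by (simp add: sum_distrib_left algebra_simps)
    qed (use iU[OF L2_sq[OF Ly]] iR bwt_integrable[OF st(1) bU] in auto)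
    also have "\<dots> = d * (\<Sum>i\<in>UNIV. Lw\<^sup>2 * (2 * (K\<^sup>2 * \<kappa>\<^sup>2) * EU + 2 * (\<integral>w. U w * (R i s t w)\<^sup>2 \<partial>M)))"
      unfolding EU_def using iR bwt_integrable[OF st(1) bU] by (simp add: Bochner_Integration.integral_sum)
    also have "\<dots> \<le> d * (\<Sum>i\<in>(UNIV::'d set). Lw\<^sup>2 * (2 * (K\<^sup>2 * \<kappa>\<^sup>2) * EU + 2 * (CR * \<kappa>\<^sup>2 * EU)))"
      using R_general(2)[OF st bU U0] unfolding \<kappa>_def EU_def d_def
      by (intro mult_left_mono sum_mono add_mono order_refl) auto
    also have "\<dots> = C' * \<kappa>\<^sup>2 * EU" unfolding C'_def d_def[symmetric] by (simp add: power2_eq_square algebra_simps flip: d_def)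
    finally show ?thesis .
  qed
  have ip2: "integrable M (\<lambda>w. U w * (p w)\<^sup>2)" by (rule iU[OF L2_sq[OF L2p]])
  \<comment> \<open>\<open>x\<close> is the Gaussian part of the radial increment, \<open>y\<close>
    its drift and remainder. The inequality \<open>p\<^sup>2 \<ge> x\<^sup>2 / 2 - y\<^sup>2\<close>
    avoids the mixed term, and half of the ellipticity suffices.\<close>
  have Ep2: "\<kappa> * (c_b * \<rho>1\<^sup>2) / 2 * EU - C' * \<kappa>\<^sup>2 * EU \<le> (\<integral>w. U w * (p w)\<^sup>2 \<partial>M)"
  proof -
    have "(\<integral>w. U w * (x w)\<^sup>2 / 2 - U w * (y w)\<^sup>2 \<partial>M) \<le> (\<integral>w. U w * (p w)\<^sup>2 \<partial>M)"
    proof (rule integral_mono)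
      fix w
      have "(x w)\<^sup>2 / 2 - (y w)\<^sup>2 \<le> (p w)\<^sup>2" using sq_sum2[of "p w" "- y w"] unfolding pxy by simp
      from mult_left_mono[OF this U0[of w]] show "U w * (x w)\<^sup>2 / 2 - U w * (y w)\<^sup>2 \<le> U w * (p w)\<^sup>2" by (simp add: right_diff_distrib)
    qed (use quad(1) iU[OF L2_sq[OF Ly]] ip2 in auto)
    moreover have "(\<integral>w. U w * (x w)\<^sup>2 / 2 - U w * (y w)\<^sup>2 \<partial>M) = (\<integral>w. U w * (x w)\<^sup>2 \<partial>M) / 2 - (\<integral>w. U w * (y w)\<^sup>2 \<partial>M)"
      using quad(1) iU[OF L2_sq[OF Ly]] by simp
    moreover have "\<kappa> * (c_b * \<rho>1\<^sup>2) / 2 * EU = \<kappa> * (c_b * \<rho>1\<^sup>2) * EU / 2" by simp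
    moreover have "\<kappa> * (c_b * \<rho>1\<^sup>2) * EU / 2 - C' * \<kappa>\<^sup>2 * EU \<le> (\<integral>w. U w * (x w)\<^sup>2 \<partial>M) / 2 - (\<integral>w. U w * (y w)\<^sup>2 \<partial>M)"
      by (intro diff_mono divide_right_mono Ex Ey) simp
    ultimately show ?thesis by (simp only:)
  qed
  have H0: "0 \<le> H" unfolding H_def using l Lw by (intro add_nonneg_nonneg mult_nonneg_nonneg) auto
  have C'0: "0 \<le> C'" unfolding C'_def using CR0 by (intro mult_nonneg_nonneg add_nonneg_nonneg) auto
  let ?I = "\<lambda>w. l * (2 * (U w * p w) + U w * n w ^ 2 - 2 * l * (U w * (p w)\<^sup>2) + H * (U w * n w ^ 3 + U w * n w ^ 6))"
  have bm: "bar l Kb r z \<in> borel_measurable borel" unfolding bar_def by measurable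
  have bb: "\<bar>bar l Kb r z u\<bar> \<le> Kb * 2" for u
  proof -
    have "\<bar>exp (- l * r\<^sup>2) - exp (- l * (norm (u - z))\<^sup>2)\<bar> \<le> 2"
    proof -
      have "0 \<le> exp (- l * u\<^sup>2) \<and> exp (- l * u\<^sup>2) \<le> 1" for u :: real using l by simp
      from this[of r] this[of "norm (u - z)"] show ?thesis by linarith
    qed
    then show ?thesis unfolding bar_def abs_mult using Kb by (auto intro!: mult_mono)
  qed
  have ibar: "integrable M (\<lambda>w. bar l Kb r z (X u w))" if "0 \<le> u" for u
    by (rule integrable_const_bound[of _ "Kb * 2"]) (use bb measurable_compose[OF meas_X_M[OF that] bm] in auto)
  have "(\<integral>w. indicator A w * (bar l Kb r z (X t w) - bar l Kb r z (X s w)) \<partial>M) \<le> (\<integral>w. ?I w \<partial>M)"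
  proof (rule integral_mono)
    show "integrable M (\<lambda>w. indicator A w * (bar l Kb r z (X t w) - bar l Kb r z (X s w)))"
      by (rule bwt_imult[OF st(1) bwt_ind[OF A]]) (use ibar st sl in auto)
    show "integrable M ?I" using ip ip2 mom(1)[of 2] mom(1)[of 3] mom(1)[of 6] by auto
    fix w
    show "indicator A w * (bar l Kb r z (X t w) - bar l Kb r z (X s w)) \<le> ?I w"
    proof (cases "w \<in> A")
      case False
      then show ?thesis using UA by simp
    next
      case True
      have Ue: "U w = Kb * exp (- l * (norm (X s w - z))\<^sup>2)" using True by (simp add: U_def)
      have pe: "p w = (X s w - z) \<bullet> (X t w - X s w)" unfolding p_def wvA[OF True] ..
      have "bar l Kb r z (X t w) - bar l Kb r z (X s w) \<le> U w * (l * (2 * p w + (n w)\<^sup>2 - 2 * l * (p w)\<^sup>2 + H * (n w ^ 3 + n w ^ 6)))"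
        unfolding Ue pe n_def H_def by (rule bar_pointwise[OF l Kb w(2)[OF True]])
      also have "\<dots> = ?I w" by (simp add: algebra_simps)
      finally show ?thesis using True by simp
    qed
  qed
  also have "(\<integral>w. ?I w \<partial>M) = l * (2 * (\<integral>w. U w * p w \<partial>M) + (\<integral>w. U w * n w ^ 2 \<partial>M) - 2 * l * (\<integral>w. U w * (p w)\<^sup>2 \<partial>M) + H * ((\<integral>w. U w * n w ^ 3 \<partial>M) + (\<integral>w. U w * n w ^ 6 \<partial>M)))"
    using ip ip2 mom(1)[of 2] mom(1)[of 3] mom(1)[of 6] by simp
  also have "\<dots> \<le> l * (2 * (3 * d * K * Lw * \<kappa> * EU) + Cn 2 * sqrt \<kappa> ^ 2 * EU - 2 * l * (\<kappa> * (c_b * \<rho>1\<^sup>2) / 2 * EU - C' * \<kappa>\<^sup>2 * EU) + H * (Cn 3 * sqrt \<kappa> ^ 3 * EU + Cn 6 * sqrt \<kappa> ^ 6 * EU))"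
    using l H0 by (intro mult_left_mono add_mono diff_mono Ep Ep2 mom(2)) auto
  also have "\<dots> \<le> l * (2 * (3 * d * K * Lw * \<kappa> * EU) + Cn 2 * \<kappa> * EU - l * (\<kappa> * (c_b * \<rho>1\<^sup>2) * EU) + 2 * l * (C' * (\<kappa> * sqrt \<kappa>) * EU) + H * (Cn 3 * (\<kappa> * sqrt \<kappa>) * EU + Cn 6 * (\<kappa> * sqrt \<kappa>) * EU))"
  proof -
    have sk: "sqrt \<kappa> \<le> 1" "0 \<le> sqrt \<kappa>" "\<kappa> \<le> sqrt \<kappa>" "sqrt \<kappa> * sqrt \<kappa> = \<kappa>"
      using \<kappa> by (auto simp: real_le_rsqrt power2_eq_square mult_left_le)
    have k2: "\<kappa>\<^sup>2 \<le> \<kappa> * sqrt \<kappa>" using sk(3) \<kappa> by (simp add: power2_eq_square)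
    have k3: "sqrt \<kappa> ^ 3 = \<kappa> * sqrt \<kappa>" using sk(4) by (simp add: power3_eq_cube)
    have k6: "sqrt \<kappa> ^ 6 \<le> \<kappa> * sqrt \<kappa>"
      unfolding k3[symmetric] using sk by (intro power_decreasing) auto
    have a: "C' * \<kappa>\<^sup>2 * EU \<le> C' * (\<kappa> * sqrt \<kappa>) * EU" using k2 C'0 EU0 by (intro mult_right_mono mult_left_mono)
    have b: "Cn 6 * sqrt \<kappa> ^ 6 * EU \<le> Cn 6 * (\<kappa> * sqrt \<kappa>) * EU" using k6 Cn_pos[of 6] EU0 by (intro mult_right_mono mult_left_mono) auto
    have c: "H * (Cn 3 * sqrt \<kappa> ^ 3 * EU + Cn 6 * sqrt \<kappa> ^ 6 * EU) \<le> H * (Cn 3 * (\<kappa> * sqrt \<kappa>) * EU + Cn 6 * (\<kappa> * sqrt \<kappa>) * EU)"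
      using b H0 unfolding k3 by (intro mult_left_mono) auto
    have k1: "sqrt \<kappa> ^ 2 = \<kappa>" using \<kappa> by simp
    have "l * (C' * \<kappa>\<^sup>2 * EU) \<le> l * (C' * (\<kappa> * sqrt \<kappa>) * EU)" using a l by (intro mult_left_mono) auto
    then show ?thesis using c l unfolding k1 by (intro mult_left_mono) (auto simp: algebra_simps)
  qed
  also have "\<dots> = l * \<kappa> * (6 * d * K * Lw + Cn 2 - l * c_b * \<rho>1\<^sup>2 + (2 * l * C' + H * (Cn 3 + Cn 6)) * sqrt \<kappa>) * EU"
    by (simp add: algebra_simps)
  finally show ?thesis unfolding d_def \<kappa>_def EU_def U_def .
qed

end

lemma exp_sq_lip:
  fixes u v :: real assumes l: "1 \<le> l"
  shows "\<bar>exp (- l * u\<^sup>2) - exp (- l * v\<^sup>2)\<bar> \<le> 2 * l * \<bar>u - v\<bar>"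
proof -
  have "norm (exp (- l * u\<^sup>2) - exp (- l * v\<^sup>2)) \<le> 2 * l * norm (u - v)"
  proof (rule field_differentiable_bound[where S=UNIV and f'="\<lambda>u. exp (- l * u\<^sup>2) * (- l * (2 * u))"])
    fix z :: real
    show "((\<lambda>u. exp (- l * u\<^sup>2)) has_field_derivative exp (- l * z\<^sup>2) * (- l * (2 * z))) (at z within UNIV)"
      by (auto intro!: derivative_eq_intros)
    have "\<bar>z\<bar> \<le> 1 + z\<^sup>2" using zero_le_power2[of "\<bar>z\<bar> - 1"] unfolding power2_diff by simp
    also have "\<dots> \<le> 1 + l * z\<^sup>2" using l mult_right_mono[of 1 l "z\<^sup>2"] by simp
    also have "\<dots> \<le> exp (l * z\<^sup>2)" by (rule exp_ge_add_one_self)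
    finally have "\<bar>z\<bar> * exp (- l * z\<^sup>2) \<le> exp (l * z\<^sup>2) * exp (- l * z\<^sup>2)" by (intro mult_right_mono) auto
    then have "\<bar>z\<bar> * exp (- l * z\<^sup>2) \<le> 1" by (simp add: exp_add[symmetric])
    then have "(2 * l) * (\<bar>z\<bar> * exp (- l * z\<^sup>2)) \<le> (2 * l) * 1" using l by (intro mult_left_mono) auto
    then show "norm (exp (- l * z\<^sup>2) * (- l * (2 * z))) \<le> 2 * l" using l by (simp add: abs_mult mult_ac)
  qed auto
  then show ?thesis by simp
qed

lemma bar_lip:
  fixes x y z :: "real^'d::finite"
  assumes "1 \<le> l" "0 \<le> Kb"
  shows "\<bar>bar l Kb r z x - bar l Kb r z y\<bar> \<le> 2 * l * Kb * norm (x - y)"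
proof -
  have "\<bar>exp (- l * (norm (y - z))\<^sup>2) - exp (- l * (norm (x - z))\<^sup>2)\<bar> \<le> 2 * l * \<bar>norm (y - z) - norm (x - z)\<bar>"
    by (rule exp_sq_lip[OF assms(1)])
  also have "\<dots> \<le> 2 * l * norm (x - y)"
    using assms norm_triangle_ineq3[of "y - z" "x - z"] by (intro mult_left_mono) (auto simp: norm_minus_commute)
  finally have "Kb * \<bar>exp (- l * (norm (y - z))\<^sup>2) - exp (- l * (norm (x - z))\<^sup>2)\<bar> \<le> Kb * (2 * l * norm (x - y))"
    using assms by (intro mult_left_mono)
  moreover have "bar l Kb r z x - bar l Kb r z y = Kb * (exp (- l * (norm (y - z))\<^sup>2) - exp (- l * (norm (x - z))\<^sup>2))"
    unfolding bar_def by (simp add: algebra_simps)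
  ultimately show ?thesis using assms by (simp add: abs_mult mult_ac)
qed

lemma bar_abs:
  assumes "0 \<le> l" "0 \<le> Kb"
  shows "\<bar>bar l Kb r z x\<bar> \<le> Kb"
proof -
  have e: "0 \<le> exp (- l * u\<^sup>2)" "exp (- l * u\<^sup>2) \<le> 1" for u :: real using assms by (auto intro: mult_nonneg_nonneg)
  have "\<bar>exp (- l * r\<^sup>2) - exp (- l * (norm (x - z))\<^sup>2)\<bar> \<le> 1"
    using e[of r] e[of "norm (x - z)"] by linarith
  then show ?thesis unfolding bar_def abs_mult using assms mult_left_mono[of _ 1 Kb] by auto
qed

definition bmin :: "real \<Rightarrow> real \<Rightarrow> real \<Rightarrow> (real^'d) set \<Rightarrow> real^'d::finite \<Rightarrow> real" where
  "bmin l Kb r Z x = Min ((\<lambda>z. bar l Kb r z x) ` Z)"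

section \<open>Minimum of finitely many barriers\<close>

context
  fixes Z :: "(real^'d::finite) set" and l Kb r :: real
  assumes Z: "finite Z" "Z \<noteq> {}" and l: "1 \<le> l" and Kb: "0 \<le> Kb"
begin

lemma bmin_le: "z \<in> Z \<Longrightarrow> bmin l Kb r Z x \<le> bar l Kb r z x"
  unfolding bmin_def using Z by (intro Min_le) auto

lemma bmin_ex: "\<exists>z\<in>Z. bmin l Kb r Z x = bar l Kb r z x"
proof -
  have "bmin l Kb r Z x \<in> (\<lambda>z. bar l Kb r z x) ` Z" unfolding bmin_def using Z by (intro Min_in) auto
  then show ?thesis by auto
qed

lemma bmin_abs: "\<bar>bmin l Kb r Z x\<bar> \<le> Kb"
  using bmin_ex[of x] bar_abs[of l Kb r _ x] l Kb by auto

lemma bmin_lip: "bmin l Kb r Z x \<le> bmin l Kb r Z y + 2 * l * Kb * norm (x - y)"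
proof -
  obtain z where z: "z \<in> Z" "bmin l Kb r Z y = bar l Kb r z y" using bmin_ex by auto
  then show ?thesis using bmin_le[OF z(1), of x] bar_lip[OF l Kb, of r z x y] by linarith
qed

lemma bmin_meas: "bmin l Kb r Z \<in> borel_measurable borel"
proof (rule borel_measurable_continuous_onI)
  have L: "0 \<le> 2 * l * Kb" using l Kb by simp
  have "dist (bmin l Kb r Z x) (bmin l Kb r Z y) \<le> 2 * l * Kb * dist x y" for x y
    using bmin_lip[of x y] bmin_lip[of y x] by (simp add: dist_real_def dist_norm norm_minus_commute abs_le_iff)
  then have "(2 * l * Kb)-lipschitz_on UNIV (bmin l Kb r Z)" using L by (intro lipschitz_onI) auto
  then show "continuous_on UNIV (bmin l Kb r Z)" by (rule lipschitz_on_continuous_on)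
qed

lemma bmin_nonneg:
  assumes D: "\<And>z y. z \<in> Z \<Longrightarrow> y \<in> D \<Longrightarrow> r \<le> dist z y" and r: "0 \<le> r" and x: "x \<in> D"
  shows "0 \<le> bmin l Kb r Z x"
proof -
  obtain z where z: "z \<in> Z" "bmin l Kb r Z x = bar l Kb r z x" using bmin_ex by auto
  have "r\<^sup>2 \<le> (norm (x - z))\<^sup>2" using D[OF z(1) x] r by (intro power_mono) (auto simp: dist_norm norm_minus_commute)
  then have "- l * (norm (x - z))\<^sup>2 \<le> - l * r\<^sup>2" using l by simp
  then show ?thesis unfolding z(2) bar_def using Kb by simp
qed

end

lemma infdist_lessE:
  assumes "infdist x D < R" "D \<noteq> {}"
  obtains y where "y \<in> D" "dist x y < R"
proof -
  have "(INF y\<in>D. dist x y) < R" using assms by (simp add: infdist_def)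
  then obtain y where "y \<in> D" "dist x y < R" using assms by (subst (asm) cINF_less_iff) auto
  then show ?thesis using that by blast
qed

text \<open>Each ball touches the boundary at its net point, where its barrier vanishes; the
  Lipschitz constant then bounds the minimum within distance \<open>h\<close> of a net point.
  \<open>l\<close> and \<open>Kb\<close> are given in advance, only the set of centres depends on
  \<open>h\<close>.\<close>

lemma exists_net:
  fixes D :: "(real^'d::finite) set"
  assumes D: "bounded D" "D \<noteq> {}" "open D" and ext: "\<And>q. q \<in> frontier D \<Longrightarrow> \<exists>z. dist z q = r \<and> (\<forall>y\<in>D. r \<le> dist z y)"
    and D0: "D \<subseteq> cball 0 D0" and h: "0 < h" and l: "1 \<le> l" "0 \<le> Kb"
  shows "\<exists>Z. finite Z \<and> Z \<noteq> {} \<and> (\<forall>z\<in>Z. (\<forall>y\<in>D. r \<le> dist z y) \<and> norm z \<le> D0 + r) \<and> (\<forall>p\<in>frontier D. bmin l Kb r Z p \<le> 2 * l * Kb * h)"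
proof -
  have "compact (frontier D)" using D by (intro compact_frontier_bounded)
  then obtain P where P: "P \<subseteq> frontier D" "finite P" "frontier D \<subseteq> (\<Union>p\<in>P. ball p h)"
    using h by (elim compactE_image[of "frontier D" "frontier D" "\<lambda>p. ball p h"]) force+
  have "D \<noteq> UNIV" using D not_bounded_UNIV by auto
  then have "frontier D \<noteq> {}" using D frontier_eq_empty by blast
  then have Pn: "P \<noteq> {}" using P by auto
  obtain \<zeta> where \<zeta>: "\<And>q. q \<in> frontier D \<Longrightarrow> dist (\<zeta> q) q = r \<and> (\<forall>y\<in>D. r \<le> dist (\<zeta> q) y)" using ext by metis
  have fD: "frontier D \<subseteq> cball 0 D0" using D0 closed_cball closure_minimal unfolding frontier_def by blast
  have Zf: "finite (\<zeta> ` P)" "\<zeta> ` P \<noteq> {}" using P Pn by auto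
  have nz: "norm (\<zeta> q) \<le> D0 + r" if "q \<in> frontier D" for q
  proof -
    have "norm (\<zeta> q) \<le> norm q + dist (\<zeta> q) q" using norm_triangle_ineq[of q "\<zeta> q - q"] by (simp add: dist_norm)
    then show ?thesis using \<zeta>[OF that] fD that by auto
  qed
  have "bmin l Kb r (\<zeta> ` P) p \<le> 2 * l * Kb * h" if p: "p \<in> frontier D" for p
  proof -
    obtain q where q: "q \<in> P" "dist q p < h" using P(3) p by auto
    have "bmin l Kb r (\<zeta> ` P) p \<le> bar l Kb r (\<zeta> q) p" using q by (intro bmin_le[OF Zf l]) auto
    also have "\<dots> \<le> bar l Kb r (\<zeta> q) q + 2 * l * Kb * norm (p - q)" using bar_lip[OF l, of r "\<zeta> q" p q] by linarith
    also have "bar l Kb r (\<zeta> q) q = 0" unfolding bar_def using \<zeta>[of q] q P(1) by (auto simp: dist_norm norm_minus_commute)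
    also have "2 * l * Kb * norm (p - q) \<le> 2 * l * Kb * h" using q l by (intro mult_left_mono) (auto simp: dist_norm norm_minus_commute)
    finally show ?thesis by simp
  qed
  then show ?thesis using Zf nz \<zeta> P(1) by (intro exI[of _ "\<zeta> ` P"]) auto
qed

section \<open>A barrier with constants independent of the net\<close>

context sde
begin

text \<open>The constants precede the quantifier over \<open>Z\<close>, since the net is refined
  with \<open>h\<close>. They need only a bound on the distances: \<open>RD \<le> r / 2\<close>
  keeps the path at least \<open>r / 2\<close> away from every centre, and \<open>D0\<close> bounds
  it from above.\<close>

lemma barrier_exists:
  assumes D: "D \<noteq> {}" "D \<subseteq> cball 0 D0" "0 \<le> D0" and r: "0 < r" and RD: "0 < RD" "RD \<le> r / 2" and cb: "0 < c_b"
    and ell: "\<And>x \<xi>. infdist x D < RD \<Longrightarrow> c_b * (norm \<xi>)\<^sup>2 \<le> \<xi> \<bullet> ((b x ** transpose (b x)) *v \<xi>)"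
  shows "\<exists>l Kb \<kappa>0. 1 \<le> l \<and> 0 < Kb \<and> 0 < \<kappa>0 \<and> \<kappa>0 \<le> 1 \<and> (\<forall>Z s t A. finite Z \<longrightarrow> Z \<noteq> {} \<longrightarrow> (\<forall>z\<in>Z. (\<forall>y\<in>D. r \<le> dist z y) \<and> norm z \<le> D0 + r) \<longrightarrow>
     0 \<le> s \<longrightarrow> s < t \<longrightarrow> t \<le> s + \<kappa>0 \<longrightarrow> A \<in> sets (F s) \<longrightarrow> (\<forall>w\<in>A. infdist (X s w) D < RD) \<longrightarrow>
     (\<integral>w. indicator A w * (bmin l Kb r Z (X t w) - bmin l Kb r Z (X s w)) \<partial>M) \<le> - (t - s) * prob A)"
proof -
  define d where "d = real CARD('d)"
  define \<rho>1 where "\<rho>1 = r / 2"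
  define Lw where "Lw = 2 * D0 + RD + r"
  have Lw: "0 \<le> Lw" unfolding Lw_def using D r RD by simp
  have \<rho>1: "0 < \<rho>1" unfolding \<rho>1_def using r by simp
  define B0 where "B0 = 6 * d * K * Lw + Cn 2"
  have B0: "0 \<le> B0" unfolding B0_def d_def using K1 Lw Cn_pos[of 2] by simp
  \<comment> \<open>Large enough for the elliptic term to exceed the first order terms by 2; one
    unit is later given up to the correction of order \<open>sqrt (t - s)\<close>.\<close>
  define l where "l = max 1 ((B0 + 2) / (c_b * \<rho>1\<^sup>2))"
  have l1: "1 \<le> l" unfolding l_def by simp
  have lB: "B0 + 2 \<le> l * c_b * \<rho>1\<^sup>2"
  proof -
    have p: "0 < c_b * \<rho>1\<^sup>2" using cb \<rho>1 by simp
    have "(B0 + 2) / (c_b * \<rho>1\<^sup>2) * (c_b * \<rho>1\<^sup>2) \<le> l * (c_b * \<rho>1\<^sup>2)" unfolding l_def using p by (intro mult_right_mono) auto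
    moreover have "(B0 + 2) / (c_b * \<rho>1\<^sup>2) * (c_b * \<rho>1\<^sup>2) = B0 + 2" using cb \<rho>1 by simp
    ultimately show ?thesis by (simp add: mult.assoc)
  qed
  define H where "H = 2 * l * Lw + l\<^sup>2 * (16 / 3 * Lw ^ 3 + 2 / 3)"
  define C' where "C' = 2 * d\<^sup>2 * Lw\<^sup>2 * (K\<^sup>2 + CR)"
  define B1 where "B1 = 2 * l * C' + H * (Cn 3 + Cn 6)"
  have B1: "0 \<le> B1" unfolding B1_def H_def C'_def using l1 Lw CR0 Cn_pos[of 3] Cn_pos[of 6]
    by (intro add_nonneg_nonneg mult_nonneg_nonneg) auto
  \<comment> \<open>Makes \<open>B1 * sqrt (t - s)\<close> at most 1.\<close>
  define \<kappa>0 where "\<kappa>0 = (1 / (B1 + 1))\<^sup>2"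
  have \<kappa>0: "0 < \<kappa>0" "\<kappa>0 \<le> 1" "sqrt \<kappa>0 = 1 / (B1 + 1)" unfolding \<kappa>0_def using B1 by (auto intro!: power_le_one)
  \<comment> \<open>Normalisation: at distance at most \<open>Lw\<close> from the centre the weight
    is at least \<open>1 / l\<close>, which turns the decrease into rate 1.\<close>
  define Kb where "Kb = exp (l * Lw\<^sup>2) / l"
  have Kb: "0 < Kb" unfolding Kb_def using l1 by simp
  have main: "(\<integral>w. indicator A w * (bar l Kb r z (X t w) - bar l Kb r z (X s w)) \<partial>M) \<le> - (t - s) * prob A"
    if z: "\<forall>y\<in>D. r \<le> dist z y" "norm z \<le> D0 + r" and st: "0 \<le> s" "s < t" "t \<le> s + \<kappa>0" and A: "A \<in> sets (F s)" "\<forall>w\<in>A. infdist (X s w) D < RD" for z s t A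
  proof -
    have w: "\<rho>1 \<le> norm (X s w - z) \<and> norm (X s w - z) \<le> Lw" if wA: "w \<in> A" for w
    proof -
      obtain y where y: "y \<in> D" "dist (X s w) y < RD" using infdist_lessE[of "X s w" D RD] A(2) wA D(1) by blast
      have "r \<le> dist z y" using z y by auto
      also have "\<dots> \<le> dist z (X s w) + dist (X s w) y" by (rule dist_triangle)
      finally have 1: "\<rho>1 \<le> norm (X s w - z)" using y RD unfolding \<rho>1_def by (simp add: dist_norm norm_minus_commute)
      have "norm y \<le> D0" using y D by auto
      moreover have "norm (X s w) \<le> norm y + dist (X s w) y" using norm_triangle_ineq[of y "X s w - y"] by (simp add: dist_norm)
      moreover have "norm (X s w - z) \<le> norm (X s w) + norm z" by (rule norm_triangle_ineq4)
      ultimately have "norm (X s w - z) \<le> Lw" unfolding Lw_def using y z by linarith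
      then show ?thesis using 1 by simp
    qed
    define EU where "EU = (\<integral>w. indicator A w * (Kb * exp (- l * (norm (X s w - z))\<^sup>2)) \<partial>M)"
    have AM: "A \<in> sets M" using sets_F_M[OF st(1) A(1)] .
    have mX[measurable]: "X s \<in> borel_measurable M" by (rule meas_X_M[OF st(1)])
    have iE: "integrable M (\<lambda>w. indicator A w * (Kb * exp (- l * (norm (X s w - z))\<^sup>2)))"
      using AM l1 Kb by (intro integrable_const_bound[of _ Kb]) (auto simp: indicator_def)
    have EU: "prob A / l \<le> EU"
    proof -
      have "prob A / l = (\<integral>w. indicator A w * (1 / l) \<partial>M)" using AM by simp
      also have "\<dots> \<le> EU" unfolding EU_def
      proof (rule integral_mono[OF _ iE])
        show "integrable M (\<lambda>w. indicator A w * (1 / l))" using AM by (auto simp: less_top[symmetric])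
        fix w
        have "1 / l \<le> Kb * exp (- l * (norm (X s w - z))\<^sup>2)" if "w \<in> A"
        proof -
          have "(norm (X s w - z))\<^sup>2 \<le> Lw\<^sup>2" using w[OF that] by (intro power_mono) auto
          then have "- l * Lw\<^sup>2 \<le> - l * (norm (X s w - z))\<^sup>2" using l1 by simp
          then have "Kb * exp (- l * Lw\<^sup>2) \<le> Kb * exp (- l * (norm (X s w - z))\<^sup>2)" using Kb by simp
          moreover have "Kb * exp (- l * Lw\<^sup>2) = 1 / l" unfolding Kb_def by (simp add: exp_add[symmetric])
          ultimately show ?thesis by simp
        qed
        then show "indicator A w * (1 / l) \<le> indicator A w * (Kb * exp (- l * (norm (X s w - z))\<^sup>2))" by (auto simp: indicator_def)
      qed
      finally show ?thesis .
    qed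
    have "(\<integral>w. indicator A w * (bar l Kb r z (X t w) - bar l Kb r z (X s w)) \<partial>M)
      \<le> l * (t - s) * (6 * real CARD('d) * K * Lw + Cn 2 - l * c_b * \<rho>1\<^sup>2 + (2 * l * (2 * (real CARD('d))\<^sup>2 * Lw\<^sup>2 * (K\<^sup>2 + CR)) + (2 * l * Lw + l\<^sup>2 * (16 / 3 * Lw ^ 3 + 2 / 3)) * (Cn 3 + Cn 6)) * sqrt (t - s)) * EU"
      unfolding EU_def by (rule bar_drift) (use st \<kappa>0 A l1 Kb w \<rho>1 Lw ell cb in auto)
    also have "\<dots> = l * (t - s) * EU * (B0 - l * c_b * \<rho>1\<^sup>2 + B1 * sqrt (t - s))"
      unfolding B0_def B1_def H_def C'_def d_def by (simp add: mult_ac)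
    also have "\<dots> \<le> l * (t - s) * EU * (- 1)"
    proof (rule mult_left_mono)
      have "sqrt (t - s) \<le> 1 / (B1 + 1)" unfolding \<kappa>0(3)[symmetric] using st by simp
      then have "B1 * sqrt (t - s) \<le> B1 * (1 / (B1 + 1))" using B1 by (intro mult_left_mono)
      also have "\<dots> \<le> 1" using B1 by simp
      finally show "B0 - l * c_b * \<rho>1\<^sup>2 + B1 * sqrt (t - s) \<le> - 1" using lB by linarith
      have "0 \<le> EU" using order_trans[OF _ EU, of 0] l1 by simp
      then show "0 \<le> l * (t - s) * EU" using l1 st by simp
    qed
    also have "\<dots> \<le> - (t - s) * prob A"
    proof -
      have "prob A \<le> l * EU" using EU l1 by (simp add: divide_le_eq mult.commute)
      then have "(t - s) * prob A \<le> (t - s) * (l * EU)" using st by (intro mult_left_mono) auto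
      then show ?thesis by (simp add: algebra_simps)
    qed
    finally show ?thesis .
  qed
  have "(\<integral>w. indicator A w * (bmin l Kb r Z (X t w) - bmin l Kb r Z (X s w)) \<partial>M) \<le> - (t - s) * prob A"
    if Z: "finite Z" "Z \<noteq> {}" and good: "\<forall>z\<in>Z. (\<forall>y\<in>D. r \<le> dist z y) \<and> norm z \<le> D0 + r" and st: "0 \<le> s" "s < t" "t \<le> s + \<kappa>0" 
      and A: "A \<in> sets (F s)" "\<forall>w\<in>A. infdist (X s w) D < RD" for Z s t A
  proof -
    let ?g = "bmin l Kb r Z"
    note bml = bmin_le[OF Z l1 less_imp_le[OF Kb]]
    have gm: "?g \<in> borel_measurable borel" by (rule bmin_meas[OF Z l1 less_imp_le[OF Kb]])
    have ig: "integrable M (\<lambda>w. ?g (X u w))" if "0 \<le> u" for u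
      by (rule integrable_const_bound[of _ Kb])
        (use bmin_abs[OF Z l1 less_imp_le[OF Kb]] measurable_compose[OF meas_X_M[OF that] gm] in auto)
    have bm: "bar l Kb r z \<in> borel_measurable borel" for z unfolding bar_def by measurable
    have ib: "integrable M (\<lambda>w. bar l Kb r z (X u w))" if "0 \<le> u" for u z
      by (rule integrable_const_bound[of _ Kb])
        (use bar_abs[of l Kb r z] l1 Kb measurable_compose[OF meas_X_M[OF that] bm] in auto)
    have t0: "0 \<le> t" using st by simp
    \<comment> \<open>Induction over the centres that may attain the minimum at time
      \<open>s\<close>. On the part of \<open>B\<close> where \<open>z\<close> attains it, the
      increment of the minimum is at most that of the barrier of \<open>z\<close>; the other part is
      left to the remaining centres.\<close>
    have "Z0 \<subseteq> Z \<Longrightarrow> B \<in> sets (F s) \<Longrightarrow> B \<subseteq> A \<Longrightarrow> (\<forall>w\<in>B. \<exists>z\<in>Z0. ?g (X s w) = bar l Kb r z (X s w)) \<Longrightarrow>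
      (\<integral>w. indicator B w * (?g (X t w) - ?g (X s w)) \<partial>M) \<le> - (t - s) * prob B" for Z0 B
    proof (induction Z0 arbitrary: B rule: infinite_finite_induct)
      case (infinite Z0)
      then show ?case using Z finite_subset by blast
    next
      case empty
      then have "B = {}" by auto
      then show ?case by simp
    next
      case (insert z Z0)
      have gs: "(\<lambda>w. ?g (X s w) - bar l Kb r z (X s w)) \<in> borel_measurable (F s)"
        using measurable_compose[OF meas_X[OF st(1)] gm] measurable_compose[OF meas_X[OF st(1)] bm] by (intro borel_measurable_diff)
      define Q where "Q = (\<lambda>w. ?g (X s w) - bar l Kb r z (X s w)) -` {0} \<inter> space (F s)"
      have Q: "Q \<in> sets (F s)" unfolding Q_def by (rule measurable_sets[OF gs]) simp
      define B1 where "B1 = B \<inter> Q"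
      define B2 where "B2 = B - Q"
      have BF: "B1 \<in> sets (F s)" "B2 \<in> sets (F s)" unfolding B1_def B2_def using Q insert by auto
      have BM: "B1 \<in> sets M" "B2 \<in> sets M" using sets_F_M[OF st(1)] BF by auto
      have Bsp: "B \<subseteq> space (F s)" using insert(5) sets.sets_into_space by blast
      have eq1: "?g (X s w) = bar l Kb r z (X s w)" if "w \<in> B1" for w using that unfolding B1_def Q_def by auto
      have i: "integrable M (\<lambda>w. indicator C w * (?g (X t w) - ?g (X s w)))" if "C \<in> sets (F s)" for C
        by (rule bwt_imult[OF st(1) bwt_ind[OF that]]) (use ig st t0 in auto)
      have 1: "(\<integral>w. indicator B1 w * (?g (X t w) - ?g (X s w)) \<partial>M) \<le> - (t - s) * prob B1"
      proof -
        have "(\<integral>w. indicator B1 w * (?g (X t w) - ?g (X s w)) \<partial>M) \<le> (\<integral>w. indicator B1 w * (bar l Kb r z (X t w) - bar l Kb r z (X s w)) \<partial>M)"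
        proof (rule integral_mono[OF i[OF BF(1)]])
          show "integrable M (\<lambda>w. indicator B1 w * (bar l Kb r z (X t w) - bar l Kb r z (X s w)))"
            by (rule bwt_imult[OF st(1) bwt_ind[OF BF(1)]]) (use ib st t0 in auto)
          show "indicator B1 w * (?g (X t w) - ?g (X s w)) \<le> indicator B1 w * (bar l Kb r z (X t w) - bar l Kb r z (X s w))" for w
            using eq1[of w] bml[of z] insert(4) by (auto simp: indicator_def)
        qed
        also have "\<dots> \<le> - (t - s) * prob B1"
          by (rule main) (use good insert(4,6) st BF A(2) in \<open>auto simp: B1_def\<close>)
        finally show ?thesis .
      qed
      have 2: "(\<integral>w. indicator B2 w * (?g (X t w) - ?g (X s w)) \<partial>M) \<le> - (t - s) * prob B2"
      proof (rule insert.IH)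
        show "\<forall>w\<in>B2. \<exists>z\<in>Z0. ?g (X s w) = bar l Kb r z (X s w)"
          using insert(7) Bsp unfolding B2_def Q_def by fastforce
      qed (use insert BF in \<open>auto simp: B2_def\<close>)
      have dis: "indicator B w = indicator B1 w + (indicator B2 w :: real)" for w unfolding B1_def B2_def by (auto simp: indicator_def)
      have "prob B = prob B1 + prob B2"
        using BM by (subst finite_measure_Union[symmetric]) (auto simp: B1_def B2_def intro: arg_cong[where f=prob])
      moreover have "(\<integral>w. indicator B w * (?g (X t w) - ?g (X s w)) \<partial>M) = (\<integral>w. indicator B1 w * (?g (X t w) - ?g (X s w)) \<partial>M) + (\<integral>w. indicator B2 w * (?g (X t w) - ?g (X s w)) \<partial>M)"
        unfolding dis distrib_right using i[OF BF(1)] i[OF BF(2)] by (rule Bochner_Integration.integral_add)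
      ultimately show ?case using 1 2 by (simp add: algebra_simps)
    qed
    from this[of Z A] show ?thesis using A bmin_ex[OF Z l1 less_imp_le[OF Kb]] by auto
  qed
  then show ?thesis using l1 Kb \<kappa>0 by (intro exI[of _ l] exI[of _ Kb] exI[of _ \<kappa>0]) auto
qed

end

text \<open>Order convexity of \<open>P\<close> makes the selected indices one interval, so that
  only its two ends count.\<close>

lemma sum_interval_telescope:
  fixes f :: "nat \<Rightarrow> real"
  assumes conv: "\<And>i j k. i \<le> j \<Longrightarrow> j \<le> k \<Longrightarrow> k < K \<Longrightarrow> P i \<Longrightarrow> P k \<Longrightarrow> P j" and ex: "\<exists>k<K. P k"
  shows "\<exists>k1 k2. k1 \<le> k2 \<and> k2 < K \<and> P k1 \<and> P k2 \<and> (k1 = 0 \<or> \<not> P (k1 - 1)) \<and> (\<Sum>k<K. if P k then f k - f (Suc k) else 0) = f k1 - f (Suc k2)"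
proof -
  define S where "S = {k. k < K \<and> P k}"
  have S: "finite S" "S \<noteq> {}" using ex by (auto simp: S_def)
  define k1 where "k1 = Min S"
  define k2 where "k2 = Max S"
  have k: "k1 \<in> S" "k2 \<in> S" "k1 \<le> k2" unfolding k1_def k2_def using S by (auto intro: Min_in Max_in)
  have "S = {k1..k2}"
  proof (intro set_eqI iffI)
    fix j assume "j \<in> {k1..k2}"
    then show "j \<in> S" using conv[of k1 j k2] k unfolding S_def by auto
  qed (use S in \<open>auto simp: k1_def k2_def\<close>)
  have "(\<Sum>k<K. if P k then f k - f (Suc k) else 0) = (\<Sum>k\<in>S. f k - f (Suc k))"
    unfolding S_def by (subst sum.inter_filter[symmetric]) (auto intro!: sum.cong)
  also have "\<dots> = (\<Sum>k=k1..k2. f k - f (Suc k))" using \<open>S = {k1..k2}\<close> by simp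
  also have "\<dots> = f k1 - f (Suc k2)"
    using sum_Suc_diff[of k1 "Suc k2" "\<lambda>k. - f k"] k(3) by (simp add: atLeastLessThanSuc_atLeastAtMost)
  finally have 1: "(\<Sum>k<K. if P k then f k - f (Suc k) else 0) = f k1 - f (Suc k2)" .
  have "k1 = 0 \<or> \<not> P (k1 - 1)"
  proof (rule ccontr)
    assume "\<not> (k1 = 0 \<or> \<not> P (k1 - 1))"
    then have "k1 - 1 \<in> S" "0 < k1" using k unfolding S_def by auto
    then have "k1 \<le> k1 - 1" unfolding k1_def using S by (intro Min_le) auto
    then show False using \<open>0 < k1\<close> by simp
  qed
  then show ?thesis using k 1 unfolding S_def by blast
qed

lemma ball_infdist_frontier:
  fixes D :: "'a::euclidean_space set"
  assumes "y \<in> D" "dist y x < infdist y (frontier D)"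
  shows "x \<in> D"
proof (rule ccontr)
  assume "x \<notin> D"
  then have "closed_segment y x \<inter> frontier D \<noteq> {}"
    using assms by (intro connected_Int_frontier) auto
  then obtain p where p: "p \<in> closed_segment y x" "p \<in> frontier D" by auto
  have "infdist y (frontier D) \<le> dist y p" by (rule infdist_le[OF p(2)])
  also have "\<dots> \<le> dist y x" using p(1) dist_in_closed_segment[of p y x] by (simp add: dist_commute)
  finally show False using assms by simp
qed

lemma exit_hits_frontier:
  fixes x :: "real \<Rightarrow> 'a::euclidean_space"
  assumes c: "continuous_on {s..t} x" and st: "s \<le> t" and xs: "x s \<in> D" and xt: "\<exists>u\<in>{s..t}. x u \<notin> D"
  shows "\<exists>u\<in>{s..t}. x u \<in> frontier D"
proof -
  have "connected (x ` {s..t})" using c by (intro connected_continuous_image) auto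
  moreover have "x ` {s..t} \<inter> D \<noteq> {}" using xs st by force
  moreover have "x ` {s..t} - D \<noteq> {}" using xt by auto
  ultimately have "x ` {s..t} \<inter> frontier D \<noteq> {}" by (rule connected_Int_frontier)
  then show ?thesis by auto
qed

subsection \<open>Comparison of the exit times\<close>

text \<open>A dyadic layer cake formula, pathwise: it turns tail bounds at the levels
  \<open>2 ^ j * h\<close> into a bound for a truncated mean.\<close>

lemma min_dyadic:
  fixes e h :: real assumes h: "0 \<le> h"
  shows "min (2 ^ J * h) e \<le> h + (\<Sum>j<J. 2 ^ j * h * of_bool (2 ^ j * h < e))"
proof (induction J)
  case (Suc J)
  have "min (2 * c) e \<le> min c e + c * of_bool (c < e)" if "0 \<le> c" for c :: real
    using that by (auto simp: min_def)
  from this[of "2 ^ J * h"] show ?case using Suc h by (simp add: mult.assoc)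
qed auto

text \<open>An interval contains at least its length divided by the mesh, minus one, grid points in
  its interior.\<close>

lemma diff_le_card_grid:
  fixes lo hi \<kappa> T :: real
  assumes \<kappa>: "0 < \<kappa>" and lo: "0 \<le> lo" and T: "hi \<le> T"
    and Q: "\<And>k. lo < real k * \<kappa> \<Longrightarrow> real k * \<kappa> < hi \<Longrightarrow> Q k"
  shows "hi - lo \<le> \<kappa> + \<kappa> * real (card {k. k < nat \<lceil>T / \<kappa>\<rceil> \<and> Q k})"
proof -
  define m where "m = nat \<lfloor>lo / \<kappa>\<rfloor>"
  define n where "n = nat \<lceil>hi / \<kappa>\<rceil>"
  have "{Suc m..<n} \<subseteq> {k. k < nat \<lceil>T / \<kappa>\<rceil> \<and> Q k}"
  proof
    fix k assume k: "k \<in> {Suc m..<n}"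
    have "\<lfloor>lo / \<kappa>\<rfloor> < int k" using k unfolding m_def by auto
    then have "lo / \<kappa> < real k" by (simp add: floor_less_iff)
    then have 1: "lo < real k * \<kappa>" using \<kappa> by (simp add: divide_less_eq)
    have kn: "int k < \<lceil>hi / \<kappa>\<rceil>" using k unfolding n_def by auto
    then have "real k < hi / \<kappa>" by (simp add: less_ceiling_iff)
    then have 2: "real k * \<kappa> < hi" using \<kappa> by (simp add: less_divide_eq)
    have "\<lceil>hi / \<kappa>\<rceil> \<le> \<lceil>T / \<kappa>\<rceil>" using T \<kappa> by (intro ceiling_mono divide_right_mono) auto
    then have "k < nat \<lceil>T / \<kappa>\<rceil>" using kn by linarith
    then show "k \<in> {k. k < nat \<lceil>T / \<kappa>\<rceil> \<and> Q k}" using Q[OF 1 2] by simp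
  qed
  then have "n - Suc m \<le> card {k. k < nat \<lceil>T / \<kappa>\<rceil> \<and> Q k}" using card_mono[of _ "{Suc m..<n}"] by simp
  then have "real n - real m - 1 \<le> real (card {k. k < nat \<lceil>T / \<kappa>\<rceil> \<and> Q k})" by linarith
  moreover have "hi / \<kappa> \<le> real n" unfolding n_def by linarith
  moreover have "real m \<le> lo / \<kappa>" unfolding m_def using lo \<kappa> by simp
  ultimately have "hi / \<kappa> - lo / \<kappa> \<le> 1 + real (card {k. k < nat \<lceil>T / \<kappa>\<rceil> \<and> Q k})" by linarith
  then have "\<kappa> * (hi / \<kappa> - lo / \<kappa>) \<le> \<kappa> * (1 + real (card {k. k < nat \<lceil>T / \<kappa>\<rceil> \<and> Q k}))" using \<kappa> by (intro mult_left_mono) auto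
  moreover have "\<kappa> * (hi / \<kappa> - lo / \<kappa>) = hi - lo" using \<kappa> by (simp add: right_diff_distrib)
  ultimately show ?thesis by (simp add: distrib_left)
qed

text \<open>\<open>g\<close> abstracts the barrier at a fixed \<open>h\<close>. In
  \<open>exit_time_rate\<close> the numbers \<open>R\<close>, \<open>Kb\<close> and \<open>L\<close>
  are chosen before \<open>h\<close>, so bounds in terms of them are uniform in \<open>h\<close>.
  The decrease is required only over time \<open>h\<^sup>2\<close>, the mesh of the comparison
  grid.\<close>

locale exit_scheme = scheme M F W a b x0 X K Cb J D h T
  for M :: "'w measure" and F and W :: "real \<Rightarrow> 'w \<Rightarrow> real^'m::finite"
    and a :: "real^'d::finite \<Rightarrow> real^'d" and b :: "real^'d \<Rightarrow> real^'m^'d" and x0 X K Cb J D h T +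
  fixes g :: "real^'d \<Rightarrow> real" and R Kb L :: real
  assumes D: "open D" "bounded D" "x0 \<in> D"
    and gm: "g \<in> borel_measurable borel" and gb: "\<And>x. \<bar>g x\<bar> \<le> Kb" and gL: "\<And>x y. g x \<le> g y + L * norm (x - y)"
    and L0: "0 \<le> L" and g0: "\<And>x. x \<in> D \<Longrightarrow> 0 \<le> g x" and gf: "\<And>p. p \<in> frontier D \<Longrightarrow> g p \<le> L * h"
    and drift: "\<And>s A. 0 \<le> s \<Longrightarrow> A \<in> sets (F s) \<Longrightarrow> (\<And>w. w \<in> A \<Longrightarrow> infdist (X s w) D < R) \<Longrightarrow>
      (\<integral>w. indicator A w * (g (X (s + h\<^sup>2) w) - g (X s w)) \<partial>M) \<le> - h\<^sup>2 * prob A"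
    and Cbp: "0 < Cb" and lnh: "1 \<le> ln (1 / h)" and dR: "sqrt (8 * Cb * real CARD('d) * h * ln (1 / h)) < R"
begin

definition dl :: real where "dl = sqrt (8 * Cb * real CARD('d) * h * ln (1 / h))"
text \<open>The factor \<open>9 / 10\<close> leaves room for the error of the scheme below the threshold \<open>dl\<close> of the step size, while the Gaussian tail
  stays below a multiple of \<open>h ^ 3\<close>.\<close>

definition cc :: "real \<Rightarrow> real" where "cc \<theta> = 9 / 10 * sqrt (8 * Cb * \<theta> * ln (1 / h))"
definition ro :: "real \<Rightarrow> real" where "ro \<theta> = sqrt (real CARD('d)) * cc \<theta>"

lemma ro_h: "ro h = 9 / 10 * dl"
proof -
  have "8 * Cb * real CARD('d) * h * ln (1 / h) = real CARD('d) * (8 * Cb * h * ln (1 / h))" by simp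
  then have "dl = sqrt (real CARD('d)) * sqrt (8 * Cb * h * ln (1 / h))" unfolding dl_def by (simp only: real_sqrt_mult)
  then show ?thesis unfolding ro_def cc_def by simp
qed

lemma ro_mono: "\<theta> \<le> \<theta>' \<Longrightarrow> ro \<theta> \<le> ro \<theta>'"
  unfolding ro_def cc_def using lnh Cbp by (intro mult_left_mono real_sqrt_le_mono mult_right_mono) auto

lemma ro_nonneg: "0 \<le> \<theta> \<Longrightarrow> 0 \<le> ro \<theta>"
  unfolding ro_def cc_def using lnh Cbp by (intro mult_nonneg_nonneg real_sqrt_ge_zero) auto

lemma ro_h2: "0 \<le> ro (h\<^sup>2)" "ro (h\<^sup>2) \<le> 9 / 10 * dl"
  using ro_nonneg[of "h\<^sup>2"] ro_mono[of "h\<^sup>2" h] h2 ro_h by auto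

lemma th_eq: "th y = (if dl < infdist y (frontier D) then h else h\<^sup>2)"
  unfolding th_def step_size_def dl_def Let_def by simp

text \<open>A deterministic grid whose mesh is the smaller of the two step sizes. Hence
  \<open>NT\<close> also bounds the number of steps that the scheme starts before
  \<open>T\<close>.\<close>

definition sg :: "nat \<Rightarrow> real" where "sg k = real k * h\<^sup>2"
definition NT :: nat where "NT = nat \<lceil>T / h\<^sup>2\<rceil>"

lemma sg_nonneg: "0 \<le> sg k" unfolding sg_def by simp
lemma sg_mono: "j \<le> k \<Longrightarrow> sg j \<le> sg k" unfolding sg_def by (intro mult_right_mono) auto
lemma sg_Suc: "sg (Suc k) = sg k + h\<^sup>2" unfolding sg_def by (simp add: algebra_simps)

lemma sg_T: "k < NT \<Longrightarrow> sg k < T"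
proof -
  assume "k < NT"
  then have "int k < \<lceil>T / h\<^sup>2\<rceil>" unfolding NT_def by linarith
  then have "real k < T / h\<^sup>2" by (simp add: less_ceiling_iff)
  then show ?thesis unfolding sg_def using h2(1) by (simp add: less_divide_eq)
qed

lemma tn_NT: "tn n w < T \<Longrightarrow> n < NT"
proof -
  assume "tn n w < T"
  then have "real n * h\<^sup>2 < T" using tn_ge[of n w] by linarith
  then have "real n < T / h\<^sup>2" using h2(1) by (simp add: less_divide_eq)
  then show ?thesis unfolding NT_def by linarith
qed

definition VN :: "nat \<Rightarrow> 'w \<Rightarrow> bool" where "VN k w \<longleftrightarrow> (\<exists>n. tn n w \<le> sg k \<and> yn n w \<notin> D)"
definition XO :: "nat \<Rightarrow> 'w \<Rightarrow> bool" where "XO k w \<longleftrightarrow> (\<exists>u. 0 \<le> u \<and> u \<le> sg k \<and> X u w \<notin> D)"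

text \<open>A version of \<open>XO\<close> (the path has left \<open>D\<close>; \<open>VN\<close> is the same for the scheme) that involves countably many times only; the two agree on continuous paths.\<close>

definition XQ :: "nat \<Rightarrow> 'w \<Rightarrow> bool" where
  "XQ k w \<longleftrightarrow> (\<forall>m::nat. \<exists>q\<in>{q\<in>\<rat>. 0 \<le> q \<and> q \<le> sg k}. infdist (X q w) (- D) < inverse (real (Suc m)))"

lemma mono_k: "j \<le> k \<Longrightarrow> VN j w \<Longrightarrow> VN k w" "j \<le> k \<Longrightarrow> XO j w \<Longrightarrow> XO k w" "j \<le> k \<Longrightarrow> XQ j w \<Longrightarrow> XQ k w"
proof -
  assume jk: "j \<le> k"
  note s = sg_mono[OF jk]
  show "VN j w \<Longrightarrow> VN k w" unfolding VN_def using s by (meson order_trans)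
  show "XO j w \<Longrightarrow> XO k w" unfolding XO_def using s by (meson order_trans)
  show "XQ j w \<Longrightarrow> XQ k w" unfolding XQ_def using s by (fastforce intro: order_trans)
qed

lemma XQ_iff_XO:
  assumes c: "continuous_on {0..} (\<lambda>t. X t w)"
  shows "XQ k w \<longleftrightarrow> XO k w"
proof -
  have "D \<noteq> UNIV" using D(2) not_bounded_UNIV by blast
  then have cl: "closed (- D)" "- D \<noteq> {}" using D(1) by (auto simp: closed_def)
  have c0: "continuous_on {0..sg k} (\<lambda>t. X t w)" using c by (rule continuous_on_subset) auto
  have "XO k w" if XQ: "XQ k w"
  proof -
    have "continuous_on {0..sg k} (\<lambda>t. infdist (X t w) (- D))" using c0 by (intro continuous_on_infdist)
    then obtain u where u: "u \<in> {0..sg k}" "\<And>v. v \<in> {0..sg k} \<Longrightarrow> infdist (X u w) (- D) \<le> infdist (X v w) (- D)"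
      using continuous_attains_inf[of "{0..sg k}"] sg_nonneg by (metis atLeastAtMost_iff compact_Icc empty_iff order_refl)
    have "infdist (X u w) (- D) < inverse (real (Suc m))" for m
    proof -
      obtain q where "0 \<le> q" "q \<le> sg k" "infdist (X q w) (- D) < inverse (real (Suc m))" using XQ unfolding XQ_def by fast
      then show ?thesis using u(2)[of q] by auto
    qed
    then have "\<not> 0 < infdist (X u w) (- D)" using reals_Archimedean[of "infdist (X u w) (- D)"] by (meson less_asym)
    then have "infdist (X u w) (- D) = 0" using infdist_nonneg[of "X u w" "- D"] by linarith
    then have "X u w \<in> - D" using in_closed_iff_infdist_zero[OF cl] by simp
    then show "XO k w" unfolding XO_def using u(1) by auto
  qed
  moreover have "XQ k w" if "XO k w"
  proof -
    from that obtain u where u: "0 \<le> u" "u \<le> sg k" "X u w \<in> - D" unfolding XO_def by auto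
    show "XQ k w" unfolding XQ_def
    proof
      fix m :: nat
      have "0 < inverse (real (Suc m))" by simp
      moreover have "u \<in> {0..}" using u by simp
      ultimately obtain d where d: "0 < d" "\<And>v. 0 \<le> v \<Longrightarrow> dist v u < d \<Longrightarrow> dist (X v w) (X u w) < inverse (real (Suc m))"
        using c unfolding continuous_on_iff by (metis atLeast_iff)
      have "\<exists>q\<in>\<rat>. 0 \<le> q \<and> q \<le> sg k \<and> dist q u < d"
      proof (cases "u = 0")
        case True
        then show ?thesis using u d by (intro bexI[of _ 0]) auto
      next
        case False
        then have "max 0 (u - d) < u" using u d by auto
        then obtain q where "q \<in> \<rat>" "max 0 (u - d) < q" "q < u" using Rats_dense_in_real by blast
        then show ?thesis using u by (intro bexI[of _ q]) (auto simp: dist_real_def)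
      qed
      then obtain q where q: "q \<in> \<rat>" "0 \<le> q" "q \<le> sg k" "dist q u < d" by auto
      have "infdist (X q w) (- D) \<le> dist (X q w) (X u w)" using u by (intro infdist_le)
      also have "\<dots> < inverse (real (Suc m))" using d q by auto
      finally show "\<exists>q\<in>{q\<in>\<rat>. 0 \<le> q \<and> q \<le> sg k}. infdist (X q w) (- D) < inverse (real (Suc m))" using q by auto
    qed
  qed
  ultimately show ?thesis by blast
qed

lemma XO_0: "w \<in> space M \<Longrightarrow> \<not> XO 0 w"
  unfolding XO_def sg_def using X_0 D(3) by (auto simp: order_antisym_conv)

lemma VN_0: "\<not> VN 0 w"
proof
  assume "VN 0 w"
  then obtain n where n: "tn n w \<le> 0" "yn n w \<notin> D" unfolding VN_def sg_def by auto
  then have "n \<noteq> 0" using D(3) by (metis yn_0)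
  then have "0 < real n * h\<^sup>2" using h2(1) by simp
  then show False using tn_ge[of n w] n(1) by linarith
qed

text \<open>Requiring \<open>infdist < R\<close> at all earlier grid times, not only at the current one, makes the set of \<open>k\<close> with \<open>w \<in> Cs k\<close>
  an interval on every path, good or bad.\<close>

definition Cs :: "nat \<Rightarrow> 'w set" where
  "Cs k = {w\<in>space M. XQ k w \<noteq> VN k w \<and> (\<forall>j\<le>k. infdist (X (sg j) w) D < R)}"

lemma Cs_F: "Cs k \<in> sets (F (sg k))"
proof -
  have sp: "space (F (sg k)) = space M" by (rule space_F[OF sg_nonneg])
  have V: "{w\<in>space M. VN k w} \<in> sets (F (sg k))"
  proof -
    have "{w\<in>space M. VN k w} = (\<Union>n. \<Union>q\<in>{q\<in>Ts n. q \<le> sg k}. Eq n q \<inter> (Yq n q -` (- D) \<inter> space (F (sg k))))"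
      unfolding VN_def Eq_def Yq_def sp using tn_Ts by fastforce
    also have "\<dots> \<in> sets (F (sg k))"
    proof (intro sets.countable_UN'' sets.finite_UN)
      fix n q assume q: "q \<in> {q \<in> Ts n. q \<le> sg k}"
      then have q0: "0 \<le> q" "q \<le> sg k" using Ts_nonneg by auto
      have "Yq n q \<in> borel_measurable (F (sg k))" using meas_F_mono[OF q0] adapted[OF q0(1)] by blast
      moreover have "Eq n q \<in> sets (F (sg k))" using sets_F_mono[OF q0] adapted[OF q0(1)] by blast
      ultimately show "Eq n q \<inter> (Yq n q -` (- D) \<inter> space (F (sg k))) \<in> sets (F (sg k))"
        using D(1) by (intro sets.Int measurable_sets[of _ _ borel]) auto
    qed (auto intro!: countable_finite Ts_finite finite_subset[of "{q \<in> Ts _. _ q}" "Ts _"])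
    finally show ?thesis .
  qed
  have mi: "(\<lambda>x. infdist x S) \<in> borel_measurable borel" for S :: "(real^'d) set"
    by (intro borel_measurable_continuous_onI continuous_on_infdist continuous_on_id)
  have mX: "(\<lambda>w. infdist (X q w) S) \<in> borel_measurable (F (sg k))" if "0 \<le> q" "q \<le> sg k" for q and S :: "(real^'d) set"
    by (rule measurable_compose[OF meas_X_le[OF that] mi])
  have lt: "{w\<in>space M. infdist (X q w) S < c} \<in> sets (F (sg k))" if "0 \<le> q" "q \<le> sg k" for q c and S :: "(real^'d) set"
    using borel_measurable_less[OF mX[OF that], of "\<lambda>_. c"] unfolding sp by simp
  have X: "{w\<in>space M. XQ k w} \<in> sets (F (sg k))"
  proof -
    have ct: "countable {q\<in>\<rat>. 0 \<le> q \<and> q \<le> sg k}" by (rule countable_subset[OF _ countable_rat]) auto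
    have "{w\<in>space M. XQ k w} = (\<Inter>m::nat. \<Union>q\<in>{q\<in>\<rat>. 0 \<le> q \<and> q \<le> sg k}. {w\<in>space M. infdist (X q w) (- D) < inverse (real (Suc m))})"
      unfolding XQ_def by auto
    also have "\<dots> \<in> sets (F (sg k))" by (intro sets.countable_INT image_subsetI sets.countable_UN'' ct) (auto intro: lt)
    finally show ?thesis .
  qed
  have I: "(\<Inter>j\<in>{..k}. {w\<in>space M. infdist (X (sg j) w) D < R}) \<in> sets (F (sg k))"
    by (intro sets.finite_INT) (auto intro!: lt sg_nonneg sg_mono)
  have "Cs k = (({w\<in>space M. XQ k w} - {w\<in>space M. VN k w}) \<union> ({w\<in>space M. VN k w} - {w\<in>space M. XQ k w}))
      \<inter> (\<Inter>j\<in>{..k}. {w\<in>space M. infdist (X (sg j) w) D < R})"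
    unfolding Cs_def by auto
  then show ?thesis using V X I by auto
qed

lemma Cs_M: "Cs k \<in> sets M" by (rule sets_F_M[OF sg_nonneg Cs_F])

lemma Cs_conv: "i \<le> j \<Longrightarrow> j \<le> k \<Longrightarrow> w \<in> Cs i \<Longrightarrow> w \<in> Cs k \<Longrightarrow> w \<in> Cs j"
  unfolding Cs_def using mono_k(1,3)[of _ _ w] by (auto intro: order_trans)

text \<open>Together with \<open>g_near\<close> this estimates \<open>g\<close> at the two ends of
  the interval of disagreement: near \<open>D\<close> it is not far below zero, near the boundary
  not far above.\<close>

lemma g_lower: "infdist x D < c \<Longrightarrow> - g x \<le> L * c"
proof -
  assume "infdist x D < c"
  moreover have "D \<noteq> {}" using D by auto
  ultimately obtain y where y: "y \<in> D" "dist x y < c" using infdist_lessE by blast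
  have "0 \<le> g x + L * norm (y - x)" using g0[OF y(1)] gL[of y x] by linarith
  moreover have "L * norm (y - x) \<le> L * c" using y(2) L0 by (intro mult_left_mono) (auto simp: dist_norm norm_minus_commute)
  ultimately show ?thesis by linarith
qed

lemma g_near: "norm (x - p) \<le> c \<Longrightarrow> p \<in> frontier D \<Longrightarrow> g x \<le> L * (c + h)"
proof -
  assume a: "norm (x - p) \<le> c" "p \<in> frontier D"
  have "g x \<le> g p + L * norm (x - p)" by (rule gL)
  also have "L * norm (x - p) \<le> L * c" using a(1) L0 by (rule mult_left_mono)
  finally show ?thesis using gf[OF a(2)] by (simp add: distrib_left)
qed

text \<open>Everything random that the comparison of the paths needs; the arguments up to
  \<open>Cs_sum_bound\<close> are then deterministic. The level \<open>\<epsilon>\<close> is left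
  free because it will itself depend on the path.\<close>

definition good :: "real \<Rightarrow> 'w \<Rightarrow> bool" where
  "good \<epsilon> w \<longleftrightarrow> w \<in> space M \<and> continuous_on {0..} (\<lambda>t. X t w) \<and> 0 \<le> \<epsilon> \<and> \<epsilon> \<le> dl / 10
    \<and> (\<forall>n u. tn n w < T \<longrightarrow> tn n w \<le> u \<longrightarrow> u \<le> tn (Suc n) w \<longrightarrow> norm (X u w - X (tn n w) w) \<le> ro (th (yn n w)))
    \<and> (\<forall>k<NT. \<forall>u. sg k \<le> u \<longrightarrow> u \<le> sg (Suc k) \<longrightarrow> norm (X u w - X (sg k) w) \<le> ro (h\<^sup>2))
    \<and> (\<forall>n. tn n w < T \<longrightarrow> err (Suc n) w \<le> \<epsilon>)"

context
  fixes \<epsilon> w assumes G: "good \<epsilon> w"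
begin

lemma good_err: "tn n w < T \<Longrightarrow> err n w \<le> \<epsilon>"
proof (cases n)
  case 0
  then show ?thesis using G unfolding good_def by (simp add: err_def tn_0 yn_0 X_0)
next
  case (Suc m)
  assume "tn n w < T"
  then have "tn m w < T" using tn_mono[of m w] Suc by simp
  then show ?thesis using G Suc unfolding good_def by simp
qed

lemma good_XQ: "XQ k w \<longleftrightarrow> XO k w"
  using G XQ_iff_XO unfolding good_def by blast

lemma good_osc: "k < NT \<Longrightarrow> sg k \<le> u \<Longrightarrow> u \<le> sg (Suc k) \<Longrightarrow> norm (X u w - X (sg k) w) \<le> ro (h\<^sup>2)"
  using G unfolding good_def by blast

text \<open>The critical case is a solution outside \<open>D\<close> while the scheme has not left.
  If the last scheme point is farther than \<open>dl\<close> from the boundary, then a long step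
  moves the solution by at most \<open>9 / 10 * dl\<close> and the error is at most
  \<open>dl / 10\<close>, so the solution would still be in \<open>D\<close>. Otherwise the step is
  \<open>h\<^sup>2\<close> and the solution is close to this scheme point.\<close>

lemma good_infdist:
  assumes k: "k < NT" and x: "XO k w \<noteq> VN k w"
  shows "infdist (X (sg k) w) D \<le> \<epsilon> + ro (h\<^sup>2)"
proof (cases "X (sg k) w \<in> D")
  case True
  then show ?thesis using G ro_h2(1) unfolding good_def by simp
next
  case False
  then have "XO k w" unfolding XO_def using sg_nonneg by blast
  then have nV: "\<not> VN k w" using x by simp
  define n where "n = (GREATEST n. tn n w \<le> sg k)"
  have bd: "\<forall>n. tn n w \<le> sg k \<longrightarrow> n \<le> k"
  proof (intro allI impI)
    fix n assume "tn n w \<le> sg k"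
    then have "real n * h\<^sup>2 \<le> real k * h\<^sup>2" using tn_ge[of n w] unfolding sg_def by linarith
    then show "n \<le> k" using h2(1) by simp
  qed
  have n: "tn n w \<le> sg k" unfolding n_def
    by (rule GreatestI_nat[of "\<lambda>n. tn n w \<le> sg k" 0 k]) (use bd tn_0 sg_nonneg in auto)
  have n': "sg k < tn (Suc n) w"
  proof (rule ccontr)
    assume "\<not> sg k < tn (Suc n) w"
    then have "Suc n \<le> n" unfolding n_def by (intro Greatest_le_nat[of _ _ k]) (use bd in auto)
    then show False by simp
  qed
  have yD: "yn n w \<in> D" using nV n unfolding VN_def by auto
  have nT: "tn n w < T" using n sg_T[OF k] by simp
  have o: "norm (X (sg k) w - X (tn n w) w) \<le> ro (th (yn n w))" using G nT n n' unfolding good_def by auto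
  have e: "norm (X (tn n w) w - yn n w) \<le> \<epsilon>" using good_err[OF nT] unfolding err_def .
  have d: "dist (X (sg k) w) (yn n w) \<le> \<epsilon> + ro (th (yn n w))"
    using o e norm_triangle_ineq[of "X (sg k) w - X (tn n w) w" "X (tn n w) w - yn n w"] by (simp add: dist_norm)
  show ?thesis
  proof (cases "dl < infdist (yn n w) (frontier D)")
    case True
    then have "dist (X (sg k) w) (yn n w) \<le> \<epsilon> + 9 / 10 * dl" using d unfolding th_eq ro_h[symmetric] by simp
    then have "dist (yn n w) (X (sg k) w) < infdist (yn n w) (frontier D)" using True G unfolding good_def by (simp add: dist_commute)
    then show ?thesis using ball_infdist_frontier[OF yD] False by blast
  next
    case False
    then have "dist (X (sg k) w) (yn n w) \<le> \<epsilon> + ro (h\<^sup>2)" using d unfolding th_eq by simp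
    then show ?thesis using infdist_le[OF yD, of "X (sg k) w"] by linarith
  qed
qed

text \<open>On good paths the distance condition in \<open>Cs\<close> is automatic: disagreement at
  \<open>sg k\<close> excludes that both paths have left at an earlier grid time.\<close>

lemma good_Cs: "k < NT \<Longrightarrow> w \<in> Cs k \<longleftrightarrow> XO k w \<noteq> VN k w"
proof
  assume "w \<in> Cs k" then show "XO k w \<noteq> VN k w" by (simp add: Cs_def good_XQ)
next
  assume k: "k < NT" and x: "XO k w \<noteq> VN k w"
  have s: "\<epsilon> + ro (h\<^sup>2) < R" using G ro_h2(2) dR unfolding good_def dl_def[symmetric] by linarith
  have "infdist (X (sg j) w) D < R" if j: "j \<le> k" for j
  proof (cases "XO j w = VN j w")
    case True
    then have "\<not> XO j w" using mono_k(1,2)[OF j] x by blast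
    then have "X (sg j) w \<in> D" unfolding XO_def using sg_nonneg by blast
    then show ?thesis using s G ro_h2(1) unfolding good_def by simp
  next
    case False
    then show ?thesis using good_infdist[of j] j k s by simp
  qed
  then show "w \<in> Cs k" using x G unfolding good_def by (simp add: Cs_def good_XQ)
qed

text \<open>If the solution leaves first, its path crosses the boundary within the last mesh; if
  only the scheme has left, the segment from the solution to the scheme point does, and it has
  length at most \<open>\<epsilon>\<close>. The oscillation is counted twice since both times are
  compared through \<open>sg k\<close>.\<close>

lemma good_entry:
  assumes k: "Suc k < NT" and x: "XO (Suc k) w \<noteq> VN (Suc k) w" and nx: "\<not> XO k w" "\<not> VN k w"
  shows "g (X (sg (Suc k)) w) \<le> L * (\<epsilon> + 2 * ro (h\<^sup>2) + h)"
proof -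
  have k': "k < NT" using k by simp
  have \<epsilon>: "0 \<le> \<epsilon>" using G unfolding good_def by blast
  have sk: "sg k \<le> sg (Suc k)" by (rule sg_mono) simp
  have o2: "norm (X (sg (Suc k)) w - X u w) \<le> 2 * ro (h\<^sup>2)" if "sg k \<le> u" "u \<le> sg (Suc k)" for u
    using good_osc[OF k' that] good_osc[OF k' sk order_refl]
      norm_triangle_ineq4[of "X (sg (Suc k)) w - X (sg k) w" "X u w - X (sg k) w"] by simp
  show ?thesis
  proof (cases "XO (Suc k) w")
    case True
    then obtain u where u: "0 \<le> u" "u \<le> sg (Suc k)" "X u w \<notin> D" unfolding XO_def by auto
    then have ku: "sg k \<le> u" using nx(1) unfolding XO_def by (meson linear)
    have ex: "\<exists>u\<in>{sg k..sg (Suc k)}. X u w \<notin> D" using ku u by (intro bexI[of _ u]) auto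
    have XD: "X (sg k) w \<in> D" using nx(1) sg_nonneg unfolding XO_def by blast
    have cont: "continuous_on {sg k..sg (Suc k)} (\<lambda>t. X t w)"
    proof (rule continuous_on_subset)
      show "continuous_on {0..} (\<lambda>t. X t w)" using G unfolding good_def by blast
      show "{sg k..sg (Suc k)} \<subseteq> {0..}" using sg_nonneg[of k] by auto
    qed
    obtain v where v: "v \<in> {sg k..sg (Suc k)}" "X v w \<in> frontier D"
      using exit_hits_frontier[OF cont sk XD ex] by blast
    have "norm (X (sg (Suc k)) w - X v w) \<le> \<epsilon> + 2 * ro (h\<^sup>2)" using o2[of v] v(1) \<epsilon> by simp
    then show ?thesis by (rule g_near[OF _ v(2)])
  next
    case False
    then obtain n where n: "tn n w \<le> sg (Suc k)" "yn n w \<notin> D" using x unfolding VN_def by auto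
    then have n': "sg k \<le> tn n w" using nx(2) unfolding VN_def by (meson linear)
    have XD: "X (tn n w) w \<in> D" using False n(1) tn_nonneg unfolding XO_def by blast
    have "tn n w < T" using n(1) sg_T[OF k] by simp
    then have e: "dist (X (tn n w) w) (yn n w) \<le> \<epsilon>" using good_err unfolding err_def dist_norm by blast
    have "closed_segment (X (tn n w) w) (yn n w) \<inter> frontier D \<noteq> {}"
      using XD n(2) by (intro connected_Int_frontier) auto
    then obtain p where p: "p \<in> closed_segment (X (tn n w) w) (yn n w)" "p \<in> frontier D" by auto
    have "norm (X (tn n w) w - p) \<le> \<epsilon>"
      using dist_in_closed_segment(1)[OF p(1)] e by (simp add: dist_norm norm_minus_commute)
    then have "norm (X (sg (Suc k)) w - p) \<le> \<epsilon> + 2 * ro (h\<^sup>2)"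
      using o2[OF n' n(1)] norm_triangle_ineq[of "X (sg (Suc k)) w - X (tn n w) w" "X (tn n w) w - p"] by simp
    then show ?thesis by (rule g_near[OF _ p(2)])
  qed
qed

end

text \<open>The sum telescopes on every path, so even on bad paths it is bounded by
  \<open>2 * Kb\<close> instead of growing with the number \<open>NT\<close> of terms.\<close>

lemma Cs_sum_bound:
  assumes w: "w \<in> space M"
  defines "S \<equiv> (\<Sum>k<NT. indicator (Cs k) w * (g (X (sg k) w) - g (X (sg (Suc k)) w)))"
  shows "S \<le> 2 * Kb" "good \<epsilon> w \<Longrightarrow> S \<le> L * (2 * \<epsilon> + 4 * ro (h\<^sup>2) + 2 * h)"
proof -
  have Kb0: "0 \<le> Kb" using gb[of 0] by linarith
  have S: "S = (\<Sum>k<NT. if w \<in> Cs k then g (X (sg k) w) - g (X (sg (Suc k)) w) else 0)"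
    unfolding S_def by (intro sum.cong refl) (auto simp: indicator_def)
  have "S \<le> 2 * Kb \<and> (good \<epsilon> w \<longrightarrow> S \<le> L * (2 * \<epsilon> + 4 * ro (h\<^sup>2) + 2 * h))"
  proof (cases "\<exists>k<NT. w \<in> Cs k")
    case False
    then have "S = 0" unfolding S by (intro sum.neutral) auto
    moreover have "0 \<le> L * (2 * \<epsilon> + 4 * ro (h\<^sup>2) + 2 * h)" if "good \<epsilon> w"
      using that L0 ro_h2(1) h unfolding good_def by (intro mult_nonneg_nonneg add_nonneg_nonneg) auto
    ultimately show ?thesis using Kb0 by auto
  next
    case True
    obtain k1 k2 where k: "k1 \<le> k2" "k2 < NT" "w \<in> Cs k1" "w \<in> Cs k2" "k1 = 0 \<or> w \<notin> Cs (k1 - 1)"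
      and Sk: "S = g (X (sg k1) w) - g (X (sg (Suc k2)) w)"
    proof -
      have conv: "i \<le> j \<Longrightarrow> j \<le> k \<Longrightarrow> k < NT \<Longrightarrow> w \<in> Cs i \<Longrightarrow> w \<in> Cs k \<Longrightarrow> w \<in> Cs j" for i j k by (rule Cs_conv)
      have "\<exists>k1 k2. k1 \<le> k2 \<and> k2 < NT \<and> w \<in> Cs k1 \<and> w \<in> Cs k2 \<and> (k1 = 0 \<or> w \<notin> Cs (k1 - 1)) \<and> S = g (X (sg k1) w) - g (X (sg (Suc k2)) w)"
        unfolding S by (rule sum_interval_telescope[where P="\<lambda>k. w \<in> Cs k", OF conv True])
      then show ?thesis using that by blast
    qed
    have "S \<le> 2 * Kb" unfolding Sk using gb[of "X (sg k1) w"] gb[of "X (sg (Suc k2)) w"] by linarith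
    moreover have "S \<le> L * (2 * \<epsilon> + 4 * ro (h\<^sup>2) + 2 * h)" if G: "good \<epsilon> w"
    proof -
      have k1: "k1 < NT" using k by simp
      have x1: "XO k1 w \<noteq> VN k1 w" using good_Cs[OF G k1] k by simp
      have x2: "XO k2 w \<noteq> VN k2 w" using good_Cs[OF G k(2)] k by simp
      \<comment> \<open>At time 0 both paths are at \<open>x0\<close> in \<open>D\<close>, so
        disagreement has a preceding grid time without exit.\<close>
      have "k1 \<noteq> 0" using x1 XO_0[OF w] VN_0 by (cases k1) auto
      then obtain j where j: "k1 = Suc j" by (cases k1) auto
      have "XO j w = VN j w" using good_Cs[OF G, of j] k1 k(5) j by simp
      then have "\<not> XO j w" "\<not> VN j w" using mono_k(1,2)[of j k1 w] x1 j by auto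
      then have 1: "g (X (sg k1) w) \<le> L * (\<epsilon> + 2 * ro (h\<^sup>2) + h)"
        unfolding j using good_entry[OF G] k1 x1 unfolding j by blast
      have "infdist (X (sg (Suc k2)) w) D \<le> infdist (X (sg k2) w) D + dist (X (sg (Suc k2)) w) (X (sg k2) w)"
        by (rule infdist_triangle)
      also have "\<dots> \<le> (\<epsilon> + ro (h\<^sup>2)) + ro (h\<^sup>2)"
        using good_infdist[OF G k(2) x2] good_osc[OF G k(2) sg_mono[of k2 "Suc k2"] order_refl]
        by (intro add_mono) (auto simp: dist_norm)
      \<comment> \<open>The summand \<open>h\<close> provides the strict inequality of
        \<open>g_lower\<close> and makes both ends contribute the same bound.\<close>
      also have "\<dots> < \<epsilon> + 2 * ro (h\<^sup>2) + h" using h by simp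
      finally have "- g (X (sg (Suc k2)) w) \<le> L * (\<epsilon> + 2 * ro (h\<^sup>2) + h)" by (rule g_lower)
      then have "S \<le> L * (\<epsilon> + 2 * ro (h\<^sup>2) + h) + L * (\<epsilon> + 2 * ro (h\<^sup>2) + h)" unfolding Sk using 1 by linarith
      then show ?thesis by (simp add: algebra_simps)
    qed
    ultimately show ?thesis by blast
  qed
  then show "S \<le> 2 * Kb" "good \<epsilon> w \<Longrightarrow> S \<le> L * (2 * \<epsilon> + 4 * ro (h\<^sup>2) + 2 * h)" by auto
qed

end

lemma min_Inf_props:
  fixes S :: "real set" and T :: real
  assumes S: "\<forall>x\<in>S. 0 \<le> x" and T: "0 < T"
  defines "e \<equiv> (if S \<noteq> {} then min (Inf S) T else T)"
  shows "0 \<le> e" "e \<le> T" "x \<in> S \<Longrightarrow> e \<le> x" "e < c \<Longrightarrow> c \<le> T \<Longrightarrow> \<exists>x\<in>S. x < c"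
proof -
  have bd: "bdd_below S" using S by (meson bdd_belowI)
  show "0 \<le> e" unfolding e_def using S T by (auto intro!: cInf_greatest)
  show "e \<le> T" unfolding e_def by auto
  show "e \<le> x" if "x \<in> S" unfolding e_def using cInf_lower[OF that bd] that by auto
  show "\<exists>x\<in>S. x < c" if "e < c" "c \<le> T"
  proof -
    have "S \<noteq> {}" using that unfolding e_def by (auto split: if_splits)
    moreover then have "Inf S < c" using that unfolding e_def by auto
    ultimately show ?thesis using cInf_less_iff[OF _ bd] by blast
  qed
qed

section \<open>Exceptional events and the mean time error\<close>

context exit_scheme
begin

definition nu :: "'w \<Rightarrow> real" where "nu w = num_exit_time T D Cb h a b W J x0 w"
definition tau :: "'w \<Rightarrow> real" where "tau w = exit_time T D X w"

lemma nu_props: "0 \<le> nu w" "nu w \<le> T" "yn n w \<notin> D \<Longrightarrow> nu w \<le> tn n w" "nu w < c \<Longrightarrow> c \<le> T \<Longrightarrow> \<exists>n. tn n w < c \<and> yn n w \<notin> D"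
proof -
  let ?S = "{tn n w |n. yn n w \<notin> D}"
  have S: "x \<in> ?S \<Longrightarrow> 0 \<le> x" for x using tn_nonneg by auto
  have e: "nu w = (if ?S \<noteq> {} then min (Inf ?S) T else T)"
    unfolding nu_def num_exit_time_def tn_def[symmetric] yn_def[symmetric] by auto
  have S': "\<forall>x\<in>?S. 0 \<le> x" using S by blast
  note m = min_Inf_props[OF S' T0, folded e]
  show "0 \<le> nu w" by (rule m(1))
  show "nu w \<le> T" by (rule m(2))
  show "yn n w \<notin> D \<Longrightarrow> nu w \<le> tn n w" by (rule m(3)) auto
  show "nu w < c \<Longrightarrow> c \<le> T \<Longrightarrow> \<exists>n. tn n w < c \<and> yn n w \<notin> D" using m(4)[of c] by auto
qed

lemma tau_props: "0 \<le> tau w" "tau w \<le> T" "0 \<le> u \<Longrightarrow> X u w \<notin> D \<Longrightarrow> tau w \<le> u" "tau w < c \<Longrightarrow> c \<le> T \<Longrightarrow> \<exists>u. 0 \<le> u \<and> u < c \<and> X u w \<notin> D"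
proof -
  let ?S = "{t. 0 \<le> t \<and> X t w \<notin> D}"
  have S: "x \<in> ?S \<Longrightarrow> 0 \<le> x" for x by auto
  have e: "tau w = (if ?S \<noteq> {} then min (Inf ?S) T else T)"
    unfolding tau_def exit_time_def by auto
  have S': "\<forall>x\<in>?S. 0 \<le> x" using S by blast
  note m = min_Inf_props[OF S' T0, folded e]
  show "0 \<le> tau w" by (rule m(1))
  show "tau w \<le> T" by (rule m(2))
  show "0 \<le> u \<Longrightarrow> X u w \<notin> D \<Longrightarrow> tau w \<le> u" by (rule m(3)) auto
  show "tau w < c \<Longrightarrow> c \<le> T \<Longrightarrow> \<exists>u. 0 \<le> u \<and> u < c \<and> X u w \<notin> D" using m(4)[of c] by auto
qed

text \<open>At every grid time strictly between the two exit times exactly one of the paths has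
  left.\<close>

lemma time_diff: "\<bar>nu w - tau w\<bar> \<le> h\<^sup>2 + h\<^sup>2 * real (card {k. k < NT \<and> XO k w \<noteq> VN k w})"
proof -
  have 1: "tau w - nu w \<le> h\<^sup>2 + h\<^sup>2 * real (card {k. k < NT \<and> XO k w \<noteq> VN k w})"
    unfolding NT_def
  proof (rule diff_le_card_grid[OF h2(1) nu_props(1) tau_props(2)])
    fix k assume k: "nu w < real k * h\<^sup>2" "real k * h\<^sup>2 < tau w"
    then have "VN k w" using nu_props(4)[of w "sg k"] tau_props(2)[of w] unfolding VN_def sg_def by (meson less_imp_le order_trans)
    moreover have "\<not> XO k w" using tau_props(3)[of _ w] k unfolding XO_def sg_def by fastforce
    ultimately show "XO k w \<noteq> VN k w" by blast
  qed
  have 2: "nu w - tau w \<le> h\<^sup>2 + h\<^sup>2 * real (card {k. k < NT \<and> XO k w \<noteq> VN k w})"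
    unfolding NT_def
  proof (rule diff_le_card_grid[OF h2(1) tau_props(1) nu_props(2)])
    fix k assume k: "tau w < real k * h\<^sup>2" "real k * h\<^sup>2 < nu w"
    then have "XO k w" using tau_props(4)[of w "sg k"] nu_props(2)[of w] unfolding XO_def sg_def by (meson less_imp_le order_trans)
    moreover have "\<not> VN k w" using nu_props(3)[of _ w] k unfolding VN_def sg_def by fastforce
    ultimately show "XO k w \<noteq> VN k w" by blast
  qed
  show ?thesis using 1 2 by (auto simp: abs_le_iff)
qed

definition Co :: real where "Co = 2 * real CARD('d) * exp (sqrt (8 * Cb) * K / Cb)"

lemma Co0: "0 \<le> Co" unfolding Co_def by simp

text \<open>The exponent is \<open>81 / 25 * ln (1 / h)\<close>, which exceeds three times the
  logarithm, and the drift part stays bounded since \<open>\<theta> * ln (1 / h) \<le> 1\<close>.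
  The cube of \<open>h\<close> compensates the roughly \<open>T / h\<^sup>2\<close> events to be
  summed and leaves order \<open>h\<close>.\<close>

lemma osc_bound_le:
  assumes \<theta>: "0 < \<theta>" "\<theta> \<le> h"
  shows "0 < cc \<theta>" "osc_bound \<theta> (cc \<theta>) \<le> Co * h ^ 3"
proof -
  have l: "0 < ln (1 / h)" using lnh by simp
  show "0 < cc \<theta>" unfolding cc_def using Cbp \<theta> l by simp
  have "ln (1 / h) \<le> 1 / h - 1" using h by (intro ln_le_minus_one) simp
  then have "h * ln (1 / h) \<le> h * (1 / h - 1)" using h by (intro mult_left_mono) auto
  also have "\<dots> \<le> 1" using h by (simp add: right_diff_distrib)
  finally have hl: "h * ln (1 / h) \<le> 1" .
  have "\<theta> * ln (1 / h) \<le> h * ln (1 / h)" using \<theta> l by (intro mult_right_mono) auto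
  then have tl: "\<theta> * ln (1 / h) \<le> 1" using hl by simp
  have "8 * Cb * (\<theta> * ln (1 / h)) \<le> 8 * Cb * 1" using tl Cbp by (intro mult_left_mono) auto
  then have "sqrt (8 * Cb * \<theta> * ln (1 / h)) \<le> sqrt (8 * Cb)" by (simp add: mult.assoc)
  moreover have "0 \<le> sqrt (8 * Cb * \<theta> * ln (1 / h))" using Cbp \<theta> l by simp
  ultimately have c: "cc \<theta> \<le> sqrt (8 * Cb)" unfolding cc_def by linarith
  have "(cc \<theta>)\<^sup>2 = 81 / 100 * (8 * Cb * \<theta> * ln (1 / h))"
    unfolding cc_def power_mult_distrib using Cbp \<theta> l by (simp add: power2_eq_square)
  then have q: "(cc \<theta>)\<^sup>2 / (2 * Cb * \<theta>) = 81 / 25 * ln (1 / h)" using Cbp \<theta> by simp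
  have "cc \<theta> * K / Cb - (cc \<theta>)\<^sup>2 / (2 * Cb * \<theta>) \<le> sqrt (8 * Cb) * K / Cb + 3 * ln h"
  proof -
    have "cc \<theta> * K / Cb \<le> sqrt (8 * Cb) * K / Cb" using c K1 Cbp by (intro divide_right_mono mult_right_mono) auto
    moreover have "ln (1 / h) = - ln h" using h by (simp add: ln_div)
    ultimately show ?thesis unfolding q using l by linarith
  qed
  then have "exp (cc \<theta> * K / Cb - (cc \<theta>)\<^sup>2 / (2 * Cb * \<theta>)) \<le> exp (sqrt (8 * Cb) * K / Cb + 3 * ln h)" by simp
  also have "\<dots> = exp (sqrt (8 * Cb) * K / Cb) * h ^ 3"
  proof -
    have "exp (3 * ln h) = exp (ln h) ^ 3" using exp_of_nat_mult[of 3 "ln h"] by simp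
    then show ?thesis using h by (simp add: exp_add)
  qed
  finally show "osc_bound \<theta> (cc \<theta>) \<le> Co * h ^ 3" unfolding osc_bound_def Co_def by (simp add: mult.assoc)
qed

lemma osc_event: "0 \<le> q \<Longrightarrow> A \<in> sets (F q) \<Longrightarrow> 0 < \<theta> \<Longrightarrow> \<theta> \<le> h \<Longrightarrow> prob (A \<inter> Osc q \<theta> (ro \<theta>)) \<le> Co * h ^ 3 * prob A"
  unfolding ro_def using Osc_prob[of q \<theta> A "cc \<theta>"] osc_bound_le[of \<theta>] Cbp
  by (meson measure_nonneg mult_right_mono order_trans)

lemma NT_h3: "real NT * h ^ 3 \<le> (T + 1) * h"
proof -
  have "0 < T / h\<^sup>2" using T0 h2(1) by simp
  then have "real NT \<le> T / h\<^sup>2 + 1" unfolding NT_def by linarith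
  then have "real NT * h\<^sup>2 \<le> (T / h\<^sup>2 + 1) * h\<^sup>2" by (intro mult_right_mono) auto
  also have "\<dots> = T + h\<^sup>2" using h2(1) by (simp add: distrib_right)
  also have "\<dots> \<le> T + 1" using h2 by simp
  finally have "real NT * h\<^sup>2 * h \<le> (T + 1) * h" using h by (intro mult_right_mono) auto
  then show ?thesis by (simp add: power2_eq_square power3_eq_cube mult.assoc)
qed

text \<open>Oscillation over the steps of the scheme, written with events that fix time and step
  because \<open>Osc\<close> requires deterministic times. \<open>Bad2\<close> is the analogue for
  the comparison grid.\<close>

definition Bad1 :: "'w set" where "Bad1 = (\<Union>n<NT. \<Union>p\<in>Ts n \<times> {h, h\<^sup>2}. G n p \<inter> Osc (fst p) (snd p) (ro (snd p)))"
definition Bad2 :: "'w set" where "Bad2 = (\<Union>k<NT. space M \<inter> Osc (sg k) (h\<^sup>2) (ro (h\<^sup>2)))"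
definition Eb :: "real \<Rightarrow> 'w set" where "Eb \<rho> = {w\<in>space M. \<exists>n<NT. tn n w < T \<and> \<rho> < err (Suc n) w}"
definition Bad :: "'w set" where "Bad = Bad1 \<union> Bad2 \<union> Eb (dl / 10)"

lemma Eb_M: "Eb \<rho> \<in> sets M"
proof -
  note err_meas[measurable] tn_meas[measurable]
  show ?thesis unfolding Eb_def by measurable
qed

lemma prob_Eb: "0 < \<rho> \<Longrightarrow> prob (Eb \<rho>) \<le> CE * h\<^sup>2 / \<rho>\<^sup>2"
  using err_ville[of \<rho> NT] CE0 unfolding Eb_def[symmetric] emeasure_eq_measure
  by (subst (asm) ennreal_le_iff) auto

lemma G_M: "p \<in> Ts n \<times> {h, h\<^sup>2} \<Longrightarrow> G n p \<in> sets (F (fst p))" "p \<in> Ts n \<times> {h, h\<^sup>2} \<Longrightarrow> G n p \<in> sets M"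
proof -
  assume "p \<in> Ts n \<times> {h, h\<^sup>2}"
  then have "0 \<le> fst p" using Ts_nonneg by auto
  then show "G n p \<in> sets (F (fst p))" "G n p \<in> sets M" using G_F sets_F_M by blast+
qed

lemma step_pos: "p \<in> Ts n \<times> {h, h\<^sup>2} \<Longrightarrow> 0 \<le> fst p \<and> 0 < snd p \<and> snd p \<le> h"
proof -
  assume "p \<in> Ts n \<times> {h, h\<^sup>2}"
  then have "0 \<le> fst p" "snd p = h \<or> snd p = h\<^sup>2" using Ts_nonneg by auto
  then show ?thesis using h h2 by (elim disjE) (intro conjI, linarith+)+
qed

lemma Bad1_M: "Bad1 \<in> sets M"
  unfolding Bad1_def by (intro sets.finite_UN finite_cartesian_product Ts_finite sets.Int G_M(2) Osc_sets) (use step_pos in auto)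

lemma Bad2_M: "Bad2 \<in> sets M"
  unfolding Bad2_def by (intro sets.finite_UN sets.Int Osc_sets) (use sg_nonneg h2 in auto)

text \<open>For fixed \<open>n\<close> the events \<open>G n p\<close> are disjoint and the
  oscillation bound is relative to their probability, so the growing number of possible times does
  not enter; only the number of steps does.\<close>

lemma prob_Bad1: "prob Bad1 \<le> Co * (T + 1) * h"
proof -
  let ?P = "\<lambda>n. Ts n \<times> {h, h\<^sup>2}"
  let ?B = "\<lambda>n p. G n p \<inter> Osc (fst p) (snd p) (ro (snd p))"
  have fP: "finite (?P n)" for n using Ts_finite by auto
  have BM: "?B n p \<in> sets M" if "p \<in> ?P n" for n p
    using G_M(2)[OF that] Osc_sets step_pos[OF that] by blast
  have 1: "prob (\<Union>p\<in>?P n. ?B n p) \<le> Co * h ^ 3" for n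
  proof -
    have "prob (\<Union>p\<in>?P n. ?B n p) \<le> (\<Sum>p\<in>?P n. prob (?B n p))"
      using BM by (intro finite_measure_subadditive_finite fP) auto
    also have "\<dots> \<le> (\<Sum>p\<in>?P n. Co * h ^ 3 * prob (G n p))"
      using step_pos G_M(1) by (intro sum_mono osc_event) auto
    also have "\<dots> = Co * h ^ 3 * (\<Sum>p\<in>?P n. prob (G n p))" by (simp add: sum_distrib_left)
    also have "(\<Sum>p\<in>?P n. prob (G n p)) = prob (\<Union>p\<in>?P n. G n p)"
      by (rule finite_measure_finite_Union[symmetric, OF fP]) (use G_M(2) in \<open>auto simp: disjoint_family_on_def G_def\<close>)
    also have "Co * h ^ 3 * \<dots> \<le> Co * h ^ 3 * 1" using Co0 h by (intro mult_left_mono prob_le_1) auto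
    finally show ?thesis by simp
  qed
  have "prob Bad1 \<le> (\<Sum>n<NT. prob (\<Union>p\<in>?P n. ?B n p))"
    unfolding Bad1_def using BM by (intro finite_measure_subadditive_finite) (auto intro!: sets.finite_UN fP)
  also have "\<dots> \<le> (\<Sum>n<NT. Co * h ^ 3)" by (intro sum_mono 1)
  also have "\<dots> = Co * (real NT * h ^ 3)" by simp
  also have "\<dots> \<le> Co * ((T + 1) * h)" using NT_h3 Co0 by (intro mult_left_mono)
  finally show ?thesis by (simp add: mult.assoc)
qed

lemma prob_Bad2: "prob Bad2 \<le> Co * (T + 1) * h"
proof -
  have "prob Bad2 \<le> (\<Sum>k<NT. prob (space M \<inter> Osc (sg k) (h\<^sup>2) (ro (h\<^sup>2))))"
    unfolding Bad2_def using Osc_sets[OF sg_nonneg h2(1)] by (intro finite_measure_subadditive_finite) auto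
  also have "\<dots> \<le> (\<Sum>k<NT. Co * h ^ 3 * prob (space M))"
  proof (intro sum_mono osc_event)
    show "space M \<in> sets (F (sg k))" for k using sets.top[of "F (sg k)"] unfolding space_F[OF sg_nonneg] .
  qed (use sg_nonneg h2 in auto)
  also have "\<dots> = Co * (real NT * h ^ 3)" by (simp add: prob_space)
  also have "\<dots> \<le> Co * ((T + 1) * h)" using NT_h3 Co0 by (intro mult_left_mono)
  finally show ?thesis by (simp add: mult.assoc)
qed

lemma Bad_M: "Bad \<in> sets M" unfolding Bad_def using Bad1_M Bad2_M Eb_M by auto

lemma dl_bound: "8 * Cb * h \<le> dl\<^sup>2" "0 < dl"
proof -
  have "1 * 1 \<le> real CARD('d) * ln (1 / h)" using lnh by (intro mult_mono) (auto simp: Suc_le_eq)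
  then have "8 * Cb * h * 1 \<le> 8 * Cb * h * (real CARD('d) * ln (1 / h))" using Cbp h by (intro mult_left_mono) auto
  moreover have "dl\<^sup>2 = 8 * Cb * h * (real CARD('d) * ln (1 / h))"
    unfolding dl_def using Cbp h lnh by (simp add: mult_ac)
  ultimately show 1: "8 * Cb * h \<le> dl\<^sup>2" by simp
  have "0 \<le> dl" unfolding dl_def using Cbp h lnh by simp
  moreover have "0 < 8 * Cb * h" using Cbp h by simp
  ultimately show "0 < dl" using 1 by (cases "dl = 0") auto
qed

text \<open>\<open>dl\<^sup>2\<close> is at least of order \<open>h\<close>, so the second moment
  tail at the level \<open>dl / 10\<close> is of order \<open>h\<close> as well.\<close>

lemma prob_Bad: "prob Bad \<le> 2 * Co * (T + 1) * h + 100 * CE / (8 * Cb) * h"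
proof -
  have "prob (Eb (dl / 10)) \<le> CE * h\<^sup>2 / (dl / 10)\<^sup>2" using dl_bound by (intro prob_Eb) simp
  also have "\<dots> = 100 * CE * h\<^sup>2 / dl\<^sup>2" by (simp add: power_divide)
  also have "\<dots> \<le> 100 * CE * h\<^sup>2 / (8 * Cb * h)"
    using dl_bound CE0 Cbp h by (intro divide_left_mono) auto
  also have "\<dots> = 100 * CE / (8 * Cb) * h" using h by (simp add: power2_eq_square)
  finally have 3: "prob (Eb (dl / 10)) \<le> 100 * CE / (8 * Cb) * h" .
  have "prob Bad \<le> prob (Bad1 \<union> Bad2) + prob (Eb (dl / 10))"
    unfolding Bad_def using Bad1_M Bad2_M Eb_M by (intro measure_Un_le) auto
  also have "prob (Bad1 \<union> Bad2) \<le> prob Bad1 + prob Bad2"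
    using Bad1_M Bad2_M by (intro measure_Un_le) auto
  finally show ?thesis using 3 prob_Bad1 prob_Bad2 by (simp add: algebra_simps)
qed

text \<open>A majorant, from dyadic levels, of the maximal error truncated at
  \<open>2 ^ J' * h\<close>; it is a finite sum of indicators and hence easy to integrate.\<close>

definition dy :: "nat \<Rightarrow> 'w \<Rightarrow> real" where
  "dy J' w = h + (\<Sum>j<J'. 2 ^ j * h * indicator (Eb (2 ^ j * h)) w)"

text \<open>Level \<open>j\<close> contributes at most \<open>CE * h / 2 ^ j\<close>: the tail is
  quadratic while the weight is linear in the level, so the sum is geometric and bounded
  independently of \<open>J'\<close>.\<close>

lemma dy_int: "integrable M (dy J')" "(\<integral>w. dy J' w \<partial>M) \<le> h + 2 * CE * h"
proof -
  have i: "integrable M (indicator (Eb \<rho>) :: 'w \<Rightarrow> real)" for \<rho> using Eb_M by (simp add: less_top[symmetric])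
  show "integrable M (dy J')" unfolding dy_def using i by (intro Bochner_Integration.integrable_add Bochner_Integration.integrable_sum integrable_mult_right) auto
  have "(\<integral>w. dy J' w \<partial>M) = h + (\<Sum>j<J'. 2 ^ j * h * prob (Eb (2 ^ j * h)))"
  proof -
    have "(\<integral>w. (\<Sum>j<J'. 2 ^ j * h * indicator (Eb (2 ^ j * h)) w) \<partial>M) = (\<Sum>j<J'. \<integral>w. 2 ^ j * h * indicator (Eb (2 ^ j * h)) w \<partial>M)"
      by (intro Bochner_Integration.integral_sum integrable_mult_right i)
    moreover have "(\<integral>w. 2 ^ j * h * indicator (Eb (2 ^ j * h)) w \<partial>M) = 2 ^ j * h * prob (Eb (2 ^ j * h))" for j :: nat
      using Eb_M sets.sets_into_space[OF Eb_M] by (simp add: Int_absorb2)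
    moreover have "(\<integral>w. dy J' w \<partial>M) = (\<integral>w. h \<partial>M) + (\<integral>w. (\<Sum>j<J'. 2 ^ j * h * indicator (Eb (2 ^ j * h)) w) \<partial>M)"
      unfolding dy_def by (intro Bochner_Integration.integral_add Bochner_Integration.integrable_sum integrable_mult_right i integrable_const)
    moreover have "(\<integral>w. h \<partial>M) = h" by (simp add: prob_space)
    ultimately show ?thesis by (simp only:)
  qed
  also have "\<dots> \<le> h + (\<Sum>j<J'. CE * h * (1 / 2) ^ j)"
  proof (intro add_left_mono sum_mono)
    fix j :: nat
    have "2 ^ j * h * prob (Eb (2 ^ j * h)) \<le> 2 ^ j * h * (CE * h\<^sup>2 / (2 ^ j * h)\<^sup>2)"
      using h by (intro mult_left_mono prob_Eb) auto
    also have "\<dots> = CE * h * (1 / 2) ^ j" using h by (simp add: power2_eq_square power_one_over field_simps)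
    finally show "2 ^ j * h * prob (Eb (2 ^ j * h)) \<le> CE * h * (1 / 2) ^ j" .
  qed
  also have "\<dots> = h + CE * h * (\<Sum>j<J'. (1 / 2) ^ j)" by (simp add: sum_distrib_left)
  also have "\<dots> \<le> h + CE * h * 2"
  proof (intro add_left_mono mult_left_mono)
    show "(\<Sum>j<J'. (1 / 2 :: real) ^ j) \<le> 2" by (simp add: sum_gp_strict)
    show "0 \<le> CE * h" using CE0 h by simp
  qed
  finally show "(\<integral>w. dy J' w \<partial>M) \<le> h + 2 * CE * h" by (simp add: mult_ac)
qed

text \<open>\<open>J'\<close> is taken so large that the truncation level lies above
  \<open>dl / 10\<close>, which bounds the error off \<open>Bad\<close>; then the truncation changes
  nothing.\<close>

lemma good_outside_Bad:
  assumes w: "w \<in> space M" "w \<notin> Bad" and c: "continuous_on {0..} (\<lambda>t. X t w)" and J: "dl / 10 \<le> 2 ^ J' * h"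
  shows "good (min (dy J' w) (dl / 10)) w"
proof -
  have dy0: "0 \<le> dy J' w" unfolding dy_def using h by (intro add_nonneg_nonneg sum_nonneg) auto
  have 1: "norm (X u w - X (tn n w) w) \<le> ro (th (yn n w))" if n: "tn n w < T" "tn n w \<le> u" "u \<le> tn (Suc n) w" for n u
  proof (rule not_Osc[OF tn_nonneg th_bounds(1) w(1) _ c n(2)])
    have "(tn n w, th (yn n w)) \<in> Ts n \<times> {h, h\<^sup>2}" using tn_Ts th_cases[of "yn n w"] by auto
    moreover have "w \<in> G n (tn n w, th (yn n w))" using G_cover[OF w(1)] by simp
    moreover have "n < NT" by (rule tn_NT[OF n(1)])
    moreover have "w \<notin> Bad1" using w(2) unfolding Bad_def by simp
    ultimately show "w \<notin> Osc (tn n w) (th (yn n w)) (ro (th (yn n w)))" unfolding Bad1_def by fastforce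
    show "u \<le> tn n w + th (yn n w)" using n(3) unfolding tn_Suc .
    show "0 \<le> ro (th (yn n w))" using th_bounds(1)[of "yn n w"] by (intro ro_nonneg) simp
  qed
  have 2: "norm (X u w - X (sg k) w) \<le> ro (h\<^sup>2)" if k: "k < NT" "sg k \<le> u" "u \<le> sg (Suc k)" for k u
  proof (rule not_Osc[OF sg_nonneg h2(1) w(1) _ c k(2) _ ro_h2(1)])
    show "w \<notin> Osc (sg k) (h\<^sup>2) (ro (h\<^sup>2))" using w k(1) unfolding Bad_def Bad2_def by auto
    show "u \<le> sg k + h\<^sup>2" using k(3) unfolding sg_Suc .
  qed
  have 3: "err (Suc n) w \<le> min (dy J' w) (dl / 10)" if n: "tn n w < T" for n
  proof -
    have nN: "n < NT" by (rule tn_NT[OF n])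
    have e: "err (Suc n) w \<le> dl / 10" using w nN n unfolding Bad_def Eb_def by (auto simp: not_less dest!: spec[of _ n])
    have "err (Suc n) w = min (2 ^ J' * h) (err (Suc n) w)" using e J by simp
    also have "\<dots> \<le> h + (\<Sum>j<J'. 2 ^ j * h * of_bool (2 ^ j * h < err (Suc n) w))" using h by (intro min_dyadic) simp
    also have "\<dots> \<le> dy J' w" unfolding dy_def
      using h nN n w(1) by (intro add_left_mono sum_mono mult_left_mono) (auto simp: Eb_def indicator_def)
    finally show ?thesis using e by simp
  qed
  show ?thesis unfolding good_def using w c 1 2 3 dy0 dl_bound(2) by auto
qed

text \<open>The left side is the mean time of disagreement on the grid. Each mesh costs
  \<open>h\<^sup>2\<close> on \<open>Cs k\<close> by the drift condition, and the total is bounded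
  pathwise by \<open>Cs_sum_bound\<close>, with the crude bound on \<open>Bad\<close>.\<close>

lemma sum_prob_Cs:
  shows "h\<^sup>2 * (\<Sum>k<NT. prob (Cs k)) \<le> L * (2 * (h + 2 * CE * h) + 4 * ro (h\<^sup>2) + 2 * h) + 2 * Kb * prob Bad"
proof -
  obtain J' :: nat where "dl / 10 / h < 2 ^ J'" using real_arch_pow[of 2 "dl / 10 / h"] by auto
  then have J: "dl / 10 \<le> 2 ^ J' * h" using h by (simp add: divide_less_eq)
  define S where "S w = (\<Sum>k<NT. indicator (Cs k) w * (g (X (sg k) w) - g (X (sg (Suc k)) w)))" for w
  have ig: "integrable M (\<lambda>w. g (X (sg k) w))" for k
    by (rule integrable_const_bound[of _ Kb])
      (use gb measurable_compose[OF meas_X_M[OF sg_nonneg] gm] in auto)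
  have i: "integrable M (\<lambda>w. indicator (Cs k) w * (g (X (sg k) w) - g (X (sg (Suc k)) w)))" for k
    by (rule bwt_imult[OF sg_nonneg bwt_ind[OF Cs_F]]) (use ig in auto)
  have iS: "integrable M S" unfolding S_def by (intro Bochner_Integration.integrable_sum i)
  have "h\<^sup>2 * (\<Sum>k<NT. prob (Cs k)) = (\<Sum>k<NT. h\<^sup>2 * prob (Cs k))" by (rule sum_distrib_left)
  also have "\<dots> \<le> (\<Sum>k<NT. \<integral>w. indicator (Cs k) w * (g (X (sg k) w) - g (X (sg (Suc k)) w)) \<partial>M)"
  proof (rule sum_mono)
    fix k
    have "(\<integral>w. indicator (Cs k) w * (g (X (sg (Suc k)) w) - g (X (sg k) w)) \<partial>M) \<le> - h\<^sup>2 * prob (Cs k)"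
      unfolding sg_Suc by (rule drift[OF sg_nonneg Cs_F]) (auto simp: Cs_def)
    moreover have "(\<lambda>w. indicator (Cs k) w * (g (X (sg k) w) - g (X (sg (Suc k)) w))) = (\<lambda>w. - (indicator (Cs k) w * (g (X (sg (Suc k)) w) - g (X (sg k) w))))"
      by (simp add: algebra_simps)
    ultimately show "h\<^sup>2 * prob (Cs k) \<le> (\<integral>w. indicator (Cs k) w * (g (X (sg k) w) - g (X (sg (Suc k)) w)) \<partial>M)"
      by simp
  qed
  also have "\<dots> = (\<integral>w. S w \<partial>M)" unfolding S_def by (rule Bochner_Integration.integral_sum[symmetric]) (rule i)
  also have "\<dots> \<le> (\<integral>w. L * (2 * dy J' w + 4 * ro (h\<^sup>2) + 2 * h) + 2 * Kb * indicator Bad w \<partial>M)"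
  proof (rule integral_mono_AE[OF iS])
    show "integrable M (\<lambda>w. L * (2 * dy J' w + 4 * ro (h\<^sup>2) + 2 * h) + 2 * Kb * indicator Bad w)"
      using dy_int(1)[of J'] Bad_M by (auto simp: less_top[symmetric])
    show "AE w in M. S w \<le> L * (2 * dy J' w + 4 * ro (h\<^sup>2) + 2 * h) + 2 * Kb * indicator Bad w"
      using X_cont AE_space
    proof eventually_elim
      case (elim w)
      have r: "0 \<le> L * (2 * dy J' w + 4 * ro (h\<^sup>2) + 2 * h)"
      proof -
        have "0 \<le> dy J' w" unfolding dy_def using h by (intro add_nonneg_nonneg sum_nonneg) auto
        then show ?thesis using L0 ro_h2(1) h by (intro mult_nonneg_nonneg add_nonneg_nonneg) auto
      qed
      show ?case
      proof (cases "w \<in> Bad")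
        case True
        then show ?thesis using Cs_sum_bound(1)[OF elim(2)] r unfolding S_def by simp
      next
        case False
        have "S w \<le> L * (2 * min (dy J' w) (dl / 10) + 4 * ro (h\<^sup>2) + 2 * h)"
          unfolding S_def by (rule Cs_sum_bound(2)[OF elim(2) good_outside_Bad[OF elim(2) False elim(1) J]])
        also have "\<dots> \<le> L * (2 * dy J' w + 4 * ro (h\<^sup>2) + 2 * h)" using L0 by (intro mult_left_mono) auto
        finally show ?thesis using False by simp
      qed
    qed
  qed
  also have "\<dots> = L * (2 * (\<integral>w. dy J' w \<partial>M) + 4 * ro (h\<^sup>2) + 2 * h) + 2 * Kb * prob Bad"
    using dy_int(1)[of J'] Bad_M by (simp add: less_top[symmetric] prob_space)
  also have "\<dots> \<le> L * (2 * (h + 2 * CE * h) + 4 * ro (h\<^sup>2) + 2 * h) + 2 * Kb * prob Bad"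
    using dy_int(2)[of J'] L0 by (intro add_right_mono mult_left_mono) auto
  finally show ?thesis .
qed

text \<open>Off \<open>Bad\<close> the indicators of \<open>Cs k\<close> count exactly the grid
  times of disagreement; on \<open>Bad\<close> the time difference is at most
  \<open>T\<close>.\<close>

lemma nn_time_error:
  "(\<integral>\<^sup>+w. ennreal \<bar>nu w - tau w\<bar> \<partial>M) \<le> ennreal (h\<^sup>2 + (L * (2 * (h + 2 * CE * h) + 4 * ro (h\<^sup>2) + 2 * h))
    + (2 * Kb + T) * (2 * Co * (T + 1) * h + 100 * CE / (8 * Cb) * h))"
proof -
  have Kb0: "0 \<le> Kb" using gb[of 0] by linarith
  let ?f = "\<lambda>w. h\<^sup>2 + h\<^sup>2 * (\<Sum>k<NT. indicator (Cs k) w) + T * indicator Bad w"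
  have i: "integrable M (indicator A :: 'w \<Rightarrow> real)" if "A \<in> sets M" for A using that by (simp add: less_top[symmetric])
  have "(\<integral>\<^sup>+w. ennreal \<bar>nu w - tau w\<bar> \<partial>M) \<le> (\<integral>\<^sup>+w. ennreal (?f w) \<partial>M)"
  proof (rule nn_integral_mono_AE)
    show "AE w in M. ennreal \<bar>nu w - tau w\<bar> \<le> ennreal (?f w)"
      using X_cont AE_space
    proof eventually_elim
      case (elim w)
      show ?case
      proof (rule ennreal_leI, cases "w \<in> Bad")
        case True
        have "\<bar>nu w - tau w\<bar> \<le> T" using nu_props(1,2)[of w] tau_props(1,2)[of w] by linarith
        moreover have "0 \<le> h\<^sup>2 * (\<Sum>k<NT. indicator (Cs k) w :: real)" by (intro mult_nonneg_nonneg sum_nonneg) auto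
        moreover have "0 \<le> h\<^sup>2" by simp
        moreover have "T * indicator Bad w = T" using True by simp
        ultimately show "\<bar>nu w - tau w\<bar> \<le> ?f w" by linarith
      next
        case False
        obtain J' :: nat where "dl / 10 / h < 2 ^ J'" using real_arch_pow[of 2 "dl / 10 / h"] by auto
        then have J: "dl / 10 \<le> 2 ^ J' * h" using h by (simp add: divide_less_eq)
        note G = good_outside_Bad[OF elim(2) False elim(1) J]
        have "real (card {k. k < NT \<and> XO k w \<noteq> VN k w}) = (\<Sum>k<NT. indicator (Cs k) w)"
        proof -
          have "(\<Sum>k<NT. indicator (Cs k) w :: real) = (\<Sum>k<NT. of_bool (XO k w \<noteq> VN k w))"
            using good_Cs[OF G] by (intro sum.cong refl) (auto simp: indicator_def)
          also have "\<dots> = real (card {k \<in> {..<NT}. XO k w \<noteq> VN k w})" by (simp add: sum_of_bool_eq Int_def)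
          finally show ?thesis by simp
        qed
        then show "\<bar>nu w - tau w\<bar> \<le> ?f w" using time_diff[of w] False by simp
      qed
    qed
  qed
  also have "\<dots> = ennreal (\<integral>w. ?f w \<partial>M)"
    using T0 i Cs_M Bad_M by (intro nn_integral_eq_integral) (auto intro!: AE_I2 add_nonneg_nonneg mult_nonneg_nonneg sum_nonneg)
  also have "(\<integral>w. ?f w \<partial>M) = h\<^sup>2 + h\<^sup>2 * (\<Sum>k<NT. prob (Cs k)) + T * prob Bad"
    using i Cs_M Bad_M by (simp add: Bochner_Integration.integral_sum prob_space)
  also have "ennreal \<dots> \<le> ennreal (h\<^sup>2 + (L * (2 * (h + 2 * CE * h) + 4 * ro (h\<^sup>2) + 2 * h))
    + (2 * Kb + T) * (2 * Co * (T + 1) * h + 100 * CE / (8 * Cb) * h))"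
  proof (rule ennreal_leI)
    have "(2 * Kb + T) * prob Bad \<le> (2 * Kb + T) * (2 * Co * (T + 1) * h + 100 * CE / (8 * Cb) * h)"
      using prob_Bad Kb0 T0 by (intro mult_left_mono) auto
    then show "h\<^sup>2 + h\<^sup>2 * (\<Sum>k<NT. prob (Cs k)) + T * prob Bad \<le> h\<^sup>2 + (L * (2 * (h + 2 * CE * h) + 4 * ro (h\<^sup>2) + 2 * h))
      + (2 * Kb + T) * (2 * Co * (T + 1) * h + 100 * CE / (8 * Cb) * h)"
      using sum_prob_Cs unfolding distrib_right by linarith
  qed
  finally show ?thesis .
qed

text \<open>All terms are of order \<open>h\<close> except \<open>ro (h\<^sup>2)\<close>, which is
  \<open>h * sqrt (ln (1 / h))\<close> up to a constant; bounding the logarithm by a power with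
  exponent \<open>\<xi>\<close> costs the factor \<open>1 / \<xi>\<close>.\<close>

lemma time_error:
  assumes \<xi>: "0 < \<xi>"
  shows "(\<integral>\<^sup>+w. ennreal \<bar>num_exit_time T D Cb h a b W J x0 w - exit_time T D X w\<bar> \<partial>M)
    \<le> ennreal ((1 + L * (2 * (1 + 2 * CE) + 4 * (sqrt (8 * Cb * real CARD('d)) / \<xi>) + 2)
       + (2 * Kb + T) * (2 * Co * (T + 1) + 100 * CE / (8 * Cb))) * h powr (1 - \<xi>))"
proof -
  let ?H = "h powr (1 - \<xi>)"
  have Kb0: "0 \<le> Kb" using gb[of 0] by linarith
  have hH: "h \<le> ?H"
  proof -
    have "h powr 1 \<le> h powr (1 - \<xi>)" using h \<xi> by (intro powr_mono') auto
    then show ?thesis using h by simp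
  qed
  have h2H: "h\<^sup>2 \<le> ?H" using h2(2) hH by linarith
  have rH: "ro (h\<^sup>2) \<le> sqrt (8 * Cb * real CARD('d)) / \<xi> * ?H"
  proof -
    define s where "s = sqrt (8 * Cb * real CARD('d))"
    have s0: "0 \<le> s" unfolding s_def using Cbp by simp
    have "sqrt (real CARD('d)) * sqrt (8 * Cb * h\<^sup>2 * ln (1 / h)) = s * (h * sqrt (ln (1 / h)))"
    proof -
      have "8 * Cb * h\<^sup>2 * ln (1 / h) = 8 * Cb * (h\<^sup>2 * ln (1 / h))" by simp
      moreover have "sqrt (h\<^sup>2) = h" using h by simp
      ultimately have "sqrt (8 * Cb * h\<^sup>2 * ln (1 / h)) = sqrt (8 * Cb) * (h * sqrt (ln (1 / h)))" by (metis real_sqrt_mult)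
      moreover have "s = sqrt (8 * Cb) * sqrt (real CARD('d))" unfolding s_def by (rule real_sqrt_mult)
      ultimately show ?thesis by (simp only: mult_ac)
    qed
    then have "ro (h\<^sup>2) = 9 / 10 * (s * (h * sqrt (ln (1 / h))))" unfolding ro_def cc_def by simp
    also have "\<dots> \<le> s * (h * sqrt (ln (1 / h)))" using s0 h lnh by simp
    also have "\<dots> \<le> s * (h * ((1 / h) powr \<xi> / \<xi>))"
    proof (intro mult_left_mono)
      \<comment> \<open>The logarithm is at least 1 here, so it dominates its square root.\<close>
      have "sqrt (ln (1 / h)) \<le> ln (1 / h)" using lnh by (intro real_le_lsqrt) (auto simp: power2_eq_square)
      also have "\<dots> \<le> (1 / h) powr \<xi> / \<xi>" using h \<xi> by (intro ln_powr_bound) auto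
      finally show "sqrt (ln (1 / h)) \<le> (1 / h) powr \<xi> / \<xi>" .
    qed (use s0 h in auto)
    also have "h * ((1 / h) powr \<xi> / \<xi>) = ?H / \<xi>"
      using h by (simp add: powr_diff powr_divide)
    finally show ?thesis unfolding s_def by simp
  qed
  have "h\<^sup>2 + (L * (2 * (h + 2 * CE * h) + 4 * ro (h\<^sup>2) + 2 * h))
    + (2 * Kb + T) * (2 * Co * (T + 1) * h + 100 * CE / (8 * Cb) * h)
    \<le> ?H + (L * (2 * (?H + 2 * CE * ?H) + 4 * (sqrt (8 * Cb * real CARD('d)) / \<xi> * ?H) + 2 * ?H))
    + (2 * Kb + T) * (2 * Co * (T + 1) * ?H + 100 * CE / (8 * Cb) * ?H)"
    using Kb0 T0 L0 CE0 Co0 Cbp by (intro add_mono mult_left_mono h2H hH rH mult_nonneg_nonneg divide_nonneg_nonneg) auto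
  also have "\<dots> = (1 + L * (2 * (1 + 2 * CE) + 4 * (sqrt (8 * Cb * real CARD('d)) / \<xi>) + 2)
       + (2 * Kb + T) * (2 * Co * (T + 1) + 100 * CE / (8 * Cb))) * ?H"
    by (simp only: distrib_left distrib_right mult_1_left mult.assoc)
  finally show ?thesis using order_trans[OF nn_time_error ennreal_leI] unfolding nu_def tau_def by blast
qed

end


section \<open>Choice of the constants and of the step size bound\<close>

context sde_mil
begin

text \<open>The barrier constants come first, then \<open>C\<close> and \<open>h0\<close>; the net
  and the locale are instantiated only after \<open>h\<close> is given. Hence \<open>C\<close> is
  assembled from quantities available outside the locale.\<close>

lemma exit_time_rate:
  assumes T: "0 < T" and D: "open D" "bounded D" "x0 \<in> D" and r: "0 < r"
    and ext: "\<And>q. q \<in> frontier D \<Longrightarrow> \<exists>z. dist z q = r \<and> (\<forall>y\<in>D. r \<le> dist z y)"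
    and R1: "0 < R1" "R1 \<le> r / 2" and cb: "0 < c_b" and Cbp: "0 < Cb" and \<xi>: "0 < \<xi>"
    and ell: "\<And>x \<xi>. infdist x D < R1 \<Longrightarrow> c_b * (norm \<xi>)\<^sup>2 \<le> \<xi> \<bullet> ((b x ** transpose (b x)) *v \<xi>)"
  shows "\<exists>C>0. \<exists>h0. 0 < h0 \<and> h0 < 1 \<and> (\<forall>h. 0 < h \<longrightarrow> h < h0 \<longrightarrow>
    (\<integral>\<^sup>+w. ennreal \<bar>num_exit_time T D Cb h a b W J x0 w - exit_time T D X w\<bar> \<partial>M) \<le> ennreal (C * h powr (1 - \<xi>)))"
proof -
  obtain D1 where "\<forall>x\<in>D. norm x \<le> D1" using D(2) unfolding bounded_iff by blast
  then have D0: "D \<subseteq> cball 0 (max 0 D1)" by fastforce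
  have Dn: "D \<noteq> {}" using D by auto
  obtain l Kb \<kappa>0 where l: "1 \<le> l" and Kb: "0 < Kb" and \<kappa>0: "0 < \<kappa>0" "\<kappa>0 \<le> 1"
    and bar: "\<And>Z s t A. finite Z \<Longrightarrow> Z \<noteq> {} \<Longrightarrow> (\<forall>z\<in>Z. (\<forall>y\<in>D. r \<le> dist z y) \<and> norm z \<le> max 0 D1 + r) \<Longrightarrow>
     0 \<le> s \<Longrightarrow> s < t \<Longrightarrow> t \<le> s + \<kappa>0 \<Longrightarrow> A \<in> sets (F s) \<Longrightarrow> (\<forall>w\<in>A. infdist (X s w) D < R1) \<Longrightarrow>
     (\<integral>w. indicator A w * (bmin l Kb r Z (X t w) - bmin l Kb r Z (X s w)) \<partial>M) \<le> - (t - s) * prob A"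
    using barrier_exists[OF Dn D0 _ r R1 cb ell] by auto
  define L where "L = 2 * l * Kb"
  have L0: "0 \<le> L" unfolding L_def using l Kb by simp
  define CE where "CE = CS2 * (T + 1) * exp (CS1 * (T + 1))"
  define Co where "Co = 2 * real CARD('d) * exp (sqrt (8 * Cb) * K / Cb)"
  define C where "C = 1 + L * (2 * (1 + 2 * CE) + 4 * (sqrt (8 * Cb * real CARD('d)) / \<xi>) + 2)
       + (2 * Kb + T) * (2 * Co * (T + 1) + 100 * CE / (8 * Cb))"
  have CE0: "0 \<le> CE" unfolding CE_def using CS0 T by simp
  have Co0: "0 \<le> Co" unfolding Co_def by simp
  have "0 \<le> L * (2 * (1 + 2 * CE) + 4 * (sqrt (8 * Cb * real CARD('d)) / \<xi>) + 2)"
    using L0 CE0 Cbp \<xi> by (intro mult_nonneg_nonneg add_nonneg_nonneg divide_nonneg_nonneg) auto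
  moreover have "0 \<le> (2 * Kb + T) * (2 * Co * (T + 1) + 100 * CE / (8 * Cb))"
    using Kb T Co0 CE0 Cbp by (intro mult_nonneg_nonneg add_nonneg_nonneg divide_nonneg_nonneg) auto
  ultimately have C: "0 < C" unfolding C_def by linarith
  \<comment> \<open>From \<open>ln (1 / h) \<le> 2 / sqrt h\<close> the squared threshold is at most
    \<open>16 * Cb * CARD('d) * sqrt h\<close>, which is below \<open>R1\<^sup>2\<close> as soon as
    \<open>sqrt h < q0\<close>.\<close>
  define q0 where "q0 = R1\<^sup>2 / (16 * Cb * real CARD('d))"
  have q0: "0 < q0" unfolding q0_def using R1 Cbp by simp
  \<comment> \<open>The three bounds give \<open>ln (1 / h) \<ge> 1\<close>, an admissible time step
    \<open>h\<^sup>2\<close> for the barrier, and a threshold below \<open>R1\<close>.\<close>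
  define h0 where "h0 = min (exp (- 1)) (min \<kappa>0 (q0\<^sup>2))"
  have h0: "0 < h0" "h0 < 1" unfolding h0_def using \<kappa>0 q0 by (auto simp: min_less_iff_disj)
  have "(\<integral>\<^sup>+w. ennreal \<bar>num_exit_time T D Cb h a b W J x0 w - exit_time T D X w\<bar> \<partial>M) \<le> ennreal (C * h powr (1 - \<xi>))"
    if h: "0 < h" "h < h0" for h
  proof -
    have h1: "h < 1" using h h0 by simp
    have hb: "h < exp (- 1)" "h < \<kappa>0" "h < q0\<^sup>2" using h unfolding h0_def by auto
    have lnh: "1 \<le> ln (1 / h)"
    proof -
      have "ln h < ln (exp (- 1))" using hb(1) h(1) by (subst ln_less_cancel_iff) auto
      then show ?thesis using h by (simp add: ln_div)
    qed
    have dR: "sqrt (8 * Cb * real CARD('d) * h * ln (1 / h)) < R1"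
    proof -
      define q where "q = sqrt h"
      have q: "0 < q" "q * q = h" "q < q0" unfolding q_def using h hb(3) q0 by (auto intro: real_less_lsqrt)
      have "ln (1 / h) = 2 * ln (1 / q)" unfolding q(2)[symmetric] using q(1) by (simp add: ln_div ln_mult)
      also have "\<dots> \<le> 2 * (1 / q)" using ln_le_minus_one[of "1 / q"] q(1) by simp
      finally have "h * ln (1 / h) \<le> h * (2 * (1 / q))" using h by (intro mult_left_mono) auto
      also have "\<dots> = 2 * q" unfolding q(2)[symmetric] using q(1) by simp
      also have "\<dots> < 2 * q0" using q(3) by simp
      finally have "8 * Cb * real CARD('d) * (h * ln (1 / h)) < 8 * Cb * real CARD('d) * (2 * q0)"
        using Cbp by (intro mult_strict_left_mono) auto
      also have "\<dots> = R1\<^sup>2" unfolding q0_def using Cbp by simp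
      finally have "8 * Cb * real CARD('d) * h * ln (1 / h) < R1\<^sup>2" by (simp add: mult.assoc)
      then show ?thesis using R1 by (intro real_less_lsqrt) auto
    qed
    obtain Z where Z: "finite Z" "Z \<noteq> {}" "\<forall>z\<in>Z. (\<forall>y\<in>D. r \<le> dist z y) \<and> norm z \<le> max 0 D1 + r"
      and Zf: "\<And>p. p \<in> frontier D \<Longrightarrow> bmin l Kb r Z p \<le> L * h"
      using exists_net[OF D(2) Dn D(1) ext D0 h(1) l less_imp_le[OF Kb]] unfolding L_def by blast
    note Kb' = less_imp_le[OF Kb]
    have hh: "0 < h\<^sup>2" "h\<^sup>2 \<le> \<kappa>0"
    proof -
      show "0 < h\<^sup>2" using h by simp
      have "h * h \<le> h * 1" using h h1 by (intro mult_left_mono) auto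
      then show "h\<^sup>2 \<le> \<kappa>0" using hb(2) by (simp add: power2_eq_square)
    qed
    interpret E: exit_scheme M F W a b x0 X K Cb J D h T "bmin l Kb r Z" R1 Kb L
    proof
      show "bmin l Kb r Z \<in> borel_measurable borel" by (rule bmin_meas[OF Z(1,2) l Kb'])
      show "\<bar>bmin l Kb r Z x\<bar> \<le> Kb" for x by (rule bmin_abs[OF Z(1,2) l Kb'])
      show "bmin l Kb r Z x \<le> bmin l Kb r Z y + L * norm (x - y)" for x y
        unfolding L_def by (rule bmin_lip[OF Z(1,2) l Kb'])
      show "0 \<le> bmin l Kb r Z x" if "x \<in> D" for x
        by (rule bmin_nonneg[OF Z(1,2) l Kb' _ _ that]) (use Z(3) r in auto)
      show "bmin l Kb r Z p \<le> L * h" if "p \<in> frontier D" for p by (rule Zf[OF that])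
      show "(\<integral>w. indicator A w * (bmin l Kb r Z (X (s + h\<^sup>2) w) - bmin l Kb r Z (X s w)) \<partial>M) \<le> - h\<^sup>2 * prob A"
        if "0 \<le> s" "A \<in> sets (F s)" "\<And>w. w \<in> A \<Longrightarrow> infdist (X s w) D < R1" for s A
        using bar[OF Z that(1) _ _ that(2), of "s + h\<^sup>2"] that(3) hh by simp
    qed (use h h1 T D L0 Cbp lnh dR in auto)
    show ?thesis using E.time_error[OF \<xi>] unfolding C_def CE_def Co_def E.CE_def E.Co_def .
  qed
  then show ?thesis using C h0 by blast
qed

end

theorem mainTheorem1:
  fixes M :: "'w measure" and F :: "real \<Rightarrow> 'w measure"
    and W :: "real \<Rightarrow> 'w \<Rightarrow> real^'m::finite"
    and J :: "real \<Rightarrow> real \<Rightarrow> 'm \<Rightarrow> 'm \<Rightarrow> 'w \<Rightarrow> real"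
    and D :: "(real^'d::finite) set"
    and a :: "real^'d \<Rightarrow> real^'d" and b :: "real^'d \<Rightarrow> real^'m^'d"
    and X :: "real \<Rightarrow> 'w \<Rightarrow> real^'d"
    and x0 :: "real^'d" and T R_D c_b C_b :: real
  assumes "prob_space M"
    and "T > 0"
    and "open D" and "connected D" and "bounded D" and "D \<noteq> {}" and "C4_boundary D"
    and "\<forall>i. Ck_fun 3 (\<lambda>x. a x $ i) \<and> bdd_derivs 3 (\<lambda>x. a x $ i)"
    and "\<forall>i j. Ck_fun 3 (\<lambda>x. b x $ i $ j) \<and> bdd_derivs 3 (\<lambda>x. b x $ i $ j)"
    and "0 < R_D" and "R_D < reach D / 2" and "c_b > 0"
    and "\<forall>x\<in>enlarge D R_D. \<forall>\<xi>. \<xi> \<bullet> ((b x ** transpose (b x)) *v \<xi>) \<ge> c_b * (norm \<xi>)\<^sup>2"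
    and "C_b > 0"
    and "\<forall>x \<xi>. \<xi> \<bullet> ((b x ** transpose (b x)) *v \<xi>) \<le> C_b * (norm \<xi>)\<^sup>2"
    and "filtration_on M F"
    and "wiener M F W"
    and "x0 \<in> D"
    and "strong_solution M F W a b x0 X"
    and "iterated_ito M F W J"
  shows "\<forall>\<xi>>0. \<exists>C>0. \<exists>h0. 0 < h0 \<and> h0 < 1 \<and>
           (\<forall>h. 0 < h \<longrightarrow> h < h0 \<longrightarrow>
              (\<integral>\<^sup>+ \<omega>. ennreal \<bar>num_exit_time T D C_b h a b W J x0 \<omega> - exit_time T D X \<omega>\<bar> \<partial>M)
                \<le> ennreal (C * h powr (1 - \<xi>)))"
proof (intro allI impI)
  fix \<xi> :: real assume \<xi>: "0 < \<xi>"
  have "\<exists>K. \<forall>K'\<ge>K. nice K' (\<lambda>x. a x $ i)" for i using nice_exists assms(8) by blast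
  then obtain Ka where Ka: "\<And>i K'. Ka i \<le> K' \<Longrightarrow> nice K' (\<lambda>x. a x $ i)" by metis
  have "\<exists>K. \<forall>K'\<ge>K. nice K' (\<lambda>x. b x $ i $ j) \<and> (\<forall>l x y. \<bar>pd l (\<lambda>x. b x $ i $ j) y - pd l (\<lambda>x. b x $ i $ j) x\<bar> \<le> K' * norm (y - x))" for i j
    using nice_exists assms(9) by blast
  then obtain Kc where Kc: "\<And>i j K'. Kc i j \<le> K' \<Longrightarrow> nice K' (\<lambda>x. b x $ i $ j) \<and> (\<forall>l x y. \<bar>pd l (\<lambda>x. b x $ i $ j) y - pd l (\<lambda>x. b x $ i $ j) x\<bar> \<le> K' * norm (y - x))"
    by metis
  \<comment> \<open>The 1 provides \<open>1 \<le> K\<close>, which is used to absorb lower powers of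
    \<open>K\<close>.\<close>
  define K where "K = Max (insert 1 (range Ka \<union> range (\<lambda>(i, j). Kc i j)))"
  have K: "1 \<le> K" "Ka i \<le> K" "Kc i j \<le> K" for i j
  proof -
    let ?S = "insert 1 (range Ka \<union> range (\<lambda>(i, j). Kc i j))"
    have f: "finite ?S" by simp
    have "Kc i j \<in> ?S" by (intro insertI2 UnI2 image_eqI[of _ _ "(i, j)"]) auto
    then show "Kc i j \<le> K" unfolding K_def by (rule Max_ge[OF f])
    show "1 \<le> K" "Ka i \<le> K" unfolding K_def by (rule Max_ge[OF f], blast)+
  qed
  \<comment> \<open>The upper ellipticity bound tested with a unit vector: the diagonal entries of
    \<open>b ** transpose b\<close> are the squared row norms.\<close>
  have Cb: "(norm (b x $ i))\<^sup>2 \<le> C_b" for x i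
  proof -
    have "(axis i 1 :: real^'d) \<bullet> ((b x ** transpose (b x)) *v axis i 1) = (norm (b x $ i))\<^sup>2"
      unfolding power2_norm_eq_inner inner_axis' matrix_vector_mult_basis
      by (simp add: column_def matrix_matrix_mult_def transpose_def inner_vec_def)
    moreover have "(axis i 1 :: real^'d) \<bullet> ((b x ** transpose (b x)) *v axis i 1) \<le> C_b * (norm (axis i 1 :: real^'d))\<^sup>2"
      using assms(15) by blast
    ultimately show ?thesis by simp
  qed
  interpret prob_space M by fact
  interpret sde_mil M F W a b x0 X K C_b J
    by unfold_locales (use assms K Ka Kc Cb in blast)+
  obtain r where r: "0 < r" "\<forall>q\<in>frontier D. \<exists>z. dist z q = r \<and> (\<forall>y\<in>D. r \<le> dist z y)"
    using ext_sphere[OF assms(3,5,7)] by blast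
  \<comment> \<open>The radius is the minimum of \<open>R_D\<close>, up to which ellipticity holds,
    and \<open>r / 2\<close>, which keeps the centres of the exterior balls at a distance.\<close>
  show "\<exists>C>0. \<exists>h0. 0 < h0 \<and> h0 < 1 \<and> (\<forall>h. 0 < h \<longrightarrow> h < h0 \<longrightarrow>
      (\<integral>\<^sup>+ \<omega>. ennreal \<bar>num_exit_time T D C_b h a b W J x0 \<omega> - exit_time T D X \<omega>\<bar> \<partial>M)
        \<le> ennreal (C * h powr (1 - \<xi>)))"
    using assms(2,3,5,10,12,14,18) r(1) \<xi>
  proof (intro exit_time_rate[of T D r "min R_D (r / 2)" c_b])
    show "\<exists>z. dist z q = r \<and> (\<forall>y\<in>D. r \<le> dist z y)" if "q \<in> frontier D" for q using r that by blast
    show "c_b * (norm \<xi>)\<^sup>2 \<le> \<xi> \<bullet> ((b x ** transpose (b x)) *v \<xi>)" if "infdist x D < min R_D (r / 2)" for x \<xi>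
      using assms(13) that unfolding enlarge_def by auto
  qed auto
qed

end
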